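(* Let $A$ be a noetherian ring with an automorphism $\sigma$. Suppose that the $A$-bimodule ${}^{\sigma}\!A$ has a resolution $I = (\cdots \to 0 \to I^0 \to I^1 \to I^2 \to \cdots)$ by $A$-bimodules which are injective both when viewed as $A$-left-modules and when viewed as $A$-right-modules. Suppose that $\operatorname{id}_A(A) < \infty$ and $\operatorname{id}_{A^{\mathrm{op}}}(A) < \infty$. Let $M$ be a finitely generated $A$-left-module and let $N$ be an $A$-bimodule which is finitely generated from either side. Suppose that $N$ viewed as an $A$-left-module has property (R) and that $N$ has property (S) (with respect to $A$ and $\sigma$). Then $$\operatorname{Ext}_A^{i}(M,N) = 0 \text{ for } i \gg 0 \;\Longrightarrow\; \operatorname{Ext}_A^{i}(N,{}^{\sigma}\!M) = 0 \text{ for } i \gg 0 .$$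
   Context: Conventions. Noetherian means left and right noetherian. $A^{\mathrm{op}}$ is the opposite ring; $A$-right-modules are identified with $A^{\mathrm{op}}$-left-modules, and $\operatorname{Hom}_A$, $\operatorname{Ext}_A$, $\operatorname{id}_A$ refer to left modules while $\operatorname{Hom}_{A^{\mathrm{op}}}$, $\operatorname{id}_{A^{\mathrm{op}}}$ refer to right modules. $\operatorname{id}$ is injective dimension. $\mathsf{D}(A^{\mathrm{op}})$ is the derived category of $A$-right-modules. A bimodule is "finitely generated from either side" if it is finitely generated as a left module and as a right module. In $\operatorname{Ext}_A(M,N)$ and $\operatorname{Ext}_A(N,{}^{\sigma}\!M)$, the bimodule $N$ is regarded as a left module. Twists. For an $A$-left-module (or $A$-bimodule) $M$, ${}^{\sigma}\!M$ is the same abelian group with left scalar multiplication $a\cdot m = \sigma(a)m$ (and unchanged right multiplication in the bimodule case). Property (R). An $A$-left-module $N$ has property (R) if, for every exact complex $L$ of finitely generated projective $A$-right-modules (not necessarily bounded), $\mathrm{H}^i(L\otimes_A N)=0$ for $i\gg 0$ implies $\mathrm{H}^i(L\otimes_A N)=0$ for all $i$. Property (S). With $A$, $\sigma$, $I$ as in the claim, a resolution means that $0\to {}^{\sigma}\!A\to I^0\to I^1\to\cdots$ is an exact sequence of bimodules. Put $\operatorname{RHom}_A(-,{}^{\sigma}\!A)=\operatorname{Hom}_A(-,I)$ and $\operatorname{RHom}_{A^{\mathrm{op}}}(-,{}^{\sigma}\!A)=\operatorname{Hom}_{A^{\mathrm{op}}}(-,I)$; these are also defined on $A$-bimodules. For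 a bimodule $N$, the right $A$-structure on $\operatorname{Hom}_A(N,I)$ comes from the right structure of $I$, and the right $A$-structure on $\operatorname{Hom}_{A^{\mathrm{op}}}(N,I)$ comes from the left structure of $N$. An $A$-bimodule $N$ which is finitely generated from either side has property (S) if $\operatorname{RHom}_A(N,{}^{\sigma}\!A)\cong\operatorname{RHom}_{A^{\mathrm{op}}}(N,{}^{\sigma}\!A)$ in $\mathsf{D}(A^{\mathrm{op}})$. *)

theory Defs
  imports
    "HOL-Algebra.Module"
    "HOL-Algebra.QuotRing"
    "HOL-Algebra.Free_Abelian_Groups"
    "HOL-Library.Extended_Nat"
begin

section \<open>Modules and bimodules over a noncommutative ring\<close>

text \<open>
  The library locale \<open>module\<close> requires a commutative ring of scalars; its record type is reused
  here.  Right modules over \<open>R\<close> are left modules over \<open>op_ring R\<close>.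
\<close>

definition op_ring :: "('a, 'r) ring_scheme \<Rightarrow> ('a, 'r) ring_scheme" where
  "op_ring R = R\<lparr>monoid.mult := (\<lambda>x y. y \<otimes>\<^bsub>R\<^esub> x)\<rparr>"

locale left_module = R?: ring R + M?: abelian_group M
  for R :: "('a, 'r) ring_scheme" (structure) and M :: "('a, 'm, 'x) module_scheme" (structure) +
  assumes smult_closed [simp, intro]:
      "\<lbrakk>a \<in> carrier R; x \<in> carrier M\<rbrakk> \<Longrightarrow> a \<odot>\<^bsub>M\<^esub> x \<in> carrier M"
    and smult_l_distr:
      "\<lbrakk>a \<in> carrier R; b \<in> carrier R; x \<in> carrier M\<rbrakk> \<Longrightarrow>
        (a \<oplus>\<^bsub>R\<^esub> b) \<odot>\<^bsub>M\<^esub> x = a \<odot>\<^bsub>M\<^esub> x \<oplus>\<^bsub>M\<^esub> b \<odot>\<^bsub>M\<^esub> x"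
    and smult_r_distr:
      "\<lbrakk>a \<in> carrier R; x \<in> carrier M; y \<in> carrier M\<rbrakk> \<Longrightarrow>
        a \<odot>\<^bsub>M\<^esub> (x \<oplus>\<^bsub>M\<^esub> y) = a \<odot>\<^bsub>M\<^esub> x \<oplus>\<^bsub>M\<^esub> a \<odot>\<^bsub>M\<^esub> y"
    and smult_assoc1:
      "\<lbrakk>a \<in> carrier R; b \<in> carrier R; x \<in> carrier M\<rbrakk> \<Longrightarrow>
        (a \<otimes>\<^bsub>R\<^esub> b) \<odot>\<^bsub>M\<^esub> x = a \<odot>\<^bsub>M\<^esub> (b \<odot>\<^bsub>M\<^esub> x)"
    and smult_one [simp]:
      "x \<in> carrier M \<Longrightarrow> \<one>\<^bsub>R\<^esub> \<odot>\<^bsub>M\<^esub> x = x"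

text \<open>A bimodule is a left module with an additional right multiplication, so that a bimodule is
  regarded as a left module by record subtyping.\<close>

record ('a, 'b) bimodule = "('a, 'b) module" +
  rsmult :: "['b, 'a] \<Rightarrow> 'b"

definition right_of :: "('a, 'b, 'x) bimodule_scheme \<Rightarrow> ('a, 'b) module" where
  "right_of B = \<lparr>carrier = carrier B, monoid.mult = monoid.mult B, one = one B, ring.zero = ring.zero B, add = add B,
     smult = (\<lambda>a x. rsmult B x a)\<rparr>"

definition bimodule :: "('a, 'r) ring_scheme \<Rightarrow> ('a, 'b, 'x) bimodule_scheme \<Rightarrow> bool" where
  "bimodule R B \<longleftrightarrow> left_module R B \<and> left_module (op_ring R) (right_of B) \<and>
     (\<forall>a\<in>carrier R. \<forall>b\<in>carrier R. \<forall>x\<in>carrier B.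
        rsmult B (smult B a x) b = smult B a (rsmult B x b))"

definition regular_bimodule :: "('a, 'r) ring_scheme \<Rightarrow> ('a, 'a) bimodule" where
  "regular_bimodule R = \<lparr>carrier = carrier R, monoid.mult = monoid.mult R, one = one R, ring.zero = ring.zero R,
     add = add R, smult = monoid.mult R, rsmult = monoid.mult R\<rparr>"

definition twist :: "('a \<Rightarrow> 'a) \<Rightarrow> ('a, 'b, 'x) module_scheme \<Rightarrow> ('a, 'b, 'x) module_scheme" where
  "twist \<sigma> M = M\<lparr>smult := (\<lambda>a x. smult M (\<sigma> a) x)\<rparr>"

definition mod_hom ::
  "('a, 'r) ring_scheme \<Rightarrow> ('a, 'm, 'x) module_scheme \<Rightarrow> ('a, 'n, 'y) module_scheme \<Rightarrow> ('m \<Rightarrow> 'n) set"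
  where
  "mod_hom R M N = {h \<in> carrier M \<rightarrow> carrier N.
     (\<forall>x\<in>carrier M. \<forall>y\<in>carrier M. h (x \<oplus>\<^bsub>M\<^esub> y) = h x \<oplus>\<^bsub>N\<^esub> h y) \<and>
     (\<forall>a\<in>carrier R. \<forall>x\<in>carrier M. h (a \<odot>\<^bsub>M\<^esub> x) = a \<odot>\<^bsub>N\<^esub> h x)}"

definition bimod_hom ::
  "('a, 'r) ring_scheme \<Rightarrow> ('a, 'm, 'x) bimodule_scheme \<Rightarrow> ('a, 'n, 'y) bimodule_scheme \<Rightarrow> ('m \<Rightarrow> 'n) set"
  where
  "bimod_hom R B C = mod_hom R B C \<inter> mod_hom (op_ring R) (right_of B) (right_of C)"

definition mod_span ::
  "('a, 'r) ring_scheme \<Rightarrow> ('a, 'm, 'x) module_scheme \<Rightarrow> 'm set \<Rightarrow> 'm set" where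
  "mod_span R M S = \<Inter>{K. submodule K R M \<and> S \<subseteq> K}"

definition fin_gen :: "('a, 'r) ring_scheme \<Rightarrow> ('a, 'm, 'x) module_scheme \<Rightarrow> bool" where
  "fin_gen R M \<longleftrightarrow> (\<exists>S. finite S \<and> S \<subseteq> carrier M \<and> mod_span R M S = carrier M)"

definition left_noetherian :: "('a, 'r) ring_scheme \<Rightarrow> bool" where
  "left_noetherian R \<longleftrightarrow> ring R \<and>
     (\<forall>K. submodule K R (regular_bimodule R) \<longrightarrow>
        (\<exists>S. finite S \<and> S \<subseteq> K \<and> mod_span R (regular_bimodule R) S = K))"

definition noetherian :: "('a, 'r) ring_scheme \<Rightarrow> bool" where
  "noetherian R \<longleftrightarrow> left_noetherian R \<and> left_noetherian (op_ring R)"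

text \<open>
  HOL cannot quantify over all modules of all types, so the test modules range over a type that is
  large enough for the usual notion.  The module \<open>P\<close> is projective in the usual sense as soon as the
  surjection onto \<open>P\<close> from the free module on the set \<open>P\<close> splits, and that free module consists of
  functions from \<open>'p\<close> to \<open>'a\<close>.
\<close>

definition projective_module :: "('a, 'r) ring_scheme \<Rightarrow> ('a, 'p, 'x) module_scheme \<Rightarrow> bool" where
  "projective_module R P \<longleftrightarrow> left_module R P \<and>
     (\<forall>(X :: ('a, 'p \<Rightarrow> 'a) module) (Y :: ('a, 'p) module) q g.
        left_module R X \<and> left_module R Y \<and>
        q \<in> mod_hom R X Y \<and> q ` carrier X = carrier Y \<and> g \<in> mod_hom R P Y \<longrightarrow>
        (\<exists>h \<in> mod_hom R P X. \<forall>x\<in>carrier P. q (h x) = g x))"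

text \<open>
  Up to isomorphism every countably generated module has its carrier in \<open>(nat \<Rightarrow> 'a) set\<close> (as a set of
  cosets in a countably generated free module).  By Baer's criterion already the inclusions of left
  ideals into the ring suffice as test maps.
\<close>

definition injective_module :: "('a, 'r) ring_scheme \<Rightarrow> ('a, 'e, 'x) module_scheme \<Rightarrow> bool" where
  "injective_module R E \<longleftrightarrow> left_module R E \<and>
     (\<forall>(X :: ('a, (nat \<Rightarrow> 'a) set) module) (Y :: ('a, (nat \<Rightarrow> 'a) set) module) j g.
        left_module R X \<and> left_module R Y \<and>
        j \<in> mod_hom R X Y \<and> inj_on j (carrier X) \<and> g \<in> mod_hom R X E \<longrightarrow>
        (\<exists>h \<in> mod_hom R Y E. \<forall>x\<in>carrier X. h (j x) = g x))"


section \<open>Cochain complexes and cohomology\<close>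

text \<open>The objects are of record type \<open>'o\<close> (abelian groups as monoid records, modules, or
  bimodules), with carriers in \<open>'b\<close>.\<close>

record ('o, 'b) cochain =
  obj :: "int \<Rightarrow> 'o"
  dif :: "int \<Rightarrow> 'b \<Rightarrow> 'b"

text \<open>If \<open>K\<close> is the subgroup divided out in the target group \<open>G\<close>, this is the map which \<open>f\<close> induces
  on cosets.\<close>

definition coset_map :: "('c, 'g) monoid_scheme \<Rightarrow> 'c set \<Rightarrow> ('b \<Rightarrow> 'c) \<Rightarrow> 'b set \<Rightarrow> 'c set" where
  "coset_map G K f C = (\<Union>x\<in>C. K #>\<^bsub>G\<^esub> f x)"

definition coboundaries :: "(('b, 'x) monoid_scheme, 'b) cochain \<Rightarrow> int \<Rightarrow> 'b set" where
  "coboundaries C i = dif C (i - 1) ` carrier (obj C (i - 1))"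

definition cohomology :: "(('b, 'x) monoid_scheme, 'b) cochain \<Rightarrow> int \<Rightarrow> 'b set monoid" where
  "cohomology C i =
     (obj C i)\<lparr>carrier := kernel (obj C i) (obj C (i + 1)) (dif C i)\<rparr> Mod coboundaries C i"

definition module_complex ::
  "('a, 'r) ring_scheme \<Rightarrow> (('a, 'b, 'x) module_scheme, 'b) cochain \<Rightarrow> bool" where
  "module_complex R X \<longleftrightarrow>
     (\<forall>i. left_module R (obj X i) \<and> dif X i \<in> mod_hom R (obj X i) (obj X (i + 1)) \<and>
       (\<forall>x\<in>carrier (obj X i). dif X (i + 1) (dif X i x) = \<zero>\<^bsub>obj X (i + 1 + 1)\<^esub>))"

definition additive ::
  "(('a, 'b, 'x) module_scheme, 'b) cochain \<Rightarrow> ('b monoid, 'b) cochain" where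
  "additive X = \<lparr>obj = (\<lambda>i. \<lparr>carrier = carrier (obj X i), monoid.mult = add (obj X i), one = ring.zero (obj X i)\<rparr>),
     dif = dif X\<rparr>"

abbreviation mod_cohomology ::
  "(('a, 'b, 'x) module_scheme, 'b) cochain \<Rightarrow> int \<Rightarrow> 'b set monoid" where
  "mod_cohomology X \<equiv> cohomology (additive X)"

definition exact_complex ::
  "('a, 'r) ring_scheme \<Rightarrow> (('a, 'b, 'x) module_scheme, 'b) cochain \<Rightarrow> bool" where
  "exact_complex R X \<longleftrightarrow> module_complex R X \<and> (\<forall>i. trivial_group (mod_cohomology X i))"


section \<open>Ext and injective dimension\<close>

definition projective_resolution ::
  "('a, 'r) ring_scheme \<Rightarrow> ('a, 'm, 'x) module_scheme \<Rightarrow>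
   (('a, 'p) module, 'p) cochain \<Rightarrow> ('p \<Rightarrow> 'm) \<Rightarrow> bool" where
  "projective_resolution R M P \<pi> \<longleftrightarrow>
     module_complex R P \<and> (\<forall>i. projective_module R (obj P i)) \<and>
     (\<forall>i>0. carrier (obj P i) = {\<zero>\<^bsub>obj P i\<^esub>}) \<and>
     \<pi> \<in> mod_hom R (obj P 0) M \<and> \<pi> ` carrier (obj P 0) = carrier M \<and>
     {x \<in> carrier (obj P 0). \<pi> x = \<zero>\<^bsub>M\<^esub>} = dif P (-1) ` carrier (obj P (-1)) \<and>
     (\<forall>i<0. trivial_group (mod_cohomology P i))"

definition hom_group ::
  "('a, 'r) ring_scheme \<Rightarrow> ('a, 'm, 'x) module_scheme \<Rightarrow> ('a, 'n, 'y) module_scheme \<Rightarrow> ('m \<Rightarrow> 'n) monoid"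
  where
  "hom_group R M N = \<lparr>carrier = mod_hom R M N \<inter> extensional (carrier M),
     monoid.mult = (\<lambda>f g. \<lambda>x\<in>carrier M. f x \<oplus>\<^bsub>N\<^esub> g x), one = (\<lambda>x\<in>carrier M. \<zero>\<^bsub>N\<^esub>)\<rparr>"

definition hom_from_complex ::
  "('a, 'r) ring_scheme \<Rightarrow> (('a, 'p, 'x) module_scheme, 'p) cochain \<Rightarrow> ('a, 'n, 'y) module_scheme \<Rightarrow>
   (('p \<Rightarrow> 'n) monoid, 'p \<Rightarrow> 'n) cochain" where
  "hom_from_complex R P N = \<lparr>obj = (\<lambda>i. hom_group R (obj P (- i)) N),
     dif = (\<lambda>i f. \<lambda>x\<in>carrier (obj P (- (i + 1))). f (dif P (- (i + 1)) x))\<rparr>"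

text \<open>
  \<open>Ext\<close> is computed with a chosen projective resolution.  The type \<open>('a + 'm) list\<close> is infinite and at
  least as large as \<open>'a\<close> and \<open>'m\<close>, so every module on \<open>'m\<close> has a free resolution in this type.
\<close>

definition chosen_resolution ::
  "('a, 'r) ring_scheme \<Rightarrow> ('a, 'm, 'x) module_scheme \<Rightarrow>
   (('a, ('a + 'm) list) module, ('a + 'm) list) cochain" where
  "chosen_resolution R M = (SOME P. \<exists>\<pi>. projective_resolution R M P \<pi>)"

definition Ext ::
  "('a, 'r) ring_scheme \<Rightarrow> nat \<Rightarrow> ('a, 'm, 'x) module_scheme \<Rightarrow> ('a, 'n, 'y) module_scheme \<Rightarrow>
   (('a + 'm) list \<Rightarrow> 'n) set monoid" where
  "Ext R i M N = cohomology (hom_from_complex R (chosen_resolution R M) N) (int i)"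

definition coresolution ::
  "('a, 'r) ring_scheme \<Rightarrow> ('a, 'm, 'x) module_scheme \<Rightarrow>
   (('a, 'e, 'y) module_scheme, 'e) cochain \<Rightarrow> ('m \<Rightarrow> 'e) \<Rightarrow> bool" where
  "coresolution R M E \<epsilon> \<longleftrightarrow>
     module_complex R E \<and> (\<forall>i<0. carrier (obj E i) = {\<zero>\<^bsub>obj E i\<^esub>}) \<and>
     \<epsilon> \<in> mod_hom R M (obj E 0) \<and> inj_on \<epsilon> (carrier M) \<and>
     \<epsilon> ` carrier M = {x \<in> carrier (obj E 0). dif E 0 x = \<zero>\<^bsub>obj E 1\<^esub>} \<and>
     (\<forall>i>0. trivial_group (mod_cohomology E i))"

text \<open>
  The token \<open>'u itself\<close> is the type in which the injective resolutions live.  A module has finite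
  injective dimension in the usual sense iff \<open>inj_dim TYPE('u) R M < \<infinity>\<close> for some (large enough) type
  \<open>'u\<close>; hence a theorem with the hypothesis \<open>inj_dim TYPE('u) R M < \<infinity>\<close> for an arbitrary type
  variable \<open>'u\<close> has precisely the usual hypothesis.
\<close>

definition inj_dim ::
  "'u itself \<Rightarrow> ('a, 'r) ring_scheme \<Rightarrow> ('a, 'm, 'x) module_scheme \<Rightarrow> enat" where
  "inj_dim U R M = Inf {enat n | n. \<exists>(E :: (('a, 'u) module, 'u) cochain) \<epsilon>.
     coresolution R M E \<epsilon> \<and> (\<forall>i. injective_module R (obj E i)) \<and>
     (\<forall>i > int n. carrier (obj E i) = {\<zero>\<^bsub>obj E i\<^esub>})}"


section \<open>Tensor products and property (R)\<close>

definition tensor_relations ::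
  "('a, 'r) ring_scheme \<Rightarrow> ('a, 'l, 'x) module_scheme \<Rightarrow> ('a, 'n, 'y) module_scheme \<Rightarrow>
   ('l \<times> 'n \<Rightarrow>\<^sub>0 int) set" where
  "tensor_relations R L N =
     {frag_of (x \<oplus>\<^bsub>L\<^esub> x', y) - frag_of (x, y) - frag_of (x', y) | x x' y.
        x \<in> carrier L \<and> x' \<in> carrier L \<and> y \<in> carrier N} \<union>
     {frag_of (x, y \<oplus>\<^bsub>N\<^esub> y') - frag_of (x, y) - frag_of (x, y') | x y y'.
        x \<in> carrier L \<and> y \<in> carrier N \<and> y' \<in> carrier N} \<union>
     {frag_of (a \<odot>\<^bsub>L\<^esub> x, y) - frag_of (x, a \<odot>\<^bsub>N\<^esub> y) | a x y.
        a \<in> carrier R \<and> x \<in> carrier L \<and> y \<in> carrier N}"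

definition tensor_subgroup ::
  "('a, 'r) ring_scheme \<Rightarrow> ('a, 'l, 'x) module_scheme \<Rightarrow> ('a, 'n, 'y) module_scheme \<Rightarrow>
   ('l \<times> 'n \<Rightarrow>\<^sub>0 int) set" where
  "tensor_subgroup R L N =
     generate (free_Abelian_group (carrier L \<times> carrier N)) (tensor_relations R L N)"

text \<open>Here \<open>L\<close> is a right module, i.e. a left module over \<open>op_ring R\<close>: \<open>a \<odot>\<^bsub>L\<^esub> x\<close> above is \<open>x\<cdot>a\<close>.\<close>

definition tensor ::
  "('a, 'r) ring_scheme \<Rightarrow> ('a, 'l, 'x) module_scheme \<Rightarrow> ('a, 'n, 'y) module_scheme \<Rightarrow>
   ('l \<times> 'n \<Rightarrow>\<^sub>0 int) set monoid" where
  "tensor R L N = free_Abelian_group (carrier L \<times> carrier N) Mod tensor_subgroup R L N"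

definition tensor_complex ::
  "('a, 'r) ring_scheme \<Rightarrow> (('a, 'l, 'x) module_scheme, 'l) cochain \<Rightarrow> ('a, 'n, 'y) module_scheme \<Rightarrow>
   (('l \<times> 'n \<Rightarrow>\<^sub>0 int) set monoid, ('l \<times> 'n \<Rightarrow>\<^sub>0 int) set) cochain" where
  "tensor_complex R L N = \<lparr>obj = (\<lambda>i. tensor R (obj L i) N),
     dif = (\<lambda>i. coset_map (free_Abelian_group (carrier (obj L (i + 1)) \<times> carrier N))
                  (tensor_subgroup R (obj L (i + 1)) N)
                  (frag_extend (\<lambda>(x, y). frag_of (dif L i x, y))))\<rparr>"

text \<open>Up to isomorphism a finitely generated projective module is a submodule of some \<open>A\<^sup>n\<close>, hence
  has its carrier in \<open>nat \<Rightarrow> 'a\<close>.\<close>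

definition property_R :: "('a, 'r) ring_scheme \<Rightarrow> ('a, 'n, 'y) module_scheme \<Rightarrow> bool" where
  "property_R R N \<longleftrightarrow> (\<forall>L :: (('a, nat \<Rightarrow> 'a) module, nat \<Rightarrow> 'a) cochain.
     exact_complex (op_ring R) L \<and>
     (\<forall>i. fin_gen (op_ring R) (obj L i) \<and> projective_module (op_ring R) (obj L i)) \<longrightarrow>
     (\<forall>\<^sub>F i in at_top. trivial_group (cohomology (tensor_complex R L N) i)) \<longrightarrow>
     (\<forall>i. trivial_group (cohomology (tensor_complex R L N) i)))"


section \<open>Isomorphism in the derived category\<close>

definition chain_map ::
  "('a, 'r) ring_scheme \<Rightarrow> (('a, 'b, 'x) module_scheme, 'b) cochain \<Rightarrow>
   (('a, 'c, 'y) module_scheme, 'c) cochain \<Rightarrow> (int \<Rightarrow> 'b \<Rightarrow> 'c) \<Rightarrow> bool" where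
  "chain_map R X Y f \<longleftrightarrow> (\<forall>i. f i \<in> mod_hom R (obj X i) (obj Y i) \<and>
     (\<forall>x\<in>carrier (obj X i). f (i + 1) (dif X i x) = dif Y i (f i x)))"

definition homotopic ::
  "('a, 'r) ring_scheme \<Rightarrow> (('a, 'b, 'x) module_scheme, 'b) cochain \<Rightarrow>
   (('a, 'c, 'y) module_scheme, 'c) cochain \<Rightarrow> (int \<Rightarrow> 'b \<Rightarrow> 'c) \<Rightarrow> (int \<Rightarrow> 'b \<Rightarrow> 'c) \<Rightarrow> bool" where
  "homotopic R X Y f g \<longleftrightarrow> (\<exists>s. \<forall>i. s i \<in> mod_hom R (obj X i) (obj Y (i - 1)) \<and>
     (\<forall>x\<in>carrier (obj X i).
        f i x = g i x \<oplus>\<^bsub>obj Y i\<^esub> (dif Y (i - 1) (s i x) \<oplus>\<^bsub>obj Y i\<^esub> s (i + 1) (dif X i x))))"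

definition quasi_iso ::
  "('a, 'r) ring_scheme \<Rightarrow> (('a, 'b, 'x) module_scheme, 'b) cochain \<Rightarrow>
   (('a, 'c, 'y) module_scheme, 'c) cochain \<Rightarrow> (int \<Rightarrow> 'b \<Rightarrow> 'c) \<Rightarrow> bool" where
  "quasi_iso R X Y f \<longleftrightarrow> chain_map R X Y f \<and>
     (\<forall>i. coset_map (obj (additive Y) i) (coboundaries (additive Y) i) (f i)
            \<in> iso (mod_cohomology X i) (mod_cohomology Y i))"

text \<open>
  A morphism \<open>X \<rightarrow> Y\<close> of the derived category is an equivalence class of roofs
  \<open>X \<leftarrow>s\<leftarrow> Z \<rightarrow>f\<rightarrow> Y\<close> with \<open>s\<close> a quasi-isomorphism, in the homotopy category.
\<close>

type_synonym ('a, 'z, 'b, 'c) roof =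
  "(('a, 'z) module, 'z) cochain \<times> (int \<Rightarrow> 'z \<Rightarrow> 'b) \<times> (int \<Rightarrow> 'z \<Rightarrow> 'c)"

definition is_roof ::
  "('a, 'r) ring_scheme \<Rightarrow> (('a, 'b) module, 'b) cochain \<Rightarrow> (('a, 'c) module, 'c) cochain \<Rightarrow>
   ('a, 'z, 'b, 'c) roof \<Rightarrow> bool" where
  "is_roof R X Y = (\<lambda>(Z, s, f). module_complex R Z \<and> quasi_iso R Z X s \<and> chain_map R Z Y f)"

definition id_roof :: "(('a, 'b) module, 'b) cochain \<Rightarrow> ('a, 'b, 'b, 'b) roof" where
  "id_roof X = (X, (\<lambda>i x. x), (\<lambda>i x. x))"

definition roof_equiv ::
  "'u itself \<Rightarrow> ('a, 'r) ring_scheme \<Rightarrow>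
   (('a, 'b) module, 'b) cochain \<Rightarrow> (('a, 'c) module, 'c) cochain \<Rightarrow>
   ('a, 'z, 'b, 'c) roof \<Rightarrow> ('a, 'w, 'b, 'c) roof \<Rightarrow> bool" where
  "roof_equiv U R X Y = (\<lambda>(Z, s, f) (Z', s', f').
     \<exists>(W :: (('a, 'u) module, 'u) cochain) h k.
       module_complex R W \<and> chain_map R W Z h \<and> chain_map R W Z' k \<and>
       quasi_iso R W X (\<lambda>i. s i \<circ> h i) \<and>
       homotopic R W X (\<lambda>i. s i \<circ> h i) (\<lambda>i. s' i \<circ> k i) \<and>
       homotopic R W Y (\<lambda>i. f i \<circ> h i) (\<lambda>i. f' i \<circ> k i))"

text \<open>\<open>roof_composite R Y \<alpha> \<beta> \<gamma>\<close>: the roof \<open>\<gamma>\<close> represents \<open>\<beta> \<circ> \<alpha>\<close>, where \<open>Y\<close> is the target of \<open>\<alpha>\<close> and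
  the source of \<open>\<beta>\<close>.\<close>

definition roof_composite ::
  "('a, 'r) ring_scheme \<Rightarrow> (('a, 'c) module, 'c) cochain \<Rightarrow>
   ('a, 'z, 'b, 'c) roof \<Rightarrow> ('a, 'w, 'c, 'd) roof \<Rightarrow> ('a, 'v, 'b, 'd) roof \<Rightarrow> bool" where
  "roof_composite R Y = (\<lambda>(Z, s, f) (Z', t, g) (W, p, q).
     \<exists>h k. module_complex R W \<and> quasi_iso R W Z h \<and> chain_map R W Z' k \<and>
       homotopic R W Y (\<lambda>i. f i \<circ> h i) (\<lambda>i. t i \<circ> k i) \<and>
       p = (\<lambda>i. s i \<circ> h i) \<and> q = (\<lambda>i. g i \<circ> k i))"

text \<open>
  The apexes of all roofs live in the type \<open>'u\<close>.  As for \<open>inj_dim\<close>, two complexes are isomorphic in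
  the derived category iff the following holds for some (large enough) type \<open>'u\<close>.
\<close>

definition derived_isomorphic ::
  "'u itself \<Rightarrow> ('a, 'r) ring_scheme \<Rightarrow>
   (('a, 'b) module, 'b) cochain \<Rightarrow> (('a, 'c) module, 'c) cochain \<Rightarrow> bool" where
  "derived_isomorphic U R X Y \<longleftrightarrow>
     (\<exists>(\<alpha> :: ('a, 'u, 'b, 'c) roof) (\<beta> :: ('a, 'u, 'c, 'b) roof)
       (\<gamma> :: ('a, 'u, 'b, 'b) roof) (\<delta> :: ('a, 'u, 'c, 'c) roof).
       is_roof R X Y \<alpha> \<and> is_roof R Y X \<beta> \<and>
       roof_composite R Y \<alpha> \<beta> \<gamma> \<and> roof_equiv U R X X \<gamma> (id_roof X) \<and>
       roof_composite R X \<beta> \<alpha> \<delta> \<and> roof_equiv U R Y Y \<delta> (id_roof Y))"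


section \<open>Property (S)\<close>

definition bimodule_coresolution ::
  "('a, 'r) ring_scheme \<Rightarrow> ('a, 'b, 'x) bimodule_scheme \<Rightarrow>
   (('a, 'i) bimodule, 'i) cochain \<Rightarrow> ('b \<Rightarrow> 'i) \<Rightarrow> bool" where
  "bimodule_coresolution R B I \<epsilon> \<longleftrightarrow>
     (\<forall>k. bimodule R (obj I k) \<and> dif I k \<in> bimod_hom R (obj I k) (obj I (k + 1))) \<and>
     \<epsilon> \<in> bimod_hom R B (obj I 0) \<and> coresolution R B I \<epsilon>"

text \<open>The right modules of left linear, respectively right linear, maps between bimodules, with
  \<open>(f\<cdot>a)(x) = f(x)\<cdot>a\<close>, respectively \<open>(f\<cdot>a)(x) = f(a\<cdot>x)\<close>.  (The fields \<open>mult\<close> and \<open>one\<close> of a module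
  record carry no information.)\<close>

definition left_hom ::
  "('a, 'r) ring_scheme \<Rightarrow> ('a, 'n, 'x) bimodule_scheme \<Rightarrow> ('a, 'i, 'y) bimodule_scheme \<Rightarrow>
   ('a, 'n \<Rightarrow> 'i) module" where
  "left_hom R N J = \<lparr>carrier = mod_hom R N J \<inter> extensional (carrier N),
     monoid.mult = undefined, one = undefined,
     ring.zero = (\<lambda>x\<in>carrier N. \<zero>\<^bsub>J\<^esub>), add = (\<lambda>f g. \<lambda>x\<in>carrier N. f x \<oplus>\<^bsub>J\<^esub> g x),
     smult = (\<lambda>a f. \<lambda>x\<in>carrier N. rsmult J (f x) a)\<rparr>"

definition right_hom ::
  "('a, 'r) ring_scheme \<Rightarrow> ('a, 'n, 'x) bimodule_scheme \<Rightarrow> ('a, 'i, 'y) bimodule_scheme \<Rightarrow>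
   ('a, 'n \<Rightarrow> 'i) module" where
  "right_hom R N J = \<lparr>carrier = mod_hom (op_ring R) (right_of N) (right_of J) \<inter> extensional (carrier N),
     monoid.mult = undefined, one = undefined,
     ring.zero = (\<lambda>x\<in>carrier N. \<zero>\<^bsub>J\<^esub>), add = (\<lambda>f g. \<lambda>x\<in>carrier N. f x \<oplus>\<^bsub>J\<^esub> g x),
     smult = (\<lambda>a f. \<lambda>x\<in>carrier N. f (smult N a x))\<rparr>"

definition RHom_left ::
  "('a, 'r) ring_scheme \<Rightarrow> ('a, 'n, 'x) bimodule_scheme \<Rightarrow> (('a, 'i, 'y) bimodule_scheme, 'i) cochain \<Rightarrow>
   (('a, 'n \<Rightarrow> 'i) module, 'n \<Rightarrow> 'i) cochain" where
  "RHom_left R N I = \<lparr>obj = (\<lambda>k. left_hom R N (obj I k)),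
     dif = (\<lambda>k f. compose (carrier N) (dif I k) f)\<rparr>"

definition RHom_right ::
  "('a, 'r) ring_scheme \<Rightarrow> ('a, 'n, 'x) bimodule_scheme \<Rightarrow> (('a, 'i, 'y) bimodule_scheme, 'i) cochain \<Rightarrow>
   (('a, 'n \<Rightarrow> 'i) module, 'n \<Rightarrow> 'i) cochain" where
  "RHom_right R N I = \<lparr>obj = (\<lambda>k. right_hom R N (obj I k)),
     dif = (\<lambda>k f. compose (carrier N) (dif I k) f)\<rparr>"

text \<open>Property (S) with respect to the ring \<open>R\<close> and the chosen bimodule resolution \<open>I\<close> of the twisted
  ring.\<close>

definition property_S ::
  "'u itself \<Rightarrow> ('a, 'r) ring_scheme \<Rightarrow> (('a, 'i) bimodule, 'i) cochain \<Rightarrow>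
   ('a, 'n, 'x) bimodule_scheme \<Rightarrow> bool" where
  "property_S U R I N \<longleftrightarrow> derived_isomorphic U (op_ring R) (RHom_left R N I) (RHom_right R N I)"

end

theory Submission
 imports Defs
begin

text \<open>
 Write \<open>\<sigma>A\<close> for \<open>twist \<sigma> (regular_bimodule A)\<close> and let \<open>F\<close> be a resolution of \<open>M\<close> by free modules of finite
 rank.  The injective dimension of \<open>A\<close> on the left is finite, so the dual complex of \<open>F\<close> is exact in high
 degrees.  Continued to the left by a resolution it becomes an exact complex \<open>L\<close> of free right
 modules of finite rank, unbounded in both directions, which in degrees at least \<open>d\<close> is dual to \<open>F\<close>
 (\<open>complete_resolution\<close>).

 In these degrees the tensor product of \<open>L\<close> with \<open>N\<close> is the complex of homomorphisms from \<open>F\<close> to \<open>N\<close>.  Hence it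
 is exact in high degrees if \<open>Ext(M, N)\<close> vanishes there, and then property (R) makes it exact
 everywhere (\<open>complete_resolution_tensor_exact\<close>).  By adjunction, chain maps from a shift of \<open>L\<close> to
 \<open>RHom_right A N I\<close> are chain maps from this exact complex to the complex \<open>I\<close> of injective modules.  Because
 the injective dimension on the right is finite, such a chain map, if it vanishes in high degrees, has a
 null-homotopy that also vanishes in high degrees (\<open>Hc_tot_exact\<close>).  This is an invariant of the derived
 category (\<open>tot_exact_pullback\<close>, \<open>tot_exact_pushforward\<close>), so property (S) yields the same for
 \<open>RHom_left A N I\<close> (\<open>tot_exact_RHom_left\<close>).

 It remains to translate this back to \<open>Ext\<close>.  The part of \<open>L\<close> in degrees at most \<open>d\<close> is a projective resolution;
 let \<open>J\<close> be the total complex of right linear homomorphisms from it to \<open>I\<close>.  The left structure of \<open>I\<close> makes it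
 a complex of left modules, and each of them is a finite product of modules which are injective on the left.
 Since the injective dimension on the right is finite, homomorphisms from \<open>L\<close> to \<open>A\<close> form an exact complex.
 Therefore \<open>J\<close> has cohomology in its lowest degree only, and this is the kernel of the dual of \<open>L\<close>: a syzygy
 \<open>\<Omega>\<close> of \<open>M\<close>, twisted by \<open>\<sigma>\<close> since \<open>I\<close> resolves \<open>\<sigma>A\<close>.  So \<open>J\<close> is an injective coresolution of
 \<open>twist \<sigma> \<Omega>\<close> (\<open>Jc_coresolution\<close>).  The cocycles of \<open>Hom(N, J)\<close> are chain maps from shifts of \<open>L\<close> to
 \<open>RHom_left A N I\<close> that vanish in high degrees, and null-homotopies of them exhibit the cocycles as
 coboundaries (\<open>Jc_hom_exact\<close>).  Thus \<open>Ext(N, twist \<sigma> \<Omega>)\<close> vanishes in high degrees.  As \<open>Ext(N, \<sigma>A)\<close> does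
 so, too, dimension shifting along \<open>F\<close> leads to \<open>twist \<sigma> M\<close> (\<open>hom_exact_from_syzygy\<close>).

 Throughout, the vanishing of a cohomology group is expressed by elements, and the vanishing of \<open>Ext\<close> by the
 predicate \<open>hom_exact\<close> for some projective resolution.
\<close>

section \<open>Abelian groups and modules\<close>

context abelian_group
begin

lemma add_rules:
 "x \<in> carrier G ==> y \<in> carrier G ==> x \<oplus> y \<in> carrier G" "\<zero> \<in> carrier G" "x \<in> carrier G ==> \<ominus> x \<in> carrier G"
 "x \<in> carrier G ==> \<zero> \<oplus> x = x" "x \<in> carrier G ==> x \<oplus> \<zero> = x"
 "x \<in> carrier G ==> x \<oplus> \<ominus> x = \<zero>" "x \<in> carrier G ==> \<ominus> x \<oplus> x = \<zero>"
 "x \<in> carrier G ==> \<ominus> (\<ominus> x) = x" "\<ominus> \<zero> = \<zero>"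
 "x \<in> carrier G ==> y \<in> carrier G ==> \<ominus> (x \<oplus> y) = \<ominus> x \<oplus> \<ominus> y"
 "x \<ominus> y = x \<oplus> \<ominus> y"
 by (simp_all add: r_neg l_neg minus_add minus_eq a_comm)

text \<open>After sorting by associativity and commutativity, a summand and its negative need not be
 adjacent; these rules cancel such pairs across small gaps.\<close>

lemma add_cancel_rules:
 assumes x: "x \<in> carrier G" and y: "y \<in> carrier G"
 shows "x \<oplus> (\<ominus> x \<oplus> y) = y" "\<ominus> x \<oplus> (x \<oplus> y) = y"
  "x \<oplus> (y \<oplus> \<ominus> x) = y" "\<ominus> x \<oplus> (y \<oplus> x) = y"
  "z \<in> carrier G ==> x \<oplus> (y \<oplus> (\<ominus> x \<oplus> z)) = y \<oplus> z" "z \<in> carrier G ==> \<ominus> x \<oplus> (y \<oplus> (x \<oplus> z)) = y \<oplus> z"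
  "z \<in> carrier G ==> x \<oplus> (y \<oplus> (z \<oplus> \<ominus> x)) = y \<oplus> z" "z \<in> carrier G ==> \<ominus> x \<oplus> (y \<oplus> (z \<oplus> x)) = y \<oplus> z"
  "z \<in> carrier G ==> w \<in> carrier G ==> x \<oplus> (y \<oplus> (z \<oplus> (\<ominus> x \<oplus> w))) = y \<oplus> (z \<oplus> w)"
  "z \<in> carrier G ==> w \<in> carrier G ==> \<ominus> x \<oplus> (y \<oplus> (z \<oplus> (x \<oplus> w))) = y \<oplus> (z \<oplus> w)"
proof -
 have a: "x \<oplus> (\<ominus> x \<oplus> y) = y" "\<ominus> x \<oplus> (x \<oplus> y) = y" if "y \<in> carrier G" for y
  using x that by (simp_all add: r_neg2 r_neg1)
 show "x \<oplus> (\<ominus> x \<oplus> y) = y" "\<ominus> x \<oplus> (x \<oplus> y) = y" by (simp_all add: a y)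
 show "x \<oplus> (y \<oplus> \<ominus> x) = y" "\<ominus> x \<oplus> (y \<oplus> x) = y" using x y by (simp_all add: a_comm[of y] a)
 show "z \<in> carrier G ==> x \<oplus> (y \<oplus> (\<ominus> x \<oplus> z)) = y \<oplus> z" "z \<in> carrier G ==> \<ominus> x \<oplus> (y \<oplus> (x \<oplus> z)) = y \<oplus> z"
  using x y by (simp_all add: a_lcomm[of y] a)
 show "z \<in> carrier G ==> x \<oplus> (y \<oplus> (z \<oplus> \<ominus> x)) = y \<oplus> z" "z \<in> carrier G ==> \<ominus> x \<oplus> (y \<oplus> (z \<oplus> x)) = y \<oplus> z"
  using x y by (simp_all add: a_assoc[symmetric, of y z] a_comm[of "y \<oplus> z"] a)
 show "z \<in> carrier G ==> w \<in> carrier G ==> x \<oplus> (y \<oplus> (z \<oplus> (\<ominus> x \<oplus> w))) = y \<oplus> (z \<oplus> w)"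
  "z \<in> carrier G ==> w \<in> carrier G ==> \<ominus> x \<oplus> (y \<oplus> (z \<oplus> (x \<oplus> w))) = y \<oplus> (z \<oplus> w)"
  using x y by (simp_all add: a_assoc[symmetric, of y z] a_lcomm[of "y \<oplus> z"] a)
qed

lemma add_eq_iff: "x \<in> carrier G ==> y \<in> carrier G ==> x \<oplus> \<ominus> y = \<zero> \<longleftrightarrow> x = y"
 by (metis minus_equality minus_minus a_inv_closed r_neg a_comm)

end

lemmas ag = abelian_group.add_rules
lemmas ag_cancel = abelian_group.add_cancel_rules

lemma ag_ac:
 fixes G (structure)
 assumes "abelian_group G"
 shows "x \<in> carrier G ==> y \<in> carrier G ==> z \<in> carrier G ==> x \<oplus> y \<oplus> z = x \<oplus> (y \<oplus> z)"
  and "x \<in> carrier G ==> y \<in> carrier G ==> x \<oplus> y = y \<oplus> x"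
  and "x \<in> carrier G ==> y \<in> carrier G ==> z \<in> carrier G ==> x \<oplus> (y \<oplus> z) = y \<oplus> (x \<oplus> z)"
 using abelian_monoid.a_ac[OF abelian_group.axioms(1)[OF assms]] by auto

lemma left_moduleD:
 assumes "left_module R M"
 shows "ring R" "abelian_group M"
 using assms by (auto simp: left_module_def)

text \<open>In simplification sets the assumption \<open>left_module R M\<close> is discharged once, by \<open>lm[OF M]\<close>; this avoids
 interpretations of \<open>left_module\<close> for the many modules that occur together in one proof.\<close>

lemma lm_smult:
 assumes M: "left_module R M"
 shows "a \<in> carrier R ==> x \<in> carrier M ==> a \<odot>\<^bsub>M\<^esub> x \<in> carrier M"
  and "a \<in> carrier R ==> a \<odot>\<^bsub>M\<^esub> \<zero>\<^bsub>M\<^esub> = \<zero>\<^bsub>M\<^esub>"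
  and "x \<in> carrier M ==> \<zero>\<^bsub>R\<^esub> \<odot>\<^bsub>M\<^esub> x = \<zero>\<^bsub>M\<^esub>"
  and "x \<in> carrier M ==> \<one>\<^bsub>R\<^esub> \<odot>\<^bsub>M\<^esub> x = x"
  and "a \<in> carrier R ==> x \<in> carrier M ==> y \<in> carrier M ==>
   a \<odot>\<^bsub>M\<^esub> (x \<oplus>\<^bsub>M\<^esub> y) = a \<odot>\<^bsub>M\<^esub> x \<oplus>\<^bsub>M\<^esub> a \<odot>\<^bsub>M\<^esub> y"
  and "a \<in> carrier R ==> x \<in> carrier M ==> a \<odot>\<^bsub>M\<^esub> (\<ominus>\<^bsub>M\<^esub> x) = \<ominus>\<^bsub>M\<^esub> (a \<odot>\<^bsub>M\<^esub> x)"
  and "a \<in> carrier R ==> b \<in> carrier R ==> x \<in> carrier M ==>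
   (a \<oplus>\<^bsub>R\<^esub> b) \<odot>\<^bsub>M\<^esub> x = a \<odot>\<^bsub>M\<^esub> x \<oplus>\<^bsub>M\<^esub> b \<odot>\<^bsub>M\<^esub> x"
  and "a \<in> carrier R ==> b \<in> carrier R ==> x \<in> carrier M ==>
   (a \<otimes>\<^bsub>R\<^esub> b) \<odot>\<^bsub>M\<^esub> x = a \<odot>\<^bsub>M\<^esub> (b \<odot>\<^bsub>M\<^esub> x)"
proof -
 interpret left_module R M by fact
 have z: "a \<odot>\<^bsub>M\<^esub> \<zero>\<^bsub>M\<^esub> = \<zero>\<^bsub>M\<^esub>" if "a \<in> carrier R" for a
  using smult_r_distr[of a "\<zero>\<^bsub>M\<^esub>" "\<zero>\<^bsub>M\<^esub>"] that by simp
 show "a \<in> carrier R ==> a \<odot>\<^bsub>M\<^esub> \<zero>\<^bsub>M\<^esub> = \<zero>\<^bsub>M\<^esub>" by (rule z)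
 show "x \<in> carrier M ==> \<zero>\<^bsub>R\<^esub> \<odot>\<^bsub>M\<^esub> x = \<zero>\<^bsub>M\<^esub>"
  using smult_l_distr[of "\<zero>\<^bsub>R\<^esub>" "\<zero>\<^bsub>R\<^esub>" x] by simp
 show "a \<in> carrier R ==> x \<in> carrier M ==> a \<odot>\<^bsub>M\<^esub> (\<ominus>\<^bsub>M\<^esub> x) = \<ominus>\<^bsub>M\<^esub> (a \<odot>\<^bsub>M\<^esub> x)"
  using smult_r_distr[of a "\<ominus>\<^bsub>M\<^esub> x" x] z by (simp add: M.l_neg M.minus_equality)
qed (use assms in \<open>auto simp: left_module_def left_module_axioms_def\<close>)

lemmas lm = ag[OF left_moduleD(2)] lm_smult
lemmas lm_ac = ag_ac[OF left_moduleD(2)]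
lemmas lm_cancel = ag_cancel[OF left_moduleD(2)]
lemmas lm_eq_iff = abelian_group.add_eq_iff[OF left_moduleD(2)]
lemmas lms = lm lm_ac lm_cancel

lemma ab_groupI:
 assumes "\<And>x y. x \<in> carrier G ==> y \<in> carrier G ==> x \<oplus>\<^bsub>G\<^esub> y \<in> carrier G"
  and "\<zero>\<^bsub>G\<^esub> \<in> carrier G"
  and "\<And>x y z. x \<in> carrier G ==> y \<in> carrier G ==> z \<in> carrier G ==>
   (x \<oplus>\<^bsub>G\<^esub> y) \<oplus>\<^bsub>G\<^esub> z = x \<oplus>\<^bsub>G\<^esub> (y \<oplus>\<^bsub>G\<^esub> z)"
  and "\<And>x y. x \<in> carrier G ==> y \<in> carrier G ==> x \<oplus>\<^bsub>G\<^esub> y = y \<oplus>\<^bsub>G\<^esub> x"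
  and "\<And>x. x \<in> carrier G ==> \<zero>\<^bsub>G\<^esub> \<oplus>\<^bsub>G\<^esub> x = x"
  and "\<And>x. x \<in> carrier G ==> \<exists>y\<in>carrier G. y \<oplus>\<^bsub>G\<^esub> x = \<zero>\<^bsub>G\<^esub>"
 shows "abelian_group G"
 by (rule abelian_groupI) (use assms in auto)

lemma left_moduleI:
 assumes "ring R" "abelian_group M"
  and "\<And>a x. a \<in> carrier R ==> x \<in> carrier M ==> a \<odot>\<^bsub>M\<^esub> x \<in> carrier M"
  and "\<And>a b x. a \<in> carrier R ==> b \<in> carrier R ==> x \<in> carrier M ==>
   (a \<oplus>\<^bsub>R\<^esub> b) \<odot>\<^bsub>M\<^esub> x = a \<odot>\<^bsub>M\<^esub> x \<oplus>\<^bsub>M\<^esub> b \<odot>\<^bsub>M\<^esub> x"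
  and "\<And>a x y. a \<in> carrier R ==> x \<in> carrier M ==> y \<in> carrier M ==>
   a \<odot>\<^bsub>M\<^esub> (x \<oplus>\<^bsub>M\<^esub> y) = a \<odot>\<^bsub>M\<^esub> x \<oplus>\<^bsub>M\<^esub> a \<odot>\<^bsub>M\<^esub> y"
  and "\<And>a b x. a \<in> carrier R ==> b \<in> carrier R ==> x \<in> carrier M ==>
   (a \<otimes>\<^bsub>R\<^esub> b) \<odot>\<^bsub>M\<^esub> x = a \<odot>\<^bsub>M\<^esub> (b \<odot>\<^bsub>M\<^esub> x)"
  and "\<And>x. x \<in> carrier M ==> \<one>\<^bsub>R\<^esub> \<odot>\<^bsub>M\<^esub> x = x"
 shows "left_module R M"
 using assms by (auto simp: left_module_def left_module_axioms_def)

lemma op_ring_simps [simp]: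
 "carrier (op_ring R) = carrier R" "\<zero>\<^bsub>op_ring R\<^esub> = \<zero>\<^bsub>R\<^esub>" "\<one>\<^bsub>op_ring R\<^esub> = \<one>\<^bsub>R\<^esub>"
 "add (op_ring R) = add R" "x \<otimes>\<^bsub>op_ring R\<^esub> y = y \<otimes>\<^bsub>R\<^esub> x" "op_ring (op_ring R) = R"
 by (simp_all add: op_ring_def)

lemma ring_op_ring: fixes R (structure) assumes "ring R" shows "ring (op_ring R)"
proof -
 interpret ring R by fact
 show ?thesis
  by (rule ringI, rule ab_groupI)
   (auto simp: a_ac m_assoc l_distr r_distr intro!: monoid.intro bexI[of _ "\<ominus> _"] l_neg)
qed

lemma regular_simps [simp]:
 "carrier (regular_bimodule R) = carrier R" "\<zero>\<^bsub>regular_bimodule R\<^esub> = \<zero>\<^bsub>R\<^esub>"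
 "add (regular_bimodule R) = add R" "smult (regular_bimodule R) = monoid.mult R"
 "rsmult (regular_bimodule R) = monoid.mult R"
 by (simp_all add: regular_bimodule_def)

lemma right_of_simps [simp]:
 "carrier (right_of B) = carrier B" "\<zero>\<^bsub>right_of B\<^esub> = \<zero>\<^bsub>B\<^esub>" "add (right_of B) = add B"
 "a \<odot>\<^bsub>right_of B\<^esub> x = rsmult B x a"
 by (simp_all add: right_of_def)

lemma twist_simps [simp]:
 "carrier (twist \<sigma> B) = carrier B" "\<zero>\<^bsub>twist \<sigma> B\<^esub> = \<zero>\<^bsub>B\<^esub>" "add (twist \<sigma> B) = add B"
 "a \<odot>\<^bsub>twist \<sigma> B\<^esub> x = \<sigma> a \<odot>\<^bsub>B\<^esub> x"
 by (simp_all add: twist_def)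

lemma rsmult_twist [simp]:
 "rsmult (twist \<sigma> B) = rsmult (B :: ('a, 'b, 'x) bimodule_scheme)"
 by (simp add: twist_def)

lemma a_inv_cong:
 "carrier M = carrier N ==> \<zero>\<^bsub>M\<^esub> = \<zero>\<^bsub>N\<^esub> ==> add M = add N ==> \<ominus>\<^bsub>M\<^esub> x = \<ominus>\<^bsub>N\<^esub> x"
 by (simp add: a_inv_def m_inv_def)

lemma ag_cong:
 assumes "abelian_group M" "carrier M = carrier N" "\<zero>\<^bsub>M\<^esub> = \<zero>\<^bsub>N\<^esub>" "add M = add N"
 shows "abelian_group N"
proof (rule ab_groupI)
 fix x assume "x \<in> carrier N"
 then show "\<exists>y\<in>carrier N. y \<oplus>\<^bsub>N\<^esub> x = \<zero>\<^bsub>N\<^esub>"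
  using ag(3,7)[OF assms(1), of x] assms(2-) by auto
qed (use ag[OF assms(1)] ag_ac[OF assms(1)] assms(2-) in auto)

lemma left_module_regular: assumes "ring R" shows "left_module R (regular_bimodule R)"
proof -
 interpret ring R by fact
 show ?thesis
  by (rule left_moduleI) (auto simp: m_assoc l_distr r_distr assms intro: ag_cong[OF abelian_group_axioms])
qed

section \<open>Module homomorphisms\<close>

lemma mod_homI:
 assumes "\<And>x. x \<in> carrier M ==> h x \<in> carrier N"
  and "\<And>x y. x \<in> carrier M ==> y \<in> carrier M ==> h (x \<oplus>\<^bsub>M\<^esub> y) = h x \<oplus>\<^bsub>N\<^esub> h y"
  and "\<And>a x. a \<in> carrier R ==> x \<in> carrier M ==> h (a \<odot>\<^bsub>M\<^esub> x) = a \<odot>\<^bsub>N\<^esub> h x"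
 shows "h \<in> mod_hom R M N"
 using assms by (auto simp: mod_hom_def)

lemma mod_homD:
 assumes "h \<in> mod_hom R M N"
 shows "x \<in> carrier M ==> h x \<in> carrier N"
  and "x \<in> carrier M ==> y \<in> carrier M ==> h (x \<oplus>\<^bsub>M\<^esub> y) = h x \<oplus>\<^bsub>N\<^esub> h y"
  and "a \<in> carrier R ==> x \<in> carrier M ==> h (a \<odot>\<^bsub>M\<^esub> x) = a \<odot>\<^bsub>N\<^esub> h x"
 using assms by (auto simp: mod_hom_def)

lemma hom_zero_ag:
 assumes "abelian_group M" "abelian_group N" "\<And>x. x \<in> carrier M ==> h x \<in> carrier N"
  "\<And>x y. x \<in> carrier M ==> y \<in> carrier M ==> h (x \<oplus>\<^bsub>M\<^esub> y) = h x \<oplus>\<^bsub>N\<^esub> h y"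
 shows "h \<zero>\<^bsub>M\<^esub> = \<zero>\<^bsub>N\<^esub>" "x \<in> carrier M ==> h (\<ominus>\<^bsub>M\<^esub> x) = \<ominus>\<^bsub>N\<^esub> h x"
proof -
 interpret M: abelian_group M by fact
 interpret N: abelian_group N by fact
 show z: "h \<zero>\<^bsub>M\<^esub> = \<zero>\<^bsub>N\<^esub>"
  using assms(4)[of "\<zero>\<^bsub>M\<^esub>" "\<zero>\<^bsub>M\<^esub>"] assms(3)[of "\<zero>\<^bsub>M\<^esub>"] by simp
 show "h (\<ominus>\<^bsub>M\<^esub> x) = \<ominus>\<^bsub>N\<^esub> h x" if "x \<in> carrier M"
  using assms(4)[of "\<ominus>\<^bsub>M\<^esub> x" x] z that assms(3) by (simp add: M.l_neg N.minus_equality)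
qed

lemma hom_simps:
 assumes "h \<in> mod_hom R M N" "left_module R M" "left_module R N"
 shows "x \<in> carrier M ==> h x \<in> carrier N"
  and "x \<in> carrier M ==> y \<in> carrier M ==> h (x \<oplus>\<^bsub>M\<^esub> y) = h x \<oplus>\<^bsub>N\<^esub> h y"
  and "a \<in> carrier R ==> x \<in> carrier M ==> h (a \<odot>\<^bsub>M\<^esub> x) = a \<odot>\<^bsub>N\<^esub> h x"
  and "h \<zero>\<^bsub>M\<^esub> = \<zero>\<^bsub>N\<^esub>"
  and "x \<in> carrier M ==> h (\<ominus>\<^bsub>M\<^esub> x) = \<ominus>\<^bsub>N\<^esub> h x"
  and "x \<in> carrier M ==> y \<in> carrier M ==> h (x \<ominus>\<^bsub>M\<^esub> y) = h x \<ominus>\<^bsub>N\<^esub> h y"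
proof -
 note * = mod_homD[OF assms(1)] and M = left_moduleD(2)[OF assms(2)] and N = left_moduleD(2)[OF assms(3)]
 show "x \<in> carrier M ==> h x \<in> carrier N"
  "x \<in> carrier M ==> y \<in> carrier M ==> h (x \<oplus>\<^bsub>M\<^esub> y) = h x \<oplus>\<^bsub>N\<^esub> h y"
  "a \<in> carrier R ==> x \<in> carrier M ==> h (a \<odot>\<^bsub>M\<^esub> x) = a \<odot>\<^bsub>N\<^esub> h x"
  by (rule *; assumption)+
 note z = hom_zero_ag[of M N h, OF M N *(1,2)]
 show "h \<zero>\<^bsub>M\<^esub> = \<zero>\<^bsub>N\<^esub>" "x \<in> carrier M ==> h (\<ominus>\<^bsub>M\<^esub> x) = \<ominus>\<^bsub>N\<^esub> h x"
  by (rule z; assumption)+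
 show "x \<in> carrier M ==> y \<in> carrier M ==> h (x \<ominus>\<^bsub>M\<^esub> y) = h x \<ominus>\<^bsub>N\<^esub> h y"
  by (simp add: lm[OF assms(2)] lm[OF assms(3)] *(2) z)
qed

lemma hom_comp:
 assumes "f \<in> mod_hom R M N" "g \<in> mod_hom R N K"
 shows "(\<lambda>x. g (f x)) \<in> mod_hom R M K"
 using assms by (auto simp: mod_hom_def Pi_iff)

lemma hom_id: "(\<lambda>x. x) \<in> mod_hom R M M"
 by (auto simp: mod_hom_def)

lemma hom_zero: "left_module R N ==> (\<lambda>x. \<zero>\<^bsub>N\<^esub>) \<in> mod_hom R M N"
 by (auto simp: mod_hom_def lm)

lemma hom_add:
 assumes "f \<in> mod_hom R M N" "g \<in> mod_hom R M N" "left_module R N"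
 shows "(\<lambda>x. f x \<oplus>\<^bsub>N\<^esub> g x) \<in> mod_hom R M N"
 by (rule mod_homI) (auto simp: mod_homD[OF assms(1)] mod_homD[OF assms(2)] lms[OF assms(3)])

lemma hom_neg:
 assumes "f \<in> mod_hom R M N" "left_module R N"
 shows "(\<lambda>x. \<ominus>\<^bsub>N\<^esub> f x) \<in> mod_hom R M N"
 by (rule mod_homI) (auto simp: mod_homD[OF assms(1)] lms[OF assms(2)])

lemma hom_diff:
 assumes "f \<in> mod_hom R M N" "g \<in> mod_hom R M N" "left_module R N"
 shows "(\<lambda>x. f x \<oplus>\<^bsub>N\<^esub> \<ominus>\<^bsub>N\<^esub> g x) \<in> mod_hom R M N"
 by (intro hom_add hom_neg assms)

lemma hom_cong:
 assumes "f \<in> mod_hom R M N" "\<And>x. x \<in> carrier M ==> f x = g x" "left_module R M"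
 shows "g \<in> mod_hom R M N"
 using assms(1) assms(2) lm[OF assms(3)] by (fastforce simp: mod_hom_def Pi_iff)

section \<open>Free modules\<close>

text \<open>The carrier consists of functions on the whole index type that vanish outside \<open>S\<close>; so two elements are
 equal if and only if they are equal as functions.\<close>

definition dsum :: "('a, 'm, 'x) module_scheme => 's set => ('a, 's => 'm) module" where
 "dsum M S = \<lparr>carrier = {f. (\<forall>s. f s \<in> carrier M) \<and> (\<forall>s. s \<notin> S --> f s = \<zero>\<^bsub>M\<^esub>) \<and> finite {s. f s \<noteq> \<zero>\<^bsub>M\<^esub>}},
   monoid.mult = undefined, one = undefined, ring.zero = (\<lambda>s. \<zero>\<^bsub>M\<^esub>),
   add = (\<lambda>f g s. f s \<oplus>\<^bsub>M\<^esub> g s), smult = (\<lambda>a f s. a \<odot>\<^bsub>M\<^esub> f s)\<rparr>"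

abbreviation free :: "('a, 'r) ring_scheme => 's set => ('a, 's => 'a) module" where
 "free R S \<equiv> dsum (regular_bimodule R) S"

abbreviation Fr :: "('a, 'r) ring_scheme => nat => ('a, nat => 'a) module" where
 "Fr R n \<equiv> free R {..<n}"

abbreviation vecs :: "('a, 'r) ring_scheme => nat => (nat => 'a) set" where
 "vecs R n \<equiv> carrier (Fr R n)"

definition bas :: "('a, 'r) ring_scheme => 's => 's => 'a" where
 "bas R s = (\<lambda>t. if t = s then \<one>\<^bsub>R\<^esub> else \<zero>\<^bsub>R\<^esub>)"

text \<open>The linear map from the free module which sends the basis vector \<open>bas R s\<close> to \<open>x s\<close>.\<close>

definition lin ::
 "('a, 'r) ring_scheme => ('a, 'm, 'x) module_scheme => ('s => 'm) => ('s => 'a) => 'm" where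
 "lin R M x f = finsum M (\<lambda>s. f s \<odot>\<^bsub>M\<^esub> x s) {s. f s \<noteq> \<zero>\<^bsub>R\<^esub>}"

lemma dsum_simps [simp]:
 "\<zero>\<^bsub>dsum M S\<^esub> = (\<lambda>s. \<zero>\<^bsub>M\<^esub>)" "f \<oplus>\<^bsub>dsum M S\<^esub> g = (\<lambda>s. f s \<oplus>\<^bsub>M\<^esub> g s)"
 "a \<odot>\<^bsub>dsum M S\<^esub> f = (\<lambda>s. a \<odot>\<^bsub>M\<^esub> f s)"
 by (simp_all add: dsum_def)

lemma dsum_carrier:
 "f \<in> carrier (dsum M S) \<longleftrightarrow>
  (\<forall>s. f s \<in> carrier M) \<and> (\<forall>s. s \<notin> S --> f s = \<zero>\<^bsub>M\<^esub>) \<and> finite {s. f s \<noteq> \<zero>\<^bsub>M\<^esub>}"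
 by (simp add: dsum_def)

lemma dsum_carrier_finite:
 assumes "finite S"
 shows "f \<in> carrier (dsum M S) \<longleftrightarrow> (\<forall>s. f s \<in> carrier M) \<and> (\<forall>s. s \<notin> S --> f s = \<zero>\<^bsub>M\<^esub>)"
proof -
 have "finite {s. f s \<noteq> \<zero>\<^bsub>M\<^esub>}" if "\<forall>s. s \<notin> S --> f s = \<zero>\<^bsub>M\<^esub>"
  using that by (intro finite_subset[OF _ assms]) auto
 then show ?thesis by (auto simp: dsum_carrier)
qed

lemma left_module_dsum:
 fixes M :: "('a, 'm, 'x) module_scheme" and S :: "'s set"
 assumes M: "left_module R M"
 shows "left_module R (dsum M S)"
proof -
 have fin: "finite {s. f s \<oplus>\<^bsub>M\<^esub> g s \<noteq> \<zero>\<^bsub>M\<^esub>}"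
  if "finite {s. f s \<noteq> \<zero>\<^bsub>M\<^esub>}" "finite {s. g s \<noteq> \<zero>\<^bsub>M\<^esub>}" for f g :: "'s => 'm"
 proof (rule finite_subset)
  show "{s. f s \<oplus>\<^bsub>M\<^esub> g s \<noteq> \<zero>\<^bsub>M\<^esub>} \<subseteq> {s. f s \<noteq> \<zero>\<^bsub>M\<^esub>} \<union> {s. g s \<noteq> \<zero>\<^bsub>M\<^esub>}"
   by (auto simp: lm[OF M])
 qed (use that in auto)
 have fin2: "finite {s. a \<odot>\<^bsub>M\<^esub> f s \<noteq> \<zero>\<^bsub>M\<^esub>}"
  if "finite {s. f s \<noteq> \<zero>\<^bsub>M\<^esub>}" "a \<in> carrier R" for f :: "'s => 'm" and a
  by (rule finite_subset[OF _ that(1)]) (auto simp: lm[OF M] that)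
 have c: "f s \<in> carrier M" if "f \<in> carrier (dsum M S)" for f :: "'s => 'm" and s
  using that by (auto simp: dsum_carrier)
 show ?thesis
 proof (rule left_moduleI)
 show "ring R" using left_moduleD[OF M] by simp
 show "abelian_group (dsum M S)"
 proof (rule ab_groupI)
  fix f assume f: "f \<in> carrier (dsum M S)"
  have "finite {s. \<ominus>\<^bsub>M\<^esub> f s \<noteq> \<zero>\<^bsub>M\<^esub>}"
   using f by (rule_tac finite_subset[of _ "{s. f s \<noteq> \<zero>\<^bsub>M\<^esub>}"]) (auto simp: dsum_carrier lm[OF M])
  then show "\<exists>g\<in>carrier (dsum M S). g \<oplus>\<^bsub>dsum M S\<^esub> f = \<zero>\<^bsub>dsum M S\<^esub>"
   using f by (intro bexI[of _ "\<lambda>s. \<ominus>\<^bsub>M\<^esub> f s"]) (auto simp: dsum_carrier lm[OF M])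
 next
  fix f g assume "f \<in> carrier (dsum M S)" "g \<in> carrier (dsum M S)"
  then show "f \<oplus>\<^bsub>dsum M S\<^esub> g \<in> carrier (dsum M S)"
   using fin by (simp add: dsum_carrier lm[OF M])
  show "f \<oplus>\<^bsub>dsum M S\<^esub> g = g \<oplus>\<^bsub>dsum M S\<^esub> f"
   using \<open>f \<in> _\<close> \<open>g \<in> _\<close> by (simp add: fun_eq_iff c lm_ac(2)[OF M])
 qed (simp_all add: fun_eq_iff c lm[OF M] lm_ac(1)[OF M], simp add: dsum_carrier lm[OF M])
 show "a \<odot>\<^bsub>dsum M S\<^esub> f \<in> carrier (dsum M S)" if "a \<in> carrier R" "f \<in> carrier (dsum M S)" for a f
  using that fin2 by (simp add: dsum_carrier lm[OF M])
 show "\<one>\<^bsub>R\<^esub> \<odot>\<^bsub>dsum M S\<^esub> f = f" if "f \<in> carrier (dsum M S)" for f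
  using that by (simp add: fun_eq_iff c lm[OF M])
qed (simp_all add: fun_eq_iff c lm[OF M])
qed

lemma left_module_free: "ring R ==> left_module R (free R S)"
 by (intro left_module_dsum left_module_regular)

lemma free_carrier:
 "f \<in> carrier (free R S) \<longleftrightarrow>
  (\<forall>s. f s \<in> carrier R) \<and> (\<forall>s. s \<notin> S --> f s = \<zero>\<^bsub>R\<^esub>) \<and> finite {s. f s \<noteq> \<zero>\<^bsub>R\<^esub>}"
 by (simp add: dsum_carrier)

lemma bas_in: assumes "ring R" "s \<in> S" shows "bas R s \<in> carrier (free R S)"
proof -
 interpret ring R by fact
 have "finite {t. bas R s t \<noteq> \<zero>\<^bsub>R\<^esub>}"
  by (rule finite_subset[of _ "{s}"]) (auto simp: bas_def)
 then show ?thesis using assms by (auto simp: free_carrier bas_def)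
qed

lemma free_induct [consumes 2, case_names zero step]:
 assumes R: "ring R" and v: "v \<in> carrier (free R S)"
  and zero: "P (\<lambda>s. \<zero>\<^bsub>R\<^esub>)"
  and step: "\<And>w a s. w \<in> carrier (free R S) ==> a \<in> carrier R ==> s \<in> S ==> P w ==>
    P (w \<oplus>\<^bsub>free R S\<^esub> a \<odot>\<^bsub>free R S\<^esub> bas R s)"
 shows "P v"
proof -
 interpret ring R by fact
 have "finite {s. v s \<noteq> \<zero>\<^bsub>R\<^esub>}" using v by (simp add: free_carrier)
 then show ?thesis using v
 proof (induction "{s. v s \<noteq> \<zero>\<^bsub>R\<^esub>}" arbitrary: v rule: finite_psubset_induct)
  case (psubset v)
  show ?case
  proof (cases "{s. v s \<noteq> \<zero>\<^bsub>R\<^esub>} = {}")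
   case True
   then have "v = (\<lambda>s. \<zero>\<^bsub>R\<^esub>)" by auto
   then show ?thesis using zero by simp
  next
   case False
   then obtain s where s: "v s \<noteq> \<zero>\<^bsub>R\<^esub>" by auto
   have sS: "s \<in> S" using psubset.prems s by (auto simp: free_carrier)
   define w where "w = v(s := \<zero>\<^bsub>R\<^esub>)"
   have sub: "{t. w t \<noteq> \<zero>\<^bsub>R\<^esub>} \<subset> {t. v t \<noteq> \<zero>\<^bsub>R\<^esub>}"
    using s by (auto simp: w_def)
   have w: "w \<in> carrier (free R S)"
    using psubset.prems finite_subset[OF psubset_imp_subset[OF sub]]
    by (auto simp: free_carrier w_def)
   have eq: "w \<oplus>\<^bsub>free R S\<^esub> v s \<odot>\<^bsub>free R S\<^esub> bas R s = v"
    using psubset.prems by (auto simp: w_def bas_def fun_eq_iff free_carrier)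
   have vs: "v s \<in> carrier R" using psubset.prems by (simp add: free_carrier)
   show ?thesis using step[OF w vs sS psubset.hyps(2)[OF sub w]] eq by simp
  qed
 qed
qed

lemma free_hom_eq:
 assumes R: "ring R" and M: "left_module R M" and f: "f \<in> mod_hom R (free R S) M"
  and g: "g \<in> mod_hom R (free R S) M" and eq: "\<And>s. s \<in> S ==> f (bas R s) = g (bas R s)"
  and v: "v \<in> carrier (free R S)"
 shows "f v = g v"
 using R v
proof (induction rule: free_induct)
 case zero
 then show ?case using hom_simps(4)[OF f left_module_free[OF R] M] hom_simps(4)[OF g left_module_free[OF R] M]
  by simp
next
 case (step w a s)
 note F = left_module_free[OF R, of S] and b = bas_in[OF R step(3)]
 show ?case
  unfolding mod_homD(2)[OF f step(1) lm(12)[OF F step(2) b]] mod_homD(2)[OF g step(1) lm(12)[OF F step(2) b]]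
   mod_homD(3)[OF f step(2) b] mod_homD(3)[OF g step(2) b] eq[OF step(3)] step(4) ..
qed

lemma finsum_hom:
 assumes M: "abelian_group M" and N: "abelian_group N"
  and h: "\<And>x. x \<in> carrier M ==> h x \<in> carrier N"
  and a: "\<And>x y. x \<in> carrier M ==> y \<in> carrier M ==> h (x \<oplus>\<^bsub>M\<^esub> y) = h x \<oplus>\<^bsub>N\<^esub> h y"
  and f: "\<And>s. s \<in> T ==> f s \<in> carrier M"
 shows "h (finsum M f T) = finsum N (\<lambda>s. h (f s)) T"
proof -
 interpret M: abelian_group M by fact
 interpret N: abelian_group N by fact
 note z = hom_zero_ag[of M N h, OF M N h a]
 show ?thesis
 proof (cases "finite T")
  case True
  then show ?thesis using f
   by (induction T rule: finite_induct) (auto simp: z a h Pi_iff)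
 next
  case False
  then show ?thesis by (simp add: M.finsum_infinite N.finsum_infinite z)
 qed
qed

lemma lin_superset:
 assumes M: "left_module R M" and f: "f \<in> carrier (free R S)" and x: "\<And>s. s \<in> S ==> x s \<in> carrier M"
  and T: "finite T" "{s. f s \<noteq> \<zero>\<^bsub>R\<^esub>} \<subseteq> T" "T \<subseteq> S"
 shows "lin R M x f = finsum M (\<lambda>s. f s \<odot>\<^bsub>M\<^esub> x s) T"
proof -
 interpret M: abelian_group M using left_moduleD[OF M] by simp
 show ?thesis unfolding lin_def
  by (rule M.add.finprod_mono_neutral_cong_left)
   (use T f x in \<open>auto simp: lm[OF M] free_carrier subset_iff\<close>)
qed

lemma lin_finite:
 assumes M: "left_module R M" and f: "f \<in> carrier (free R S)" and x: "\<And>s. s \<in> S ==> x s \<in> carrier M"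
  and S: "finite S"
 shows "lin R M x f = finsum M (\<lambda>s. f s \<odot>\<^bsub>M\<^esub> x s) S"
 using f by (intro lin_superset[OF M f x S]) (auto simp: free_carrier)

lemma lin_hom:
 assumes M: "left_module R M" and x: "\<And>s. s \<in> S ==> x s \<in> carrier M"
 shows "lin R M x \<in> mod_hom R (free R S) M"
proof -
 have R: "ring R" and Ma: "abelian_group M" using left_moduleD[OF M] by auto
 interpret M: abelian_group M by fact
 note F = left_module_free[OF R, of S]
 show ?thesis
 proof (rule mod_homI)
  fix f assume f: "f \<in> carrier (free R S)"
  show "lin R M x f \<in> carrier M"
   unfolding lin_def using f x
   by (intro M.finsum_closed) (auto simp: free_carrier intro!: lm(12)[OF M] dest: spec)
 next
  fix f g assume f: "f \<in> carrier (free R S)" and g: "g \<in> carrier (free R S)"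
  define T where "T = {s. f s \<noteq> \<zero>\<^bsub>R\<^esub>} \<union> {s. g s \<noteq> \<zero>\<^bsub>R\<^esub>}"
  have T: "finite T" "{s. f s \<noteq> \<zero>\<^bsub>R\<^esub>} \<subseteq> T" "{s. g s \<noteq> \<zero>\<^bsub>R\<^esub>} \<subseteq> T" "T \<subseteq> S"
   using f g by (auto simp: T_def free_carrier)
  have fg: "f \<oplus>\<^bsub>free R S\<^esub> g \<in> carrier (free R S)" using f g by (rule lm(1)[OF F])
  have T': "{s. (f \<oplus>\<^bsub>free R S\<^esub> g) s \<noteq> \<zero>\<^bsub>R\<^esub>} \<subseteq> T"
   using ring.is_abelian_group[OF R] by (auto simp: T_def ag)
  have c: "f s \<in> carrier R" "g s \<in> carrier R" for s using f g by (auto simp: free_carrier)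
  have xT: "s \<in> T ==> x s \<in> carrier M" for s using x T by auto
  have lf: "lin R M x f = finsum M (\<lambda>s. f s \<odot>\<^bsub>M\<^esub> x s) T"
   by (rule lin_superset[OF M f x T(1,2,4)])
  have lg: "lin R M x g = finsum M (\<lambda>s. g s \<odot>\<^bsub>M\<^esub> x s) T"
   by (rule lin_superset[OF M g x T(1,3,4)])
  have "lin R M x (f \<oplus>\<^bsub>free R S\<^esub> g) = finsum M (\<lambda>s. (f \<oplus>\<^bsub>free R S\<^esub> g) s \<odot>\<^bsub>M\<^esub> x s) T"
   by (rule lin_superset[OF M fg x T(1) T' T(4)])
  also have "\<dots> = finsum M (\<lambda>s. f s \<odot>\<^bsub>M\<^esub> x s \<oplus>\<^bsub>M\<^esub> g s \<odot>\<^bsub>M\<^esub> x s) T"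
   by (rule M.finsum_cong') (auto simp: lm[OF M] c xT)
  also have "\<dots> = lin R M x f \<oplus>\<^bsub>M\<^esub> lin R M x g"
   unfolding lf lg by (rule M.finsum_addf) (auto simp: lm[OF M] c xT)
  finally show "lin R M x (f \<oplus>\<^bsub>free R S\<^esub> g) = lin R M x f \<oplus>\<^bsub>M\<^esub> lin R M x g" .
 next
  fix a f assume a: "a \<in> carrier R" and f: "f \<in> carrier (free R S)"
  define T where "T = {s. f s \<noteq> \<zero>\<^bsub>R\<^esub>}"
  have T: "finite T" "{s. f s \<noteq> \<zero>\<^bsub>R\<^esub>} \<subseteq> T" "T \<subseteq> S"
   using f by (auto simp: T_def free_carrier)
  have af: "a \<odot>\<^bsub>free R S\<^esub> f \<in> carrier (free R S)" using a f by (rule lm(12)[OF F])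
  have T': "{s. (a \<odot>\<^bsub>free R S\<^esub> f) s \<noteq> \<zero>\<^bsub>R\<^esub>} \<subseteq> T"
   using lm(13)[OF left_module_regular[OF R] a] by (auto simp: T_def)
  have c: "f s \<in> carrier R" for s using f by (auto simp: free_carrier)
  have xT: "s \<in> T ==> x s \<in> carrier M" for s using x T by auto
  have lf: "lin R M x f = finsum M (\<lambda>s. f s \<odot>\<^bsub>M\<^esub> x s) T"
   by (rule lin_superset[OF M f x T])
  have "lin R M x (a \<odot>\<^bsub>free R S\<^esub> f) = finsum M (\<lambda>s. (a \<odot>\<^bsub>free R S\<^esub> f) s \<odot>\<^bsub>M\<^esub> x s) T"
   by (rule lin_superset[OF M af x T(1) T' T(3)])
  also have "\<dots> = finsum M (\<lambda>s. a \<odot>\<^bsub>M\<^esub> (f s \<odot>\<^bsub>M\<^esub> x s)) T"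
   by (rule M.finsum_cong') (auto simp: lm[OF M] c xT a)
  also have "\<dots> = a \<odot>\<^bsub>M\<^esub> finsum M (\<lambda>s. f s \<odot>\<^bsub>M\<^esub> x s) T"
   by (rule finsum_hom[OF Ma Ma, symmetric]) (simp_all add: lm[OF M] c xT a)
  finally show "lin R M x (a \<odot>\<^bsub>free R S\<^esub> f) = a \<odot>\<^bsub>M\<^esub> lin R M x f"
   unfolding lf .
 qed
qed

lemma lin_bas:
 assumes M: "left_module R M" and "s \<in> S" and x: "\<And>s. s \<in> S ==> x s \<in> carrier M"
 shows "lin R M x (bas R s) = x s"
proof -
 have R: "ring R" and Ma: "abelian_group M" using left_moduleD[OF M] by auto
 interpret M: abelian_group M by fact
 have "lin R M x (bas R s) = finsum M (\<lambda>t. bas R s t \<odot>\<^bsub>M\<^esub> x t) {s}"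
  by (rule lin_superset[OF M bas_in[OF R \<open>s \<in> S\<close>] x]) (use assms in \<open>auto simp: bas_def\<close>)
 also have "\<dots> = x s" using x[OF \<open>s \<in> S\<close>] by (simp add: bas_def lm[OF M])
 finally show ?thesis .
qed

lemma free_lift:
 assumes U: "left_module R U" and V: "left_module R V" and q: "q \<in> mod_hom R U V"
  and g: "g \<in> mod_hom R (free R S) V" and im: "\<And>s. s \<in> S ==> g (bas R s) \<in> q ` carrier U"
 shows "\<exists>h\<in>mod_hom R (free R S) U. \<forall>v\<in>carrier (free R S). q (h v) = g v"
proof -
 have R: "ring R" using left_moduleD[OF U] by simp
 have "\<forall>s\<in>S. \<exists>u\<in>carrier U. g (bas R s) = q u" using im by (auto simp: image_iff)
 then obtain u where u: "\<And>s. s \<in> S ==> u s \<in> carrier U" "\<And>s. s \<in> S ==> g (bas R s) = q (u s)"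
  by metis
 have h: "lin R U u \<in> mod_hom R (free R S) U" by (rule lin_hom[OF U u(1)])
 have lb: "lin R U u (bas R s) = u s" if "s \<in> S" for s
  by (rule lin_bas[OF U that]) (rule u(1))
 have "q (lin R U u v) = g v" if "v \<in> carrier (free R S)" for v
  by (rule free_hom_eq[OF R V hom_comp[OF h q] g _ that]) (simp add: lb u(2))
 then show ?thesis by (intro bexI[OF _ h] ballI)
qed

section \<open>Projective modules\<close>

lemma projective_moduleD: "projective_module R P ==> left_module R P"
 by (simp add: projective_module_def)

lemma module_cong:
 fixes M :: "('a, 'm, 'x) module_scheme" and N :: "('a, 'm, 'y) module_scheme"
 assumes M: "left_module R M" and eq: "carrier M = carrier N" "\<zero>\<^bsub>M\<^esub> = \<zero>\<^bsub>N\<^esub>" "add M = add N"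
  and smult: "\<And>a x. a \<in> carrier R ==> x \<in> carrier M ==> a \<odot>\<^bsub>M\<^esub> x = a \<odot>\<^bsub>N\<^esub> x"
 shows "left_module R N"
proof -
 note s = eq[symmetric] smult[symmetric]
 interpret ring R using M by (rule left_moduleD)
 show ?thesis
  by (rule left_moduleI[OF ring_axioms ag_cong[OF left_moduleD(2)[OF M] eq]])
   (simp_all add: s lm[OF M])
qed

definition trunc :: "('a, 'm, 'x) module_scheme => ('a, 'm) module" where
 "trunc M = \<lparr>carrier = carrier M, monoid.mult = undefined, one = undefined, ring.zero = ring.zero M,
   add = add M, smult = smult M\<rparr>"

lemma trunc_simps [simp]:
 "carrier (trunc M) = carrier M" "\<zero>\<^bsub>trunc M\<^esub> = \<zero>\<^bsub>M\<^esub>" "add (trunc M) = add M"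
 "smult (trunc M) = smult M"
 by (simp_all add: trunc_def)

lemma left_module_trunc: "left_module R M ==> left_module R (trunc M)"
 by (erule module_cong) auto

lemma mod_hom_trunc [simp]: "mod_hom R (trunc M) N = mod_hom R M N" "mod_hom R M (trunc N) = mod_hom R M N"
 by (auto simp: mod_hom_def)

lemma projective_section:
 assumes P: "projective_module R (P :: ('a, 'p, 'x) module_scheme)"
 shows "\<exists>s\<in>mod_hom R P (free R (carrier P)). \<forall>x\<in>carrier P. lin R P (\<lambda>x. x) (s x) = x"
proof -
 have M: "left_module R P" using P by (rule projective_moduleD)
 then have R: "ring R" by (rule left_moduleD)
 have q: "lin R P (\<lambda>x. x) \<in> mod_hom R (free R (carrier P)) (trunc P)"
  using lin_hom[OF M, of "carrier P" "\<lambda>x. x"] by simp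
 have "x \<in> lin R P (\<lambda>x. x) ` carrier (free R (carrier P))" if "x \<in> carrier P" for x
  by (rule image_eqI[where x = "bas R x"])
   (use that in \<open>auto intro: bas_in[OF R] simp: lin_bas[OF M that]\<close>)
 then have "lin R P (\<lambda>x. x) ` carrier (free R (carrier P)) = carrier (trunc P)"
  using mod_homD(1)[OF q] by auto
 moreover have "(\<lambda>x. x) \<in> mod_hom R P (trunc P)" by (simp add: hom_id)
 ultimately show ?thesis
  using P q left_module_free[OF R, of "carrier P"] left_module_trunc[OF M]
  unfolding projective_module_def by blast
qed

text \<open>The definition of projectivity tests with modules on one fixed type.  The canonical surjection from the
 free module on the elements of \<open>P\<close> is among the test maps, and its section reduces every lifting problem, on
 any type, to one for a free module.\<close>

lemma proj_lift:
 assumes P: "projective_module R P" and U: "left_module R U" and V: "left_module R V"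
  and q: "q \<in> mod_hom R U V" and g: "g \<in> mod_hom R P V"
  and im: "\<And>x. x \<in> carrier P ==> g x \<in> q ` carrier U"
 shows "\<exists>h\<in>mod_hom R P U. \<forall>x\<in>carrier P. q (h x) = g x"
proof -
 have M: "left_module R P" using P by (rule projective_moduleD)
 then have R: "ring R" by (rule left_moduleD)
 obtain s where s: "s \<in> mod_hom R P (free R (carrier P))"
  "\<And>x. x \<in> carrier P ==> lin R P (\<lambda>x. x) (s x) = x"
  using projective_section[OF P] by blast
 have p: "lin R P (\<lambda>x. x) \<in> mod_hom R (free R (carrier P)) P"
  using lin_hom[OF M, of "carrier P" "\<lambda>x. x"] by simp
 note g' = hom_comp[OF p g]
 have "\<exists>h\<in>mod_hom R (free R (carrier P)) U. \<forall>v\<in>carrier (free R (carrier P)). q (h v) = g (lin R P (\<lambda>x. x) v)"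
  by (rule free_lift[OF U V q g']) (simp add: lin_bas[OF M, of _ "carrier P" "\<lambda>x. x"] im)
 then obtain h where h: "h \<in> mod_hom R (free R (carrier P)) U"
  "\<And>v. v \<in> carrier (free R (carrier P)) ==> q (h v) = g (lin R P (\<lambda>x. x) v)" by blast
 show ?thesis
  by (rule bexI[of _ "\<lambda>x. h (s x)"]) (auto simp: h(2) mod_homD(1)[OF s(1)] s(2) hom_comp[OF s(1) h(1)])
qed

text \<open>A retract of a free module is projective in the sense of the definition, whatever types are involved.\<close>

lemma projective_of_free_iso:
 assumes P: "left_module R P" and s: "s \<in> mod_hom R P (free R S)" and p: "p \<in> mod_hom R (free R S) P"
  and sp: "\<And>x. x \<in> carrier P ==> p (s x) = x"
 shows "projective_module R P"
 unfolding projective_module_def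
proof (intro conjI P allI impI)
 fix X :: "('a, 'c => 'a) module" and Y :: "('a, 'c) module" and q g
 assume *: "left_module R X \<and> left_module R Y \<and> q \<in> mod_hom R X Y \<and> q ` carrier X = carrier Y \<and> g \<in> mod_hom R P Y"
 then have X: "left_module R X" and Y: "left_module R Y" and q: "q \<in> mod_hom R X Y"
  and qs: "q ` carrier X = carrier Y" and g: "g \<in> mod_hom R P Y" by auto
 have R: "ring R" using P by (rule left_moduleD)
 note g' = hom_comp[OF p g]
 have "\<exists>h\<in>mod_hom R (free R S) X. \<forall>v\<in>carrier (free R S). q (h v) = g (p v)"
  by (rule free_lift[OF X Y q g']) (simp add: qs bas_in[OF R] mod_homD(1)[OF p] mod_homD(1)[OF g])
 then obtain h where h: "h \<in> mod_hom R (free R S) X"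
  "\<And>v. v \<in> carrier (free R S) ==> q (h v) = g (p v)" by blast
 show "\<exists>h\<in>mod_hom R P X. \<forall>x\<in>carrier P. q (h x) = g x"
  by (rule bexI[of _ "\<lambda>x. h (s x)"]) (auto simp: h(2) mod_homD(1)[OF s(1)] sp hom_comp[OF s(1) h(1)])
qed

lemma projective_free: "ring R ==> projective_module R (free R S)"
 by (rule projective_of_free_iso[OF left_module_free hom_id hom_id]) auto

section \<open>Cohomology in terms of elements\<close>

abbreviation elts :: "(('b, 'x) partial_object_scheme, 'c) cochain => int => 'b set" where
 "elts X i \<equiv> carrier (obj X i)"

abbreviation null :: "(('b, 'x) ring_scheme, 'c) cochain => int => 'b" where
 "null X i \<equiv> \<zero>\<^bsub>obj X i\<^esub>"

lemma cohomology_group: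
 fixes C :: "(('b, 'x) monoid_scheme, 'b) cochain" and i :: int
 assumes G: "comm_group (obj C (i - 1))" "comm_group (obj C i)" "comm_group (obj C (i + 1))"
  and d: "dif C (i - 1) \<in> hom (obj C (i - 1)) (obj C i)" "dif C i \<in> hom (obj C i) (obj C (i + 1))"
  and dd: "\<And>x. x \<in> elts C (i - 1) ==> dif C i (dif C (i - 1) x) = \<one>\<^bsub>obj C (i + 1)\<^esub>"
 defines "K \<equiv> (obj C i)\<lparr>carrier := kernel (obj C i) (obj C (i + 1)) (dif C i)\<rparr>"
 shows "group K" "subgroup (coboundaries C i) K" "group (cohomology C i)"
  "subgroup (coboundaries C i) (obj C i)"
proof -
 interpret G0: comm_group "obj C (i - 1)" by fact
 interpret G1: comm_group "obj C i" by fact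
 interpret G2: comm_group "obj C (i + 1)" by fact
 interpret d0: group_hom "obj C (i - 1)" "obj C i" "dif C (i - 1)"
  by (intro group_hom.intro group_hom_axioms.intro d) unfold_locales
 interpret d1: group_hom "obj C i" "obj C (i + 1)" "dif C i"
  by (intro group_hom.intro group_hom_axioms.intro d) unfold_locales
 have sub: "subgroup (kernel (obj C i) (obj C (i + 1)) (dif C i)) (obj C i)"
  by (rule d1.subgroup_kernel)
 show K: "group K" unfolding K_def by (rule G1.subgroup_imp_group[OF sub])
 show B: "subgroup (coboundaries C i) (obj C i)"
  unfolding coboundaries_def by (rule d0.img_is_subgroup)
 have "coboundaries C i \<subseteq> kernel (obj C i) (obj C (i + 1)) (dif C i)"
  by (auto simp: coboundaries_def kernel_def dd)
 then show B': "subgroup (coboundaries C i) K"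
  unfolding K_def using G1.subgroup_incl[OF B sub] by simp
 have "comm_group K"
  by (rule group.group_comm_groupI[OF K]) (auto simp: K_def kernel_def G1.m_comm)
 then have "coboundaries C i \<lhd> K" by (rule comm_group.subgroup_imp_normal[OF _ B'])
 then show "group (cohomology C i)"
  unfolding cohomology_def K_def[symmetric] by (rule normal.factorgroup_is_group)
qed

lemma carrier_cohomology:
 "carrier (cohomology C i) =
  (\<lambda>x. coboundaries C i #>\<^bsub>obj C i\<^esub> x) ` kernel (obj C i) (obj C (i + 1)) (dif C i)"
 by (simp add: cohomology_def carrier_FactGroup r_coset_def)

text \<open>This and its variants for modules and for complexes of homomorphisms remove the quotient groups: from here
 on exactness is a statement about elements.\<close>

lemma trivial_cohomology_iff:
 fixes C :: "(('b, 'x) monoid_scheme, 'b) cochain" and i :: int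
 assumes G: "comm_group (obj C (i - 1))" "comm_group (obj C i)" "comm_group (obj C (i + 1))"
  and d: "dif C (i - 1) \<in> hom (obj C (i - 1)) (obj C i)" "dif C i \<in> hom (obj C i) (obj C (i + 1))"
  and dd: "\<And>x. x \<in> elts C (i - 1) ==> dif C i (dif C (i - 1) x) = \<one>\<^bsub>obj C (i + 1)\<^esub>"
 shows "trivial_group (cohomology C i) \<longleftrightarrow>
  (\<forall>x\<in>elts C i. dif C i x = \<one>\<^bsub>obj C (i + 1)\<^esub> --> x \<in> dif C (i - 1) ` elts C (i - 1))"
proof -
 note c = cohomology_group[OF assms]
 interpret G1: comm_group "obj C i" by fact
 have one: "\<one>\<^bsub>cohomology C i\<^esub> = coboundaries C i" by (simp add: cohomology_def)
 have "trivial_group (cohomology C i) \<longleftrightarrow> carrier (cohomology C i) \<subseteq> {\<one>\<^bsub>cohomology C i\<^esub>}"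
  by (rule group.trivial_group_subset[OF c(3)])
 also have "\<dots> \<longleftrightarrow> (\<forall>x\<in>kernel (obj C i) (obj C (i + 1)) (dif C i). coboundaries C i #>\<^bsub>obj C i\<^esub> x = coboundaries C i)"
  unfolding carrier_cohomology one by auto
 also have "\<dots> \<longleftrightarrow> (\<forall>x\<in>kernel (obj C i) (obj C (i + 1)) (dif C i). x \<in> coboundaries C i)"
  using G1.coset_join2[OF _ c(4)] G1.coset_join1[OF _ _ c(4)] by (auto simp: kernel_def)
 finally show ?thesis by (auto simp: kernel_def coboundaries_def)
qed

lemma comm_group_additive:
 assumes "abelian_group M"
 shows "comm_group \<lparr>carrier = carrier M, monoid.mult = add M, one = ring.zero M\<rparr>"
proof (rule comm_groupI)
 fix x assume "x \<in> carrier \<lparr>carrier = carrier M, monoid.mult = add M, one = \<zero>\<^bsub>M\<^esub>\<rparr>"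
 then show "\<exists>y\<in>carrier \<lparr>carrier = carrier M, monoid.mult = add M, one = \<zero>\<^bsub>M\<^esub>\<rparr>.
   y \<otimes>\<^bsub>\<lparr>carrier = carrier M, monoid.mult = add M, one = \<zero>\<^bsub>M\<^esub>\<rparr>\<^esub> x = \<one>\<^bsub>\<lparr>carrier = carrier M, monoid.mult = add M, one = \<zero>\<^bsub>M\<^esub>\<rparr>\<^esub>"
  using ag(3,7)[OF assms] by auto
qed (simp_all add: ag[OF assms] ag_ac(1)[OF assms], simp add: ag_ac(2)[OF assms])

lemma module_complexD:
 assumes "module_complex R X"
 shows "left_module R (obj X i)" "dif X i \<in> mod_hom R (obj X i) (obj X (i + 1))"
  "dif X (i - 1) \<in> mod_hom R (obj X (i - 1)) (obj X i)"
  "x \<in> elts X i ==> dif X (i + 1) (dif X i x) = null X (i + 2)"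
  "x \<in> elts X (i - 1) ==> dif X i (dif X (i - 1) x) = null X (i + 1)"
proof -
 note * = assms[unfolded module_complex_def, rule_format]
 show "left_module R (obj X i)" "dif X i \<in> mod_hom R (obj X i) (obj X (i + 1))"
  using *[of i] by auto
 show "dif X (i - 1) \<in> mod_hom R (obj X (i - 1)) (obj X i)" using *[of "i - 1"] by auto
 show "x \<in> elts X i ==> dif X (i + 1) (dif X i x) = null X (i + 2)"
  using *[of i] by (auto simp: add.assoc)
 show "x \<in> elts X (i - 1) ==> dif X i (dif X (i - 1) x) = null X (i + 1)"
  using *[of "i - 1"] by auto
qed

lemma additive_simps [simp]:
 "elts (additive X) i = elts X i" "\<one>\<^bsub>obj (additive X) i\<^esub> = null X i"
 "monoid.mult (obj (additive X) i) = add (obj X i)" "dif (additive X) = dif X"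
 by (simp_all add: additive_def)

lemma additive_complex:
 assumes "module_complex R X"
 shows "comm_group (obj (additive X) i)" "dif (additive X) i \<in> hom (obj (additive X) i) (obj (additive X) (i + 1))"
  "dif (additive X) (i - 1) \<in> hom (obj (additive X) (i - 1)) (obj (additive X) i)"
  "x \<in> elts (additive X) (i - 1) ==>
   dif (additive X) i (dif (additive X) (i - 1) x) = \<one>\<^bsub>obj (additive X) (i + 1)\<^esub>"
proof -
 note * = module_complexD[OF assms]
 show "comm_group (obj (additive X) i)"
  unfolding additive_def using comm_group_additive[OF left_moduleD(2)[OF *(1)[of i]]] by simp
 show "dif (additive X) i \<in> hom (obj (additive X) i) (obj (additive X) (i + 1))"
  by (rule homI) (simp_all add: mod_homD[OF *(2)])
 show "dif (additive X) (i - 1) \<in> hom (obj (additive X) (i - 1)) (obj (additive X) i)"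
  by (rule homI) (simp_all add: mod_homD[OF *(3)])
qed (use module_complexD[OF assms] in simp)

lemma trivial_mod_cohomology_iff:
 assumes X: "module_complex R X"
 shows "trivial_group (mod_cohomology X i) \<longleftrightarrow>
  (\<forall>x\<in>elts X i. dif X i x = null X (i + 1) --> x \<in> dif X (i - 1) ` elts X (i - 1))"
proof -
 note a = additive_complex[OF X]
 show ?thesis
  using trivial_cohomology_iff[of "additive X" i, OF a(1,1,1) a(3) a(2) a(4)] by simp
qed

text \<open>Injectivity and surjectivity in cohomology, in terms of cocycles and coboundaries.\<close>

definition coh_inj :: "(('a, 'b, 'x) module_scheme, 'b) cochain => (('a, 'c, 'y) module_scheme, 'c) cochain =>
  (int => 'b => 'c) => bool" where
 "coh_inj X Y f \<longleftrightarrow> (\<forall>i. \<forall>x\<in>elts X i. dif X i x = null X (i + 1) -->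
   f i x \<in> dif Y (i - 1) ` elts Y (i - 1) --> x \<in> dif X (i - 1) ` elts X (i - 1))"

definition coh_surj :: "(('a, 'b, 'x) module_scheme, 'b) cochain => (('a, 'c, 'y) module_scheme, 'c) cochain =>
  (int => 'b => 'c) => bool" where
 "coh_surj X Y f \<longleftrightarrow> (\<forall>i. \<forall>y\<in>elts Y i. dif Y i y = null Y (i + 1) -->
   (\<exists>x\<in>elts X i. dif X i x = null X (i + 1) \<and>
    (\<exists>w\<in>elts Y (i - 1). y = f i x \<oplus>\<^bsub>obj Y i\<^esub> dif Y (i - 1) w)))"

lemma chain_mapD:
 assumes "chain_map R X Y f"
 shows "f i \<in> mod_hom R (obj X i) (obj Y i)"
  "x \<in> elts X i ==> f (i + 1) (dif X i x) = dif Y i (f i x)"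
  "x \<in> elts X (i - 1) ==> f i (dif X (i - 1) x) = dif Y (i - 1) (f (i - 1) x)"
proof -
 note * = assms[unfolded chain_map_def, rule_format]
 show "f i \<in> mod_hom R (obj X i) (obj Y i)"
  "x \<in> elts X i ==> f (i + 1) (dif X i x) = dif Y i (f i x)"
  using *[of i] by auto
 show "x \<in> elts X (i - 1) ==> f i (dif X (i - 1) x) = dif Y (i - 1) (f (i - 1) x)"
  using *[of "i - 1"] by auto
qed

lemma quasi_iso_coh:
 assumes X: "module_complex R X" and Y: "module_complex R Y" and q: "quasi_iso R X Y f"
 shows "coh_inj X Y f" "coh_surj X Y f"
proof -
 have f: "chain_map R X Y f" using q by (simp add: quasi_iso_def)
 note aX = additive_complex[OF X] and aY = additive_complex[OF Y]
 note fh = chain_mapD[OF f]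
 let ?GX = "obj (additive X)" and ?GY = "obj (additive Y)"
 let ?BX = "coboundaries (additive X)" and ?BY = "coboundaries (additive Y)"
 let ?F = "\<lambda>i. coset_map (?GY i) (?BY i) (f i)"
 have iso: "?F i \<in> iso (mod_cohomology X i) (mod_cohomology Y i)" for i
  using q by (simp add: quasi_iso_def)
 note cX = cohomology_group[of "additive X", OF aX(1,1,1) aX(3) aX(2) aX(4)]
 note cY = cohomology_group[of "additive Y", OF aY(1,1,1) aY(3) aY(2) aY(4)]
 have fB: "f i b \<in> ?BY i" if "b \<in> ?BX i" for i b
  using that fh mod_homD(1)[OF fh(1)[of "i - 1"]] by (auto simp: coboundaries_def)
 have ker: "kernel (?GX i) (?GX (i + 1)) (dif X i) = {x \<in> elts X i. dif X i x = null X (i + 1)}"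
  "kernel (?GY i) (?GY (i + 1)) (dif Y i) = {x \<in> elts Y i. dif Y i x = null Y (i + 1)}" for i
  by (simp_all add: kernel_def)
 have Fx: "?F i (?BX i #>\<^bsub>?GX i\<^esub> x) = ?BY i #>\<^bsub>?GY i\<^esub> f i x" if x: "x \<in> elts X i" for i x
 proof -
  interpret GX: comm_group "?GX i" by (rule aX)
  interpret GY: comm_group "?GY i" by (rule aY)
  have fx: "f i x \<in> elts Y i" using mod_homD(1)[OF fh(1)] x .
  have *: "?BY i #>\<^bsub>?GY i\<^esub> f i z = ?BY i #>\<^bsub>?GY i\<^esub> f i x" if z: "z \<in> ?BX i #>\<^bsub>?GX i\<^esub> x" for z
  proof -
   obtain b where b: "b \<in> ?BX i" "z = b \<oplus>\<^bsub>obj X i\<^esub> x" using z by (auto simp: r_coset_def)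
   have bc: "b \<in> elts X i" using subgroup.mem_carrier[OF cX(4) b(1)] by simp
   have "f i z = f i b \<oplus>\<^bsub>obj Y i\<^esub> f i x" using mod_homD(2)[OF fh(1) bc x] b by simp
   then have "f i z \<in> ?BY i #>\<^bsub>?GY i\<^esub> f i x" using fB[OF b(1)] by (auto simp: r_coset_def)
   from GY.repr_independence[OF this _ cY(4)] show ?thesis using fx by simp
  qed
  have "x \<in> ?BX i #>\<^bsub>?GX i\<^esub> x" using x by (intro GX.rcos_self cX) simp
  then show ?thesis unfolding coset_map_def using * by blast
 qed
 show "coh_inj X Y f"
  unfolding coh_inj_def
 proof (intro allI ballI impI)
  fix i x assume x: "x \<in> elts X i" and dx: "dif X i x = null X (i + 1)"
   and fx: "f i x \<in> dif Y (i - 1) ` elts Y (i - 1)"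
  interpret GX: comm_group "?GX i" by (rule aX)
  interpret GY: comm_group "?GY i" by (rule aY)
  have inj: "inj_on (?F i) (carrier (mod_cohomology X i))"
   using iso[of i] by (simp add: iso_def bij_betw_def)
  let ?z = "null X i"
  have z: "?z \<in> elts X i" "dif X i ?z = null X (i + 1)" "f i ?z = null Y i"
   using hom_simps(4)[OF module_complexD(2)[OF X] module_complexD(1)[OF X] module_complexD(1)[OF X]]
    hom_simps(4)[OF fh(1) module_complexD(1)[OF X] module_complexD(1)[OF Y]]
   by (auto simp: lm[OF module_complexD(1)[OF X]])
  have "?BY i #>\<^bsub>?GY i\<^esub> f i x = ?BY i"
   using fx mod_homD(1)[OF fh(1) x] by (intro GY.coset_join2 cY) (auto simp: coboundaries_def)
  moreover have "?BY i #>\<^bsub>?GY i\<^esub> f i ?z = ?BY i"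
   using z subgroup.one_closed[OF cY(4)[of i]] lm(2)[OF module_complexD(1)[OF Y]]
   by (intro GY.coset_join2 cY) auto
  ultimately have "?F i (?BX i #>\<^bsub>?GX i\<^esub> x) = ?F i (?BX i #>\<^bsub>?GX i\<^esub> ?z)"
   by (simp add: Fx x z)
  with inj have "?BX i #>\<^bsub>?GX i\<^esub> x = ?BX i #>\<^bsub>?GX i\<^esub> ?z"
   by (rule inj_onD) (use x dx z in \<open>auto simp: carrier_cohomology ker\<close>)
  also have "\<dots> = ?BX i"
   using z subgroup.one_closed[OF cX(4)[of i]] by (intro GX.coset_join2 cX) auto
  finally have "x \<in> ?BX i" using GX.coset_join1[OF _ _ cX(4)] x by simp
  then show "x \<in> dif X (i - 1) ` elts X (i - 1)" by (simp add: coboundaries_def)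
 qed
 show "coh_surj X Y f"
  unfolding coh_surj_def
 proof (intro allI ballI impI)
  fix i y assume y: "y \<in> elts Y i" and dy: "dif Y i y = null Y (i + 1)"
  interpret GY: comm_group "?GY i" by (rule aY)
  have "?BY i #>\<^bsub>?GY i\<^esub> y \<in> carrier (mod_cohomology Y i)"
   using y dy by (auto simp: carrier_cohomology ker)
  then have "?BY i #>\<^bsub>?GY i\<^esub> y \<in> ?F i ` carrier (mod_cohomology X i)"
   using iso[of i] by (simp add: iso_def bij_betw_def)
  then obtain x where x: "x \<in> elts X i" "dif X i x = null X (i + 1)"
   and eq: "?BY i #>\<^bsub>?GY i\<^esub> y = ?F i (?BX i #>\<^bsub>?GX i\<^esub> x)"
   by (auto simp: carrier_cohomology ker)
  have "y \<in> ?BY i #>\<^bsub>?GY i\<^esub> f i x"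
   using GY.rcos_self[of y, OF _ cY(4)] y unfolding eq Fx[OF x(1)] by simp
  then obtain w where w: "w \<in> elts Y (i - 1)" "y = dif Y (i - 1) w \<oplus>\<^bsub>obj Y i\<^esub> f i x"
   by (auto simp: r_coset_def coboundaries_def)
  have "y = f i x \<oplus>\<^bsub>obj Y i\<^esub> dif Y (i - 1) w"
   using w mod_homD(1)[OF module_complexD(3)[OF Y] w(1)] mod_homD(1)[OF fh(1) x(1)]
   by (simp add: lm_ac(2)[OF module_complexD(1)[OF Y]])
  then show "\<exists>x\<in>elts X i. dif X i x = null X (i + 1) \<and>
    (\<exists>w\<in>elts Y (i - 1). y = f i x \<oplus>\<^bsub>obj Y i\<^esub> dif Y (i - 1) w)"
   using x w(1) by blast
 qed
qed

section \<open>Comparison of projective resolutions\<close>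

text \<open>Resolutions indexed by natural numbers, in the direction of the arrows \<open>P (Suc i) \<rightarrow> P i\<close>; the modules
 need not be projective.\<close>

definition nat_resolution :: "('a, 'r) ring_scheme => (nat => ('a, 'p, 'y) module_scheme) => (nat => 'p => 'p) =>
  ('a, 'm, 'x) module_scheme => ('p => 'm) => bool" where
 "nat_resolution R P f M \<pi> \<longleftrightarrow> left_module R M \<and> (\<forall>i. left_module R (P i)) \<and>
   (\<forall>i. f i \<in> mod_hom R (P (Suc i)) (P i)) \<and> \<pi> \<in> mod_hom R (P 0) M \<and> \<pi> ` carrier (P 0) = carrier M \<and>
   f 0 ` carrier (P (Suc 0)) = {x \<in> carrier (P 0). \<pi> x = \<zero>\<^bsub>M\<^esub>} \<and>
   (\<forall>i. f (Suc i) ` carrier (P (Suc (Suc i))) = {x \<in> carrier (P (Suc i)). f i x = \<zero>\<^bsub>P i\<^esub>})"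

text \<open>If \<open>P\<close> is a projective resolution of \<open>M\<close>, this says that \<open>Ext\<close> of degree \<open>Suc i\<close> from \<open>M\<close> to \<open>N\<close> vanishes.\<close>

definition hom_exact :: "('a, 'r) ring_scheme => (nat => ('a, 'p, 'y) module_scheme) => (nat => 'p => 'p) =>
  ('a, 'm, 'x) module_scheme => nat => bool" where
 "hom_exact R P f N i \<longleftrightarrow> (\<forall>g\<in>mod_hom R (P (Suc i)) N.
   (\<forall>x\<in>carrier (P (Suc (Suc i))). g (f (Suc i) x) = \<zero>\<^bsub>N\<^esub>) -->
   (\<exists>h\<in>mod_hom R (P i) N. \<forall>x\<in>carrier (P (Suc i)). g x = h (f i x)))"

abbreviation free_hom_exact :: "('a, 'r) ring_scheme => (nat => nat) => (nat => (nat => 'a) => nat => 'a) =>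
  ('a, 'm, 'x) module_scheme => nat => bool" where
 "free_hom_exact R n \<equiv> hom_exact R (\<lambda>i. Fr R (n i))"

lemma nat_resolutionD:
 assumes "nat_resolution R P f M \<pi>"
 shows "left_module R M" "left_module R (P i)" "f i \<in> mod_hom R (P (Suc i)) (P i)"
  "\<pi> \<in> mod_hom R (P 0) M" "\<pi> ` carrier (P 0) = carrier M"
  "x \<in> carrier (P (Suc 0)) ==> \<pi> (f 0 x) = \<zero>\<^bsub>M\<^esub>"
  "x \<in> carrier (P (Suc (Suc i))) ==> f i (f (Suc i) x) = \<zero>\<^bsub>P i\<^esub>"
  "x \<in> carrier (P 0) ==> \<pi> x = \<zero>\<^bsub>M\<^esub> ==> x \<in> f 0 ` carrier (P (Suc 0))"
  "x \<in> carrier (P (Suc i)) ==> f i x = \<zero>\<^bsub>P i\<^esub> ==> x \<in> f (Suc i) ` carrier (P (Suc (Suc i)))"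
proof -
 have *: "left_module R M" "\<And>i. left_module R (P i)" "\<And>i. f i \<in> mod_hom R (P (Suc i)) (P i)"
  "\<pi> \<in> mod_hom R (P 0) M" "\<pi> ` carrier (P 0) = carrier M"
  "f 0 ` carrier (P (Suc 0)) = {x \<in> carrier (P 0). \<pi> x = \<zero>\<^bsub>M\<^esub>}"
  "\<And>i. f (Suc i) ` carrier (P (Suc (Suc i))) = {x \<in> carrier (P (Suc i)). f i x = \<zero>\<^bsub>P i\<^esub>}"
  using assms by (simp_all add: nat_resolution_def)
 show "left_module R M" "left_module R (P i)" "f i \<in> mod_hom R (P (Suc i)) (P i)"
  "\<pi> \<in> mod_hom R (P 0) M" "\<pi> ` carrier (P 0) = carrier M" by (fact *)+
 show "x \<in> carrier (P (Suc 0)) ==> \<pi> (f 0 x) = \<zero>\<^bsub>M\<^esub>" using *(6) by auto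
 show "x \<in> carrier (P (Suc (Suc i))) ==> f i (f (Suc i) x) = \<zero>\<^bsub>P i\<^esub>" using *(7)[of i] by auto
 show "x \<in> carrier (P 0) ==> \<pi> x = \<zero>\<^bsub>M\<^esub> ==> x \<in> f 0 ` carrier (P (Suc 0))" by (simp add: *(6))
 show "x \<in> carrier (P (Suc i)) ==> f i x = \<zero>\<^bsub>P i\<^esub> ==> x \<in> f (Suc i) ` carrier (P (Suc (Suc i)))"
  by (simp add: *(7))
qed

lemma chain_lift:
 assumes P: "nat_resolution R P f M \<pi>" "\<And>i. projective_module R (P i)"
  and Q: "nat_resolution R Q k M \<rho>"
 shows "\<exists>\<phi>. (\<forall>i. \<phi> i \<in> mod_hom R (P i) (Q i)) \<and> (\<forall>x\<in>carrier (P 0). \<rho> (\<phi> 0 x) = \<pi> x) \<and>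
  (\<forall>i. \<forall>x\<in>carrier (P (Suc i)). k i (\<phi> (Suc i) x) = \<phi> i (f i x))"
proof -
 note p = nat_resolutionD[OF P(1)] and q = nat_resolutionD[OF Q]
 have "\<exists>h\<in>mod_hom R (P 0) (Q 0). \<forall>x\<in>carrier (P 0). \<rho> (h x) = \<pi> x"
  by (rule proj_lift[OF P(2) q(2,1,4) p(4)]) (use q(5) mod_homD(1)[OF p(4)] in auto)
 then obtain h0 where h0: "h0 \<in> mod_hom R (P 0) (Q 0)" "\<And>x. x \<in> carrier (P 0) ==> \<rho> (h0 x) = \<pi> x"
  by blast
 define Good where "Good i h \<longleftrightarrow> h \<in> mod_hom R (P i) (Q i) \<and> (\<forall>x\<in>carrier (P (Suc i)). h (f i x) \<in> k i ` carrier (Q (Suc i)))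
   \<and> (i = 0 --> (\<forall>x\<in>carrier (P 0). \<rho> (h x) = \<pi> x))" for i h
 have "\<exists>\<phi>. \<forall>i. Good i (\<phi> i) \<and> (\<forall>x\<in>carrier (P (Suc i)). k i (\<phi> (Suc i) x) = \<phi> i (f i x))"
 proof (rule dependent_nat_choice)
  have "h0 (f 0 x) \<in> k 0 ` carrier (Q (Suc 0))" if "x \<in> carrier (P (Suc 0))" for x
   by (rule q(8)) (simp_all add: that h0(2) p(6) mod_homD(1)[OF h0(1)] mod_homD(1)[OF p(3)])
  then show "\<exists>h. Good 0 h" using h0 unfolding Good_def by blast
 next
  fix h i assume h: "Good i h"
  have "\<exists>h'\<in>mod_hom R (P (Suc i)) (Q (Suc i)). \<forall>x\<in>carrier (P (Suc i)). k i (h' x) = h (f i x)"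
   by (rule proj_lift[OF P(2) q(2,2) q(3) hom_comp[OF p(3)]]) (use h in \<open>auto simp: Good_def\<close>)
  then obtain h' where h': "h' \<in> mod_hom R (P (Suc i)) (Q (Suc i))"
   "\<And>x. x \<in> carrier (P (Suc i)) ==> k i (h' x) = h (f i x)" by blast
  have hz: "h \<zero>\<^bsub>P i\<^esub> = \<zero>\<^bsub>Q i\<^esub>" using h hom_simps(4)[OF _ p(2) q(2)] by (auto simp: Good_def)
  have "h' (f (Suc i) x) \<in> k (Suc i) ` carrier (Q (Suc (Suc i)))" if "x \<in> carrier (P (Suc (Suc i)))" for x
   by (rule q(9)) (simp_all add: that h'(2) p(7) hz mod_homD(1)[OF h'(1)] mod_homD(1)[OF p(3)])
  then show "\<exists>h'. Good (Suc i) h' \<and> (\<forall>x\<in>carrier (P (Suc i)). k i (h' x) = h (f i x))"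
   using h' unfolding Good_def by blast
 qed
 then show ?thesis unfolding Good_def by metis
qed

lemma null_homotopy:
 assumes P: "nat_resolution R P f M \<pi>" "\<And>i. projective_module R (P i)"
  and t: "\<And>i. \<theta> i \<in> mod_hom R (P i) (P i)" "\<And>i x. x \<in> carrier (P (Suc i)) ==> f i (\<theta> (Suc i) x) = \<theta> i (f i x)"
  and t0: "\<And>x. x \<in> carrier (P 0) ==> \<pi> (\<theta> 0 x) = \<zero>\<^bsub>M\<^esub>"
 shows "\<exists>s. (\<forall>i. s i \<in> mod_hom R (P i) (P (Suc i))) \<and>
  (\<forall>i. \<forall>x\<in>carrier (P (Suc i)). \<theta> (Suc i) x = f (Suc i) (s (Suc i) x) \<oplus>\<^bsub>P (Suc i)\<^esub> s i (f i x))"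
proof -
 note p = nat_resolutionD[OF P(1)]
 note th = hom_simps[OF t(1) p(2,2)] and fh = hom_simps[OF p(3) p(2,2)]
 define Good where "Good i s \<longleftrightarrow> s \<in> mod_hom R (P i) (P (Suc i)) \<and>
   (\<forall>x\<in>carrier (P (Suc i)). \<theta> (Suc i) x \<oplus>\<^bsub>P (Suc i)\<^esub> \<ominus>\<^bsub>P (Suc i)\<^esub> s (f i x) \<in> f (Suc i) ` carrier (P (Suc (Suc i))))" for i s
 have "\<exists>s. \<forall>i. Good i (s i) \<and> (\<forall>x\<in>carrier (P (Suc i)).
   \<theta> (Suc i) x = f (Suc i) (s (Suc i) x) \<oplus>\<^bsub>P (Suc i)\<^esub> s i (f i x))"
 proof (rule dependent_nat_choice)
  have "\<exists>s\<in>mod_hom R (P 0) (P (Suc 0)). \<forall>x\<in>carrier (P 0). f 0 (s x) = \<theta> 0 x"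
   by (rule proj_lift[OF P(2) p(2,2) p(3) t(1)]) (rule p(8), simp_all add: t0 th)
  then obtain s where s: "s \<in> mod_hom R (P 0) (P (Suc 0))" "\<And>x. x \<in> carrier (P 0) ==> f 0 (s x) = \<theta> 0 x"
   by blast
  note sh = hom_simps[OF s(1) p(2,2)]
  have "\<theta> (Suc 0) x \<oplus>\<^bsub>P (Suc 0)\<^esub> \<ominus>\<^bsub>P (Suc 0)\<^esub> s (f 0 x) \<in> f (Suc 0) ` carrier (P (Suc (Suc 0)))"
   if "x \<in> carrier (P (Suc 0))" for x
   by (rule p(9)) (simp_all add: that th fh sh lm[OF p(2)] s(2) t(2))
  then show "\<exists>s. Good 0 s" using s unfolding Good_def by blast
 next
  fix s i assume "Good i s"
  then have s: "s \<in> mod_hom R (P i) (P (Suc i))" and im: "\<And>x. x \<in> carrier (P (Suc i)) ==>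
   \<theta> (Suc i) x \<oplus>\<^bsub>P (Suc i)\<^esub> \<ominus>\<^bsub>P (Suc i)\<^esub> s (f i x) \<in> f (Suc i) ` carrier (P (Suc (Suc i)))"
   by (auto simp: Good_def)
  note sh = hom_simps[OF s p(2,2)]
  have "\<exists>s'\<in>mod_hom R (P (Suc i)) (P (Suc (Suc i))). \<forall>x\<in>carrier (P (Suc i)).
    f (Suc i) (s' x) = \<theta> (Suc i) x \<oplus>\<^bsub>P (Suc i)\<^esub> \<ominus>\<^bsub>P (Suc i)\<^esub> s (f i x)"
   by (rule proj_lift[OF P(2) p(2,2) p(3) hom_diff[OF t(1) hom_comp[OF p(3) s] p(2)]]) (rule im)
  then obtain s' where s': "s' \<in> mod_hom R (P (Suc i)) (P (Suc (Suc i)))" "\<And>x. x \<in> carrier (P (Suc i)) ==>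
    f (Suc i) (s' x) = \<theta> (Suc i) x \<oplus>\<^bsub>P (Suc i)\<^esub> \<ominus>\<^bsub>P (Suc i)\<^esub> s (f i x)" by blast
  note sh' = hom_simps[OF s'(1) p(2,2)]
  have "\<theta> (Suc (Suc i)) x \<oplus>\<^bsub>P (Suc (Suc i))\<^esub> \<ominus>\<^bsub>P (Suc (Suc i))\<^esub> s' (f (Suc i) x) \<in> f (Suc (Suc i)) ` carrier (P (Suc (Suc (Suc i))))"
   if "x \<in> carrier (P (Suc (Suc i)))" for x
   by (rule p(9)) (simp_all add: that th fh sh' sh lms[OF p(2)] s'(2) t(2) p(7))
  moreover have "\<theta> (Suc i) x = f (Suc i) (s' x) \<oplus>\<^bsub>P (Suc i)\<^esub> s (f i x)" if "x \<in> carrier (P (Suc i))" for x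
   by (simp add: s'(2) that th fh sh lms[OF p(2)])
  ultimately show "\<exists>s'. Good (Suc i) s' \<and> (\<forall>x\<in>carrier (P (Suc i)).
    \<theta> (Suc i) x = f (Suc i) (s' x) \<oplus>\<^bsub>P (Suc i)\<^esub> s (f i x))"
   using s'(1) unfolding Good_def by blast
 qed
 then show ?thesis unfolding Good_def by metis
qed

text \<open>The vanishing of \<open>Ext\<close> does not depend on the projective resolution: chain maps between two resolutions
 exist in both directions and their composite is homotopic to the identity.\<close>

lemma hom_exact_transfer:
 assumes P: "nat_resolution R P f M \<pi>" "\<And>i. projective_module R (P i)"
  and Q: "nat_resolution R Q k M \<rho>" "\<And>i. projective_module R (Q i)"
  and N: "left_module R N" and ex: "hom_exact R P f N i"
 shows "hom_exact R Q k N i"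
 unfolding hom_exact_def
proof (intro ballI impI)
 note p = nat_resolutionD[OF P(1)] and q = nat_resolutionD[OF Q(1)]
 obtain \<phi> where \<phi>: "\<And>i. \<phi> i \<in> mod_hom R (P i) (Q i)" "\<And>x. x \<in> carrier (P 0) ==> \<rho> (\<phi> 0 x) = \<pi> x"
  "\<And>i x. x \<in> carrier (P (Suc i)) ==> k i (\<phi> (Suc i) x) = \<phi> i (f i x)"
  using chain_lift[OF P Q(1)] by blast
 obtain \<psi> where \<psi>: "\<And>i. \<psi> i \<in> mod_hom R (Q i) (P i)" "\<And>x. x \<in> carrier (Q 0) ==> \<pi> (\<psi> 0 x) = \<rho> x"
  "\<And>i x. x \<in> carrier (Q (Suc i)) ==> f i (\<psi> (Suc i) x) = \<psi> i (k i x)"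
  using chain_lift[OF Q P(1)] by blast
 note ph = hom_simps[OF \<phi>(1) p(2) q(2)] and ps = hom_simps[OF \<psi>(1) q(2) p(2)]
  and kh = hom_simps[OF q(3) q(2,2)] and fh = hom_simps[OF p(3) p(2,2)] and rh = hom_simps[OF q(4) q(2) q(1)]
 define \<theta> where "\<theta> i x = x \<oplus>\<^bsub>Q i\<^esub> \<ominus>\<^bsub>Q i\<^esub> \<phi> i (\<psi> i x)" for i x
 have t: "\<theta> i \<in> mod_hom R (Q i) (Q i)" for i
  unfolding \<theta>_def by (rule hom_diff[OF hom_id hom_comp[OF \<psi>(1) \<phi>(1)] q(2)])
 obtain s where s: "\<And>i. s i \<in> mod_hom R (Q i) (Q (Suc i))"
  "\<And>i x. x \<in> carrier (Q (Suc i)) ==> \<theta> (Suc i) x = k (Suc i) (s (Suc i) x) \<oplus>\<^bsub>Q (Suc i)\<^esub> s i (k i x)"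
  using null_homotopy[OF Q t] by (auto simp: \<theta>_def kh ph ps rh lm[OF q(2)] lm[OF q(1)] \<phi>(2,3) \<psi>(2,3))
 note sh = hom_simps[OF s(1) q(2,2)]
 fix g assume g: "g \<in> mod_hom R (Q (Suc i)) N" and g0: "\<forall>x\<in>carrier (Q (Suc (Suc i))). g (k (Suc i) x) = \<zero>\<^bsub>N\<^esub>"
 note gh = hom_simps[OF g q(2) N]
 have "\<exists>h\<in>mod_hom R (P i) N. \<forall>x\<in>carrier (P (Suc i)). g (\<phi> (Suc i) x) = h (f i x)"
  using ex hom_comp[OF \<phi>(1) g] g0 unfolding hom_exact_def by (auto simp: \<phi>(3)[symmetric] ph)
 then obtain h where h: "h \<in> mod_hom R (P i) N" "\<And>x. x \<in> carrier (P (Suc i)) ==> g (\<phi> (Suc i) x) = h (f i x)"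
  by blast
 note hh = hom_simps[OF h(1) p(2) N]
 show "\<exists>h\<in>mod_hom R (Q i) N. \<forall>x\<in>carrier (Q (Suc i)). g x = h (k i x)"
 proof (rule bexI[of _ "\<lambda>x. h (\<psi> i x) \<oplus>\<^bsub>N\<^esub> g (s i x)"], rule ballI)
  fix x assume x: "x \<in> carrier (Q (Suc i))"
  have "g (\<theta> (Suc i) x) = g (s i (k i x))"
   using x g0 by (simp add: s(2) gh sh kh lm[OF N])
  moreover have "x = \<theta> (Suc i) x \<oplus>\<^bsub>Q (Suc i)\<^esub> \<phi> (Suc i) (\<psi> (Suc i) x)"
   using x by (simp add: \<theta>_def ph ps lms[OF q(2)])
  then have "g x = g (\<theta> (Suc i) x) \<oplus>\<^bsub>N\<^esub> g (\<phi> (Suc i) (\<psi> (Suc i) x))"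
   using x gh(2)[of "\<theta> (Suc i) x" "\<phi> (Suc i) (\<psi> (Suc i) x)"] mod_homD(1)[OF t x] by (simp add: ph ps)
  ultimately show "g x = h (\<psi> i (k i x)) \<oplus>\<^bsub>N\<^esub> g (s i (k i x))"
   using x by (simp add: h(2) ps \<psi>(3) hh gh sh kh lm_ac(2)[OF N])
 qed (intro hom_add hom_comp[OF \<psi>(1) h(1)] hom_comp[OF s(1) g] N)
qed

section \<open>Submodules and finite generation\<close>

lemma lm_neg_one:
 assumes M: "left_module R M" and x: "x \<in> carrier M"
 shows "(\<ominus>\<^bsub>R\<^esub> \<one>\<^bsub>R\<^esub>) \<odot>\<^bsub>M\<^esub> x = \<ominus>\<^bsub>M\<^esub> x"
proof -
 interpret R: ring R using M by (rule left_moduleD)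
 interpret M: abelian_group M using M by (rule left_moduleD)
 have "(\<ominus>\<^bsub>R\<^esub> \<one>\<^bsub>R\<^esub>) \<odot>\<^bsub>M\<^esub> x \<oplus>\<^bsub>M\<^esub> x = (\<ominus>\<^bsub>R\<^esub> \<one>\<^bsub>R\<^esub> \<oplus>\<^bsub>R\<^esub> \<one>\<^bsub>R\<^esub>) \<odot>\<^bsub>M\<^esub> x"
  using x by (simp add: lm(18)[OF M] lm(15)[OF M])
 also have "\<dots> = \<zero>\<^bsub>M\<^esub>" using x by (simp add: R.l_neg lm[OF M])
 finally show ?thesis using x by (intro M.minus_equality[symmetric]) (simp_all add: lm[OF M])
qed

lemma submodule_iff:
 assumes M: "left_module R M"
 shows "submodule K R M \<longleftrightarrow> K \<subseteq> carrier M \<and> \<zero>\<^bsub>M\<^esub> \<in> K \<and> (\<forall>x\<in>K. \<forall>y\<in>K. x \<oplus>\<^bsub>M\<^esub> y \<in> K) \<and>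
  (\<forall>a\<in>carrier R. \<forall>x\<in>K. a \<odot>\<^bsub>M\<^esub> x \<in> K)"
proof
 assume K: "submodule K R M"
 then show "K \<subseteq> carrier M \<and> \<zero>\<^bsub>M\<^esub> \<in> K \<and> (\<forall>x\<in>K. \<forall>y\<in>K. x \<oplus>\<^bsub>M\<^esub> y \<in> K) \<and>
  (\<forall>a\<in>carrier R. \<forall>x\<in>K. a \<odot>\<^bsub>M\<^esub> x \<in> K)"
  by (auto simp: submodule_def submodule_axioms_def subgroup_def)
next
 assume K: "K \<subseteq> carrier M \<and> \<zero>\<^bsub>M\<^esub> \<in> K \<and> (\<forall>x\<in>K. \<forall>y\<in>K. x \<oplus>\<^bsub>M\<^esub> y \<in> K) \<and>
  (\<forall>a\<in>carrier R. \<forall>x\<in>K. a \<odot>\<^bsub>M\<^esub> x \<in> K)"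
 interpret R: ring R using M by (rule left_moduleD)
 have "\<ominus>\<^bsub>M\<^esub> x \<in> K" if "x \<in> K" for x
  using K that lm_neg_one[OF M, of x] by (metis R.a_inv_closed R.one_closed subsetD)
 then show "submodule K R M"
  using K by (auto simp: submodule_def submodule_axioms_def subgroup_def a_inv_def)
qed

lemma submoduleD:
 assumes M: "left_module R M" and K: "submodule K R M"
 shows "x \<in> K ==> x \<in> carrier M" "\<zero>\<^bsub>M\<^esub> \<in> K"
  "x \<in> K ==> y \<in> K ==> x \<oplus>\<^bsub>M\<^esub> y \<in> K"
  "a \<in> carrier R ==> x \<in> K ==> a \<odot>\<^bsub>M\<^esub> x \<in> K"
 using K unfolding submodule_iff[OF M] by blast+

lemma left_module_sub:
 assumes M: "left_module R M" and K: "submodule K R M"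
 shows "left_module R (M\<lparr>carrier := K\<rparr>)"
proof -
 note k = K[unfolded submodule_iff[OF M]]
 have kc: "x \<in> K ==> x \<in> carrier M" for x using k by auto
 have inv: "\<exists>y\<in>K. y \<oplus>\<^bsub>M\<^esub> x = \<zero>\<^bsub>M\<^esub>" if "x \<in> K" for x
 proof (rule bexI[of _ "\<ominus>\<^bsub>M\<^esub> x"])
  interpret R: ring R using M by (rule left_moduleD)
  show "\<ominus>\<^bsub>M\<^esub> x \<in> K" using k that lm_neg_one[OF M kc[OF that]] by (metis R.a_inv_closed R.one_closed)
 qed (simp add: lm[OF M] kc that)
 show ?thesis
  by (rule left_moduleI[OF left_moduleD(1)[OF M]], rule ab_groupI)
   (use k inv in \<open>simp_all add: kc lm[OF M] lm_ac(1)[OF M]\<close>, simp add: kc lm_ac(2)[OF M])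
qed

lemma submodule_image:
 assumes M: "left_module R M" and N: "left_module R N" and h: "h \<in> mod_hom R M N"
 shows "submodule (h ` carrier M) R N"
proof -
 note hs = hom_simps[OF h M N]
 have "h x \<oplus>\<^bsub>N\<^esub> h y \<in> h ` carrier M" if "x \<in> carrier M" "y \<in> carrier M" for x y
  using that hs(2)[OF that] by (intro image_eqI[of _ _ "x \<oplus>\<^bsub>M\<^esub> y"]) (simp_all add: lm[OF M])
 moreover have "a \<odot>\<^bsub>N\<^esub> h x \<in> h ` carrier M" if "a \<in> carrier R" "x \<in> carrier M" for a x
  using that hs(3)[OF that] by (intro image_eqI[of _ _ "a \<odot>\<^bsub>M\<^esub> x"]) (simp_all add: lm[OF M])
 moreover have "\<zero>\<^bsub>N\<^esub> \<in> h ` carrier M" using hs(4) by (intro image_eqI[of _ _ "\<zero>\<^bsub>M\<^esub>"]) (simp_all add: lm[OF M])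
 ultimately show ?thesis using hs(1) unfolding submodule_iff[OF N] by blast
qed

lemma submodule_preimage:
 assumes M: "left_module R M" and N: "left_module R N" and h: "h \<in> mod_hom R M N" and K: "submodule K R N"
 shows "submodule {x \<in> carrier M. h x \<in> K} R M"
 using K unfolding submodule_iff[OF M] submodule_iff[OF N]
 by (auto simp: hom_simps[OF h M N] lm[OF M])

lemma submodule_zero: "left_module R M ==> submodule {\<zero>\<^bsub>M\<^esub>} R M"
 by (simp add: submodule_iff lm)

lemma submodule_kernel:
 assumes M: "left_module R M" and N: "left_module R N" and h: "h \<in> mod_hom R M N"
 shows "submodule {x \<in> carrier M. h x = \<zero>\<^bsub>N\<^esub>} R M"
 using submodule_preimage[OF M N h submodule_zero[OF N]] by simp

lemma submodule_Int:
 assumes "left_module R M" "submodule K R M" "submodule L R M"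
 shows "submodule (K \<inter> L) R M"
 using assms by (auto simp: submodule_iff)

text \<open>The span of a finite set is the image of a free module of finite rank; this replaces the intersection of
 submodules by which spans are defined.\<close>

lemma finite_set_in_image:
 assumes M: "left_module R M" and S: "finite S" "S \<subseteq> carrier M"
 shows "\<exists>n::nat. \<exists>\<pi>\<in>mod_hom R (Fr R n) M. S \<subseteq> \<pi> ` vecs R n \<and>
  (\<forall>K. submodule K R M --> S \<subseteq> K --> \<pi> ` vecs R n \<subseteq> K)"
proof -
 have R: "ring R" using M by (rule left_moduleD)
 obtain n :: nat and x where x: "S = x ` {..<n}"
  using finite_imp_nat_seg_image_inj_on[OF S(1)] by (auto simp: lessThan_def)
 have xc: "s \<in> {..<n} ==> x s \<in> carrier M" for s using S x by auto
 have h: "lin R M x \<in> mod_hom R (Fr R n) M" by (rule lin_hom[OF M xc])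
 have lb: "lin R M x (bas R s) = x s" if "s < n" for s
  by (rule lin_bas[OF M, of s "{..<n}"]) (use that xc in auto)
 have "S \<subseteq> lin R M x ` vecs R n"
  unfolding x
 proof (rule image_subsetI)
  fix s assume "s \<in> {..<n}"
  then show "x s \<in> lin R M x ` vecs R n"
   using lb[of s] bas_in[OF R, of s "{..<n}"] by (intro image_eqI[of _ _ "bas R s"]) simp_all
 qed
 moreover have "lin R M x v \<in> K" if K: "submodule K R M" "S \<subseteq> K" and v: "v \<in> vecs R n" for K v
  using R v
 proof (induction rule: free_induct)
  case zero
  then show ?case using hom_simps(4)[OF h left_module_free[OF R] M] K by (simp add: submodule_iff[OF M])
 next
  case (step w a s)
  note b = bas_in[OF R step(3)]
  show ?case
   unfolding mod_homD(2)[OF h step(1) lm(12)[OF left_module_free[OF R] step(2) b]] mod_homD(3)[OF h step(2) b]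
   using step K x lb[of s] by (simp add: submodule_iff[OF M] subset_iff)
 qed
 ultimately show ?thesis using h by blast
qed

lemma mod_span_least:
 assumes "submodule K R M" "S \<subseteq> K"
 shows "mod_span R M S \<subseteq> K"
 using assms by (auto simp: mod_span_def)

lemma fin_gen_surj:
 assumes M: "left_module R M" and fg: "fin_gen R M"
 shows "\<exists>n::nat. \<exists>\<pi>\<in>mod_hom R (Fr R n) M. \<pi> ` vecs R n = carrier M"
proof -
 obtain S where S: "finite S" "S \<subseteq> carrier M" "mod_span R M S = carrier M"
  using fg by (auto simp: fin_gen_def)
 obtain n :: nat and \<pi> where \<pi>: "\<pi> \<in> mod_hom R (Fr R n) M" "S \<subseteq> \<pi> ` vecs R n"
  using finite_set_in_image[OF M S(1,2)] by blast
 have "carrier M \<subseteq> \<pi> ` vecs R n"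
  using mod_span_least[OF submodule_image[OF left_module_free[OF left_moduleD(1)[OF M]] M \<pi>(1)] \<pi>(2)] S(3)
  by simp
 then show ?thesis using \<pi> mod_homD(1)[OF \<pi>(1)] by blast
qed

lemma fin_gen_free:
 assumes R: "ring R"
 shows "fin_gen R (Fr R n)"
proof -
 note F = left_module_free[OF R, of "{..<n}"]
 have "v \<in> K" if K: "submodule K R (Fr R n)" "bas R ` {..<n} \<subseteq> K" and v: "v \<in> vecs R n" for K v
  using R v
 proof (induction rule: free_induct)
  case zero
  then show ?case using K by (simp add: submodule_iff[OF F])
 next
  case (step w a s)
  then show ?case using K by (simp add: submodule_iff[OF F] subset_iff del: dsum_simps)
 qed
 then have 1: "vecs R n \<subseteq> mod_span R (Fr R n) (bas R ` {..<n})"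
  unfolding mod_span_def by blast
 have b: "bas R ` {..<n} \<subseteq> vecs R n" using bas_in[OF R, of _ "{..<n}"] by blast
 have "submodule (vecs R n) R (Fr R n)"
  by (simp add: submodule_iff[OF F] lm[OF F] del: dsum_simps)
 from mod_span_least[OF this b] 1 show ?thesis unfolding fin_gen_def using b
  by (intro exI[of _ "bas R ` {..<n}"]) simp
qed

lemma dsum_surj:
 assumes N: "left_module R N" and \<pi>: "\<pi> \<in> mod_hom R (Fr R m) N" "\<pi> ` vecs R m = carrier N"
 shows "\<exists>k::nat. \<exists>\<rho>\<in>mod_hom R (Fr R k) (dsum N {..<n::nat}). \<rho> ` vecs R k = carrier (dsum N {..<n})"
proof -
 have R: "ring R" using N by (rule left_moduleD)
 note D = left_module_dsum[OF N, of "{..<n}"]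
 note dc = dsum_carrier_finite[OF finite_lessThan, of _ N n]
 define sg where "sg r x = (\<lambda>s. if s = r then x else \<zero>\<^bsub>N\<^esub>)" for r :: nat and x
 define S where "S = (\<lambda>(r, i). sg r (\<pi> (bas R i))) ` ({..<n} \<times> {..<m})"
 have sgh: "sg r \<in> mod_hom R N (dsum N {..<n})" if "r < n" for r
  using that by (intro mod_homI) (auto simp: sg_def dc lm[OF N])
 have "finite S" "S \<subseteq> carrier (dsum N {..<n})"
  using bas_in[OF R, of _ "{..<m}"] \<pi> mod_homD(1)[OF sgh] by (auto simp: S_def)
 from finite_set_in_image[OF D this] obtain k :: nat and \<rho> where
  \<rho>: "\<rho> \<in> mod_hom R (Fr R k) (dsum N {..<n})" "S \<subseteq> \<rho> ` vecs R k" by blast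
 let ?K = "\<rho> ` vecs R k"
 have K: "submodule ?K R (dsum N {..<n})" by (rule submodule_image[OF left_module_free[OF R] D \<rho>(1)])
 note k = submoduleD[OF D K]
 note zK = k(2)[simplified dsum_simps] and addK = k(3) and smK = k(4)
 have Kc: "?K \<subseteq> carrier (dsum N {..<n})" using k(1) by blast
 have s: "sg r x \<in> ?K" if "r < n" "x \<in> carrier N" for r x
 proof -
  obtain v where v: "v \<in> vecs R m" "x = \<pi> v" using \<pi>(2) \<open>x \<in> carrier N\<close> by auto
  note h = hom_comp[OF \<pi>(1) sgh[OF \<open>r < n\<close>]]
  have "sg r (\<pi> v) \<in> ?K" using R v(1)
  proof (induction rule: free_induct)
   case zero
   then show ?case using hom_simps(4)[OF h left_module_free[OF R] D] zK by simp
  next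
   case (step w a i)
   note b = bas_in[OF R step(3)]
   show ?case
    unfolding mod_homD(2)[OF h step(1) lm(12)[OF left_module_free[OF R] step(2) b]] mod_homD(3)[OF h step(2) b]
   proof (intro addK smK step)
    have "sg r (\<pi> (bas R i)) \<in> S" using step(3) \<open>r < n\<close> by (auto simp: S_def)
    then show "sg r (\<pi> (bas R i)) \<in> ?K" using \<rho>(2) by blast
   qed
  qed
  then show ?thesis using v by simp
 qed
 have "f \<in> ?K" if "j \<le> n" "f \<in> carrier (dsum N {..<n})" "\<And>s. j \<le> s ==> f s = \<zero>\<^bsub>N\<^esub>" for j f
  using that
 proof (induction j arbitrary: f)
  case 0
  then have "f = (\<lambda>s. \<zero>\<^bsub>N\<^esub>)" by auto
  then show ?case using zK by simp
 next
  case (Suc j)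
  have fc: "f s \<in> carrier N" for s using Suc.prems by (simp add: dc)
  have "f(j := \<zero>\<^bsub>N\<^esub>) \<in> ?K" by (rule Suc.IH) (use Suc.prems in \<open>auto simp: dc lm[OF N] le_Suc_eq\<close>)
  moreover have "sg j (f j) \<in> ?K" by (rule s) (use Suc.prems fc in auto)
  moreover have "f = f(j := \<zero>\<^bsub>N\<^esub>) \<oplus>\<^bsub>dsum N {..<n}\<^esub> sg j (f j)"
   by (auto simp: sg_def lm[OF N] fc fun_eq_iff)
  ultimately show ?case using addK by metis
 qed
 from this[of n] have "carrier (dsum N {..<n}) \<subseteq> ?K" by (auto simp: dc)
 then have "?K = carrier (dsum N {..<n})" using Kc by blast
 then show ?thesis using \<rho>(1) by blast
qed

section \<open>Noetherian rings and free resolutions\<close>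

text \<open>By induction on the rank: the last coordinates of the elements of \<open>K\<close> form a finitely generated left ideal,
 and elements of \<open>K\<close> with last coordinate zero lie in a free module of smaller rank.\<close>

lemma noetherian_free_submodule:
 assumes noeth: "left_noetherian R" and K: "submodule K R (Fr R n)"
 shows "\<exists>T. finite T \<and> T \<subseteq> K \<and> (\<forall>L. submodule L R (Fr R n) --> T \<subseteq> L --> K \<subseteq> L)"
proof -
 have R: "ring R" using noeth by (simp add: left_noetherian_def)
 interpret R: ring R by fact
 note F = left_module_free[OF R]
 note fc = dsum_carrier_finite[OF finite_lessThan, of _ "regular_bimodule R"]
 show ?thesis using K
 proof (induction n arbitrary: K)
  case 0
  have "K \<subseteq> {\<lambda>s. \<zero>\<^bsub>R\<^esub>}" using submoduleD(1)[OF F 0] by (auto simp: dsum_carrier fun_eq_iff)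
  then show ?case using 0 by (intro exI[of _ K]) (auto intro: finite_subset)
 next
  case (Suc n)
  note k = Suc.prems[unfolded submodule_iff[OF F]]
  have ev: "(\<lambda>v. v n) \<in> mod_hom R (Fr R (Suc n)) (regular_bimodule R)"
   by (rule mod_homI) (auto simp: fc)
  have sub: "vecs R n \<subseteq> vecs R (Suc n)" by (auto simp: fc)
  have inc: "(\<lambda>v. v) \<in> mod_hom R (Fr R n) (Fr R (Suc n))"
   by (rule mod_homI) (auto simp: fc)
  let ?I = "(\<lambda>v. v n) ` K"
  have img: "submodule ((\<lambda>v. v n) ` L) R (regular_bimodule R)" if L: "submodule L R (Fr R (Suc n))" for L
   using submodule_image[OF left_module_sub[OF F L] left_module_regular[OF R], of "\<lambda>v. v n"] ev L
   by (auto simp: mod_hom_def submodule_iff[OF F] subset_iff)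
  obtain S where S: "finite S" "S \<subseteq> ?I" "mod_span R (regular_bimodule R) S = ?I"
   using noeth img[OF Suc.prems] by (auto simp: left_noetherian_def)
  obtain U where U: "finite U" "U \<subseteq> K" "S = (\<lambda>v. v n) ` U"
   using finite_subset_image[OF S(1,2)] by blast
  let ?K0 = "{v \<in> vecs R n. v \<in> K}"
  have "submodule ?K0 R (Fr R n)" by (rule submodule_preimage[OF F F inc Suc.prems])
  from Suc.IH[OF this] obtain T where T: "finite T" "T \<subseteq> ?K0"
   "\<And>L. submodule L R (Fr R n) ==> T \<subseteq> L ==> ?K0 \<subseteq> L" by blast
  have "K \<subseteq> L" if L: "submodule L R (Fr R (Suc n))" and TU: "T \<union> U \<subseteq> L" for L
  proof
   fix v assume v: "v \<in> K"
   note l = L[unfolded submodule_iff[OF F]]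
   have "submodule {v \<in> vecs R n. v \<in> L} R (Fr R n)"
    by (rule submodule_preimage[OF F F inc L])
   then have K0: "?K0 \<subseteq> L" using T(3) T(2) TU by blast
   have KL: "submodule (K \<inter> L) R (Fr R (Suc n))" by (rule submodule_Int[OF F Suc.prems L])
   have "?I \<subseteq> (\<lambda>v. v n) ` (K \<inter> L)"
    using mod_span_least[OF img[OF KL], of S] U TU S(3) by blast
   then obtain w where w: "w \<in> K" "w \<in> L" "w n = v n" using v by force
   have vc: "v \<in> vecs R (Suc n)" "w \<in> vecs R (Suc n)" using v w k by auto
   let ?u = "v \<oplus>\<^bsub>Fr R (Suc n)\<^esub> (\<ominus>\<^bsub>R\<^esub> \<one>\<^bsub>R\<^esub>) \<odot>\<^bsub>Fr R (Suc n)\<^esub> w"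
   have "?u \<in> K" using k v w(1) by (simp del: dsum_simps)
   moreover have "?u \<in> vecs R n"
    unfolding fc
   proof (intro conjI allI impI)
    fix s
    show "?u s \<in> carrier (regular_bimodule R)" using vc by (simp add: fc)
    show "?u s = \<zero>\<^bsub>regular_bimodule R\<^esub>" if "s \<notin> {..<n}"
     using that vc w(3) by (cases "s = n") (simp_all add: fc R.l_minus R.r_neg)
   qed
   ultimately have "?u \<in> L" using K0 by blast
   then have "?u \<oplus>\<^bsub>Fr R (Suc n)\<^esub> w \<in> L" using l w(2) by (simp del: dsum_simps)
   moreover have "?u \<oplus>\<^bsub>Fr R (Suc n)\<^esub> w = v"
    using vc by (auto simp: fc R.l_minus R.a_assoc R.l_neg)
   ultimately show "v \<in> L" by simp
  qed
  then show ?case using T U by (intro exI[of _ "T \<union> U"]) auto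
 qed
qed

lemma noetherian_cover:
 assumes noeth: "left_noetherian R" and K: "submodule K R (Fr R n)"
 shows "\<exists>m::nat. \<exists>\<pi>\<in>mod_hom R (Fr R m) (Fr R n). \<pi> ` vecs R m = K"
proof -
 have R: "ring R" using noeth by (simp add: left_noetherian_def)
 note F = left_module_free[OF R]
 obtain T where T: "finite T" "T \<subseteq> K" "\<And>L. submodule L R (Fr R n) ==> T \<subseteq> L ==> K \<subseteq> L"
  using noetherian_free_submodule[OF assms] by blast
 have "T \<subseteq> vecs R n" using T(2) K by (auto simp: submodule_iff[OF F])
 from finite_set_in_image[OF F T(1) this] obtain m :: nat and \<pi> where
  \<pi>: "\<pi> \<in> mod_hom R (Fr R m) (Fr R n)" "T \<subseteq> \<pi> ` vecs R m"
  "\<And>L. submodule L R (Fr R n) ==> T \<subseteq> L ==> \<pi> ` vecs R m \<subseteq> L" by metis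
 have "\<pi> ` vecs R m = K"
  using T(3)[OF submodule_image[OF F F \<pi>(1)] \<pi>(2)] \<pi>(3)[OF K T(2)] by (rule equalityI[rotated])
 then show ?thesis using \<pi>(1) by blast
qed

abbreviation exact_at :: "('a, 'r) ring_scheme => (nat => nat) => (nat => (nat => 'a) => nat => 'a) => nat => bool" where
 "exact_at R n f i \<equiv> f (Suc i) ` vecs R (n (Suc (Suc i))) =
   {x \<in> vecs R (n (Suc i)). f i x = (\<lambda>s. \<zero>\<^bsub>R\<^esub>)}"

text \<open>An exact sequence of finitely generated free modules, continuing to the left.\<close>

definition free_exact :: "('a, 'r) ring_scheme => (nat => nat) => (nat => (nat => 'a) => nat => 'a) => bool" where
 "free_exact R n f \<longleftrightarrow> (\<forall>i. f i \<in> mod_hom R (Fr R (n (Suc i))) (Fr R (n i))) \<and> (\<forall>i. exact_at R n f i)"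

lemma free_resolution_of_submodule:
 assumes noeth: "left_noetherian R" and K: "submodule K R (Fr R m)"
 shows "\<exists>n f. n 0 = m \<and> free_exact R n f \<and>
  f 0 ` vecs R (n (Suc 0)) = K"
proof -
 have R: "ring R" using noeth by (simp add: left_noetherian_def)
 note F = left_module_free[OF R]
 have start: "\<exists>a::nat. \<exists>g\<in>mod_hom R (Fr R a) (Fr R m). g ` vecs R a = K"
  by (rule noetherian_cover[OF noeth K])
 define Good where "Good i s \<longleftrightarrow> (case s of (a::nat, b::nat, g) => g \<in> mod_hom R (Fr R a) (Fr R b) \<and>
   (i = (0::nat) --> b = m \<and> g ` vecs R a = K))" for i s
 define Rel where "Rel s t \<longleftrightarrow> (case s of (a::nat, b::nat, g::(nat=>'a)=>nat=>'a) => case t of (a'::nat, b'::nat, g') => b' = a \<and>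
   g' ` vecs R a' = {x \<in> vecs R a. g x = (\<lambda>s. \<zero>\<^bsub>R\<^esub>)})" for s t
 have "\<exists>S. \<forall>i. Good i (S i) \<and> Rel (S i) (S (Suc i))"
 proof (rule dependent_nat_choice)
  show "\<exists>s. Good 0 s" using start by (auto simp: Good_def)
 next
  fix s i assume s: "Good i s"
  obtain a b g where s': "s = (a, b, g)" by (metis prod_cases3)
  have g: "g \<in> mod_hom R (Fr R a) (Fr R b)" using s by (simp add: s' Good_def)
  from noetherian_cover[OF noeth submodule_kernel[OF F F g]] obtain a' :: nat and g' where
   "g' \<in> mod_hom R (Fr R a') (Fr R a)"
   "g' ` vecs R a' = {x \<in> vecs R a. g x = (\<lambda>s. \<zero>\<^bsub>R\<^esub>)}"
   by auto
  then show "\<exists>t. Good (Suc i) t \<and> Rel s t"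
   by (intro exI[of _ "(a', a, g')"]) (simp add: Good_def Rel_def s')
 qed
 then obtain S where S: "\<And>i. Good i (S i)" "\<And>i. Rel (S i) (S (Suc i))" by blast
 define n where "n i = fst (snd (S i))" for i
 define f where "f i = snd (snd (S i))" for i
 have nS: "n (Suc i) = fst (S i)" for i using S(2)[of i] by (simp add: n_def Rel_def split: prod.splits)
 have Si: "S i = (n (Suc i), n i, f i)" for i by (simp add: nS, simp add: n_def f_def)
 have "f i \<in> mod_hom R (Fr R (n (Suc i))) (Fr R (n i))" for i
  using S(1)[of i] unfolding Si Good_def by simp
 moreover have "exact_at R n f i" for i using S(2)[of i] unfolding Si Rel_def by simp
 moreover have "n 0 = m" "f 0 ` vecs R (n (Suc 0)) = K"
  using S(1)[of 0] unfolding Si Good_def by simp_all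
 ultimately show ?thesis unfolding free_exact_def by blast
qed

lemma free_resolution_of_map:
 assumes noeth: "left_noetherian R" and X: "left_module R X" and h: "h \<in> mod_hom R (Fr R m) X"
 shows "\<exists>n f. n 0 = m \<and> free_exact R n f \<and>
  f 0 ` vecs R (n (Suc 0)) = {x \<in> vecs R m. h x = \<zero>\<^bsub>X\<^esub>}"
 by (rule free_resolution_of_submodule[OF noeth submodule_kernel[OF left_module_free[OF left_moduleD(1)[OF X]] X h]])

lemma free_resolution:
 assumes noeth: "left_noetherian R" and M: "left_module R M" and fg: "fin_gen R M"
 shows "\<exists>n f \<pi>. free_exact R n f \<and> nat_resolution R (\<lambda>i. Fr R (n i)) f M \<pi>"
proof -
 have R: "ring R" using noeth by (simp add: left_noetherian_def)
 obtain m :: nat and \<pi> where \<pi>: "\<pi> \<in> mod_hom R (Fr R m) M" "\<pi> ` vecs R m = carrier M"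
  using fin_gen_surj[OF M fg] by blast
 obtain n f where nf: "n 0 = m" "free_exact R n f"
  "f 0 ` vecs R (n (Suc 0)) = {x \<in> vecs R m. \<pi> x = \<zero>\<^bsub>M\<^esub>}"
  using free_resolution_of_map[OF noeth M \<pi>(1)] by blast
 have "nat_resolution R (\<lambda>i. Fr R (n i)) f M \<pi>"
  unfolding nat_resolution_def using nf \<pi> M left_module_free[OF R] by (auto simp: free_exact_def)
 then show ?thesis using nf(2) by blast
qed

section \<open>Injective modules\<close>

text \<open>Transport of a module structure along an injection \<open>e\<close> with left inverse \<open>d\<close>.\<close>

definition transport :: "('m => 'n) => ('n => 'm) => ('a, 'm, 'x) module_scheme => ('a, 'n) module" where
 "transport e d M = \<lparr>carrier = e ` carrier M, monoid.mult = undefined, one = undefined, ring.zero = e \<zero>\<^bsub>M\<^esub>,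
   add = (\<lambda>x y. e (d x \<oplus>\<^bsub>M\<^esub> d y)), smult = (\<lambda>a x. e (a \<odot>\<^bsub>M\<^esub> d x))\<rparr>"

lemma transport:
 assumes M: "left_module R M" and d: "\<And>x. x \<in> carrier M ==> d (e x) = x"
 shows "left_module R (transport e d M)" "e \<in> mod_hom R M (transport e d M)" "d \<in> mod_hom R (transport e d M) M"
  "carrier (transport e d M) = e ` carrier M" "\<zero>\<^bsub>transport e d M\<^esub> = e \<zero>\<^bsub>M\<^esub>"
proof -
 have inv: "\<exists>y\<in>carrier M. e (x \<oplus>\<^bsub>M\<^esub> y) = e \<zero>\<^bsub>M\<^esub>" if "x \<in> carrier M" for x
  by (rule bexI[of _ "\<ominus>\<^bsub>M\<^esub> x"]) (simp_all add: lm[OF M] that)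
 show "left_module R (transport e d M)"
  by (rule left_moduleI[OF left_moduleD(1)[OF M]], rule ab_groupI)
   (auto simp: transport_def d lm[OF M] lm_ac[OF M] inv)
 show "e \<in> mod_hom R M (transport e d M)" "d \<in> mod_hom R (transport e d M) M"
  by (rule mod_homI; auto simp: transport_def d lm[OF M])+
qed (simp_all add: transport_def)

lemma injective_moduleD: "injective_module R E ==> left_module R E"
 by (simp add: injective_module_def)

text \<open>The test modules in the definition of injectivity are large enough for all extension problems
 into which a finitely generated module enters: such a problem can be pulled back to a free module
 \<open>F\<close> of finite rank and, via singletons, to the type of test modules.\<close>

lemma injective_factor:
 assumes E: "injective_module R E" and U: "left_module R U" and Y: "left_module R Y"
  and \<pi>: "\<pi> \<in> mod_hom R (Fr R n) Y" "\<pi> ` vecs R n = carrier Y"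
  and a: "a \<in> mod_hom R U Y" and g: "g \<in> mod_hom R U E"
  and ker: "\<And>u. u \<in> carrier U ==> a u = \<zero>\<^bsub>Y\<^esub> ==> g u = \<zero>\<^bsub>E\<^esub>"
 shows "\<exists>h\<in>mod_hom R Y E. \<forall>u\<in>carrier U. g u = h (a u)"
proof -
 have R: "ring R" using U by (rule left_moduleD)
 have Em: "left_module R E" by (rule injective_moduleD[OF E])
 let ?F = "Fr R n"
 note F = left_module_free[OF R, of "{..<n}"]
 note ps = hom_simps[OF \<pi>(1) F Y] and as = hom_simps[OF a U Y] and gs = hom_simps[OF g U Em]
 define K where "K = {v \<in> carrier ?F. \<pi> v \<in> a ` carrier U}"
 have K: "submodule K R ?F"
  unfolding K_def by (rule submodule_preimage[OF F Y \<pi>(1) submodule_image[OF U Y a]])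
 have Kc: "v \<in> K ==> v \<in> carrier ?F" for v by (simp add: K_def)
 have KM: "left_module R (?F\<lparr>carrier := K\<rparr>)" by (rule left_module_sub[OF F K])
 have ga: "g u = g u'" if "u \<in> carrier U" "u' \<in> carrier U" "a u = a u'" for u u'
 proof -
  have "g (u \<oplus>\<^bsub>U\<^esub> \<ominus>\<^bsub>U\<^esub> u') = \<zero>\<^bsub>E\<^esub>" using that by (intro ker) (simp_all add: lm[OF U] as lm[OF Y])
  then show ?thesis using that by (simp add: lm[OF U] gs lm_eq_iff[OF Em])
 qed
 define g0 where "g0 v = g (SOME u. u \<in> carrier U \<and> a u = \<pi> v)" for v
 have g0: "g0 v = g u" if "v \<in> K" "u \<in> carrier U" "a u = \<pi> v" for u v
  unfolding g0_def
  by (rule someI2[of "\<lambda>u. u \<in> carrier U \<and> a u = \<pi> v"]) (use that in \<open>auto intro: ga\<close>)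
 have g0h: "g0 \<in> mod_hom R (?F\<lparr>carrier := K\<rparr>) E"
 proof (rule mod_homI)
  fix v assume v: "v \<in> carrier (?F\<lparr>carrier := K\<rparr>)"
  then obtain u where u: "u \<in> carrier U" "a u = \<pi> v" by (auto simp: K_def)
  show "g0 v \<in> carrier E" using g0[of v u] u v by (simp add: gs)
  fix c assume c: "c \<in> carrier R"
  have cv: "c \<odot>\<^bsub>?F\<^esub> v \<in> K" using lm(12)[OF KM c v] by simp
  have "a (c \<odot>\<^bsub>U\<^esub> u) = \<pi> (c \<odot>\<^bsub>?F\<^esub> v)" using u v c Kc by (simp add: as ps(3)[symmetric] del: dsum_simps)
  then have "g0 (c \<odot>\<^bsub>?F\<^esub> v) = g (c \<odot>\<^bsub>U\<^esub> u)" by (rule g0[OF cv lm(12)[OF U c u(1)]])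
  then show "g0 (c \<odot>\<^bsub>?F\<lparr>carrier := K\<rparr>\<^esub> v) = c \<odot>\<^bsub>E\<^esub> g0 v"
   using g0[of v u] u v c by (simp add: gs)
 next
  fix v w assume v: "v \<in> carrier (?F\<lparr>carrier := K\<rparr>)" and w: "w \<in> carrier (?F\<lparr>carrier := K\<rparr>)"
  obtain u where u: "u \<in> carrier U" "a u = \<pi> v" using v by (auto simp: K_def)
  obtain t where t: "t \<in> carrier U" "a t = \<pi> w" using w by (auto simp: K_def)
  have vw: "v \<oplus>\<^bsub>?F\<^esub> w \<in> K" using lm(1)[OF KM v w] by simp
  have "a (u \<oplus>\<^bsub>U\<^esub> t) = \<pi> (v \<oplus>\<^bsub>?F\<^esub> w)" using u t v w Kc by (simp add: as ps(2)[symmetric] del: dsum_simps)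
  then have "g0 (v \<oplus>\<^bsub>?F\<^esub> w) = g (u \<oplus>\<^bsub>U\<^esub> t)" by (rule g0[OF vw lm(1)[OF U u(1) t(1)]])
  then show "g0 (v \<oplus>\<^bsub>?F\<lparr>carrier := K\<rparr>\<^esub> w) = g0 v \<oplus>\<^bsub>E\<^esub> g0 w"
   using g0[of v u] g0[of w t] u t v w by (simp add: gs)
 qed
 let ?e = "\<lambda>v :: nat => 'a. {v}"
 let ?X = "transport ?e the_elem (?F\<lparr>carrier := K\<rparr>)" and ?Y = "transport ?e the_elem ?F"
 note tX = transport[OF KM, of the_elem ?e, simplified the_elem_eq, OF refl]
 note tY = transport[OF F, of the_elem ?e, simplified the_elem_eq, OF refl]
 have j: "(\<lambda>x. x) \<in> mod_hom R ?X ?Y"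
  by (rule mod_homI) (auto simp: transport_def Kc)
 note g1 = hom_comp[OF tX(3) g0h]
 have "\<exists>h\<in>mod_hom R ?Y E. \<forall>x\<in>carrier ?X. h x = g0 (the_elem x)"
  by (rule E[unfolded injective_module_def, THEN conjunct2, rule_format, of ?X ?Y "\<lambda>x. x" "\<lambda>x. g0 (the_elem x)"])
   (intro conjI tX(1) tY(1) j g1 inj_on_id2)
 then obtain h1 where h1: "h1 \<in> mod_hom R ?Y E" "\<And>x. x \<in> carrier ?X ==> h1 x = g0 (the_elem x)"
  by blast
 define h2 where "h2 v = h1 {v}" for v
 have h2: "h2 \<in> mod_hom R ?F E" unfolding h2_def by (rule hom_comp[OF tY(2) h1(1)])
 have h2K: "h2 v = g0 v" if "v \<in> K" for v using h1(2)[of "{v}"] that by (simp add: h2_def tX(4))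
 note hs = hom_simps[OF h2 F Em]
 have h2z: "h2 v = \<zero>\<^bsub>E\<^esub>" if v: "v \<in> carrier ?F" "\<pi> v = \<zero>\<^bsub>Y\<^esub>" for v
 proof -
  have "v \<in> K" using v as(4) lm(2)[OF U] by (auto simp: K_def intro!: image_eqI[of _ _ "\<zero>\<^bsub>U\<^esub>"])
  then show ?thesis using h2K g0[of v "\<zero>\<^bsub>U\<^esub>"] v as(4) lm(2)[OF U] gs(4) by simp
 qed
 have h2e: "h2 v = h2 w" if v: "v \<in> carrier ?F" "w \<in> carrier ?F" "\<pi> v = \<pi> w" for v w
 proof -
  have "h2 (v \<oplus>\<^bsub>?F\<^esub> \<ominus>\<^bsub>?F\<^esub> w) = \<zero>\<^bsub>E\<^esub>"
   using v by (intro h2z) (simp_all add: lm[OF F] ps lm[OF Y] del: dsum_simps)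
  then show ?thesis using v by (simp add: lm[OF F] hs lm_eq_iff[OF Em] del: dsum_simps)
 qed
 define h where "h y = h2 (SOME v. v \<in> carrier ?F \<and> \<pi> v = y)" for y
 have h: "h (\<pi> v) = h2 v" if "v \<in> carrier ?F" for v
  unfolding h_def
  by (rule someI2[of "\<lambda>w. w \<in> carrier ?F \<and> \<pi> w = \<pi> v"]) (use that in \<open>auto intro: h2e\<close>)
 have sur: "\<exists>v\<in>carrier ?F. y = \<pi> v" if "y \<in> carrier Y" for y using \<pi>(2) that by auto
 have "h \<in> mod_hom R Y E"
 proof (rule mod_homI)
  fix y assume y: "y \<in> carrier Y"
  then obtain v where v: "v \<in> carrier ?F" "y = \<pi> v" using sur by blast
  show "h y \<in> carrier E" using v by (simp add: h hs)
  fix c assume c: "c \<in> carrier R"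
  then show "h (c \<odot>\<^bsub>Y\<^esub> y) = c \<odot>\<^bsub>E\<^esub> h y"
   using v h[OF lm(12)[OF F c v(1)]] by (simp add: ps h hs del: dsum_simps)
 next
  fix y z assume y: "y \<in> carrier Y" and z: "z \<in> carrier Y"
  obtain v where v: "v \<in> carrier ?F" "y = \<pi> v" using sur y by blast
  obtain w where w: "w \<in> carrier ?F" "z = \<pi> w" using sur z by blast
  show "h (y \<oplus>\<^bsub>Y\<^esub> z) = h y \<oplus>\<^bsub>E\<^esub> h z"
   using v w h[OF lm(1)[OF F v(1) w(1)]] by (simp add: ps h hs del: dsum_simps)
 qed
 moreover have "g u = h (a u)" if u: "u \<in> carrier U" for u
 proof -
  obtain v where v: "v \<in> carrier ?F" "a u = \<pi> v" using sur as(1)[OF u] by blast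
  have "v \<in> K" using u v by (auto simp: K_def intro!: image_eqI[of _ _ u])
  then show ?thesis using v u by (simp add: h h2K g0)
 qed
 ultimately show ?thesis by blast
qed

section \<open>Ext from free resolutions\<close>

text \<open>The universal property of the quotient of \<open>P\<close> by the kernel of \<open>\<pi>\<close>.\<close>

lemma hom_factor:
 assumes P: "left_module R P" and C: "left_module R C" and X: "left_module R X"
  and \<pi>: "\<pi> \<in> mod_hom R P C" "\<pi> ` carrier P = carrier C" and w: "w \<in> mod_hom R P X"
  and ker: "\<And>x. x \<in> carrier P ==> \<pi> x = \<zero>\<^bsub>C\<^esub> ==> w x = \<zero>\<^bsub>X\<^esub>"
 shows "\<exists>h\<in>mod_hom R C X. \<forall>x\<in>carrier P. w x = h (\<pi> x)"
proof -
 note ps = hom_simps[OF \<pi>(1) P C] and ws = hom_simps[OF w P X]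
 have we: "w x = w y" if "x \<in> carrier P" "y \<in> carrier P" "\<pi> x = \<pi> y" for x y
 proof -
  have "w (x \<oplus>\<^bsub>P\<^esub> \<ominus>\<^bsub>P\<^esub> y) = \<zero>\<^bsub>X\<^esub>" using that by (intro ker) (simp_all add: lm[OF P] ps lm[OF C])
  then show ?thesis using that by (simp add: lm[OF P] ws lm_eq_iff[OF X])
 qed
 define h where "h y = w (SOME x. x \<in> carrier P \<and> \<pi> x = y)" for y
 have h: "h (\<pi> x) = w x" if "x \<in> carrier P" for x
  unfolding h_def by (rule someI2[of "\<lambda>z. z \<in> carrier P \<and> \<pi> z = \<pi> x"]) (use that in \<open>auto intro: we\<close>)
 have sur: "\<exists>x\<in>carrier P. y = \<pi> x" if "y \<in> carrier C" for y using \<pi>(2) that by auto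
 have "h \<in> mod_hom R C X"
 proof (rule mod_homI)
  fix y assume y: "y \<in> carrier C"
  then obtain x where x: "x \<in> carrier P" "y = \<pi> x" using sur by blast
  show "h y \<in> carrier X" using x by (simp add: h ws)
  fix c assume c: "c \<in> carrier R"
  then show "h (c \<odot>\<^bsub>C\<^esub> y) = c \<odot>\<^bsub>X\<^esub> h y" using x h[OF lm(12)[OF P c x(1)]] by (simp add: ps h ws)
 next
  fix y z assume y: "y \<in> carrier C" and z: "z \<in> carrier C"
  obtain u where u: "u \<in> carrier P" "y = \<pi> u" using sur y by blast
  obtain v where v: "v \<in> carrier P" "z = \<pi> v" using sur z by blast
  show "h (y \<oplus>\<^bsub>C\<^esub> z) = h y \<oplus>\<^bsub>X\<^esub> h z" using u v h[OF lm(1)[OF P u(1) v(1)]] by (simp add: ps h ws)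
 qed
 then show ?thesis by (rule bexI[rotated]) (simp add: h)
qed

lemma hom_group_simps:
 "carrier (hom_group R M N) = mod_hom R M N \<inter> extensional (carrier M)"
 "f \<otimes>\<^bsub>hom_group R M N\<^esub> g = (\<lambda>x\<in>carrier M. f x \<oplus>\<^bsub>N\<^esub> g x)"
 "\<one>\<^bsub>hom_group R M N\<^esub> = (\<lambda>x\<in>carrier M. \<zero>\<^bsub>N\<^esub>)"
 by (simp_all add: hom_group_def)

lemma restrict_hom:
 assumes "left_module R M" "f \<in> mod_hom R M N"
 shows "(\<lambda>x\<in>carrier M. f x) \<in> mod_hom R M N \<inter> extensional (carrier M)"
 using hom_cong[OF assms(2) _ assms(1), of "\<lambda>x\<in>carrier M. f x"] by simp

lemma comm_group_hom_group:
 assumes M: "left_module R M" and N: "left_module R N"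
 shows "comm_group (hom_group R M N)"
proof (rule comm_groupI)
 fix f g assume f: "f \<in> carrier (hom_group R M N)" and g: "g \<in> carrier (hom_group R M N)"
 show "f \<otimes>\<^bsub>hom_group R M N\<^esub> g \<in> carrier (hom_group R M N)"
  unfolding hom_group_simps using f g restrict_hom[OF M hom_add[OF _ _ N, of f _ g]] by (simp add: hom_group_simps)
 show "f \<otimes>\<^bsub>hom_group R M N\<^esub> g = g \<otimes>\<^bsub>hom_group R M N\<^esub> f"
  using f g mod_homD(1)[of _ R M N] by (auto simp: hom_group_simps lm_ac(2)[OF N] intro!: restrict_ext)
 fix h assume h: "h \<in> carrier (hom_group R M N)"
 show "f \<otimes>\<^bsub>hom_group R M N\<^esub> g \<otimes>\<^bsub>hom_group R M N\<^esub> h = f \<otimes>\<^bsub>hom_group R M N\<^esub> (g \<otimes>\<^bsub>hom_group R M N\<^esub> h)"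
  using f g h mod_homD(1)[of _ R M N] by (auto simp: hom_group_simps lm_ac(1)[OF N] intro!: restrict_ext)
next
 show "\<one>\<^bsub>hom_group R M N\<^esub> \<in> carrier (hom_group R M N)"
  unfolding hom_group_simps by (rule restrict_hom[OF M hom_zero[OF N]])
next
 fix f assume f: "f \<in> carrier (hom_group R M N)"
 then have fh: "f \<in> mod_hom R M N" and fe: "f \<in> extensional (carrier M)" by (auto simp: hom_group_simps)
 show "\<one>\<^bsub>hom_group R M N\<^esub> \<otimes>\<^bsub>hom_group R M N\<^esub> f = f"
  using fe by (auto simp: hom_group_simps lm[OF N] mod_homD(1)[OF fh] extensional_def fun_eq_iff)
 show "\<exists>g\<in>carrier (hom_group R M N). g \<otimes>\<^bsub>hom_group R M N\<^esub> f = \<one>\<^bsub>hom_group R M N\<^esub>"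
 proof (rule bexI)
  show "(\<lambda>x\<in>carrier M. \<ominus>\<^bsub>N\<^esub> f x) \<in> carrier (hom_group R M N)"
   unfolding hom_group_simps by (rule restrict_hom[OF M hom_neg[OF fh N]])
  show "(\<lambda>x\<in>carrier M. \<ominus>\<^bsub>N\<^esub> f x) \<otimes>\<^bsub>hom_group R M N\<^esub> f = \<one>\<^bsub>hom_group R M N\<^esub>"
   by (auto simp: hom_group_simps lm[OF N] mod_homD(1)[OF fh] intro!: restrict_ext)
 qed
qed

lemma restrict_eq_zero_iff:
 "(\<lambda>x\<in>S. f x) = (\<lambda>x\<in>S. c) \<longleftrightarrow> (\<forall>x\<in>S. f x = c)"
 by (auto simp: fun_eq_iff)

lemma trivial_hom_cohomology_iff:
 assumes P: "module_complex R P" and N: "left_module R N"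
 shows "trivial_group (cohomology (hom_from_complex R P N) (int (Suc i))) \<longleftrightarrow>
  hom_exact R (\<lambda>i. obj P (- int i)) (\<lambda>i. dif P (- int (Suc i))) N i"
proof -
 let ?C = "hom_from_complex R P N"
 note p = module_complexD[OF P]
 have o: "obj ?C j = hom_group R (obj P (- j)) N" for j by (simp add: hom_from_complex_def)
 have d: "dif ?C j = (\<lambda>f. \<lambda>x\<in>elts P (- (j + 1)). f (dif P (- (j + 1)) x))" for j
  by (simp add: hom_from_complex_def)
 have ph: "dif P (- (j + 1)) \<in> mod_hom R (obj P (- (j + 1))) (obj P (- j))" for j
  using p(2)[of "- (j + 1)"] by simp
 have pp: "dif P (- (j + 1)) (dif P (- (j + 1 + 1)) x) = null P (- j)" if "x \<in> elts P (- (j + 1 + 1))" for j x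
 proof -
  have e: "- (j + 1 + 1) + 1 = - (j + 1)" "- (j + 1 + 1) + 2 = - j" by simp_all
  show ?thesis using p(4)[OF that] unfolding e .
 qed
 have G: "comm_group (obj ?C j)" for j unfolding o by (rule comm_group_hom_group[OF p(1) N])
 have dh: "dif ?C j \<in> hom (obj ?C j) (obj ?C (j + 1))" for j
 proof (rule homI)
  fix f assume f: "f \<in> elts ?C j"
  then have fh: "f \<in> mod_hom R (obj P (- j)) N" by (simp add: o hom_group_simps)
  show "dif ?C j f \<in> elts ?C (j + 1)"
   unfolding o d hom_group_simps by (rule restrict_hom[OF p(1) hom_comp[OF ph fh]])
  fix g assume g: "g \<in> elts ?C j"
  show "dif ?C j (f \<otimes>\<^bsub>obj ?C j\<^esub> g) = dif ?C j f \<otimes>\<^bsub>obj ?C (j + 1)\<^esub> dif ?C j g"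
   unfolding o d hom_group_simps using mod_homD(1)[OF ph[of j]] by (auto intro!: restrict_ext)
 qed
 have dd: "dif ?C (j + 1) (dif ?C j f) = \<one>\<^bsub>obj ?C (j + 1 + 1)\<^esub>" if f: "f \<in> elts ?C j" for j f
 proof -
  have fh: "f \<in> mod_hom R (obj P (- j)) N" using f by (simp add: o hom_group_simps)
  note z = hom_simps(4)[OF fh p(1) N]
  show ?thesis
   unfolding o d hom_group_simps restrict_eq_zero_iff
   using mod_homD(1)[OF ph, of _ "j + 1"] pp[of _ j] by (auto simp: z)
 qed
 have e: "- (int (Suc i) + 1) = - int (Suc (Suc i))" "- (int (Suc i) - 1) = - int i"
  "- (int (Suc i) - 1 + 1) = - int (Suc i)" "int (Suc i) - 1 + 1 = int (Suc i)" by simp_all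
 have dh': "dif ?C (int (Suc i) - 1) \<in> hom (obj ?C (int (Suc i) - 1)) (obj ?C (int (Suc i)))"
  using dh[of "int (Suc i) - 1"] unfolding e .
 have dd': "dif ?C (int (Suc i)) (dif ?C (int (Suc i) - 1) f) = \<one>\<^bsub>obj ?C (int (Suc i) + 1)\<^esub>"
  if "f \<in> elts ?C (int (Suc i) - 1)" for f
  using dd[OF that] unfolding e .
 have ph': "dif P (- int (Suc i)) \<in> mod_hom R (obj P (- int (Suc i))) (obj P (- int i))"
  using ph[of "int i"] by (simp add: add.commute)
 have "trivial_group (cohomology ?C (int (Suc i))) \<longleftrightarrow>
  (\<forall>g\<in>elts ?C (int (Suc i)). dif ?C (int (Suc i)) g = \<one>\<^bsub>obj ?C (int (Suc i) + 1)\<^esub> -->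
    g \<in> dif ?C (int (Suc i) - 1) ` elts ?C (int (Suc i) - 1))"
  by (rule trivial_cohomology_iff[OF G G G dh' dh dd'])
 also have "\<dots> \<longleftrightarrow> hom_exact R (\<lambda>i. obj P (- int i)) (\<lambda>i. dif P (- int (Suc i))) N i"
  unfolding o d hom_group_simps restrict_eq_zero_iff e hom_exact_def
 proof (intro iffI ballI impI)
  fix g assume A: "\<forall>g\<in>mod_hom R (obj P (- int (Suc i))) N \<inter> extensional (elts P (- int (Suc i))).
    (\<forall>x\<in>elts P (- int (Suc (Suc i))). g (dif P (- int (Suc (Suc i))) x) = \<zero>\<^bsub>N\<^esub>) -->
    g \<in> (\<lambda>f. \<lambda>x\<in>elts P (- int (Suc i)). f (dif P (- int (Suc i)) x)) `
     (mod_hom R (obj P (- int i)) N \<inter> extensional (elts P (- int i)))"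
   and g: "g \<in> mod_hom R (obj P (- int (Suc i))) N"
   and g0: "\<forall>x\<in>elts P (- int (Suc (Suc i))). g (dif P (- int (Suc (Suc i))) x) = \<zero>\<^bsub>N\<^esub>"
  have "dif P (- int (Suc (Suc i))) x \<in> elts P (- int (Suc i))"
   if "x \<in> elts P (- int (Suc (Suc i)))" for x
   using mod_homD(1)[OF ph[of "int (Suc i)", unfolded e(1)] that] .
  then obtain h where h: "h \<in> mod_hom R (obj P (- int i)) N"
   "(\<lambda>x\<in>elts P (- int (Suc i)). g x) = (\<lambda>x\<in>elts P (- int (Suc i)). h (dif P (- int (Suc i)) x))"
   using A[rule_format, OF restrict_hom[OF p(1) g]] g0 by auto
  show "\<exists>h\<in>mod_hom R (obj P (- int i)) N. \<forall>x\<in>elts P (- int (Suc i)). g x = h (dif P (- int (Suc i)) x)"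
  proof (rule bexI[OF _ h(1)], rule ballI)
   fix x assume "x \<in> elts P (- int (Suc i))"
   then show "g x = h (dif P (- int (Suc i)) x)" using fun_cong[OF h(2), of x] by (simp only: restrict_apply')
  qed
 next
  fix g assume A: "\<forall>g\<in>mod_hom R (obj P (- int (Suc i))) N.
    (\<forall>x\<in>elts P (- int (Suc (Suc i))). g (dif P (- int (Suc (Suc i))) x) = \<zero>\<^bsub>N\<^esub>) -->
    (\<exists>h\<in>mod_hom R (obj P (- int i)) N. \<forall>x\<in>elts P (- int (Suc i)). g x = h (dif P (- int (Suc i)) x))"
   and g: "g \<in> mod_hom R (obj P (- int (Suc i))) N \<inter> extensional (elts P (- int (Suc i)))"
   and g0: "\<forall>x\<in>elts P (- int (Suc (Suc i))). g (dif P (- int (Suc (Suc i))) x) = \<zero>\<^bsub>N\<^esub>"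
  then obtain h where h: "h \<in> mod_hom R (obj P (- int i)) N"
   "\<And>x. x \<in> elts P (- int (Suc i)) ==> g x = h (dif P (- int (Suc i)) x)" by blast
  let ?h = "\<lambda>x\<in>elts P (- int i). h x"
  have "g = (\<lambda>x\<in>elts P (- int (Suc i)). ?h (dif P (- int (Suc i)) x))"
  proof (rule extensionalityI)
   show "g \<in> extensional (elts P (- int (Suc i)))" using g by simp
  qed (use h(2) mod_homD(1)[OF ph'] in auto)
  then show "g \<in> (\<lambda>f. \<lambda>x\<in>elts P (- int (Suc i)). f (dif P (- int (Suc i)) x)) `
     (mod_hom R (obj P (- int i)) N \<inter> extensional (elts P (- int i)))"
   by (rule image_eqI[OF _ restrict_hom[OF p(1) h(1)]])
 qed
 finally show ?thesis .
qed

lemma projective_resolution_nat: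
 assumes P: "projective_resolution R M P \<pi>" and M: "left_module R M"
 shows "nat_resolution R (\<lambda>i. obj P (- int i)) (\<lambda>i. dif P (- int (Suc i))) M \<pi>"
  "projective_module R (obj P i)" "module_complex R P"
proof -
 have X: "module_complex R P" and pr: "\<And>i. projective_module R (obj P i)"
  and \<pi>: "\<pi> \<in> mod_hom R (obj P 0) M" "\<pi> ` elts P 0 = carrier M"
   "{x \<in> elts P 0. \<pi> x = \<zero>\<^bsub>M\<^esub>} = dif P (-1) ` elts P (-1)"
  and ex: "\<And>i. i < 0 ==> trivial_group (mod_cohomology P i)"
  using P by (auto simp: projective_resolution_def)
 note p = module_complexD[OF X]
 show "projective_module R (obj P i)" "module_complex R P" by (fact pr X)+
 have d: "dif P (- int (Suc i)) \<in> mod_hom R (obj P (- int (Suc i))) (obj P (- int i))" for i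
  using p(2)[of "- int (Suc i)"] by simp
 have "dif P (- int (Suc (Suc i))) ` elts P (- int (Suc (Suc i))) =
   {x \<in> elts P (- int (Suc i)). dif P (- int (Suc i)) x = null P (- int i)}" for i
 proof -
  have e: "- int (Suc i) - 1 = - int (Suc (Suc i))" "- int (Suc i) + 1 = - int i" by simp_all
  have "trivial_group (mod_cohomology P (- int (Suc i)))" by (rule ex) simp
  then have "\<forall>x\<in>elts P (- int (Suc i)). dif P (- int (Suc i)) x = null P (- int i) -->
    x \<in> dif P (- int (Suc (Suc i))) ` elts P (- int (Suc (Suc i)))"
   unfolding trivial_mod_cohomology_iff[OF X] e .
  moreover have "dif P (- int (Suc i)) (dif P (- int (Suc (Suc i))) x) = null P (- int i)"
   if "x \<in> elts P (- int (Suc (Suc i)))" for x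
   using p(5)[of x "- int (Suc i)"] that unfolding e by simp
  ultimately show ?thesis using mod_homD(1)[OF d[of "Suc i"]] by blast
 qed
 then show "nat_resolution R (\<lambda>i. obj P (- int i)) (\<lambda>i. dif P (- int (Suc i))) M \<pi>"
  unfolding nat_resolution_def using M p(1) d \<pi> by simp
qed

text \<open>A resolution by free modules of finite rank lives on functions \<open>nat => 'a\<close> with finite support; these are
 encoded as lists of coefficients in order to obtain a resolution on the type prescribed for the chosen one.\<close>

lemma projective_resolution_exists:
 fixes R :: "('a, 'r) ring_scheme" and M :: "('a, 'm, 'x) module_scheme"
 assumes noeth: "left_noetherian R" and M: "left_module R M" and fg: "fin_gen R M"
 shows "\<exists>(P :: (('a, ('a + 'm) list) module, ('a + 'm) list) cochain) \<pi>. projective_resolution R M P \<pi>"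
proof -
 have R: "ring R" using noeth by (simp add: left_noetherian_def)
 note F = left_module_free[OF R]
 obtain n f \<pi> where nf: "free_exact R n f" "nat_resolution R (\<lambda>i. Fr R (n i)) f M \<pi>"
  using free_resolution[OF assms] by blast
 note q = nat_resolutionD[OF nf(2)]
 define e :: "nat => (nat => 'a) => ('a + 'm) list" where "e k v = map (\<lambda>i. Inl (v i)) [0..<k]" for k v
 define d :: "nat => ('a + 'm) list => nat => 'a" where "d k xs = (\<lambda>i. if i < k then projl (xs ! i) else \<zero>\<^bsub>R\<^esub>)" for k xs
 have de: "d k (e k v) = v" if "v \<in> vecs R k" for k v
  using that by (auto simp: d_def e_def fun_eq_iff dsum_carrier)
 define T where "T k = transport (e k) (d k) (Fr R k)" for k
 have t: "left_module R (T k)" "e k \<in> mod_hom R (Fr R k) (T k)" "d k \<in> mod_hom R (T k) (Fr R k)"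
  "carrier (T k) = e k ` vecs R k" "\<zero>\<^bsub>T k\<^esub> = e k \<zero>\<^bsub>Fr R k\<^esub>" for k
  unfolding T_def by (rule transport[OF F], erule de)+
 have Tproj: "projective_module R (T k)" for k
  by (rule projective_of_free_iso[OF t(1) t(3) t(2)]) (auto simp: t(4) de)
 have T0: "carrier (T 0) = {\<zero>\<^bsub>T 0\<^esub>}"
  by (auto simp: t(4,5) e_def lm(2)[OF F] intro!: image_eqI[of _ _ "\<zero>\<^bsub>Fr R 0\<^esub>"] simp del: dsum_simps)
 define P where "P = \<lparr>obj = (\<lambda>i::int. if i \<le> 0 then T (n (nat (- i))) else T 0),
  dif = (\<lambda>i::int. if i < 0 then (\<lambda>x. e (n (nat (- i - 1))) (f (nat (- i - 1)) (d (n (nat (- i))) x))) else (\<lambda>x. e 0 (\<lambda>s. \<zero>\<^bsub>R\<^esub>)))\<rparr>"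
 have o: "obj P i = (if i \<le> 0 then T (n (nat (- i))) else T 0)" for i by (simp add: P_def)
 have df: "dif P i = (if i < 0 then (\<lambda>x. e (n (nat (- i - 1))) (f (nat (- i - 1)) (d (n (nat (- i))) x))) else (\<lambda>x. e 0 (\<lambda>s. \<zero>\<^bsub>R\<^esub>)))" for i
  by (simp add: P_def)
 have neg: "\<exists>j. i = - int (Suc j)" if "i < 0" for i :: int
  using that by (intro exI[of _ "nat (- i - 1)"]) simp
 have on: "obj P (- int j) = T (n j)" for j by (simp add: o)
 have dn: "dif P (- int (Suc j)) = (\<lambda>x. e (n j) (f j (d (n (Suc j)) x)))" for j
  by (simp add: df nat_add_distrib add.commute[of 1])
 have dnh: "dif P (- int (Suc j)) \<in> mod_hom R (T (n (Suc j))) (T (n j))" for j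
  unfolding dn by (rule hom_comp[OF hom_comp[OF t(3) q(3)] t(2)])
 have z0: "e 0 v = \<zero>\<^bsub>T 0\<^esub>" for v by (simp add: t(5) e_def)
 have X: "module_complex R P"
  unfolding module_complex_def
 proof (intro allI conjI ballI)
  fix i :: int
  show "left_module R (obj P i)" by (simp add: o t)
  show "dif P i \<in> mod_hom R (obj P i) (obj P (i + 1))"
  proof (cases "i < 0")
   case True
   then obtain j where j: "i = - int (Suc j)" using neg by blast
   have "i + 1 = - int j" using j by simp
   then show ?thesis using dnh[of j] unfolding j by (simp only: on)
  next
   case False
   then show ?thesis by (simp add: o df z0 hom_zero[OF t(1)])
  qed
  fix x assume x: "x \<in> elts P i"
  show "dif P (i + 1) (dif P i x) = null P (i + 1 + 1)"
  proof (cases "i + 1 < 0")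
   case True
   then obtain j where j: "i + 1 = - int (Suc j)" using neg by blast
   then have i: "i = - int (Suc (Suc j))" "i + 1 + 1 = - int j" by simp_all
   have "d (n (Suc (Suc j))) x \<in> vecs R (n (Suc (Suc j)))"
    using x mod_homD(1)[OF t(3)] unfolding i by (simp only: on)
   then show ?thesis
    unfolding i(2) unfolding j dn on unfolding i(1) dn
    using mod_homD(1)[OF q(3)] q(7) hom_simps(4)[OF t(2) F t(1)] by (simp add: de)
  next
   case False
   then show ?thesis by (simp add: o df z0)
  qed
 qed
 have ker: "x \<in> e (n (Suc j)) ` S" if "x \<in> carrier (T (n (Suc j)))" "d (n (Suc j)) x \<in> S" for x j S
  using that by (auto simp: t(4) de)
 have "projective_resolution R M P (\<lambda>x. \<pi> (d (n 0) x))"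
  unfolding projective_resolution_def
 proof (intro conjI allI impI X)
  show "projective_module R (obj P i)" for i by (simp add: o Tproj)
  show "elts P i = {null P i}" if "i > 0" for i using that T0 by (simp add: o)
  have o0: "obj P 0 = T (n 0)" "obj P (- 1) = T (n (Suc 0))" "dif P (- 1) = (\<lambda>x. e (n 0) (f 0 (d (n (Suc 0)) x)))"
   using on[of 0] on[of 1] dn[of 0] by simp_all
  show "(\<lambda>x. \<pi> (d (n 0) x)) \<in> mod_hom R (obj P 0) M" unfolding o0 by (rule hom_comp[OF t(3) q(4)])
  show "(\<lambda>x. \<pi> (d (n 0) x)) ` elts P 0 = carrier M"
   unfolding o0 t(4) q(5)[symmetric] by (simp add: image_image de cong: image_cong_simp)
  show "{x \<in> elts P 0. \<pi> (d (n 0) x) = \<zero>\<^bsub>M\<^esub>} = dif P (- 1) ` elts P (- 1)"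
  proof (intro equalityI subsetI)
   fix x assume "x \<in> {x \<in> elts P 0. \<pi> (d (n 0) x) = \<zero>\<^bsub>M\<^esub>}"
   then obtain v where v: "v \<in> vecs R (n 0)" "x = e (n 0) v" "\<pi> v = \<zero>\<^bsub>M\<^esub>"
    unfolding o0 t(4) by (auto simp: de)
   then obtain w where "w \<in> vecs R (n (Suc 0))" "v = f 0 w" using q(8) by blast
   then show "x \<in> dif P (- 1) ` elts P (- 1)" unfolding o0 t(4) using v by (auto simp: de image_iff)
  next
   fix x assume "x \<in> dif P (- 1) ` elts P (- 1)"
   then obtain w where "w \<in> vecs R (n (Suc 0))" "x = e (n 0) (f 0 w)"
    unfolding o0 t(4) by (auto simp: de)
   then show "x \<in> {x \<in> elts P 0. \<pi> (d (n 0) x) = \<zero>\<^bsub>M\<^esub>}"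
    unfolding o0 t(4) using mod_homD(1)[OF q(3)] by (simp add: de q(6))
  qed
  fix i :: int assume "i < 0"
  then obtain j where j: "i = - int (Suc j)" using neg by blast
  have e': "i + 1 = - int j" "i - 1 = - int (Suc (Suc j))" using j by simp_all
  show "trivial_group (mod_cohomology P i)"
   unfolding trivial_mod_cohomology_iff[OF X] e' unfolding j on dn
  proof (intro ballI impI)
   fix x assume x: "x \<in> carrier (T (n (Suc j)))" and "e (n j) (f j (d (n (Suc j)) x)) = \<zero>\<^bsub>T (n j)\<^esub>"
   then obtain v where v: "v \<in> vecs R (n (Suc j))" "x = e (n (Suc j)) v"
    and *: "e (n j) (f j v) = e (n j) \<zero>\<^bsub>Fr R (n j)\<^esub>"
    by (auto simp: t(4,5) de simp del: dsum_simps)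
   have "f j v = \<zero>\<^bsub>Fr R (n j)\<^esub>"
    using arg_cong[OF *, of "d (n j)"] unfolding de[OF mod_homD(1)[OF q(3) v(1)]] de[OF lm(2)[OF F]] .
   then obtain w where "w \<in> vecs R (n (Suc (Suc j)))" "v = f (Suc j) w" using q(9)[OF v(1)] by blast
   then show "x \<in> (\<lambda>x. e (n (Suc j)) (f (Suc j) (d (n (Suc (Suc j))) x))) ` carrier (T (n (Suc (Suc j))))"
    unfolding t(4) using v by (auto simp: de image_iff)
  qed
 qed
 then show ?thesis by blast
qed

text \<open>\<open>Ext\<close> can be computed with any resolution by free modules of finite rank instead of the chosen resolution.\<close>

lemma trivial_Ext_iff:
 assumes noeth: "left_noetherian R" and M: "left_module R M" and fg: "fin_gen R M" and N: "left_module R N"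
  and nf: "nat_resolution R (\<lambda>i. Fr R (n i)) f M \<pi>"
 shows "trivial_group (Ext R (Suc i) M N) \<longleftrightarrow> free_hom_exact R n f N i"
proof -
 have R: "ring R" using noeth by (simp add: left_noetherian_def)
 obtain \<rho> where "projective_resolution R M (chosen_resolution R M) \<rho>"
  using someI_ex[OF projective_resolution_exists[OF noeth M fg]] unfolding chosen_resolution_def by blast
 note c = projective_resolution_nat[OF this M]
 show ?thesis
  unfolding Ext_def trivial_hom_cohomology_iff[OF c(3) N]
  by (rule iffI)
   (erule hom_exact_transfer[OF c(1,2) nf projective_free[OF R] N],
    erule hom_exact_transfer[OF nf projective_free[OF R] c(1,2) N])
qed

section \<open>Homomorphisms into coresolutions\<close>

lemma coresolutionD:
 assumes "coresolution R B E \<epsilon>"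
 shows "module_complex R E" "\<epsilon> \<in> mod_hom R B (obj E 0)" "inj_on \<epsilon> (carrier B)"
  "x \<in> elts E 0 ==> dif E 0 x = null E 1 ==> x \<in> \<epsilon> ` carrier B"
  "b \<in> carrier B ==> dif E 0 (\<epsilon> b) = null E 1"
  "i \<ge> 0 ==> y \<in> elts E (i + 1) ==> dif E (i + 1) y = null E (i + 2) ==>
   y \<in> dif E i ` elts E i"
  "i < 0 ==> elts E i = {null E i}"
proof -
 have *: "module_complex R E" "\<epsilon> \<in> mod_hom R B (obj E 0)" "inj_on \<epsilon> (carrier B)"
  "\<epsilon> ` carrier B = {x \<in> elts E 0. dif E 0 x = null E 1}"
  "\<And>i. i < 0 ==> elts E i = {null E i}" "\<And>i. i > 0 ==> trivial_group (mod_cohomology E i)"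
  using assms unfolding coresolution_def by blast+
 show "module_complex R E" "\<epsilon> \<in> mod_hom R B (obj E 0)" "inj_on \<epsilon> (carrier B)" by fact+
 show "x \<in> elts E 0 ==> dif E 0 x = null E 1 ==> x \<in> \<epsilon> ` carrier B"
  "b \<in> carrier B ==> dif E 0 (\<epsilon> b) = null E 1"
  using *(4) by blast+
 show "i < 0 ==> elts E i = {null E i}" by (rule *(5))
 assume i: "i \<ge> 0" and y: "y \<in> elts E (i + 1)" "dif E (i + 1) y = null E (i + 2)"
 have e: "i + 1 + 1 = i + 2" "i + 1 - 1 = i" by simp_all
 have "trivial_group (mod_cohomology E (i + 1))" using i by (intro *(6)) simp
 then show "y \<in> dif E i ` elts E i"
  using y unfolding trivial_mod_cohomology_iff[OF *(1)] e by blast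
qed

lemma cocycle_lift:
 assumes X: "module_complex R X" and P: "projective_module R P"
  and ex: "\<And>x. x \<in> elts X (i + 1) ==> dif X (i + 1) x = null X (i + 2) ==> x \<in> dif X i ` elts X i"
  and u: "u \<in> mod_hom R P (obj X (i + 1))" "\<And>x. x \<in> carrier P ==> dif X (i + 1) (u x) = null X (i + 2)"
 shows "\<exists>g\<in>mod_hom R P (obj X i). \<forall>x\<in>carrier P. dif X i (g x) = u x"
 by (rule proj_lift[OF P module_complexD(1)[OF X] module_complexD(1)[OF X] module_complexD(2)[OF X] u(1)])
  (rule ex, use u mod_homD(1)[OF u(1)] in auto)

lemma free_exactD:
 assumes "free_exact R n f"
 shows "f i \<in> mod_hom R (Fr R (n (Suc i))) (Fr R (n i))"
  "x \<in> vecs R (n (Suc (Suc i))) ==> f i (f (Suc i) x) = (\<lambda>s. \<zero>\<^bsub>R\<^esub>)"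
  "x \<in> vecs R (n (Suc i)) ==> f i x = (\<lambda>s. \<zero>\<^bsub>R\<^esub>) ==> x \<in> f (Suc i) ` vecs R (n (Suc (Suc i)))"
proof -
 show "f i \<in> mod_hom R (Fr R (n (Suc i))) (Fr R (n i))" using assms by (simp add: free_exact_def)
 have *: "exact_at R n f i" using assms by (simp add: free_exact_def)
 show "x \<in> vecs R (n (Suc (Suc i))) ==> f i (f (Suc i) x) = (\<lambda>s. \<zero>\<^bsub>R\<^esub>)"
  "x \<in> vecs R (n (Suc i)) ==> f i x = (\<lambda>s. \<zero>\<^bsub>R\<^esub>) ==> x \<in> f (Suc i) ` vecs R (n (Suc (Suc i)))"
  using * by blast+
qed

lemma hom_exactD:
 assumes "hom_exact R P f N i" "g \<in> mod_hom R (P (Suc i)) N"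
  "\<And>x. x \<in> carrier (P (Suc (Suc i))) ==> g (f (Suc i) x) = \<zero>\<^bsub>N\<^esub>"
 shows "\<exists>h\<in>mod_hom R (P i) N. \<forall>x\<in>carrier (P (Suc i)). g x = h (f i x)"
 using assms unfolding hom_exact_def by blast

lemma id_surj: "(\<lambda>x. x) ` S = S" by simp

lemma hom_exact_injective:
 assumes J: "injective_module R J" and fe: "free_exact R n f"
 shows "free_hom_exact R n f J i"
 unfolding hom_exact_def
proof (intro ballI impI)
 have R: "ring R" and Jm: "left_module R J" using injective_moduleD[OF J] left_moduleD by auto
 note F = left_module_free[OF R] and fd = free_exactD[OF fe]
 fix g assume g: "g \<in> mod_hom R (Fr R (n (Suc i))) J"
  and g0: "\<forall>x\<in>vecs R (n (Suc (Suc i))). g (f (Suc i) x) = \<zero>\<^bsub>J\<^esub>"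
 show "\<exists>h\<in>mod_hom R (Fr R (n i)) J. \<forall>x\<in>vecs R (n (Suc i)). g x = h (f i x)"
 proof (rule injective_factor[OF J F F hom_id id_surj fd(1) g])
  fix u assume "u \<in> vecs R (n (Suc i))" "f i u = \<zero>\<^bsub>Fr R (n i)\<^esub>"
  then obtain w where "w \<in> vecs R (n (Suc (Suc i)))" "u = f (Suc i) w" using fd(3)[of u i] by auto
  then show "g u = \<zero>\<^bsub>J\<^esub>" using g0 by simp
 qed
qed

text \<open>\<open>Ext\<close> into \<open>B\<close> can be computed with a coresolution \<open>J\<close> of \<open>B\<close> whose components behave like injective
 modules: a cocycle with values in \<open>B\<close> is pushed along \<open>J\<close> until it is defined on \<open>P 0\<close>, and the
 correction found there is carried back.\<close>

lemma hom_exact_of_coresolution: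
 assumes P: "\<And>i. projective_module R (P i)" and fh: "\<And>i. f i \<in> mod_hom R (P (Suc i)) (P i)"
  and ff: "\<And>i x. x \<in> carrier (P (Suc (Suc i))) ==> f i (f (Suc i) x) = \<zero>\<^bsub>P i\<^esub>"
  and B: "left_module R B" and cor: "coresolution R B J \<epsilon>"
  and exJ: "\<And>m i. hom_exact R P f (obj J m) i"
  and ex0: "\<And>p v. p0 \<le> p ==> v \<in> mod_hom R (P 0) (obj J (int p + 1)) ==>
   (\<And>x. x \<in> carrier (P 0) ==> dif J (int p + 1) (v x) = null J (int p + 2)) ==>
   (\<And>x. x \<in> carrier (P (Suc 0)) ==> v (f 0 x) = null J (int p + 1)) ==>
   \<exists>w\<in>mod_hom R (P 0) (obj J (int p)). (\<forall>x\<in>carrier (P (Suc 0)). w (f 0 x) = null J (int p)) \<and>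
    (\<forall>x\<in>carrier (P 0). dif J (int p) (w x) = v x)"
  and i: "p0 \<le> i"
 shows "hom_exact R P f B i"
proof -
 note Pm = projective_moduleD[OF P] and c = coresolutionD[OF cor]
 note X = module_complexD(1)[OF c(1)] and dX = module_complexD(2)[OF c(1)]
 note ds = hom_simps[OF dX X X] and es = hom_simps[OF c(2) B X] and fs = hom_simps[OF fh Pm Pm]
 have claim: "p0 \<le> p + j ==> u \<in> mod_hom R (P j) (obj J (int p)) ==>
  (\<And>x. x \<in> carrier (P (Suc j)) ==> dif J (int p) (u (f j x)) = null J (int p + 1)) ==>
  \<exists>u'\<in>mod_hom R (P j) (obj J (int p)). (\<forall>x\<in>carrier (P j). dif J (int p) (u' x) = null J (int p + 1)) \<and>
   (\<forall>x\<in>carrier (P (Suc j)). u' (f j x) = u (f j x))" for p j u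
 proof (induction j arbitrary: p u)
  case (0 p u)
  note us = hom_simps[OF 0(2) Pm X]
  have "\<exists>w\<in>mod_hom R (P 0) (obj J (int p)). (\<forall>x\<in>carrier (P (Suc 0)). w (f 0 x) = null J (int p)) \<and>
    (\<forall>x\<in>carrier (P 0). dif J (int p) (w x) = dif J (int p) (u x))"
   by (rule ex0[OF _ hom_comp[OF 0(2) dX] module_complexD(4)[OF c(1) us(1)] 0(3)]) (use 0(1) in simp_all)
  then obtain w where w: "w \<in> mod_hom R (P 0) (obj J (int p))" "\<And>x. x \<in> carrier (P (Suc 0)) ==> w (f 0 x) = null J (int p)"
   "\<And>x. x \<in> carrier (P 0) ==> dif J (int p) (w x) = dif J (int p) (u x)" by blast
  show ?case
   by (intro bexI[OF _ hom_diff[OF 0(2) w(1) X]] conjI ballI)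
    (simp_all add: ds us fs mod_homD(1)[OF w(1)] w(2,3) lm[OF X])
 next
  case (Suc j p u)
  note us = hom_simps[OF Suc.prems(2) Pm X]
  have "\<exists>u2\<in>mod_hom R (P j) (obj J (int p + 1)). \<forall>x\<in>carrier (P (Suc j)). dif J (int p) (u x) = u2 (f j x)"
   by (rule hom_exactD[OF exJ hom_comp[OF Suc.prems(2) dX] Suc.prems(3)])
  then obtain u2 where u2: "u2 \<in> mod_hom R (P j) (obj J (int p + 1))" "\<And>x. x \<in> carrier (P (Suc j)) ==> dif J (int p) (u x) = u2 (f j x)" by blast
  have e: "int (Suc p) = int p + 1" "int p + 1 + 1 = int p + 2" by simp_all
  have "\<exists>u'\<in>mod_hom R (P j) (obj J (int (Suc p))). (\<forall>x\<in>carrier (P j). dif J (int (Suc p)) (u' x) = null J (int (Suc p) + 1)) \<and>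
   (\<forall>x\<in>carrier (P (Suc j)). u' (f j x) = u2 (f j x))"
  proof (rule Suc.IH)
   show "p0 \<le> Suc p + j" using Suc.prems(1) by simp
   show "u2 \<in> mod_hom R (P j) (obj J (int (Suc p)))" unfolding e by (rule u2(1))
   show "dif J (int (Suc p)) (u2 (f j x)) = null J (int (Suc p) + 1)" if "x \<in> carrier (P (Suc j))" for x
    unfolding e u2(2)[OF that, symmetric] by (rule module_complexD(4)[OF c(1) us(1)[OF that]])
  qed
  then obtain u' where u': "u' \<in> mod_hom R (P j) (obj J (int p + 1))"
   "\<And>x. x \<in> carrier (P j) ==> dif J (int p + 1) (u' x) = null J (int p + 2)"
   "\<And>x. x \<in> carrier (P (Suc j)) ==> u' (f j x) = u2 (f j x)" unfolding e by blast
  have "\<exists>s\<in>mod_hom R (P j) (obj J (int p)). \<forall>x\<in>carrier (P j). dif J (int p) (s x) = u' x"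
   by (rule cocycle_lift[OF c(1) P c(6) u'(1,2)]) simp_all
  then obtain s where s: "s \<in> mod_hom R (P j) (obj J (int p))" "\<And>x. x \<in> carrier (P j) ==> dif J (int p) (s x) = u' x" by blast
  note ss = hom_simps[OF s(1) Pm X]
  show ?case
  proof (intro bexI[OF _ hom_diff[OF Suc.prems(2) hom_comp[OF fh s(1)] X]] conjI ballI)
   fix x assume x: "x \<in> carrier (P (Suc j))"
   then show "dif J (int p) (u x \<oplus>\<^bsub>obj J (int p)\<^esub> \<ominus>\<^bsub>obj J (int p)\<^esub> s (f j x)) = null J (int p + 1)"
    using us(1)[OF x] ss(1)[OF fs(1)[OF x]] mod_homD(1)[OF u2(1) fs(1)[OF x]]
    by (simp add: ds lm[OF X] u2(2) s(2) u'(3) fs)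
  next
   fix x assume x: "x \<in> carrier (P (Suc (Suc j)))"
   then show "u (f (Suc j) x) \<oplus>\<^bsub>obj J (int p)\<^esub> \<ominus>\<^bsub>obj J (int p)\<^esub> s (f j (f (Suc j) x)) = u (f (Suc j) x)"
    by (simp add: ff ss us fs lm[OF X])
  qed
 qed
 show ?thesis
  unfolding hom_exact_def
 proof (intro ballI impI)
  fix g assume g: "g \<in> mod_hom R (P (Suc i)) B" and g0: "\<forall>x\<in>carrier (P (Suc (Suc i))). g (f (Suc i) x) = \<zero>\<^bsub>B\<^esub>"
  note gs = hom_simps[OF g Pm B]
  have "\<exists>u\<in>mod_hom R (P i) (obj J 0). \<forall>x\<in>carrier (P (Suc i)). \<epsilon> (g x) = u (f i x)"
   by (rule hom_exactD[OF exJ hom_comp[OF g c(2)]]) (simp add: g0 es(4))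
  then obtain u where u: "u \<in> mod_hom R (P i) (obj J 0)" "\<And>x. x \<in> carrier (P (Suc i)) ==> \<epsilon> (g x) = u (f i x)" by blast
  have "dif J (int 0) (u (f i x)) = null J (int 0 + 1)" if "x \<in> carrier (P (Suc i))" for x
   using c(5)[OF gs(1)[OF that]] unfolding u(2)[OF that] by simp
  from claim[of 0 i u, OF _ _ this] obtain u' where u': "u' \<in> mod_hom R (P i) (obj J 0)"
   "\<And>x. x \<in> carrier (P i) ==> dif J 0 (u' x) = null J 1" "\<And>x. x \<in> carrier (P (Suc i)) ==> u' (f i x) = u (f i x)"
   using i u(1) by auto
  have "\<exists>h\<in>mod_hom R (P i) B. \<forall>x\<in>carrier (P i). \<epsilon> (h x) = u' x"
   by (rule proj_lift[OF P B X c(2) u'(1)]) (rule c(4)[OF mod_homD(1)[OF u'(1)] u'(2)])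
  then obtain h where h: "h \<in> mod_hom R (P i) B" "\<And>x. x \<in> carrier (P i) ==> \<epsilon> (h x) = u' x" by blast
  show "\<exists>h\<in>mod_hom R (P i) B. \<forall>x\<in>carrier (P (Suc i)). g x = h (f i x)"
  proof (intro bexI[OF _ h(1)] ballI)
   fix x assume x: "x \<in> carrier (P (Suc i))"
   have "\<epsilon> (g x) = \<epsilon> (h (f i x))" using h(2)[OF fs(1)[OF x]] u(2)[OF x] u'(3)[OF x] by simp
   then show "g x = h (f i x)" by (rule inj_onD[OF c(3)]) (use x in \<open>simp_all add: gs(1) mod_homD(1)[OF h(1)] fs(1)\<close>)
  qed
 qed
qed

text \<open>Finite injective dimension, in the only form in which it is used later.\<close>

lemma hom_exact_of_finite_coresolution:
 assumes B: "left_module R B" and cor: "coresolution R B E \<epsilon>" and inj: "\<And>i. injective_module R (obj E i)"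
  and top: "\<And>i. i > int d ==> elts E i = {null E i}"
  and fe: "free_exact R n f" and di: "d \<le> i"
 shows "free_hom_exact R n f B i"
proof (rule hom_exact_of_coresolution[OF projective_free free_exactD(1)[OF fe] _ B cor hom_exact_injective[OF inj fe] _ di])
 note X = module_complexD(1)[OF coresolutionD(1)[OF cor]] and dX = module_complexD(2)[OF coresolutionD(1)[OF cor]]
 show R: "ring R" using left_moduleD[OF B] by simp
 show "f i (f (Suc i) x) = \<zero>\<^bsub>Fr R (n i)\<^esub>" if "x \<in> vecs R (n (Suc (Suc i)))" for i x
  using free_exactD(2)[OF fe that] by simp
 fix p v assume p: "d \<le> p" and v: "v \<in> mod_hom R (Fr R (n 0)) (obj E (int p + 1))"
 have "v x = null E (int p + 1)" if "x \<in> vecs R (n 0)" for x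
  using mod_homD(1)[OF v that] top[of "int p + 1"] p by simp
 then show "\<exists>w\<in>mod_hom R (Fr R (n 0)) (obj E (int p)). (\<forall>x\<in>vecs R (n (Suc 0)). w (f 0 x) = null E (int p)) \<and>
   (\<forall>x\<in>vecs R (n 0). dif E (int p) (w x) = v x)"
  by (intro bexI[OF _ hom_zero[OF X]]) (simp add: hom_simps(4)[OF dX X X])
qed

text \<open>Conversely, exactness of \<open>Hom(F, B)\<close> in high degrees, for all free resolutions \<open>F\<close>, bounds the
 cohomology of \<open>Hom(C, I)\<close> for every coresolution \<open>I\<close> of \<open>B\<close> by injectives.\<close>

locale fin_inj_coresolution =
 fixes R :: "('a, 'r) ring_scheme" and B :: "('a, 'b, 'x) module_scheme"
  and I :: "(('a, 'i, 'y) module_scheme, 'i) cochain" and \<epsilon> :: "'b => 'i" and d :: nat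
 assumes noeth: "left_noetherian R" and B: "left_module R B" and cor: "coresolution R B I \<epsilon>"
  and inj: "\<And>i. injective_module R (obj I i)"
  and bound: "\<And>n f i. free_exact R n f ==> d \<le> i ==> free_hom_exact R n f B i"
begin

lemma R: "ring R" using left_moduleD[OF B] by simp
lemmas F = left_module_free[OF R]
lemmas c = coresolutionD[OF cor]
lemmas X = module_complexD(1)[OF c(1)] and dX = module_complexD(2)[OF c(1)]
lemmas ds = hom_simps[OF dX X X] and es = hom_simps[OF c(2) B X]

text \<open>A cocycle \<open>v\<close> of degree \<open>q + 1\<close> on the \<open>j\<close>-th syzygy is lifted through \<open>dif I q\<close>; the obstruction against
 choosing the lift on the syzygy itself is a cocycle of degree \<open>q\<close> on the next syzygy.  After \<open>q\<close> steps it
 is a class in \<open>Ext\<close> with values in \<open>B\<close>, of degree larger than \<open>d\<close>.\<close>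

lemma cocycle_on_syzygy:
 assumes fe: "free_exact R n f"
 shows "d \<le> q + j ==> v \<in> mod_hom R (Fr R (n j)) (obj I (int q + 1)) ==>
  (\<And>x. x \<in> vecs R (n j) ==> dif I (int q + 1) (v x) = null I (int q + 2)) ==>
  (\<And>x. x \<in> vecs R (n (Suc j)) ==> v (f j x) = null I (int q + 1)) ==>
  \<exists>w\<in>mod_hom R (Fr R (n j)) (obj I (int q)).
   (\<forall>x\<in>vecs R (n (Suc j)). w (f j x) = null I (int q)) \<and>
   (\<forall>x\<in>vecs R (n j). dif I (int q) (w x) = v x)"
proof (induction q arbitrary: j v)
 note fd = free_exactD[OF fe] note fs = hom_simps[OF fd(1) F F]
 case (0 j v)
 let ?P = "\<lambda>i. Fr R (n i)"
 have v: "v \<in> mod_hom R (?P j) (obj I (0 + 1))"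
  "\<And>x. x \<in> carrier (?P j) ==> dif I (0 + 1) (v x) = null I (0 + 2)"
  "\<And>x. x \<in> carrier (?P (Suc j)) ==> v (f j x) = null I 1"
  using 0 by simp_all
 have "\<exists>w\<in>mod_hom R (?P j) (obj I 0). \<forall>x\<in>carrier (?P j). dif I 0 (w x) = v x"
  by (rule cocycle_lift[OF c(1) projective_free[OF R] c(6)[OF order_refl] v(1,2)])
 then obtain w0 where w0: "w0 \<in> mod_hom R (?P j) (obj I 0)" "\<And>x. x \<in> carrier (?P j) ==> dif I 0 (w0 x) = v x" by blast
 note ws = hom_simps[OF w0(1) F X]
 have "\<exists>t\<in>mod_hom R (?P (Suc j)) B. \<forall>x\<in>carrier (?P (Suc j)). \<epsilon> (t x) = w0 (f j x)"
  by (rule proj_lift[OF projective_free[OF R] B X c(2) hom_comp[OF fd(1) w0(1)]])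
   (rule c(4), simp_all add: ws fs w0(2) v(3))
 then obtain t where t: "t \<in> mod_hom R (?P (Suc j)) B" "\<And>x. x \<in> carrier (?P (Suc j)) ==> \<epsilon> (t x) = w0 (f j x)" by blast
 have t0: "t (f (Suc j) x) = \<zero>\<^bsub>B\<^esub>" if x: "x \<in> carrier (?P (Suc (Suc j)))" for x
 proof (rule inj_onD[OF c(3)])
  show "\<epsilon> (t (f (Suc j) x)) = \<epsilon> \<zero>\<^bsub>B\<^esub>" using t(2)[OF fs(1)[OF x]] fd(2)[OF x] ws(4) es(4) by simp
 qed (simp_all add: mod_homD(1)[OF t(1)] fs x lm[OF B])
 have "\<exists>u\<in>mod_hom R (?P j) B. \<forall>x\<in>carrier (?P (Suc j)). t x = u (f j x)"
  by (rule hom_exactD[OF bound[OF fe], OF _ t(1) t0]) (use 0 in simp_all)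
 then obtain u where u: "u \<in> mod_hom R (?P j) B" "\<And>x. x \<in> carrier (?P (Suc j)) ==> t x = u (f j x)" by blast
 note us = hom_simps[OF u(1) F B]
 have w: "(\<lambda>x. w0 x \<oplus>\<^bsub>obj I 0\<^esub> \<ominus>\<^bsub>obj I 0\<^esub> \<epsilon> (u x)) \<in> mod_hom R (?P j) (obj I 0)"
  by (rule hom_diff[OF w0(1) hom_comp[OF u(1) c(2)] X])
 have "w0 (f j x) \<oplus>\<^bsub>obj I 0\<^esub> \<ominus>\<^bsub>obj I 0\<^esub> \<epsilon> (u (f j x)) = null I 0" if "x \<in> carrier (?P (Suc j))" for x
  using that t(2)[OF that] u(2)[OF that] by (simp add: lm[OF X] ws fs)
 moreover have "dif I 0 (w0 x \<oplus>\<^bsub>obj I 0\<^esub> \<ominus>\<^bsub>obj I 0\<^esub> \<epsilon> (u x)) = v x" if "x \<in> carrier (?P j)" for x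
  using that ds[where i = 0] ws(1)[OF that] mod_homD(1)[OF v(1)] by (simp add: w0(2) c(5) us es lm[OF X])
 ultimately show ?case by (simp only: of_nat_0) (intro bexI[OF _ w] conjI ballI)
next
 note fd = free_exactD[OF fe] note fs = hom_simps[OF fd(1) F F]
 case (Suc q j v)
 let ?P = "\<lambda>i. Fr R (n i)"
 define p where "p = int (Suc q)"
 have e: "int (Suc q) = p" "int q + 1 = p" "int q + 2 = p + 1" by (simp_all add: p_def)
 note v = Suc.prems(2-4)[unfolded e]
 have "\<exists>w\<in>mod_hom R (?P j) (obj I p). \<forall>x\<in>carrier (?P j). dif I p (w x) = v x"
  by (rule cocycle_lift[OF c(1) projective_free[OF R] c(6) v(1,2)]) (simp_all add: p_def)
 then obtain w0 where w0: "w0 \<in> mod_hom R (?P j) (obj I p)" "\<And>x. x \<in> carrier (?P j) ==> dif I p (w0 x) = v x" by blast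
 note ws = hom_simps[OF w0(1) F X]
 have "\<exists>w\<in>mod_hom R (?P (Suc j)) (obj I (int q)).
   (\<forall>x\<in>carrier (?P (Suc (Suc j))). w (f (Suc j) x) = null I (int q)) \<and>
   (\<forall>x\<in>carrier (?P (Suc j)). dif I (int q) (w x) = w0 (f j x))"
 proof (rule Suc.IH, unfold e)
  show "(\<lambda>x. w0 (f j x)) \<in> mod_hom R (?P (Suc j)) (obj I p)" by (rule hom_comp[OF fd(1) w0(1)])
  show "dif I p (w0 (f j x)) = null I (p + 1)" if "x \<in> carrier (?P (Suc j))" for x
   using that by (simp add: w0(2) fs v(3))
  show "w0 (f j (f (Suc j) x)) = null I p" if "x \<in> carrier (?P (Suc (Suc j)))" for x
   using fd(2)[OF that] ws(4) by simp
 qed (use Suc.prems in simp)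
 then obtain w1 where w1: "w1 \<in> mod_hom R (?P (Suc j)) (obj I (int q))"
  "\<And>x. x \<in> carrier (?P (Suc (Suc j))) ==> w1 (f (Suc j) x) = null I (int q)"
  "\<And>x. x \<in> carrier (?P (Suc j)) ==> dif I (int q) (w1 x) = w0 (f j x)" by blast
 have "\<exists>u\<in>mod_hom R (?P j) (obj I (int q)). \<forall>x\<in>carrier (?P (Suc j)). w1 x = u (f j x)"
  by (rule hom_exactD[OF hom_exact_injective[OF inj fe], OF w1(1,2)])
 then obtain u where u: "u \<in> mod_hom R (?P j) (obj I (int q))" "\<And>x. x \<in> carrier (?P (Suc j)) ==> w1 x = u (f j x)" by blast
 have dq: "dif I (int q) \<in> mod_hom R (obj I (int q)) (obj I p)" using dX[of "int q"] unfolding e .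
 have dd: "dif I p (dif I (int q) x) = null I (p + 1)" if "x \<in> elts I (int q)" for x
  using module_complexD(4)[OF c(1) that] unfolding e .
 have w: "(\<lambda>x. w0 x \<oplus>\<^bsub>obj I p\<^esub> \<ominus>\<^bsub>obj I p\<^esub> dif I (int q) (u x)) \<in> mod_hom R (?P j) (obj I p)"
  by (rule hom_diff[OF w0(1) hom_comp[OF u(1) dq] X])
 have "w0 (f j x) \<oplus>\<^bsub>obj I p\<^esub> \<ominus>\<^bsub>obj I p\<^esub> dif I (int q) (u (f j x)) = null I p" if "x \<in> carrier (?P (Suc j))" for x
  using w1(3)[OF that] u(2)[OF that] ws(1)[OF fs(1)[OF that]] by (simp add: lm[OF X])
 moreover have "dif I p (w0 x \<oplus>\<^bsub>obj I p\<^esub> \<ominus>\<^bsub>obj I p\<^esub> dif I (int q) (u x)) = v x" if x: "x \<in> carrier (?P j)" for x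
  using ws(1)[OF x] mod_homD(1)[OF u(1) x] mod_homD(1)[OF dq] mod_homD(1)[OF v(1) x]
  by (simp add: ds lm[OF X] dd w0(2)[OF x])
 ultimately show ?case unfolding e by (intro bexI[OF _ w] conjI ballI)
qed

text \<open>For \<open>p \<ge> d\<close> the \<open>p\<close>-th cocycles of \<open>I\<close> have the extension property of an injective module.\<close>

lemma cocycle_extension:
 assumes U: "left_module R U" and Y: "left_module R Y"
  and \<pi>: "\<pi> \<in> mod_hom R (Fr R m) Y" "\<pi> ` vecs R m = carrier Y"
  and a: "a \<in> mod_hom R U Y" and g: "g \<in> mod_hom R U (obj I (int p))"
  and ker: "\<And>u. u \<in> carrier U ==> a u = \<zero>\<^bsub>Y\<^esub> ==> g u = null I (int p)"
  and dg: "\<And>u. u \<in> carrier U ==> dif I (int p) (g u) = null I (int p + 1)" and dp: "d \<le> p"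
 shows "\<exists>h\<in>mod_hom R Y (obj I (int p)). (\<forall>u\<in>carrier U. g u = h (a u)) \<and>
  (\<forall>y\<in>carrier Y. dif I (int p) (h y) = null I (int p + 1))"
proof -
 have "\<exists>h\<in>mod_hom R Y (obj I (int p)). \<forall>u\<in>carrier U. g u = h (a u)"
  by (rule injective_factor[OF inj U Y \<pi> a g ker])
 then obtain h0 where h0: "h0 \<in> mod_hom R Y (obj I (int p))" "\<And>u. u \<in> carrier U ==> g u = h0 (a u)" by blast
 note hs = hom_simps[OF h0(1) Y X] and ps = hom_simps[OF \<pi>(1) F Y]
 have "submodule {v \<in> vecs R m. \<pi> v \<in> a ` carrier U} R (Fr R m)"
  by (rule submodule_preimage[OF F Y \<pi>(1) submodule_image[OF U Y a]])
 from free_resolution_of_submodule[OF noeth this] obtain n f where nf: "n 0 = m" "free_exact R n f"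
  "f 0 ` vecs R (n (Suc 0)) = {v \<in> vecs R m. \<pi> v \<in> a ` carrier U}" by blast
 have "\<exists>w\<in>mod_hom R (Fr R (n 0)) (obj I (int p)).
   (\<forall>x\<in>vecs R (n (Suc 0)). w (f 0 x) = null I (int p)) \<and>
   (\<forall>x\<in>vecs R (n 0). dif I (int p) (w x) = dif I (int p) (h0 (\<pi> x)))"
 proof (rule cocycle_on_syzygy[OF nf(2)])
  show "(\<lambda>x. dif I (int p) (h0 (\<pi> x))) \<in> mod_hom R (Fr R (n 0)) (obj I (int p + 1))"
   unfolding nf(1) by (rule hom_comp[OF hom_comp[OF \<pi>(1) h0(1)] dX])
  show "dif I (int p + 1) (dif I (int p) (h0 (\<pi> x))) = null I (int p + 2)" if "x \<in> vecs R (n 0)" for x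
   by (rule module_complexD(4)[OF c(1)]) (use that in \<open>simp add: nf(1) ps hs\<close>)
  fix x assume "x \<in> vecs R (n (Suc 0))"
  then have "\<pi> (f 0 x) \<in> a ` carrier U" using nf(3) by blast
  then show "dif I (int p) (h0 (\<pi> (f 0 x))) = null I (int p + 1)"
   using h0(2) dg by (auto simp flip: h0(2))
 qed (use dp in simp)
 then obtain w where w: "w \<in> mod_hom R (Fr R m) (obj I (int p))"
  "\<And>x. x \<in> vecs R (n (Suc 0)) ==> w (f 0 x) = null I (int p)"
  "\<And>x. x \<in> vecs R m ==> dif I (int p) (w x) = dif I (int p) (h0 (\<pi> x))"
  unfolding nf(1) by blast
 have wz: "w v = null I (int p)" if "v \<in> vecs R m" "\<pi> v \<in> a ` carrier U" for v
 proof -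
  have "v \<in> f 0 ` vecs R (n (Suc 0))" using nf(3) that by blast
  then show ?thesis using w(2) by blast
 qed
 have a0: "\<zero>\<^bsub>Y\<^esub> \<in> a ` carrier U" using submoduleD(2)[OF Y submodule_image[OF U Y a]] .
 have "\<exists>h\<in>mod_hom R Y (obj I (int p)). \<forall>x\<in>vecs R m. w x = h (\<pi> x)"
  by (rule hom_factor[OF F Y X \<pi> w(1)]) (rule wz, use a0 in simp_all)
 then obtain h1 where h1: "h1 \<in> mod_hom R Y (obj I (int p))" "\<And>x. x \<in> vecs R m ==> w x = h1 (\<pi> x)" by blast
 note hs1 = hom_simps[OF h1(1) Y X]
 have sur: "\<exists>v\<in>vecs R m. y = \<pi> v" if "y \<in> carrier Y" for y using \<pi>(2) that by auto
 show ?thesis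
 proof (intro bexI[OF _ hom_diff[OF h0(1) h1(1) X]] conjI ballI)
  fix u assume u: "u \<in> carrier U"
  have au: "a u \<in> carrier Y" by (rule mod_homD(1)[OF a u])
  obtain v where v: "v \<in> vecs R m" "a u = \<pi> v" using sur[OF au] by blast
  have "h1 (a u) = null I (int p)" using wz[OF v(1)] h1(2)[OF v(1)] v(2) u by (metis imageI)
  then show "g u = h0 (a u) \<oplus>\<^bsub>obj I (int p)\<^esub> \<ominus>\<^bsub>obj I (int p)\<^esub> h1 (a u)"
   using h0(2)[OF u] hs(1)[OF au] by (simp add: lm[OF X])
 next
  fix y assume y: "y \<in> carrier Y"
  obtain v where v: "v \<in> vecs R m" "y = \<pi> v" using sur[OF y] by blast
  have "dif I (int p) (h1 y) = dif I (int p) (h0 y)" using w(3)[OF v(1)] h1(2)[OF v(1)] v(2) by simp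
  then show "dif I (int p) (h0 y \<oplus>\<^bsub>obj I (int p)\<^esub> \<ominus>\<^bsub>obj I (int p)\<^esub> h1 y) = null I (int p + 1)"
   using y by (simp add: ds hs hs1 lm[OF X])
 qed
qed

lemma cocycle_is_coboundary:
 assumes C: "left_module R C" and fg: "fin_gen R C"
  and g: "g \<in> mod_hom R C (obj I (int p + 1))"
  and dg: "\<And>x. x \<in> carrier C ==> dif I (int p + 1) (g x) = null I (int p + 2)" and dp: "d \<le> p"
 shows "\<exists>w\<in>mod_hom R C (obj I (int p)). \<forall>x\<in>carrier C. g x = dif I (int p) (w x)"
proof -
 obtain n f \<pi> where nf: "free_exact R n f" "nat_resolution R (\<lambda>i. Fr R (n i)) f C \<pi>"
  using free_resolution[OF noeth C fg] by blast
 note q = nat_resolutionD[OF nf(2)]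
 note gs = hom_simps[OF g C X]
 have "\<exists>w\<in>mod_hom R (Fr R (n 0)) (obj I (int p)).
   (\<forall>x\<in>vecs R (n (Suc 0)). w (f 0 x) = null I (int p)) \<and>
   (\<forall>x\<in>vecs R (n 0). dif I (int p) (w x) = g (\<pi> x))"
  by (rule cocycle_on_syzygy[OF nf(1) _ hom_comp[OF q(4) g]])
   (use dp in \<open>simp_all add: dg mod_homD(1)[OF q(4)] q(6) gs\<close>)
 then obtain w where w: "w \<in> mod_hom R (Fr R (n 0)) (obj I (int p))"
  "\<And>x. x \<in> vecs R (n (Suc 0)) ==> w (f 0 x) = null I (int p)"
  "\<And>x. x \<in> vecs R (n 0) ==> dif I (int p) (w x) = g (\<pi> x)" by blast
 have "w x = null I (int p)" if x: "x \<in> vecs R (n 0)" "\<pi> x = \<zero>\<^bsub>C\<^esub>" for x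
  using q(8)[OF x] w(2) by blast
 then have "\<exists>h\<in>mod_hom R C (obj I (int p)). \<forall>x\<in>vecs R (n 0). w x = h (\<pi> x)"
  by (intro hom_factor[OF F C X q(4,5) w(1)])
 then obtain h where h: "h \<in> mod_hom R C (obj I (int p))" "\<And>x. x \<in> vecs R (n 0) ==> w x = h (\<pi> x)" by blast
 show ?thesis
 proof (intro bexI[OF _ h(1)] ballI)
  fix y assume "y \<in> carrier C"
  then obtain x where "x \<in> vecs R (n 0)" "y = \<pi> x" using q(5) by auto
  then show "g y = dif I (int p) (h y)" using h(2) w(3) by simp
 qed
qed

end

lemma inj_dim_finiteD:
 assumes "inj_dim TYPE('u) R M < \<infinity>"
 shows "\<exists>(E :: (('a, 'u) module, 'u) cochain) \<epsilon> n. coresolution (R :: ('a, 'r) ring_scheme) M E \<epsilon> \<and>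
  (\<forall>i. injective_module R (obj E i)) \<and> (\<forall>i > int n. elts E i = {null E i})"
proof (rule ccontr)
 assume "\<not> ?thesis"
 then have "{enat n | n. \<exists>(E :: (('a, 'u) module, 'u) cochain) \<epsilon>.
   coresolution R M E \<epsilon> \<and> (\<forall>i. injective_module R (obj E i)) \<and>
   (\<forall>i > int n. elts E i = {null E i})} = {}" by blast
 then have "inj_dim TYPE('u) R M = Inf {}" unfolding inj_dim_def by (rule arg_cong)
 then have "inj_dim TYPE('u) R M = \<infinity>" by (simp add: top_enat_def)
 then show False using assms by simp
qed

section \<open>Duality for free modules of finite rank\<close>

text \<open>The free right module \<open>Fr (op_ring R) n\<close> is dual to the free left module \<open>Fr R n\<close> by \<open>pair\<close>, and \<open>transp\<close>
 is the transpose of a linear map with respect to this pairing.\<close>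

definition pair :: "('a, 'r) ring_scheme => nat => (nat => 'a) => (nat => 'a) => 'a" where
 "pair R n t l = finsum R (\<lambda>s. t s \<otimes>\<^bsub>R\<^esub> l s) {..<n}"

definition transp :: "('a, 'r) ring_scheme => nat => nat => ((nat => 'a) => nat => 'a) => (nat => 'a) => nat => 'a" where
 "transp R n m h l = (\<lambda>s. if s < n then pair R m (h (bas R s)) l else \<zero>\<^bsub>R\<^esub>)"

lemma bas_op [simp]: "bas (op_ring R) s = bas R s"
 by (auto simp: bas_def fun_eq_iff)

lemma free_op_carrier [simp]: "carrier (free (op_ring R) S) = carrier (free R S)"
 by (auto simp: dsum_carrier)

lemma finsum_op [simp]: "finsum (op_ring R) f S = finsum R f S"
 by (simp add: finsum_def)

lemma finsum_regular [simp]: "finsum (regular_bimodule R) f S = finsum R f S"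
 by (simp add: finsum_def finprod_def)

lemma pair_op: "pair (op_ring R) n l t = pair R n t l"
 by (simp add: pair_def)

lemma free_fin: "f \<in> vecs R n \<longleftrightarrow> (\<forall>s. f s \<in> carrier R) \<and> (\<forall>s. \<not> s < n --> f s = \<zero>\<^bsub>R\<^esub>)"
 by (simp add: dsum_carrier_finite)

lemma pair_eq_lin:
 assumes R: "ring R" and t: "t \<in> vecs R n" and l: "\<And>s. s < n ==> l s \<in> carrier R"
 shows "pair R n t l = lin R (regular_bimodule R) l t"
proof -
 have "lin R (regular_bimodule R) l t = finsum (regular_bimodule R) (\<lambda>s. t s \<odot>\<^bsub>regular_bimodule R\<^esub> l s) {..<n}"
  by (rule lin_finite[OF left_module_regular[OF R] t]) (use l in auto)
 then show ?thesis by (simp add: pair_def)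
qed

lemma pair_hom:
 assumes R: "ring R" and l: "\<And>s. s < n ==> l s \<in> carrier R"
 shows "(\<lambda>t. pair R n t l) \<in> mod_hom R (Fr R n) (regular_bimodule R)"
 by (rule hom_cong[OF lin_hom[OF left_module_regular[OF R], of "{..<n}" l]])
  (use l in \<open>simp_all add: pair_eq_lin[OF R] left_module_free[OF R]\<close>)

lemma pair_hom_right:
 assumes R: "ring R" and t: "\<And>s. s < n ==> t s \<in> carrier R"
 shows "(\<lambda>l. pair R n t l) \<in> mod_hom (op_ring R) (Fr (op_ring R) n) (regular_bimodule (op_ring R))"
 using pair_hom[OF ring_op_ring[OF R], of n t] t by (simp add: pair_op)

lemma pair_bas:
 assumes R: "ring R" and l: "\<And>s. s < n ==> l s \<in> carrier R" and s: "s < n"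
 shows "pair R n (bas R s) l = l s"
proof -
 have "pair R n (bas R s) l = lin R (regular_bimodule R) l (bas R s)"
  by (rule pair_eq_lin[OF R bas_in[OF R] l]) (use s in auto)
 also have "\<dots> = l s" by (rule lin_bas[OF left_module_regular[OF R], of _ "{..<n}"]) (use s l in auto)
 finally show ?thesis .
qed

lemma pair_bas_right:
 assumes R: "ring R" and t: "\<And>s. s < n ==> t s \<in> carrier R" and s: "s < n"
 shows "pair R n t (bas R s) = t s"
 using pair_bas[OF ring_op_ring[OF R], of n t s] t s by (simp add: pair_op)

lemma hom_eq_pair:
 assumes R: "ring R" and g: "g \<in> mod_hom R (Fr R n) (regular_bimodule R)" and t: "t \<in> vecs R n"
 shows "g t = pair R n t (\<lambda>s. if s < n then g (bas R s) else \<zero>\<^bsub>R\<^esub>)"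
proof -
 have c: "g (bas R s) \<in> carrier R" if "s < n" for s using mod_homD(1)[OF g bas_in[OF R]] that by simp
 show ?thesis
  by (rule free_hom_eq[OF R left_module_regular[OF R] g pair_hom[OF R] _ t]) (use c in \<open>simp_all add: pair_bas[OF R]\<close>)
qed

lemma transp_hom:
 assumes R: "ring R" and h: "h \<in> mod_hom R (Fr R n) (Fr R m)"
 shows "transp R n m h \<in> mod_hom (op_ring R) (Fr (op_ring R) m) (Fr (op_ring R) n)"
proof -
 note O = ring_op_ring[OF R]
 have c: "h (bas R s) r \<in> carrier R" if "s < n" for s r
  using mod_homD(1)[OF h bas_in[OF R, of s "{..<n}"]] that by (simp add: free_fin)
 have ph: "(\<lambda>l. pair R m (h (bas R s)) l) \<in> mod_hom (op_ring R) (Fr (op_ring R) m) (regular_bimodule (op_ring R))"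
  if "s < n" for s by (rule pair_hom_right[OF R]) (rule c[OF that])
 show ?thesis
 proof (rule mod_homI)
  fix l assume l: "l \<in> vecs (op_ring R) m"
  show "transp R n m h l \<in> vecs (op_ring R) n"
   using mod_homD(1)[OF ph l] ag(2)[OF ring.is_abelian_group[OF R]] by (auto simp: free_fin transp_def)
  fix a assume a: "a \<in> carrier (op_ring R)"
  show "transp R n m h (a \<odot>\<^bsub>Fr (op_ring R) m\<^esub> l) = a \<odot>\<^bsub>Fr (op_ring R) n\<^esub> transp R n m h l"
  proof
   fix s
   show "transp R n m h (a \<odot>\<^bsub>Fr (op_ring R) m\<^esub> l) s = (a \<odot>\<^bsub>Fr (op_ring R) n\<^esub> transp R n m h l) s"
    using mod_homD(3)[OF ph a l, of s] a lm(14)[OF left_module_regular[OF R], of a] by (auto simp: transp_def)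
  qed
 next
  fix l l' assume l: "l \<in> vecs (op_ring R) m" "l' \<in> vecs (op_ring R) m"
  show "transp R n m h (l \<oplus>\<^bsub>Fr (op_ring R) m\<^esub> l') = transp R n m h l \<oplus>\<^bsub>Fr (op_ring R) n\<^esub> transp R n m h l'"
  proof
   fix s
   show "transp R n m h (l \<oplus>\<^bsub>Fr (op_ring R) m\<^esub> l') s = (transp R n m h l \<oplus>\<^bsub>Fr (op_ring R) n\<^esub> transp R n m h l') s"
    using mod_homD(2)[OF ph l, of s] ag(2,5)[OF ring.is_abelian_group[OF R]] by (auto simp: transp_def)
  qed
 qed
qed

lemma pair_transp:
 assumes R: "ring R" and h: "h \<in> mod_hom R (Fr R n) (Fr R m)"
  and t: "t \<in> vecs R n" and l: "l \<in> vecs R m"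
 shows "pair R m (h t) l = pair R n t (transp R n m h l)"
proof -
 have tl: "transp R n m h l \<in> vecs R n" using mod_homD(1)[OF transp_hom[OF R h], of l] l by simp
 show ?thesis
 proof (rule free_hom_eq[OF R left_module_regular[OF R] _ _ _ t])
  show "(\<lambda>t. pair R m (h t) l) \<in> mod_hom R (Fr R n) (regular_bimodule R)"
   by (rule hom_comp[OF h pair_hom[OF R]]) (use l in \<open>simp add: free_fin\<close>)
  show "(\<lambda>t. pair R n t (transp R n m h l)) \<in> mod_hom R (Fr R n) (regular_bimodule R)"
   by (rule pair_hom[OF R]) (use tl in \<open>simp add: free_fin\<close>)
  fix s assume s: "s \<in> {..<n}"
  have "pair R n (bas R s) (transp R n m h l) = transp R n m h l s"
   by (rule pair_bas[OF R]) (use s tl in \<open>simp_all add: free_fin\<close>)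
  then show "pair R m (h (bas R s)) l = pair R n (bas R s) (transp R n m h l)"
   using s by (simp add: transp_def)
 qed
qed

lemma transp_bas:
 assumes R: "ring R" and h: "h \<in> mod_hom R (Fr R n) (Fr R m)" and "s < n" "r < m"
 shows "transp R n m h (bas R r) s = h (bas R s) r"
proof -
 have "h (bas R s) \<in> vecs R m" using mod_homD(1)[OF h bas_in[OF R, of s "{..<n}"]] \<open>s < n\<close> by simp
 then show ?thesis using assms(3,4) pair_bas_right[OF R, of m "h (bas R s)" r] by (simp add: transp_def free_fin)
qed

lemma transp_transp:
 assumes R: "ring R" and h: "h \<in> mod_hom R (Fr R n) (Fr R m)" and t: "t \<in> vecs R n"
 shows "transp (op_ring R) m n (transp R n m h) t = h t"
proof (rule free_hom_eq[OF R left_module_free[OF R] _ h _ t])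
 note O = ring_op_ring[OF R] and th = transp_hom[OF R h]
 show h': "transp (op_ring R) m n (transp R n m h) \<in> mod_hom R (Fr R n) (Fr R m)"
  using transp_hom[OF O th] by simp
 fix s assume s: "s \<in> {..<n}"
 show "transp (op_ring R) m n (transp R n m h) (bas R s) = h (bas R s)"
 proof
  fix r
  have hs: "h (bas R s) \<in> vecs R m" by (rule mod_homD(1)[OF h bas_in[OF R s]])
  show "transp (op_ring R) m n (transp R n m h) (bas R s) r = h (bas R s) r"
  proof (cases "r < m")
   case True
   then show ?thesis using transp_bas[OF O th, of r s] transp_bas[OF R h, of s r] s by simp
  next
   case False
   then show ?thesis using hs by (simp add: transp_def free_fin)
  qed
 qed
qed

section \<open>Tensor products with free modules of finite rank\<close>

lemma tensor_relations_mem: "a \<in> tensor_relations A L N ==> a \<in> tensor_subgroup A L N"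
 by (auto simp: tensor_subgroup_def intro: generate.incl)

lemma tensor_subgroup_is_subgroup:
 assumes L: "left_module R' L" and N: "left_module R N" and R': "carrier R' = carrier R"
 shows "subgroup (tensor_subgroup R L N) (free_Abelian_group (carrier L \<times> carrier N))"
  "c \<in> tensor_subgroup R L N ==> d \<in> tensor_subgroup R L N ==> c + d \<in> tensor_subgroup R L N"
  "c \<in> tensor_subgroup R L N ==> - c \<in> tensor_subgroup R L N" "0 \<in> tensor_subgroup R L N"
  "c \<in> tensor_subgroup R L N ==> d \<in> tensor_subgroup R L N ==> c - d \<in> tensor_subgroup R L N"
proof -
 let ?G = "free_Abelian_group (carrier L \<times> carrier N)"
 have k: "Poly_Mapping.keys (frag_of p - frag_of q - frag_of r) \<subseteq> carrier L \<times> carrier N"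
  "Poly_Mapping.keys (frag_of p - frag_of q) \<subseteq> carrier L \<times> carrier N"
  if "p \<in> carrier L \<times> carrier N" "q \<in> carrier L \<times> carrier N" "r \<in> carrier L \<times> carrier N" for p q r
  using that keys_diff[of "frag_of p - frag_of q" "frag_of r"] keys_diff[of "frag_of p" "frag_of q"] by auto
 have "tensor_relations R L N \<subseteq> carrier ?G"
  unfolding tensor_relations_def
  by (auto simp: lm[OF L] lm[OF N] R' subset_iff dest!: k(1)[THEN subsetD, rotated 3] k(2)[THEN subsetD, rotated 3])
 then show S: "subgroup (tensor_subgroup R L N) ?G"
  unfolding tensor_subgroup_def by (rule group.generate_is_subgroup[OF group_free_Abelian_group])
 show a: "c \<in> tensor_subgroup R L N ==> d \<in> tensor_subgroup R L N ==> c + d \<in> tensor_subgroup R L N" for c d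
  using subgroup.m_closed[OF S] by simp
 show m: "c \<in> tensor_subgroup R L N ==> - c \<in> tensor_subgroup R L N" for c
  using subgroup.m_inv_closed[OF S, of c] subgroup.mem_carrier[OF S, of c] by simp
 show "0 \<in> tensor_subgroup R L N" using subgroup.one_closed[OF S] by simp
 show "c - d \<in> tensor_subgroup R L N" if "c \<in> tensor_subgroup R L N" "d \<in> tensor_subgroup R L N"
  using a[OF that(1) m[OF that(2)]] by simp
qed

text \<open>For a free right module \<open>L n\<close> of rank \<open>n\<close> the tensor product of \<open>L n\<close> with \<open>N\<close> is the group \<open>W n\<close> of \<open>n\<close>-tuples
 in \<open>N\<close>.  The isomorphism is induced by \<open>ev\<close>, which sends \<open>l \<otimes> y\<close> to the tuple of the \<open>l s \<cdot> y\<close>; its inverse is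
 induced by \<open>sec\<close>, which writes a tuple as a combination of \<open>bas s \<otimes> y\<close>.\<close>

locale tensor_free =
 fixes A :: "('a, 'r) ring_scheme" and N :: "('a, 'n, 'x) module_scheme"
 assumes N: "left_module A N"
begin

lemma A: "ring A" using left_moduleD[OF N] by simp
lemmas O = ring_op_ring[OF A]

abbreviation L :: "nat => ('a, nat => 'a) module" where "L n \<equiv> Fr (op_ring A) n"
abbreviation W :: "nat => ('a, nat => 'n) module" where "W n \<equiv> dsum N {..<n}"
abbreviation G :: "nat => ((nat => 'a) \<times> 'n \<Rightarrow>\<^sub>0 int) monoid" where "G n \<equiv> free_Abelian_group (carrier (L n) \<times> carrier N)"
abbreviation TS :: "nat => ((nat => 'a) \<times> 'n \<Rightarrow>\<^sub>0 int) set" where "TS n \<equiv> tensor_subgroup A (L n) N"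

lemmas Lm = left_module_free[OF O] and Wm = left_module_dsum[OF N]
lemma ts: "subgroup (TS n) (G n)"
 "c \<in> TS n ==> d \<in> TS n ==> c + d \<in> TS n" "c \<in> TS n ==> - c \<in> TS n" "0 \<in> TS n"
 "c \<in> TS n ==> d \<in> TS n ==> c - d \<in> TS n"
 by (rule tensor_subgroup_is_subgroup[OF Lm N op_ring_simps(1)]; assumption)+

definition WG :: "nat => (nat => 'n) monoid" where
 "WG n = \<lparr>carrier = carrier (W n), monoid.mult = add (W n), one = ring.zero (W n)\<rparr>"

lemma WG_simps [simp]:
 "carrier (WG n) = carrier (W n)" "x \<otimes>\<^bsub>WG n\<^esub> y = (\<lambda>s. x s \<oplus>\<^bsub>N\<^esub> y s)" "\<one>\<^bsub>WG n\<^esub> = (\<lambda>s. \<zero>\<^bsub>N\<^esub>)"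
 by (simp_all add: WG_def)

lemma WG: "comm_group (WG n)"
 unfolding WG_def by (rule comm_group_additive[OF left_moduleD(2)[OF Wm]])

lemma W_fin: "u \<in> carrier (W n) \<longleftrightarrow> (\<forall>s. u s \<in> carrier N) \<and> (\<forall>s. \<not> s < n --> u s = \<zero>\<^bsub>N\<^esub>)"
 by (simp add: dsum_carrier_finite)

lemma ev_exists:
 "\<exists>h. h \<in> hom (G n) (WG n) \<and> (\<forall>x\<in>carrier (L n). \<forall>y\<in>carrier N. h (frag_of (x, y)) = (\<lambda>s. x s \<odot>\<^bsub>N\<^esub> y))"
proof -
 interpret W: comm_group "WG n" by (rule WG)
 have "(\<lambda>(x, y). \<lambda>s. x s \<odot>\<^bsub>N\<^esub> y) ` (carrier (L n) \<times> carrier N) \<subseteq> carrier (WG n)"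
  by (auto simp: free_fin W_fin lm[OF N])
 from W.free_Abelian_group_universal[OF this] obtain h where
  "h \<in> hom (G n) (WG n)" "\<And>p. p \<in> carrier (L n) \<times> carrier N ==> h (frag_of p) = (\<lambda>(x, y). \<lambda>s. x s \<odot>\<^bsub>N\<^esub> y) p"
  by blast
 then show ?thesis by (intro exI[of _ h]) auto
qed

definition ev :: "nat => ((nat => 'a) \<times> 'n \<Rightarrow>\<^sub>0 int) => nat => 'n" where
 "ev n = (SOME h. h \<in> hom (G n) (WG n) \<and> (\<forall>x\<in>carrier (L n). \<forall>y\<in>carrier N. h (frag_of (x, y)) = (\<lambda>s. x s \<odot>\<^bsub>N\<^esub> y)))"

lemma ev: "ev n \<in> hom (G n) (WG n)"
 "x \<in> carrier (L n) ==> y \<in> carrier N ==> ev n (frag_of (x, y)) = (\<lambda>s. x s \<odot>\<^bsub>N\<^esub> y)"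
 using someI_ex[OF ev_exists[of n]] by (simp_all add: ev_def)

lemma ev_gh: "group_hom (G n) (WG n) (ev n)"
 using ev(1) WG[of n] by (simp add: group_hom_def group_hom_axioms_def comm_group_def)

lemma ev_closed: "Poly_Mapping.keys c \<subseteq> carrier (L n) \<times> carrier N ==> ev n c \<in> carrier (W n)"
 using group_hom.hom_closed[OF ev_gh, of c n] by simp

lemma ev_add:
 assumes "Poly_Mapping.keys c \<subseteq> carrier (L n) \<times> carrier N" "Poly_Mapping.keys d \<subseteq> carrier (L n) \<times> carrier N"
 shows "ev n (c + d) = (\<lambda>s. ev n c s \<oplus>\<^bsub>N\<^esub> ev n d s)"
 using group_hom.hom_mult[OF ev_gh, of c n d] assms by simp

lemma ev_zero: "ev n 0 = (\<lambda>s. \<zero>\<^bsub>N\<^esub>)"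
 using group_hom.hom_one[OF ev_gh, of n] by simp

lemma ev_diff:
 assumes c: "Poly_Mapping.keys c \<subseteq> carrier (L n) \<times> carrier N" and d: "Poly_Mapping.keys d \<subseteq> carrier (L n) \<times> carrier N"
 shows "ev n (c - d) = (\<lambda>s. ev n c s \<oplus>\<^bsub>N\<^esub> \<ominus>\<^bsub>N\<^esub> ev n d s)"
proof
 fix s
 have k: "Poly_Mapping.keys (c - d) \<subseteq> carrier (L n) \<times> carrier N" using keys_diff[of c d] assms by blast
 have "ev n c = (\<lambda>s. ev n (c - d) s \<oplus>\<^bsub>N\<^esub> ev n d s)" using ev_add[OF k d] by simp
 then have "ev n c s = ev n (c - d) s \<oplus>\<^bsub>N\<^esub> ev n d s" by (rule fun_cong)
 then show "ev n (c - d) s = ev n c s \<oplus>\<^bsub>N\<^esub> \<ominus>\<^bsub>N\<^esub> ev n d s"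
  using ev_closed[OF k] ev_closed[OF d] by (simp add: W_fin lms[OF N])
qed

lemma keys_frag2: "p \<in> S ==> q \<in> S ==> Poly_Mapping.keys (frag_of p - frag_of q) \<subseteq> S"
 "p \<in> S ==> q \<in> S ==> r \<in> S ==> Poly_Mapping.keys (frag_of p - frag_of q - frag_of r) \<subseteq> S" for p q r :: 'c
 using keys_diff[of "frag_of p" "frag_of q"] keys_diff[of "frag_of p - frag_of q" "frag_of r"] by auto

lemma ts_ev: assumes c: "c \<in> TS n" shows "ev n c = (\<lambda>s. \<zero>\<^bsub>N\<^esub>)"
proof -
 have "tensor_relations A (L n) N \<subseteq> kernel (G n) (WG n) (ev n)"
 proof
  fix r assume "r \<in> tensor_relations A (L n) N"
  then consider (a) x x' y where "r = frag_of (x \<oplus>\<^bsub>L n\<^esub> x', y) - frag_of (x, y) - frag_of (x', y)"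
    "x \<in> carrier (L n)" "x' \<in> carrier (L n)" "y \<in> carrier N"
   | (b) x y y' where "r = frag_of (x, y \<oplus>\<^bsub>N\<^esub> y') - frag_of (x, y) - frag_of (x, y')"
    "x \<in> carrier (L n)" "y \<in> carrier N" "y' \<in> carrier N"
   | (c) a x y where "r = frag_of (a \<odot>\<^bsub>L n\<^esub> x, y) - frag_of (x, a \<odot>\<^bsub>N\<^esub> y)"
    "a \<in> carrier A" "x \<in> carrier (L n)" "y \<in> carrier N"
   unfolding tensor_relations_def by blast
  then show "r \<in> kernel (G n) (WG n) (ev n)"
  proof cases
   case a
   have xc: "x s \<in> carrier A" "x' s \<in> carrier A" for s using a(2,3) by (simp_all add: free_fin)
   have "x \<oplus>\<^bsub>L n\<^esub> x' \<in> carrier (L n)" using lm(1)[OF Lm a(2,3)] .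
   then show ?thesis using a(2-4) xc unfolding a(1) kernel_def
    by (simp add: keys_frag2 ev_diff ev lm[OF N] lm_ac[OF N] lm_cancel[OF N] del: dsum_simps(2) free_op_carrier) (simp add: lms[OF N])
  next
   case b
   have xc: "x s \<in> carrier A" for s using b(2) by (simp add: free_fin)
   show ?thesis using b(2-4) xc unfolding b(1) kernel_def
    by (simp add: keys_frag2 ev_diff ev lms[OF N] del: free_op_carrier)
  next
   case c
   have xc: "x s \<in> carrier A" for s using c(3) by (simp add: free_fin)
   have "a \<odot>\<^bsub>L n\<^esub> x \<in> carrier (L n)" using lm(12)[OF Lm _ c(3), of a] c(2) by simp
   then show ?thesis using c(2-4) xc unfolding c(1) kernel_def
    by (simp add: keys_frag2 ev_diff ev lms[OF N] del: dsum_simps(3) free_op_carrier) (simp add: lms[OF N])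
  qed
 qed
 from group.generate_subgroup_incl[OF group_free_Abelian_group this group_hom.subgroup_kernel[OF ev_gh]]
 have "TS n \<subseteq> kernel (G n) (WG n) (ev n)" unfolding tensor_subgroup_def .
 then show ?thesis using c by (auto simp: kernel_def)
qed

definition sec :: "nat => (nat => 'n) => (nat => 'a) \<times> 'n \<Rightarrow>\<^sub>0 int" where
 "sec n u = (\<Sum>r<n. frag_of (bas A r, u r))"

lemma basL: "r < n ==> bas A r \<in> carrier (L n)"
 using bas_in[OF O, of r "{..<n}"] by (simp del: free_op_carrier)

lemma ts_sum: "(\<And>r. r < k ==> c r \<in> TS n) ==> (\<Sum>r<k. c r) \<in> TS n" for k :: nat
 by (induction k) (auto intro: ts(2,4))

lemma ts_rel:
 "x \<in> carrier (L n) ==> x' \<in> carrier (L n) ==> y \<in> carrier N ==>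
   frag_of (x \<oplus>\<^bsub>L n\<^esub> x', y) - frag_of (x, y) - frag_of (x', y) \<in> TS n"
 "x \<in> carrier (L n) ==> y \<in> carrier N ==> y' \<in> carrier N ==>
   frag_of (x, y \<oplus>\<^bsub>N\<^esub> y') - frag_of (x, y) - frag_of (x, y') \<in> TS n"
 "a \<in> carrier A ==> x \<in> carrier (L n) ==> y \<in> carrier N ==>
   frag_of (a \<odot>\<^bsub>L n\<^esub> x, y) - frag_of (x, a \<odot>\<^bsub>N\<^esub> y) \<in> TS n"
 by (rule tensor_relations_mem, unfold tensor_relations_def, blast)+

lemma ts_zero: "x \<in> carrier (L n) ==> frag_of (x, \<zero>\<^bsub>N\<^esub>) \<in> TS n"
 "y \<in> carrier N ==> frag_of (\<zero>\<^bsub>L n\<^esub>, y) \<in> TS n"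
proof -
 assume "x \<in> carrier (L n)"
 from ts_rel(2)[OF this lm(2)[OF N] lm(2)[OF N]] show "frag_of (x, \<zero>\<^bsub>N\<^esub>) \<in> TS n"
  using ts(3)[of "- frag_of (x, \<zero>\<^bsub>N\<^esub>)" n] by (simp add: lm[OF N])
next
 assume "y \<in> carrier N"
 from ts_rel(1)[OF lm(2)[OF Lm] lm(2)[OF Lm] this] show "frag_of (\<zero>\<^bsub>L n\<^esub>, y) \<in> TS n"
  using ts(3)[of "- frag_of (\<zero>\<^bsub>L n\<^esub>, y)" n] by (simp add: lm(4)[OF Lm lm(2)[OF Lm]] del: dsum_simps)
qed

lemma sec_add:
 assumes "u \<in> carrier (W n)" "v \<in> carrier (W n)"
 shows "sec n (\<lambda>s. u s \<oplus>\<^bsub>N\<^esub> v s) - sec n u - sec n v \<in> TS n"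
proof -
 have "(\<Sum>r<n. frag_of (bas A r, u r \<oplus>\<^bsub>N\<^esub> v r) - frag_of (bas A r, u r) - frag_of (bas A r, v r)) \<in> TS n"
  by (rule ts_sum, rule ts_rel(2)) (use basL assms in \<open>auto simp: W_fin\<close>)
 then show ?thesis by (simp add: sec_def sum_subtractf)
qed

lemma sec_single: assumes s: "s < n" and y: "y \<in> carrier N"
 shows "sec n (\<lambda>r. if r = s then y else \<zero>\<^bsub>N\<^esub>) - frag_of (bas A s, y) \<in> TS n"
proof -
 have "sec n (\<lambda>r. if r = s then y else \<zero>\<^bsub>N\<^esub>) =
   frag_of (bas A s, y) + (\<Sum>r\<in>{..<n} - {s}. frag_of (bas A r, \<zero>\<^bsub>N\<^esub>))"
  unfolding sec_def using s by (subst sum.remove[of _ s]) auto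
 moreover have "(\<Sum>r\<in>{..<n} - {s}. frag_of (bas A r, \<zero>\<^bsub>N\<^esub>)) = (\<Sum>r<n. if r = s then 0 else frag_of (bas A r, \<zero>\<^bsub>N\<^esub>))"
  using s by (subst sum.remove[of "{..<n}" s]) (auto intro: sum.cong)
 moreover have "\<dots> \<in> TS n" by (rule ts_sum) (auto intro: ts_zero basL ts(4))
 ultimately show ?thesis by simp
qed

lemma sec_ev_gen:
 assumes x: "x \<in> carrier (L n)" and y: "y \<in> carrier N"
 shows "frag_of (x, y) - sec n (\<lambda>s. x s \<odot>\<^bsub>N\<^esub> y) \<in> TS n"
 using O x
proof (induction rule: free_induct)
 case zero
 have "sec n (\<lambda>s. \<zero>\<^bsub>N\<^esub>) \<in> TS n" unfolding sec_def by (rule ts_sum, rule ts_zero(1), rule basL)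
 from ts(5)[OF ts_zero(2)[OF y] this] show ?case using y by (simp add: lm[OF N])
next
 case (step w a s)
 let ?b = "bas (op_ring A) s" let ?w' = "w \<oplus>\<^bsub>L n\<^esub> a \<odot>\<^bsub>L n\<^esub> ?b"
 have s: "s < n" and a: "a \<in> carrier A" using step by auto
 have b: "?b \<in> carrier (L n)" by (rule bas_in[OF O step(3)])
 have ab: "a \<odot>\<^bsub>L n\<^esub> ?b \<in> carrier (L n)" by (rule lm(12)[OF Lm step(2) b])
 have ay: "a \<odot>\<^bsub>N\<^esub> y \<in> carrier N" by (rule lm(12)[OF N a y])
 have wc: "w r \<in> carrier A" for r using step(1) by (simp add: free_fin)
 let ?u = "\<lambda>r. w r \<odot>\<^bsub>N\<^esub> y" and ?v = "\<lambda>r. if r = s then a \<odot>\<^bsub>N\<^esub> y else \<zero>\<^bsub>N\<^esub>"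
 have eq: "(\<lambda>r. ?w' r \<odot>\<^bsub>N\<^esub> y) = (\<lambda>r. ?u r \<oplus>\<^bsub>N\<^esub> ?v r)"
  using wc a y ring.ring_simprules[OF A] by (auto simp: bas_def lm[OF N] fun_eq_iff)
 have uv: "?u \<in> carrier (W n)" "?v \<in> carrier (W n)"
  using step(1) y ay s by (auto simp: W_fin free_fin lm[OF N])
 have 1: "frag_of (?w', y) - frag_of (w, y) - frag_of (a \<odot>\<^bsub>L n\<^esub> ?b, y) \<in> TS n" by (rule ts_rel(1)[OF step(1) ab y])
 have 2: "frag_of (a \<odot>\<^bsub>L n\<^esub> ?b, y) - frag_of (?b, a \<odot>\<^bsub>N\<^esub> y) \<in> TS n" by (rule ts_rel(3)[OF a b y])
 have 3: "sec n (\<lambda>r. ?u r \<oplus>\<^bsub>N\<^esub> ?v r) - sec n ?u - sec n ?v \<in> TS n" by (rule sec_add[OF uv])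
 have 4: "sec n ?v - frag_of (?b, a \<odot>\<^bsub>N\<^esub> y) \<in> TS n" using sec_single[OF s ay] by simp
 have "((frag_of (?w', y) - frag_of (w, y) - frag_of (a \<odot>\<^bsub>L n\<^esub> ?b, y)) + (frag_of (a \<odot>\<^bsub>L n\<^esub> ?b, y) - frag_of (?b, a \<odot>\<^bsub>N\<^esub> y)))
   + (frag_of (w, y) - sec n ?u) - ((sec n (\<lambda>r. ?u r \<oplus>\<^bsub>N\<^esub> ?v r) - sec n ?u - sec n ?v) + (sec n ?v - frag_of (?b, a \<odot>\<^bsub>N\<^esub> y))) \<in> TS n"
  by (rule ts(5)[OF ts(2)[OF ts(2)[OF 1 2] step(4)] ts(2)[OF 3 4]])
 then show ?case unfolding eq by (simp add: algebra_simps del: dsum_simps)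
qed

text \<open>Modulo the tensor relations, \<open>sec\<close> is inverse to \<open>ev\<close>; hence the kernel of \<open>ev\<close> consists of these
 relations.\<close>

lemma sec_ev:
 assumes "Poly_Mapping.keys c \<subseteq> carrier (L n) \<times> carrier N"
 shows "c - sec n (ev n c) \<in> TS n"
 using assms
proof (induction rule: free_Abelian_group_induct[consumes 1, case_names 1 2 3])
 case 1
 have "sec n (\<lambda>s. \<zero>\<^bsub>N\<^esub>) \<in> TS n" unfolding sec_def by (rule ts_sum, rule ts_zero(1), rule basL)
 then show ?case using ts(3) by (simp add: ev_zero)
next
 case (2 x y)
 have k: "Poly_Mapping.keys (x - y) \<subseteq> carrier (L n) \<times> carrier N" using keys_diff[of x y] 2 by blast
 have "sec n (\<lambda>s. ev n (x - y) s \<oplus>\<^bsub>N\<^esub> ev n y s) - sec n (ev n (x - y)) - sec n (ev n y) \<in> TS n"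
  by (rule sec_add) (use ev_closed[OF k] ev_closed[OF 2(2)] in auto)
 moreover have "(\<lambda>s. ev n (x - y) s \<oplus>\<^bsub>N\<^esub> ev n y s) = ev n x" using ev_add[OF k 2(2)] by simp
 ultimately have a: "sec n (ev n x) - sec n (ev n (x - y)) - sec n (ev n y) \<in> TS n" by simp
 have "(x - sec n (ev n x)) - (y - sec n (ev n y)) + (sec n (ev n x) - sec n (ev n (x - y)) - sec n (ev n y)) \<in> TS n"
  by (rule ts(2)[OF ts(5)[OF 2(3,4)] a])
 then show ?case by (simp add: algebra_simps)
next
 case (3 a)
 then show ?case using sec_ev_gen[of "fst a" n "snd a"] ev(2)[of "fst a" n "snd a"] by auto
qed

lemma ts_iff:
 assumes "Poly_Mapping.keys c \<subseteq> carrier (L n) \<times> carrier N"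
 shows "c \<in> TS n \<longleftrightarrow> ev n c = (\<lambda>s. \<zero>\<^bsub>N\<^esub>)"
proof
 assume "ev n c = (\<lambda>s. \<zero>\<^bsub>N\<^esub>)"
 then have "c - sec n (\<lambda>s. \<zero>\<^bsub>N\<^esub>) \<in> TS n" using sec_ev[OF assms] by simp
 moreover have "sec n (\<lambda>s. \<zero>\<^bsub>N\<^esub>) \<in> TS n" unfolding sec_def by (rule ts_sum, rule ts_zero(1), rule basL)
 ultimately show "c \<in> TS n" using ts(2)[of "c - sec n (\<lambda>s. \<zero>\<^bsub>N\<^esub>)" n "sec n (\<lambda>s. \<zero>\<^bsub>N\<^esub>)"] by simp
qed (rule ts_ev)

lemma ev_sec:
 assumes u: "u \<in> carrier (W n)"
 shows "Poly_Mapping.keys (sec n u) \<subseteq> carrier (L n) \<times> carrier N" "ev n (sec n u) = u"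
proof -
 have uc: "u s \<in> carrier N" for s using u by (simp add: W_fin)
 have "Poly_Mapping.keys (\<Sum>r<k. frag_of (bas A r, u r)) \<subseteq> carrier (L n) \<times> carrier N \<and>
   ev n (\<Sum>r<k. frag_of (bas A r, u r)) = (\<lambda>s. if s < k then u s else \<zero>\<^bsub>N\<^esub>)" if "k \<le> n" for k
  using that
 proof (induction k)
  case 0
  then show ?case by (simp add: ev_zero)
 next
  case (Suc k)
  then have k: "k < n" and IH: "Poly_Mapping.keys (\<Sum>r<k. frag_of (bas A r, u r)) \<subseteq> carrier (L n) \<times> carrier N"
   "ev n (\<Sum>r<k. frag_of (bas A r, u r)) = (\<lambda>s. if s < k then u s else \<zero>\<^bsub>N\<^esub>)" by auto
  have f: "Poly_Mapping.keys (frag_of (bas A k, u k)) \<subseteq> carrier (L n) \<times> carrier N"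
   using basL[OF k] uc by (simp del: free_op_carrier)
  have "ev n (\<Sum>r<Suc k. frag_of (bas A r, u r)) =
    (\<lambda>s. (if s < k then u s else \<zero>\<^bsub>N\<^esub>) \<oplus>\<^bsub>N\<^esub> bas A k s \<odot>\<^bsub>N\<^esub> u k)"
   by (simp only: sum.lessThan_Suc ev_add[OF IH(1) f] IH(2) ev(2)[OF basL[OF k] uc])
  also have "\<dots> = (\<lambda>s. if s < Suc k then u s else \<zero>\<^bsub>N\<^esub>)"
   by (auto simp: fun_eq_iff bas_def lm[OF N] uc less_Suc_eq)
  finally show ?case
   using keys_add[of "\<Sum>r<k. frag_of (bas A r, u r)" "frag_of (bas A k, u k)"] IH(1) f
   unfolding sum.lessThan_Suc by blast
 qed
 from this[of n] show "Poly_Mapping.keys (sec n u) \<subseteq> carrier (L n) \<times> carrier N" "ev n (sec n u) = u"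
  using u by (auto simp: sec_def W_fin fun_eq_iff)
qed

text \<open>Under the isomorphism with \<open>W n\<close> a tensor is a fibre of \<open>ev\<close>.\<close>

definition cl :: "nat => (nat => 'n) => ((nat => 'a) \<times> 'n \<Rightarrow>\<^sub>0 int) set" where
 "cl n u = {c \<in> carrier (G n). ev n c = u}"

lemma coset_cl: assumes c: "c \<in> carrier (G n)" shows "TS n #>\<^bsub>G n\<^esub> c = cl n (ev n c)"
proof (intro equalityI subsetI)
 fix z assume "z \<in> TS n #>\<^bsub>G n\<^esub> c"
 then obtain t where t: "t \<in> TS n" "z = t + c" by (auto simp: r_coset_def)
 have tc: "t \<in> carrier (G n)" by (rule subgroup.mem_carrier[OF ts(1) t(1)])
 have "z \<in> carrier (G n)" using monoid.m_closed[OF group.is_monoid[OF group_free_Abelian_group] tc c] t(2) by simp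
 moreover have "ev n z = ev n c" using ev_add[of t n c] tc c ts_ev[OF t(1)] ev_closed[of c n] t(2)
  by (simp add: W_fin lm[OF N])
 ultimately show "z \<in> cl n (ev n c)" by (simp add: cl_def)
next
 fix z assume "z \<in> cl n (ev n c)"
 then have z: "Poly_Mapping.keys z \<subseteq> carrier (L n) \<times> carrier N" "ev n z = ev n c" by (auto simp: cl_def)
 have k: "Poly_Mapping.keys (z - c) \<subseteq> carrier (L n) \<times> carrier N" using keys_diff[of z c] z(1) c by auto
 have "z - c \<in> TS n" unfolding ts_iff[OF k] using ev_diff[OF z(1), of c] c ev_closed[of c n] z(2) by (simp add: W_fin lm[OF N])
 then show "z \<in> TS n #>\<^bsub>G n\<^esub> c" by (auto simp: r_coset_def intro!: bexI[of _ "z - c"])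
qed

lemma carrier_tensor: "carrier (tensor A (L n) N) = cl n ` carrier (W n)"
proof -
 have "carrier (tensor A (L n) N) = (\<lambda>c. cl n (ev n c)) ` carrier (G n)"
  unfolding tensor_def carrier_FactGroup by (rule image_cong[OF refl coset_cl])
 also have "\<dots> = cl n ` carrier (W n)"
 proof (intro equalityI subsetI)
  fix z assume "z \<in> (\<lambda>c. cl n (ev n c)) ` carrier (G n)"
  then show "z \<in> cl n ` carrier (W n)" using ev_closed by auto
 next
  fix z assume "z \<in> cl n ` carrier (W n)"
  then obtain u where u: "u \<in> carrier (W n)" "z = cl n u" by blast
  show "z \<in> (\<lambda>c. cl n (ev n c)) ` carrier (G n)"
   by (rule image_eqI[of _ _ "sec n u"]) (use u ev_sec[OF u(1)] in auto)
 qed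
 finally show ?thesis .
qed

lemma cl_inj: "u \<in> carrier (W n) ==> v \<in> carrier (W n) ==> cl n u = cl n v ==> u = v"
 using ev_sec[of u n] by (auto simp: cl_def)

lemma tensor_comm_group: "comm_group (tensor A (L n) N)"
 unfolding tensor_def by (rule comm_group.abelian_FactGroup[OF abelian_free_Abelian_group ts(1)])

lemma one_tensor: "\<one>\<^bsub>tensor A (L n) N\<^esub> = cl n (\<lambda>s. \<zero>\<^bsub>N\<^esub>)"
proof -
 have "cl n (\<lambda>s. \<zero>\<^bsub>N\<^esub>) = TS n"
  using ts_iff[of _ n] subgroup.mem_carrier[OF ts(1)[of n]] by (auto simp: cl_def)
 then show ?thesis by (simp add: tensor_def)
qed

lemma cl_mult:
 assumes "u \<in> carrier (W n)" "v \<in> carrier (W n)"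
 shows "cl n u \<otimes>\<^bsub>tensor A (L n) N\<^esub> cl n v = cl n (\<lambda>s. u s \<oplus>\<^bsub>N\<^esub> v s)"
proof -
 note su = ev_sec[OF assms(1)] and sv = ev_sec[OF assms(2)]
 have nm: "TS n \<lhd> G n" by (rule comm_group.subgroup_imp_normal[OF abelian_free_Abelian_group ts(1)])
 have "cl n u \<otimes>\<^bsub>tensor A (L n) N\<^esub> cl n v = (TS n #>\<^bsub>G n\<^esub> sec n u) <#>\<^bsub>G n\<^esub> (TS n #>\<^bsub>G n\<^esub> sec n v)"
  using coset_cl[of "sec n u" n] coset_cl[of "sec n v" n] su sv by (simp add: tensor_def)
 also have "\<dots> = TS n #>\<^bsub>G n\<^esub> (sec n u + sec n v)"
  using normal.rcos_sum[OF nm, of "sec n u" "sec n v"] su sv by simp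
 also have "\<dots> = cl n (ev n (sec n u + sec n v))"
  by (rule coset_cl) (use su sv keys_add[of "sec n u" "sec n v"] in auto)
 finally show ?thesis using su sv by (simp add: ev_add)
qed

abbreviation gen :: "(nat => 'a) => 'n => nat => 'n" where "gen l y \<equiv> (\<lambda>s. l s \<odot>\<^bsub>N\<^esub> y)"

lemma gen_W: "l \<in> carrier (L n) ==> y \<in> carrier N ==> gen l y \<in> carrier (W n)"
 by (simp add: free_fin W_fin lm[OF N])

lemma W_induct [consumes 1, case_names zero step]:
 assumes u: "u \<in> carrier (W n)" and zero: "P (\<lambda>s. \<zero>\<^bsub>N\<^esub>)"
  and step: "\<And>u l y. u \<in> carrier (W n) ==> l \<in> carrier (L n) ==> y \<in> carrier N ==> P u ==> P (\<lambda>s. u s \<oplus>\<^bsub>N\<^esub> gen l y s)"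
 shows "P u"
proof -
 have uc: "u s \<in> carrier N" for s using u by (simp add: W_fin)
 have "P (\<lambda>s. if s < k then u s else \<zero>\<^bsub>N\<^esub>)" if "k \<le> n" for k
  using that
 proof (induction k)
  case 0
  then show ?case using zero by simp
 next
  case (Suc k)
  have "(\<lambda>s. if s < k then u s else \<zero>\<^bsub>N\<^esub>) \<in> carrier (W n)" using Suc.prems uc by (auto simp: W_fin lm[OF N])
  from step[OF this basL[of k n] uc[of k]] Suc
  have "P (\<lambda>s. (if s < k then u s else \<zero>\<^bsub>N\<^esub>) \<oplus>\<^bsub>N\<^esub> gen (bas A k) (u k) s)" by simp
  moreover have "(\<lambda>s. (if s < k then u s else \<zero>\<^bsub>N\<^esub>) \<oplus>\<^bsub>N\<^esub> gen (bas A k) (u k) s) = (\<lambda>s. if s < Suc k then u s else \<zero>\<^bsub>N\<^esub>)"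
   by (auto simp: fun_eq_iff bas_def lm[OF N] uc less_Suc_eq)
  ultimately show ?case by simp
 qed
 moreover have "(\<lambda>s. if s < n then u s else \<zero>\<^bsub>N\<^esub>) = u" using u by (auto simp: W_fin fun_eq_iff)
 ultimately show ?thesis using order_refl[of n] by metis
qed

text \<open>Under the identification of tensor products with tuples, the map \<open>h \<otimes> N\<close>.\<close>

definition cmap :: "nat => nat => ((nat => 'a) => nat => 'a) => (nat => 'n) => nat => 'n" where
 "cmap n m h u = (\<lambda>s. if s < m then lin A N u (transp (op_ring A) n m h (bas A s)) else \<zero>\<^bsub>N\<^esub>)"

lemma lin_W: "u \<in> carrier (W n) ==> lin A N u \<in> mod_hom A (Fr A n) N"
 by (rule lin_hom[OF N]) (simp add: W_fin)

lemma transp_back: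
 assumes h: "h \<in> mod_hom (op_ring A) (L n) (L m)"
 shows "transp (op_ring A) n m h \<in> mod_hom A (Fr A m) (Fr A n)"
 using transp_hom[OF O h] by simp

lemma cmap_closed:
 assumes h: "h \<in> mod_hom (op_ring A) (L n) (L m)" and u: "u \<in> carrier (W n)"
 shows "cmap n m h u \<in> carrier (W m)"
 using mod_homD(1)[OF lin_W[OF u] mod_homD(1)[OF transp_back[OF h] bas_in[OF A, of _ "{..<m}"]]]
 by (simp add: cmap_def W_fin lm[OF N])

lemma lin_add:
 assumes u: "u \<in> carrier (W n)" "v \<in> carrier (W n)" and t: "t \<in> vecs A n"
 shows "lin A N (\<lambda>s. u s \<oplus>\<^bsub>N\<^esub> v s) t = lin A N u t \<oplus>\<^bsub>N\<^esub> lin A N v t"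
proof (rule free_hom_eq[OF A N lin_W hom_add[OF lin_W[OF u(1)] lin_W[OF u(2)] N] _ t])
 show "(\<lambda>s. u s \<oplus>\<^bsub>N\<^esub> v s) \<in> carrier (W n)" using u by (simp add: W_fin lm[OF N])
 fix s assume "s \<in> {..<n}"
 then show "lin A N (\<lambda>s. u s \<oplus>\<^bsub>N\<^esub> v s) (bas A s) = lin A N u (bas A s) \<oplus>\<^bsub>N\<^esub> lin A N v (bas A s)"
  using u lin_bas[OF N, of s "{..<n}"] by (simp add: W_fin lm[OF N])
qed

lemma cmap_add:
 assumes h: "h \<in> mod_hom (op_ring A) (L n) (L m)" and u: "u \<in> carrier (W n)" "v \<in> carrier (W n)"
 shows "cmap n m h (\<lambda>s. u s \<oplus>\<^bsub>N\<^esub> v s) = (\<lambda>s. cmap n m h u s \<oplus>\<^bsub>N\<^esub> cmap n m h v s)"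
 using lin_add[OF u mod_homD(1)[OF transp_back[OF h] bas_in[OF A, of _ "{..<m}"]]]
 by (auto simp: cmap_def fun_eq_iff lm[OF N])

lemma cmap_zero: "h \<in> mod_hom (op_ring A) (L n) (L m) ==> cmap n m h (\<lambda>s. \<zero>\<^bsub>N\<^esub>) = (\<lambda>s. \<zero>\<^bsub>N\<^esub>)"
 using hom_zero_ag(1)[of "W n" "W m" "cmap n m h", OF left_moduleD(2)[OF Wm] left_moduleD(2)[OF Wm]]
  cmap_closed cmap_add by simp

lemma cmap_gen:
 assumes h: "h \<in> mod_hom (op_ring A) (L n) (L m)" and x: "x \<in> carrier (L n)" and y: "y \<in> carrier N"
 shows "cmap n m h (\<lambda>s. x s \<odot>\<^bsub>N\<^esub> y) = (\<lambda>s. h x s \<odot>\<^bsub>N\<^esub> y)"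
proof
 fix s
 have xc: "x r \<in> carrier A" for r using x by (simp add: free_fin)
 have u: "(\<lambda>s. x s \<odot>\<^bsub>N\<^esub> y) \<in> carrier (W n)" using x y by (simp add: free_fin W_fin lm[OF N])
 have lin: "lin A N (\<lambda>s. x s \<odot>\<^bsub>N\<^esub> y) t = pair A n t x \<odot>\<^bsub>N\<^esub> y" if t: "t \<in> vecs A n" for t
 proof (rule free_hom_eq[OF A N lin_W[OF u] _ _ t])
  have "(\<lambda>a. a \<odot>\<^bsub>N\<^esub> y) \<in> mod_hom A (regular_bimodule A) N" by (rule mod_homI) (simp_all add: lm[OF N] y)
  from hom_comp[OF pair_hom[OF A xc] this] show "(\<lambda>t. pair A n t x \<odot>\<^bsub>N\<^esub> y) \<in> mod_hom A (Fr A n) N" .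
  fix r assume r: "r \<in> {..<n}"
  have "lin A N (\<lambda>s. x s \<odot>\<^bsub>N\<^esub> y) (bas A r) = x r \<odot>\<^bsub>N\<^esub> y"
   by (rule lin_bas[OF N r]) (simp add: lm[OF N] xc y)
  then show "lin A N (\<lambda>s. x s \<odot>\<^bsub>N\<^esub> y) (bas A r) = pair A n (bas A r) x \<odot>\<^bsub>N\<^esub> y"
   using r by (simp add: pair_bas[OF A xc])
 qed
 show "cmap n m h (\<lambda>s. x s \<odot>\<^bsub>N\<^esub> y) s = h x s \<odot>\<^bsub>N\<^esub> y"
 proof (cases "s < m")
  case True
  then have b: "bas A s \<in> vecs A m" by (intro bas_in[OF A]) simp
  have hx: "h x \<in> carrier (L m)" by (rule mod_homD(1)[OF h x])
  have "pair A n (transp (op_ring A) n m h (bas A s)) x = pair A m (bas A s) (h x)"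
   using pair_transp[OF O h x, of "bas A s"] b by (simp add: pair_op)
  also have "\<dots> = h x s" by (rule pair_bas[OF A]) (use hx True in \<open>simp_all add: free_fin\<close>)
  finally show ?thesis using True by (simp add: cmap_def lin[OF mod_homD(1)[OF transp_back[OF h] b]])
 next
  case False
  then show ?thesis using mod_homD(1)[OF h x] y by (simp add: cmap_def free_fin lm[OF N])
 qed
qed

lemma cmap_comp_zero:
 assumes h: "h \<in> mod_hom (op_ring A) (L n) (L m)" and k: "k \<in> mod_hom (op_ring A) (L m) (L p)"
  and kh: "\<And>x. x \<in> carrier (L n) ==> k (h x) = (\<lambda>s. \<zero>\<^bsub>A\<^esub>)" and u: "u \<in> carrier (W n)"
 shows "cmap m p k (cmap n m h u) = (\<lambda>s. \<zero>\<^bsub>N\<^esub>)"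
 using u
proof (induction rule: W_induct)
 case (step u l y)
 have hl: "h l \<in> carrier (L m)" by (rule mod_homD(1)[OF h step(2)])
 show ?case
  using step cmap_add[OF k cmap_closed[OF h step(1)] gen_W[OF hl step(3)]]
  by (simp add: cmap_add[OF h _ gen_W] cmap_gen[OF h] cmap_gen[OF k hl] kh lm[OF N] del: free_op_carrier)
qed (simp add: cmap_zero[OF h] cmap_zero[OF k])

lemma ev_extend:
 assumes h: "h \<in> mod_hom (op_ring A) (L n) (L m)" and c: "Poly_Mapping.keys c \<subseteq> carrier (L n) \<times> carrier N"
 shows "Poly_Mapping.keys (frag_extend (\<lambda>(x, y). frag_of (h x, y)) c) \<subseteq> carrier (L m) \<times> carrier N \<and>
  ev m (frag_extend (\<lambda>(x, y). frag_of (h x, y)) c) = cmap n m h (ev n c)"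
 using c
proof (induction rule: free_Abelian_group_induct[consumes 1, case_names 1 2 3])
 case 1
 then show ?case by (simp add: ev_zero cmap_zero[OF h])
next
 case (2 x y)
 let ?e = "frag_extend (\<lambda>(x, y). frag_of (h x, y))"
 have k: "Poly_Mapping.keys (x - y) \<subseteq> carrier (L n) \<times> carrier N" using keys_diff[of x y] 2 by blast
 have e: "?e x = ?e (x - y) + ?e y" by (simp add: frag_extend_diff)
 have k': "Poly_Mapping.keys (?e (x - y)) \<subseteq> carrier (L m) \<times> carrier N"
  using keys_diff[of "?e x" "?e y"] 2 by (auto simp: frag_extend_diff)
 have x: "ev n x = (\<lambda>s. ev n (x - y) s \<oplus>\<^bsub>N\<^esub> ev n y s)" using ev_add[OF k 2(2)] by simp
 have "(\<lambda>s. ev m (?e (x - y)) s \<oplus>\<^bsub>N\<^esub> ev m (?e y) s) = ev m (?e x)"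
  unfolding e using ev_add[OF k', of "?e y"] 2 by simp
 also have "\<dots> = (\<lambda>s. cmap n m h (ev n (x - y)) s \<oplus>\<^bsub>N\<^esub> cmap n m h (ev n y) s)"
  using 2 cmap_add[OF h ev_closed[OF k] ev_closed[OF 2(2)]] by (simp add: x)
 also have "cmap n m h (ev n y) = ev m (?e y)" using 2 by simp
 finally have eq: "ev m (?e (x - y)) s \<oplus>\<^bsub>N\<^esub> ev m (?e y) s = cmap n m h (ev n (x - y)) s \<oplus>\<^bsub>N\<^esub> ev m (?e y) s" for s
  by (rule fun_cong)
 interpret N: abelian_group N using N by (rule left_moduleD)
 have "ev m (?e (x - y)) = cmap n m h (ev n (x - y))"
 proof
  fix s show "ev m (?e (x - y)) s = cmap n m h (ev n (x - y)) s"
   using eq[of s] ev_closed[OF k'] ev_closed[of "?e y" m] 2 cmap_closed[OF h ev_closed[OF k]]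
   by (simp add: W_fin)
 qed
 then show ?case using k' by simp
next
 case (3 a)
 then obtain x y where a: "a = (x, y)" "x \<in> carrier (L n)" "y \<in> carrier N" by auto
 have hx: "h x \<in> carrier (L m)" by (rule mod_homD(1)[OF h a(2)])
 show ?case using a hx ev(2)[OF hx a(3)] ev(2)[OF a(2,3)] cmap_gen[OF h a(2,3)] by simp
qed

lemma dif_cl:
 assumes h: "h \<in> mod_hom (op_ring A) (L n) (L m)" and u: "u \<in> carrier (W n)"
 shows "coset_map (G m) (TS m) (frag_extend (\<lambda>(x, y). frag_of (h x, y))) (cl n u) = cl m (cmap n m h u)"
proof -
 let ?e = "frag_extend (\<lambda>(x, y). frag_of (h x, y))"
 have *: "TS m #>\<^bsub>G m\<^esub> ?e z = cl m (cmap n m h u)" if "z \<in> cl n u" for z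
  using ev_extend[OF h, of z] that coset_cl[of "?e z" m] by (simp add: cl_def)
 have "sec n u \<in> cl n u" using ev_sec[OF u] by (simp add: cl_def)
 then show ?thesis unfolding coset_map_def using * by blast
qed

text \<open>Exactness of the tensor product of a complex of free right modules with \<open>N\<close>, on tuples of elements of \<open>N\<close>.\<close>

lemma trivial_tensor_cohomology_iff:
 fixes C :: "(('a, nat => 'a) module, nat => 'a) cochain" and n :: "int => nat"
 assumes C: "module_complex (op_ring A) C" and obj: "\<And>j. obj C j = L (n j)"
 shows "trivial_group (cohomology (tensor_complex A C N) i) \<longleftrightarrow>
  (\<forall>u\<in>carrier (W (n i)). cmap (n i) (n (i + 1)) (dif C i) u = (\<lambda>s. \<zero>\<^bsub>N\<^esub>) -->
   (\<exists>v\<in>carrier (W (n (i - 1))). u = cmap (n (i - 1)) (n i) (dif C (i - 1)) v))"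
proof -
 let ?T = "tensor_complex A C N"
 have o: "obj ?T j = tensor A (L (n j)) N" for j by (simp add: tensor_complex_def obj)
 have h: "dif C j \<in> mod_hom (op_ring A) (L (n j)) (L (n (j + 1)))" for j
  using module_complexD(2)[OF C, of j] by (simp only: obj)
 have h': "dif C (j - 1) \<in> mod_hom (op_ring A) (L (n (j - 1))) (L (n j))" for j
  using module_complexD(3)[OF C, of j] by (simp only: obj)
 have hh: "dif C j (dif C (j - 1) x) = (\<lambda>s. \<zero>\<^bsub>A\<^esub>)" if "x \<in> carrier (L (n (j - 1)))" for j x
  using module_complexD(5)[OF C, of x j] that by (simp add: obj)
 let ?c = "\<lambda>j. cmap (n j) (n (j + 1)) (dif C j)"
 have d: "dif ?T j (cl (n j) u) = cl (n (j + 1)) (?c j u)" if "u \<in> carrier (W (n j))" for j u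
  using dif_cl[OF h that] by (simp add: tensor_complex_def obj)
 have d': "dif ?T (j - 1) (cl (n (j - 1)) u) = cl (n j) (?c (j - 1) u)" if "u \<in> carrier (W (n (j - 1)))" for j u
  using d[OF that] by simp
 have dhom: "dif ?T j \<in> hom (obj ?T j) (obj ?T (j + 1))" for j
 proof (rule homI)
  fix x y assume "x \<in> elts ?T j" "y \<in> elts ?T j"
  then obtain u v where uv: "u \<in> carrier (W (n j))" "x = cl (n j) u" "v \<in> carrier (W (n j))" "y = cl (n j) v"
   unfolding o carrier_tensor by blast
  note cu = cmap_closed[OF h uv(1)] cmap_closed[OF h uv(3)]
  show "dif ?T j x \<in> elts ?T (j + 1)" using cu d[OF uv(1)] uv(2) unfolding o carrier_tensor by blast
  have uvc: "(\<lambda>s. u s \<oplus>\<^bsub>N\<^esub> v s) \<in> carrier (W (n j))" using uv by (simp add: W_fin lm[OF N])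
  show "dif ?T j (x \<otimes>\<^bsub>obj ?T j\<^esub> y) = dif ?T j x \<otimes>\<^bsub>obj ?T (j + 1)\<^esub> dif ?T j y"
   unfolding o uv(2,4) cl_mult[OF uv(1,3)] d[OF uvc] d[OF uv(1)] d[OF uv(3)] cl_mult[OF cu] cmap_add[OF h uv(1,3)] ..
 qed
 have cl_lin: "?c j (?c (j - 1) u) = (\<lambda>s. \<zero>\<^bsub>N\<^esub>)" if u: "u \<in> carrier (W (n (j - 1)))" for j u
  using cmap_comp_zero[OF h' h hh u] by simp
 have dd: "dif ?T j (dif ?T (j - 1) x) = \<one>\<^bsub>obj ?T (j + 1)\<^esub>" if x: "x \<in> elts ?T (j - 1)" for j x
 proof -
  obtain u where u: "u \<in> carrier (W (n (j - 1)))" "x = cl (n (j - 1)) u" using x unfolding o carrier_tensor by blast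
  have "?c (j - 1) u \<in> carrier (W (n j))" using cmap_closed[OF h' u(1)] by simp
  then show ?thesis unfolding u(2) d'[OF u(1)] using d cl_lin[OF u(1)] by (simp add: o one_tensor)
 qed
 have z: "(\<lambda>s. \<zero>\<^bsub>N\<^esub>) \<in> carrier (W k)" for k by (simp add: W_fin lm[OF N])
 have "trivial_group (cohomology ?T i) \<longleftrightarrow>
  (\<forall>x\<in>elts ?T i. dif ?T i x = \<one>\<^bsub>obj ?T (i + 1)\<^esub> --> x \<in> dif ?T (i - 1) ` elts ?T (i - 1))"
  by (rule trivial_cohomology_iff) (use tensor_comm_group dhom[of i] dhom[of "i - 1"] dd in \<open>simp_all add: o\<close>)
 also have "\<dots> \<longleftrightarrow> (\<forall>u\<in>carrier (W (n i)). ?c i u = (\<lambda>s. \<zero>\<^bsub>N\<^esub>) --> (\<exists>v\<in>carrier (W (n (i - 1))). u = ?c (i - 1) v))"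
 proof (intro iffI ballI impI)
  fix u assume A: "\<forall>x\<in>elts ?T i. dif ?T i x = \<one>\<^bsub>obj ?T (i + 1)\<^esub> --> x \<in> dif ?T (i - 1) ` elts ?T (i - 1)"
   and u: "u \<in> carrier (W (n i))" "?c i u = (\<lambda>s. \<zero>\<^bsub>N\<^esub>)"
  have "cl (n i) u \<in> dif ?T (i - 1) ` elts ?T (i - 1)"
   by (rule A[rule_format]) (use u in \<open>auto simp: o carrier_tensor d one_tensor\<close>)
  then obtain v where v: "v \<in> carrier (W (n (i - 1)))" "cl (n i) u = cl (n i) (?c (i - 1) v)"
   unfolding o carrier_tensor using d' by auto
  have "?c (i - 1) v \<in> carrier (W (n i))" using cmap_closed[OF h' v(1)] by simp
  then have "u = ?c (i - 1) v" using cl_inj[OF u(1) _ v(2)] by blast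
  then show "\<exists>v\<in>carrier (W (n (i - 1))). u = ?c (i - 1) v" using v(1) by blast
 next
  fix x assume A: "\<forall>u\<in>carrier (W (n i)). ?c i u = (\<lambda>s. \<zero>\<^bsub>N\<^esub>) --> (\<exists>v\<in>carrier (W (n (i - 1))). u = ?c (i - 1) v)"
   and x: "x \<in> elts ?T i" "dif ?T i x = \<one>\<^bsub>obj ?T (i + 1)\<^esub>"
  obtain u where u: "u \<in> carrier (W (n i))" "x = cl (n i) u" using x(1) unfolding o carrier_tensor by blast
  have "cl (n (i + 1)) (?c i u) = cl (n (i + 1)) (\<lambda>s. \<zero>\<^bsub>N\<^esub>)"
   using x(2) d[OF u(1)] u(2) by (simp add: o one_tensor)
  from cl_inj[OF cmap_closed[OF h u(1)] z this] obtain v where v: "v \<in> carrier (W (n (i - 1)))" "u = ?c (i - 1) v"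
   using A u(1) by blast
  show "x \<in> dif ?T (i - 1) ` elts ?T (i - 1)"
   by (rule image_eqI[of _ _ "cl (n (i - 1)) v"]) (use u v d'[OF v(1)] in \<open>auto simp: o carrier_tensor\<close>)
 qed
 finally show ?thesis by simp
qed

text \<open>Tuples of length \<open>n\<close> in \<open>N\<close> are homomorphisms from a free left module of rank \<open>n\<close> to \<open>N\<close>; hence the tensor
 product is exact if the complex of homomorphisms from the transposed complex to \<open>N\<close> is.\<close>

lemma trivial_tensor_cohomologyI:
 fixes C :: "(('a, nat => 'a) module, nat => 'a) cochain" and n :: "int => nat"
 assumes C: "module_complex (op_ring A) C" and obj: "\<And>j. obj C j = L (n j)"
 defines "t \<equiv> \<lambda>j. transp (op_ring A) (n j) (n (j + 1)) (dif C j)"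
 assumes ex: "\<And>g. g \<in> mod_hom A (Fr A (n i)) N ==> (\<And>x. x \<in> vecs A (n (i + 1)) ==> g (t i x) = \<zero>\<^bsub>N\<^esub>) ==>
   \<exists>h\<in>mod_hom A (Fr A (n (i - 1))) N. \<forall>x\<in>vecs A (n i). g x = h (t (i - 1) x)"
 shows "trivial_group (cohomology (tensor_complex A C N) i)"
 unfolding trivial_tensor_cohomology_iff[OF C obj]
proof (intro ballI impI)
 have h: "dif C j \<in> mod_hom (op_ring A) (L (n j)) (L (n (j + 1)))" for j
  using module_complexD(2)[OF C, of j] by (simp only: obj)
 have tt: "t j \<in> mod_hom A (Fr A (n (j + 1))) (Fr A (n j))" for j
  unfolding t_def by (rule transp_back[OF h])
 have tt': "t (j - 1) \<in> mod_hom A (Fr A (n j)) (Fr A (n (j - 1)))" for j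
  using tt[of "j - 1"] by simp
 let ?c = "\<lambda>j. cmap (n j) (n (j + 1)) (dif C j)"
 have cc: "?c j u = (\<lambda>s. if s < n (j + 1) then lin A N u (t j (bas A s)) else \<zero>\<^bsub>N\<^esub>)" for j u
  by (auto simp: cmap_def t_def fun_eq_iff)
 have cc': "cmap (n (i - 1)) (n i) (dif C (i - 1)) u = (\<lambda>s. if s < n i then lin A N u (t (i - 1) (bas A s)) else \<zero>\<^bsub>N\<^esub>)" for u
  by (auto simp: cmap_def t_def fun_eq_iff)
 fix u assume u: "u \<in> carrier (W (n i))" "?c i u = (\<lambda>s. \<zero>\<^bsub>N\<^esub>)"
 have lz: "lin A N u (t i x) = \<zero>\<^bsub>N\<^esub>" if x: "x \<in> vecs A (n (i + 1))" for x
 proof (rule free_hom_eq[OF A N hom_comp[OF tt lin_W[OF u(1)]] hom_zero[OF N] _ x])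
  fix s assume "s \<in> {..<n (i + 1)}"
  then show "lin A N u (t i (bas A s)) = \<zero>\<^bsub>N\<^esub>" using fun_cong[OF u(2), of s] unfolding cc by simp
 qed
 then obtain h where h: "h \<in> mod_hom A (Fr A (n (i - 1))) N" "\<And>x. x \<in> vecs A (n i) ==> lin A N u x = h (t (i - 1) x)"
  using ex[OF lin_W[OF u(1)] lz] by blast
 define v where "v s = (if s < n (i - 1) then h (bas A s) else \<zero>\<^bsub>N\<^esub>)" for s
 have v: "v \<in> carrier (W (n (i - 1)))" using mod_homD(1)[OF h(1) bas_in[OF A]] by (simp add: v_def W_fin lm[OF N])
 have hv: "h x = lin A N v x" if x: "x \<in> vecs A (n (i - 1))" for x
 proof (rule free_hom_eq[OF A N h(1) lin_W[OF v] _ x])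
  fix s assume s: "s \<in> {..<n (i - 1)}"
  have "lin A N v (bas A s) = v s" by (rule lin_bas[OF N s]) (use v in \<open>simp add: W_fin\<close>)
  then show "h (bas A s) = lin A N v (bas A s)" using s by (simp add: v_def)
 qed
 have "u = cmap (n (i - 1)) (n i) (dif C (i - 1)) v"
 proof
  fix s
  show "u s = cmap (n (i - 1)) (n i) (dif C (i - 1)) v s"
  proof (cases "s < n i")
   case True
   then have b: "bas A s \<in> vecs A (n i)" by (intro bas_in[OF A]) simp
   have "u s = lin A N u (bas A s)"
    by (rule lin_bas[OF N, of s "{..<n i}", symmetric]) (use True u(1) in \<open>simp_all add: W_fin\<close>)
   then show ?thesis using True h(2)[OF b] hv[OF mod_homD(1)[OF tt' b]] unfolding cc' by simp
  next
   case False
   then show ?thesis using u(1) unfolding cc' by (simp add: W_fin)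
  qed
 qed
 then show "\<exists>v\<in>carrier (W (n (i - 1))). u = cmap (n (i - 1)) (n i) (dif C (i - 1)) v" using v by blast
qed

end

section \<open>Complete resolutions\<close>

text \<open>The dual of a free resolution is exact in high degrees; there it is cut off and continued to the
 left by a free resolution of a kernel.\<close>

lemma complete_resolution:
 fixes A :: "('a, 'r) ring_scheme"
 assumes A: "ring A" and noeth: "left_noetherian (op_ring A)" and fe: "free_exact A n f"
  and ex: "\<And>i. d \<le> i ==> free_hom_exact A n f (regular_bimodule A) i" and dk: "d \<le> k"
 shows "\<exists>(L :: (('a, nat => 'a) module, nat => 'a) cochain) \<nu>. module_complex (op_ring A) L \<and>
  (\<forall>j. obj L j = Fr (op_ring A) (\<nu> j)) \<and>
  (\<forall>j. \<forall>x\<in>elts L j. dif L j x = (\<lambda>s. \<zero>\<^bsub>A\<^esub>) --> x \<in> dif L (j - 1) ` elts L (j - 1)) \<and>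
  (\<forall>i\<ge>k. \<nu> (int i) = n i \<and> dif L (int i) = transp A (n (Suc i)) (n i) (f i))"
proof -
 let ?O = "op_ring A"
 note O = ring_op_ring[OF A] note F = left_module_free[OF A] and FO = left_module_free[OF O]
 note fd = free_exactD[OF fe]
 have tf: "transp A (n (Suc i)) (n i) (f i) \<in> mod_hom ?O (Fr ?O (n i)) (Fr ?O (n (Suc i)))" for i
  by (rule transp_hom[OF A fd(1)])
 have ttf: "transp A (n (Suc (Suc i))) (n (Suc i)) (f (Suc i)) (transp A (n (Suc i)) (n i) (f i) l) = (\<lambda>s. \<zero>\<^bsub>A\<^esub>)"
  if l: "l \<in> vecs ?O (n i)" for i l
 proof
  fix s
  let ?l1 = "transp A (n (Suc i)) (n i) (f i) l"
  have l1: "?l1 \<in> vecs ?O (n (Suc i))" by (rule mod_homD(1)[OF tf l])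
  show "transp A (n (Suc (Suc i))) (n (Suc i)) (f (Suc i)) ?l1 s = \<zero>\<^bsub>A\<^esub>"
  proof (cases "s < n (Suc (Suc i))")
   case True
   then have b: "bas A s \<in> vecs A (n (Suc (Suc i)))" by (intro bas_in[OF A]) simp
   have fb: "f (Suc i) (bas A s) \<in> vecs A (n (Suc i))" by (rule mod_homD(1)[OF fd(1) b])
   have "pair A (n (Suc i)) (f (Suc i) (bas A s)) ?l1 = pair A (n i) (f i (f (Suc i) (bas A s))) l"
    using pair_transp[OF A fd(1) fb, of l] l by simp
   also have "\<dots> = pair A (n i) (\<lambda>s. \<zero>\<^bsub>A\<^esub>) l" by (simp add: fd(2)[OF b])
   also have "\<dots> = \<zero>\<^bsub>A\<^esub>"
    using hom_simps(4)[OF pair_hom[OF A] F left_module_regular[OF A], of "n i" l] l by (simp add: free_fin)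
   finally show ?thesis using True by (simp add: transp_def)
  qed (simp add: transp_def)
 qed
 have exd: "l \<in> transp A (n (Suc i)) (n i) (f i) ` vecs ?O (n i)"
  if i: "d \<le> i" and l: "l \<in> vecs ?O (n (Suc i))"
   and z: "transp A (n (Suc (Suc i))) (n (Suc i)) (f (Suc i)) l = (\<lambda>s. \<zero>\<^bsub>A\<^esub>)" for i l
 proof -
  have lc: "l s \<in> carrier A" for s using l by (simp add: free_fin)
  have pz: "pair A (n (Suc i)) (f (Suc i) x) l = \<zero>\<^bsub>regular_bimodule A\<^esub>" if x: "x \<in> vecs A (n (Suc (Suc i)))" for x
  proof -
   have "pair A (n (Suc i)) (f (Suc i) x) l = pair A (n (Suc (Suc i))) x (\<lambda>s. \<zero>\<^bsub>A\<^esub>)"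
    using pair_transp[OF A fd(1) x, of l] l z by simp
   then show ?thesis
    using hom_simps(4)[OF pair_hom_right[OF A] FO left_module_regular[OF O], of "n (Suc (Suc i))" x] x
    by (simp add: free_fin)
  qed
  have ph: "(\<lambda>x. pair A (n (Suc i)) x l) \<in> mod_hom A (Fr A (n (Suc i))) (regular_bimodule A)"
   by (rule pair_hom[OF A]) (rule lc)
  have "\<exists>h\<in>mod_hom A (Fr A (n i)) (regular_bimodule A).
    \<forall>x\<in>vecs A (n (Suc i)). pair A (n (Suc i)) x l = h (f i x)"
   by (rule hom_exactD[OF ex[OF i], OF ph pz])
  then obtain h where h: "h \<in> mod_hom A (Fr A (n i)) (regular_bimodule A)"
   "\<And>x. x \<in> vecs A (n (Suc i)) ==> pair A (n (Suc i)) x l = h (f i x)" by blast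
  define l' where "l' s = (if s < n i then h (bas A s) else \<zero>\<^bsub>A\<^esub>)" for s
  have l': "l' \<in> vecs ?O (n i)"
   using mod_homD(1)[OF h(1) bas_in[OF A]] ag(2)[OF ring.is_abelian_group[OF A]] by (simp add: l'_def free_fin)
  have "l = transp A (n (Suc i)) (n i) (f i) l'"
  proof
   fix s
   show "l s = transp A (n (Suc i)) (n i) (f i) l' s"
   proof (cases "s < n (Suc i)")
    case True
    then have b: "bas A s \<in> vecs A (n (Suc i))" by (intro bas_in[OF A]) simp
    have "l s = pair A (n (Suc i)) (bas A s) l" by (rule pair_bas[OF A _ True, symmetric]) (rule lc)
    also have "\<dots> = h (f i (bas A s))" by (rule h(2)[OF b])
    also have "\<dots> = pair A (n i) (f i (bas A s)) l'"
     using hom_eq_pair[OF A h(1) mod_homD(1)[OF fd(1) b]] by (simp add: l'_def[abs_def])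
    finally show ?thesis using True by (simp add: transp_def)
   qed (use l in \<open>simp add: transp_def free_fin\<close>)
  qed
  then show ?thesis using l' by blast
 qed
 obtain m g where mg: "m 0 = n k" "free_exact ?O m g"
  "g 0 ` vecs ?O (m (Suc 0)) = {x \<in> vecs ?O (n k). transp A (n (Suc k)) (n k) (f k) x = \<zero>\<^bsub>Fr ?O (n (Suc k))\<^esub>}"
  using free_resolution_of_map[OF noeth FO tf[of k]] by blast
 note gd = free_exactD[OF mg(2)]
 define \<nu> where "\<nu> j = (if j \<ge> int k then n (nat j) else m (nat (int k - j)))" for j
 define L :: "(('a, nat => 'a) module, nat => 'a) cochain" where "L = \<lparr>obj = (\<lambda>j. Fr ?O (\<nu> j)),
  dif = (\<lambda>j. if j \<ge> int k then transp A (n (Suc (nat j))) (n (nat j)) (f (nat j)) else g (nat (int k - 1 - j)))\<rparr>"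
 have Lo: "obj L j = Fr ?O (\<nu> j)" for j by (simp add: L_def)
 have hi: "\<nu> (int (k + i)) = n (k + i)" "dif L (int (k + i)) = transp A (n (Suc (k + i))) (n (k + i)) (f (k + i))" for i
  by (simp_all add: \<nu>_def L_def nat_add_distrib)
 have lo: "\<nu> (int k - int i) = m i" "dif L (int k - int (Suc i)) = g i" for i
  by (cases i) (simp_all add: \<nu>_def L_def mg(1) nat_add_distrib)
 have cases: thesis if "\<And>i. j = int (k + i) ==> thesis" "\<And>i. j = int k - int (Suc i) ==> thesis" for j thesis
 proof (cases "j \<ge> int k")
  case True
  then show ?thesis by (intro that(1)[of "nat (j - int k)"]) simp
 next
  case False
  then show ?thesis by (intro that(2)[of "nat (int k - 1 - j)"]) simp
 qed
 have dL: "dif L j \<in> mod_hom ?O (obj L j) (obj L (j + 1))" for j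
 proof (rule cases[of j])
  fix i assume j: "j = int (k + i)"
  have e: "int (k + i) + 1 = int (k + Suc i)" by simp
  show ?thesis unfolding j e Lo hi using tf[of "k + i"] by simp
 next
  fix i assume j: "j = int k - int (Suc i)"
  have e: "int k - int (Suc i) + 1 = int k - int i" by simp
  show ?thesis unfolding j e Lo lo by (rule gd(1))
 qed
 have ddL: "dif L (j + 1) (dif L j x) = (\<lambda>s. \<zero>\<^bsub>A\<^esub>)" if x: "x \<in> elts L j" for j x
 proof (rule cases[of j])
  fix i assume j: "j = int (k + i)"
  have e: "int (k + i) + 1 = int (k + Suc i)" by simp
  show ?thesis using x ttf[of x "k + i"] unfolding j e Lo hi by simp
 next
  fix i assume j: "j = int k - int (Suc i)"
  have e: "int k - int (Suc i) + 1 = int k - int i" by simp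
  have x': "x \<in> vecs ?O (m (Suc i))" using x unfolding j Lo lo .
  show ?thesis
  proof (cases i)
   case 0
   have "g 0 x \<in> g 0 ` vecs ?O (m (Suc 0))" using x' 0 by blast
   then have "transp A (n (Suc k)) (n k) (f k) (g 0 x) = (\<lambda>s. \<zero>\<^bsub>A\<^esub>)" unfolding mg(3) by simp
   then show ?thesis using hi(2)[of 0] unfolding j e lo 0 by simp
  next
   case (Suc i')
   then show ?thesis using gd(2)[of x i'] x' unfolding j e[unfolded Suc] Suc lo by simp
  qed
 qed
 have X: "module_complex ?O L"
  unfolding module_complex_def using dL ddL by (simp add: Lo FO)
 have exL: "x \<in> dif L (j - 1) ` elts L (j - 1)" if x: "x \<in> elts L j" "dif L j x = (\<lambda>s. \<zero>\<^bsub>A\<^esub>)" for j x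
 proof (rule cases[of j])
  fix i assume j: "j = int (k + i)"
  show ?thesis
  proof (cases i)
   case 0
   have e: "int k - 1 = int k - int (Suc 0)" by simp
   have "x \<in> g 0 ` vecs ?O (m (Suc 0))"
    using x hi[of 0] unfolding mg(3) j 0 Lo by simp
   then show ?thesis unfolding j 0 by (simp only: add_0_right e Lo lo)
  next
   case (Suc i')
   have e: "int (k + Suc i') - 1 = int (k + i')" by simp
   show ?thesis using x exd[of "k + i'" x] dk unfolding j Suc e Lo hi by simp
  qed
 next
  fix i assume j: "j = int k - int (Suc i)"
  have e: "int k - int (Suc i) - 1 = int k - int (Suc (Suc i))" by simp
  show ?thesis using x gd(3)[of x i] unfolding j e Lo lo by simp
 qed
 have "\<nu> (int i) = n i \<and> dif L (int i) = transp A (n (Suc i)) (n i) (f i)" if "i \<ge> k" for i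
  using hi[of "i - k"] that by simp
 then show ?thesis using X Lo exL by blast
qed

text \<open>Homomorphisms from an exact complex \<open>L\<close> of free modules, unbounded in both directions, into a
 module \<open>B\<close>: every place of \<open>L\<close> is arbitrarily far to the left of some other place.\<close>

lemma hom_exact_unbounded:
 assumes R: "ring R" and L: "module_complex R L" and Lo: "\<And>j. obj L j = Fr R (\<nu> j)"
  and ex: "\<And>j x. x \<in> elts L j ==> dif L j x = (\<lambda>s. \<zero>\<^bsub>R\<^esub>) ==> x \<in> dif L (j - 1) ` elts L (j - 1)"
  and B: "\<And>n f i. free_exact R n f ==> d \<le> i ==> free_hom_exact R n f B i"
  and \<phi>: "\<phi> \<in> mod_hom R (obj L j) B" "\<And>x. x \<in> elts L (j - 1) ==> \<phi> (dif L (j - 1) x) = \<zero>\<^bsub>B\<^esub>"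
 shows "\<exists>\<psi>\<in>mod_hom R (obj L (j + 1)) B. \<forall>x\<in>elts L j. \<phi> x = \<psi> (dif L j x)"
proof -
 define n where "n i = \<nu> (j + 1 + int d - int i)" for i
 define f where "f i = dif L (j + int d - int i)" for i
 have o: "Fr R (n i) = obj L (j + 1 + int d - int i)" for i by (simp add: n_def Lo)
 have "free_exact R n f"
  unfolding free_exact_def
 proof (intro conjI allI)
  fix i
  have e: "j + 1 + int d - int (Suc i) = j + int d - int i" "j + 1 + int d - int i = j + int d - int i + 1"
   "j + 1 + int d - int (Suc (Suc i)) = j + int d - int i - 1" "j + int d - int (Suc i) = j + int d - int i - 1"
   by simp_all
  show "f i \<in> mod_hom R (Fr R (n (Suc i))) (Fr R (n i))"
   unfolding o f_def e by (rule module_complexD(2)[OF L])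
  show "exact_at R n f i"
   unfolding o f_def e
  proof (intro equalityI subsetI)
   fix x assume "x \<in> dif L (j + int d - int i - 1) ` elts L (j + int d - int i - 1)"
   then obtain y where y: "y \<in> elts L (j + int d - int i - 1)" "x = dif L (j + int d - int i - 1) y" by blast
   show "x \<in> {x \<in> elts L (j + int d - int i). dif L (j + int d - int i) x = (\<lambda>s. \<zero>\<^bsub>R\<^esub>)}"
    using mod_homD(1)[OF module_complexD(3)[OF L] y(1)] module_complexD(5)[OF L y(1)] unfolding y(2)
    by (simp add: Lo)
  qed (use ex in blast)
 qed
 from B[OF this order_refl] have "free_hom_exact R n f B d" .
 moreover have e: "n (Suc d) = \<nu> j" "n d = \<nu> (j + 1)" "n (Suc (Suc d)) = \<nu> (j - 1)" "f d = dif L j" "f (Suc d) = dif L (j - 1)"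
  by (simp_all add: n_def f_def)
 ultimately show ?thesis using \<phi> unfolding hom_exact_def e Lo by blast
qed

section \<open>Tensor products and homomorphisms\<close>

text \<open>As \<open>right_hom\<close>, but with the two structures of \<open>N\<close> given separately and a target that is only a right
 module.\<close>

definition rhom :: "('a, 'r) ring_scheme => ('a, 'n, 'x) module_scheme => ('a, 'n, 'z) module_scheme => ('a, 'i, 'y) module_scheme =>
  ('a, 'n => 'i) module" where
 "rhom R N Nr J = \<lparr>carrier = mod_hom (op_ring R) Nr J \<inter> extensional (carrier N),
   monoid.mult = undefined, one = undefined,
   ring.zero = (\<lambda>x\<in>carrier N. \<zero>\<^bsub>J\<^esub>), add = (\<lambda>f g. \<lambda>x\<in>carrier N. f x \<oplus>\<^bsub>J\<^esub> g x),
   smult = (\<lambda>a f. \<lambda>x\<in>carrier N. f (smult N a x))\<rparr>"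

lemma right_hom_rhom: "right_hom R N J = rhom R N (right_of N) (right_of J)"
 by (simp add: right_hom_def rhom_def)

lemma finsum_comm_hom:
 assumes "abelian_group M" "\<And>r. r \<in> T ==> a r \<in> carrier M" "\<And>r. r \<in> T ==> b r \<in> carrier M"
 shows "finsum M (\<lambda>r. a r \<oplus>\<^bsub>M\<^esub> b r) T = finsum M a T \<oplus>\<^bsub>M\<^esub> finsum M b T"
proof -
 interpret abelian_group M by fact
 show ?thesis by (rule finsum_addf) (use assms in auto)
qed

lemma dsum_hom:
 assumes M: "left_module R M" and J: "left_module R J" and \<phi>: "\<And>r. r < n ==> \<phi> r \<in> mod_hom R M J"
 shows "(\<lambda>u. finsum J (\<lambda>r. \<phi> r (u r)) {..<n::nat}) \<in> mod_hom R (dsum M {..<n}) J"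
proof -
 interpret J: abelian_group J using J by (rule left_moduleD)
 note dc = dsum_carrier_finite[OF finite_lessThan, of _ M n]
 note ph = mod_homD[OF \<phi>]
 show ?thesis
 proof (rule mod_homI)
  fix u assume u: "u \<in> carrier (dsum M {..<n})"
  then have uc: "u r \<in> carrier M" for r by (simp add: dc)
  show "finsum J (\<lambda>r. \<phi> r (u r)) {..<n} \<in> carrier J" by (rule J.finsum_closed) (auto simp: ph uc)
  fix a assume a: "a \<in> carrier R"
  have "finsum J (\<lambda>r. \<phi> r ((a \<odot>\<^bsub>dsum M {..<n}\<^esub> u) r)) {..<n} = finsum J (\<lambda>r. a \<odot>\<^bsub>J\<^esub> \<phi> r (u r)) {..<n}"
   by (rule J.finsum_cong') (auto simp: ph uc a lm[OF J])
  also have "\<dots> = a \<odot>\<^bsub>J\<^esub> finsum J (\<lambda>r. \<phi> r (u r)) {..<n}"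
   by (rule finsum_hom[OF J.abelian_group_axioms J.abelian_group_axioms, symmetric]) (simp_all add: lm[OF J] a ph uc)
  finally show "finsum J (\<lambda>r. \<phi> r ((a \<odot>\<^bsub>dsum M {..<n}\<^esub> u) r)) {..<n} = a \<odot>\<^bsub>J\<^esub> finsum J (\<lambda>r. \<phi> r (u r)) {..<n}" .
 next
  fix u v assume u: "u \<in> carrier (dsum M {..<n})" and v: "v \<in> carrier (dsum M {..<n})"
  then have uc: "u r \<in> carrier M" "v r \<in> carrier M" for r by (simp_all add: dc)
  have "finsum J (\<lambda>r. \<phi> r ((u \<oplus>\<^bsub>dsum M {..<n}\<^esub> v) r)) {..<n} = finsum J (\<lambda>r. \<phi> r (u r) \<oplus>\<^bsub>J\<^esub> \<phi> r (v r)) {..<n}"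
   by (rule J.finsum_cong') (auto simp: ph uc lm[OF J])
  also have "\<dots> = finsum J (\<lambda>r. \<phi> r (u r)) {..<n} \<oplus>\<^bsub>J\<^esub> finsum J (\<lambda>r. \<phi> r (v r)) {..<n}"
   by (rule finsum_comm_hom[OF J.abelian_group_axioms]) (simp_all add: ph uc)
  finally show "finsum J (\<lambda>r. \<phi> r ((u \<oplus>\<^bsub>dsum M {..<n}\<^esub> v) r)) {..<n} =
    finsum J (\<lambda>r. \<phi> r (u r)) {..<n} \<oplus>\<^bsub>J\<^esub> finsum J (\<lambda>r. \<phi> r (v r)) {..<n}" .
 qed
qed

locale tensor_bimodule =
 fixes A :: "('a, 'r) ring_scheme" and N :: "('a, 'n, 'x) bimodule_scheme"
 assumes bim: "bimodule A N"
begin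

lemma Nl: "left_module A N" and Nr: "left_module (op_ring A) (right_of N)"
 and bisc: "a \<in> carrier A ==> b \<in> carrier A ==> x \<in> carrier N ==> rsmult N (smult N a x) b = smult N a (rsmult N x b)"
 using bim by (auto simp: bimodule_def)

sublocale tensor_free A N using Nl by (rule tensor_free.intro)

abbreviation Wr :: "nat => ('a, nat => 'n) module" where "Wr n \<equiv> dsum (right_of N) {..<n}"
lemma rs: "x \<in> carrier N ==> b \<in> carrier A ==> rsmult N x b \<in> carrier N"
 "x \<in> carrier N ==> y \<in> carrier N ==> b \<in> carrier A ==> rsmult N (x \<oplus>\<^bsub>N\<^esub> y) b = rsmult N x b \<oplus>\<^bsub>N\<^esub> rsmult N y b"
 "b \<in> carrier A ==> rsmult N \<zero>\<^bsub>N\<^esub> b = \<zero>\<^bsub>N\<^esub>"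
 using lm(12,13,16)[OF Nr] by simp_all

lemma Wr_carrier [simp]: "carrier (Wr n) = carrier (W n)"
 by (auto simp: dsum_carrier_finite)

lemma Wrm: "left_module (op_ring A) (Wr n)" by (rule left_module_dsum[OF Nr])

lemma W_hom_eq:
 assumes J: "left_module (op_ring A) J" and f: "f \<in> mod_hom (op_ring A) (Wr n) J" and g: "g \<in> mod_hom (op_ring A) (Wr n) J"
  and eq: "\<And>l y. l \<in> carrier (L n) ==> y \<in> carrier N ==> f (gen l y) = g (gen l y)" and u: "u \<in> carrier (W n)"
 shows "f u = g u"
 using u
proof (induction rule: W_induct)
 case zero
 then show ?case using hom_simps(4)[OF f Wrm J] hom_simps(4)[OF g Wrm J] by simp
next
 case (step u l y)
 then show ?case
  using mod_homD(2)[OF f, of u "gen l y"] mod_homD(2)[OF g, of u "gen l y"] eq[of l y] gen_W[of l n y]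
  by (simp del: free_op_carrier)
qed

lemma cmap_hom:
 assumes h: "h \<in> mod_hom (op_ring A) (L n) (L m)"
 shows "cmap n m h \<in> mod_hom (op_ring A) (Wr n) (Wr m)"
proof (rule mod_homI)
 fix a u assume a: "a \<in> carrier (op_ring A)" and u: "u \<in> carrier (Wr n)"
 have ua: "(\<lambda>s. rsmult N (u s) a) \<in> carrier (W n)" using u a by (simp add: W_fin rs)
 have ra: "(\<lambda>x. rsmult N x a) \<in> mod_hom A N N" by (rule mod_homI) (use a in \<open>simp_all add: rs bisc\<close>)
 have "lin A N (\<lambda>s. rsmult N (u s) a) t = rsmult N (lin A N u t) a" if t: "t \<in> vecs A n" for t
 proof (rule free_hom_eq[OF A N lin_W[OF ua] hom_comp[OF lin_W ra] _ t])
  show "u \<in> carrier (W n)" using u by simp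
  fix s assume s: "s \<in> {..<n}"
  show "lin A N (\<lambda>s. rsmult N (u s) a) (bas A s) = rsmult N (lin A N u (bas A s)) a"
   using lin_bas[OF N s, of u] lin_bas[OF N s, of "\<lambda>s. rsmult N (u s) a"] u ua by (simp add: W_fin)
 qed
 then show "cmap n m h (a \<odot>\<^bsub>Wr n\<^esub> u) = a \<odot>\<^bsub>Wr m\<^esub> cmap n m h u"
  using mod_homD(1)[OF transp_back[OF h] bas_in[OF A, of _ "{..<m}"]] a by (auto simp: cmap_def fun_eq_iff rs)
qed (simp_all add: cmap_closed[OF h] cmap_add[OF h])

lemma rhomD:
 assumes "x \<in> mod_hom (op_ring A) (L n) (rhom A N (right_of N) J)"
 shows "l \<in> carrier (L n) ==> x l \<in> mod_hom (op_ring A) (right_of N) J"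
  "l \<in> carrier (L n) ==> l' \<in> carrier (L n) ==> y \<in> carrier N ==> x (\<lambda>s. l s \<oplus>\<^bsub>A\<^esub> l' s) y = x l y \<oplus>\<^bsub>J\<^esub> x l' y"
  "l \<in> carrier (L n) ==> a \<in> carrier A ==> y \<in> carrier N ==> x (\<lambda>s. l s \<otimes>\<^bsub>A\<^esub> a) y = x l (a \<odot>\<^bsub>N\<^esub> y)"
 using mod_homD(1)[OF assms, of l] mod_homD(2)[OF assms, of l l'] mod_homD(3)[OF assms, of a l]
 by (simp_all add: rhom_def)

text \<open>The adjunction between tensor product and homomorphisms, with tuples in place of tensors: right linear maps
 from \<open>L n\<close> to homomorphisms on \<open>N\<close> are right linear maps on \<open>W n\<close>.\<close>

lemma adjunct:
 assumes J: "left_module (op_ring A) J" and x: "x \<in> mod_hom (op_ring A) (L n) (rhom A N (right_of N) J)"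
 shows "\<exists>\<xi>\<in>mod_hom (op_ring A) (Wr n) J. \<forall>l\<in>carrier (L n). \<forall>y\<in>carrier N. \<xi> (gen l y) = x l y"
proof (rule bexI)
 note xd = rhomD[OF x]
 let ?\<xi> = "\<lambda>u. finsum J (\<lambda>r. x (bas A r) (u r)) {..<n}"
 show \<xi>: "?\<xi> \<in> mod_hom (op_ring A) (Wr n) J"
  by (rule dsum_hom[OF Nr J]) (rule xd(1)[OF basL])
 note xs = hom_simps[OF \<xi> Wrm J, unfolded Wr_carrier]
 interpret J: abelian_group J using J by (rule left_moduleD)
 have "?\<xi> (gen l y) = x l y" if l: "l \<in> carrier (L n)" and y: "y \<in> carrier N" for l y
  using O l
 proof (induction rule: free_induct)
  case zero
  have "x (\<lambda>s. \<zero>\<^bsub>A\<^esub> \<oplus>\<^bsub>A\<^esub> \<zero>\<^bsub>A\<^esub>) y = x (\<lambda>s. \<zero>\<^bsub>A\<^esub>) y \<oplus>\<^bsub>J\<^esub> x (\<lambda>s. \<zero>\<^bsub>A\<^esub>) y"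
   using xd(2)[OF _ _ y, of "\<lambda>s. \<zero>\<^bsub>A\<^esub>" "\<lambda>s. \<zero>\<^bsub>A\<^esub>"] lm(2)[OF left_module_free[OF O, of "{..<n}"]] by simp
  moreover have "x (\<lambda>s. \<zero>\<^bsub>A\<^esub>) y \<in> carrier J"
   using mod_homD(1)[OF xd(1), of "\<lambda>s. \<zero>\<^bsub>A\<^esub>" y] lm(2)[OF left_module_free[OF O, of "{..<n}"]] y by simp
  ultimately have "x (\<lambda>s. \<zero>\<^bsub>A\<^esub>) y = \<zero>\<^bsub>J\<^esub>"
   using ag(2)[OF ring.is_abelian_group[OF A]] ag(4)[OF ring.is_abelian_group[OF A]] by simp
  then show ?case using xs(4) y by (simp add: lm[OF N])
 next
  case (step w a s)
  have s: "s < n" and a: "a \<in> carrier A" and wA: "w r \<in> carrier A" for r using step by (auto simp: free_fin)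
  have b: "bas A s \<in> carrier (L n)" by (rule basL[OF s])
  have ab: "(\<lambda>r. bas A s r \<otimes>\<^bsub>A\<^esub> a) \<in> carrier (L n)" using lm(12)[OF Lm step(2), of "bas A s"] b by simp
  have ay: "a \<odot>\<^bsub>N\<^esub> y \<in> carrier N" by (rule lm(12)[OF N a y])
  have bA: "bas A s r \<in> carrier A" for r using b by (simp add: free_fin)
  have e: "gen (\<lambda>r. w r \<oplus>\<^bsub>A\<^esub> bas A s r \<otimes>\<^bsub>A\<^esub> a) y = gen w y \<oplus>\<^bsub>Wr n\<^esub> gen (bas A s) (a \<odot>\<^bsub>N\<^esub> y)"
   using wA bA a y ring.ring_simprules(5)[OF A] by (simp add: lm[OF N] fun_eq_iff)
  have "?\<xi> (gen (\<lambda>r. w r \<oplus>\<^bsub>A\<^esub> bas A s r \<otimes>\<^bsub>A\<^esub> a) y) = ?\<xi> (gen w y) \<oplus>\<^bsub>J\<^esub> ?\<xi> (gen (bas A s) (a \<odot>\<^bsub>N\<^esub> y))"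
   by (rule trans[OF arg_cong[OF e, of ?\<xi>] xs(2)[OF gen_W[OF step(1) y] gen_W[OF b ay]]])
  also have "?\<xi> (gen (bas A s) (a \<odot>\<^bsub>N\<^esub> y)) = x (bas A s) (a \<odot>\<^bsub>N\<^esub> y)"
  proof -
   have xz: "x (bas A r) \<zero>\<^bsub>N\<^esub> = \<zero>\<^bsub>J\<^esub>" if "r < n" for r
    using hom_simps(4)[OF xd(1)[OF basL[OF that]] Nr J] by simp
   have xc: "x (bas A r) z \<in> carrier J" if "r < n" "z \<in> carrier N" for r z
    using mod_homD(1)[OF xd(1)[OF basL[OF that(1)]]] that(2) by simp
   have "?\<xi> (gen (bas A s) (a \<odot>\<^bsub>N\<^esub> y)) = finsum J (\<lambda>r. if s = r then x (bas A r) (a \<odot>\<^bsub>N\<^esub> y) else \<zero>\<^bsub>J\<^esub>) {..<n}"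
    by (rule J.finsum_cong') (auto simp: bas_def[of A s] xc xz ay lm[OF N])
   also have "\<dots> = x (bas A s) (a \<odot>\<^bsub>N\<^esub> y)"
    by (rule J.finsum_singleton) (use s xc ay in auto)
   finally show ?thesis .
  qed
  also have "?\<xi> (gen w y) = x w y" by (rule step(4))
  also have "x w y \<oplus>\<^bsub>J\<^esub> x (bas A s) (a \<odot>\<^bsub>N\<^esub> y) = x (\<lambda>r. w r \<oplus>\<^bsub>A\<^esub> bas A s r \<otimes>\<^bsub>A\<^esub> a) y"
   using xd(2)[OF step(1) ab y] xd(3)[OF b a y] by simp
  finally show ?case by simp
 qed
 then show "\<forall>l\<in>carrier (L n). \<forall>y\<in>carrier N. ?\<xi> (gen l y) = x l y" by blast
qed

lemma coadjunct:
 assumes J: "left_module (op_ring A) J" and \<eta>: "\<eta> \<in> mod_hom (op_ring A) (Wr n) J"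
 shows "(\<lambda>l. \<lambda>y\<in>carrier N. \<eta> (gen l y)) \<in> mod_hom (op_ring A) (L n) (rhom A N (right_of N) J)"
proof (rule mod_homI)
 note es = hom_simps[OF \<eta> Wrm J, unfolded Wr_carrier]
 fix l assume l: "l \<in> carrier (L n)"
 then have lA: "l r \<in> carrier A" for r by (simp add: free_fin)
 have "(\<lambda>y. \<eta> (gen l y)) \<in> mod_hom (op_ring A) (right_of N) J"
 proof (rule mod_homI)
  fix y z assume yz: "y \<in> carrier (right_of N)" "z \<in> carrier (right_of N)"
  have "gen l (y \<oplus>\<^bsub>right_of N\<^esub> z) = gen l y \<oplus>\<^bsub>Wr n\<^esub> gen l z" using yz lA by (simp add: lm[OF N])
  then show "\<eta> (gen l (y \<oplus>\<^bsub>right_of N\<^esub> z)) = \<eta> (gen l y) \<oplus>\<^bsub>J\<^esub> \<eta> (gen l z)"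
   using es(2)[OF gen_W[OF l, of y] gen_W[OF l, of z]] yz by simp
 next
  fix a y assume ay: "a \<in> carrier (op_ring A)" "y \<in> carrier (right_of N)"
  have "gen l (a \<odot>\<^bsub>right_of N\<^esub> y) = a \<odot>\<^bsub>Wr n\<^esub> gen l y" using ay lA by (simp add: bisc)
  then show "\<eta> (gen l (a \<odot>\<^bsub>right_of N\<^esub> y)) = a \<odot>\<^bsub>J\<^esub> \<eta> (gen l y)" using es(3)[OF ay(1) gen_W[OF l, of y]] ay by simp
 qed (use es(1) gen_W[OF l] in simp)
 then show "(\<lambda>y\<in>carrier N. \<eta> (gen l y)) \<in> carrier (rhom A N (right_of N) J)"
  using restrict_hom[OF Nr] by (simp add: rhom_def)
 fix a assume a: "a \<in> carrier (op_ring A)"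
 show "(\<lambda>y\<in>carrier N. \<eta> (gen (a \<odot>\<^bsub>L n\<^esub> l) y)) = a \<odot>\<^bsub>rhom A N (right_of N) J\<^esub> (\<lambda>y\<in>carrier N. \<eta> (gen l y))"
  using a lA by (auto simp: rhom_def lm[OF N] intro!: restrict_ext)
next
 note es = hom_simps[OF \<eta> Wrm J, unfolded Wr_carrier]
 fix l l' assume l: "l \<in> carrier (L n)" "l' \<in> carrier (L n)"
 have "\<eta> (gen (l \<oplus>\<^bsub>L n\<^esub> l') y) = \<eta> (gen l y) \<oplus>\<^bsub>J\<^esub> \<eta> (gen l' y)" if y: "y \<in> carrier N" for y
 proof -
  have "gen (l \<oplus>\<^bsub>L n\<^esub> l') y = gen l y \<oplus>\<^bsub>Wr n\<^esub> gen l' y" using y l by (simp add: free_fin lm[OF N])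
  then show ?thesis using es(2)[OF gen_W[OF l(1) y] gen_W[OF l(2) y]] by simp
 qed
 then show "(\<lambda>y\<in>carrier N. \<eta> (gen (l \<oplus>\<^bsub>L n\<^esub> l') y)) =
   (\<lambda>y\<in>carrier N. \<eta> (gen l y)) \<oplus>\<^bsub>rhom A N (right_of N) J\<^esub> (\<lambda>y\<in>carrier N. \<eta> (gen l' y))"
  by (auto simp: rhom_def simp del: dsum_simps intro!: restrict_ext)
qed

end

section \<open>Isomorphisms in the derived category\<close>

definition bd :: "(('a, 'b, 'x) module_scheme, 'b) cochain => int => 'b set" where
 "bd X i = dif X (i - 1) ` elts X (i - 1)"

definition cyc :: "(('a, 'b, 'x) module_scheme, 'b) cochain => int => 'b set" where
 "cyc X i = {x \<in> elts X i. dif X i x = null X (i + 1)}"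

lemma bd_submodule: "module_complex R X ==> submodule (bd X i) R (obj X i)"
 unfolding bd_def by (rule submodule_image[OF module_complexD(1) module_complexD(1) module_complexD(3)])

lemma coh_injD: "coh_inj X Y f ==> x \<in> cyc X i ==> f i x \<in> bd Y i ==> x \<in> bd X i"
 by (simp add: coh_inj_def bd_def cyc_def)

lemma coh_surjD:
 assumes "coh_surj X Y f" "y \<in> cyc Y i"
 shows "\<exists>x\<in>cyc X i. \<exists>w\<in>bd Y i. y = f i x \<oplus>\<^bsub>obj Y i\<^esub> w"
 using assms unfolding coh_surj_def bd_def cyc_def by blast

lemma chain_map_bd:
 assumes f: "chain_map R X Y f" and x: "x \<in> bd X i" shows "f i x \<in> bd Y i"
 using x chain_mapD(3)[OF f, of _ i] mod_homD(1)[OF chain_mapD(1)[OF f, of "i - 1"]] by (auto simp: bd_def)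

lemma chain_map_cyc:
 assumes X: "module_complex R X" and Y: "module_complex R Y" and f: "chain_map R X Y f" and x: "x \<in> cyc X i"
 shows "f i x \<in> cyc Y i"
 using x chain_mapD(2)[OF f, of x i] mod_homD(1)[OF chain_mapD(1)[OF f, of i], of x]
  hom_simps(4)[OF chain_mapD(1)[OF f, of "i + 1"] module_complexD(1)[OF X] module_complexD(1)[OF Y]]
 by (simp add: cyc_def)

lemma chain_map_comp:
 assumes f: "chain_map R X Y f" and g: "chain_map R Y Z g"
 shows "chain_map R X Z (\<lambda>i. g i \<circ> f i)"
 unfolding chain_map_def comp_def
proof (intro allI conjI ballI)
 show "(\<lambda>x. g i (f i x)) \<in> mod_hom R (obj X i) (obj Z i)" for i
  by (rule hom_comp[OF chain_mapD(1)[OF f] chain_mapD(1)[OF g]])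
qed (simp add: chain_mapD(2)[OF f] chain_mapD(2)[OF g] mod_homD(1)[OF chain_mapD(1)[OF f]])

lemma sub_cancel:
 assumes M: "left_module R M" and K: "submodule K R M" and x: "x \<in> carrier M" and y: "y \<in> K"
 shows "x \<oplus>\<^bsub>M\<^esub> y \<in> K \<longleftrightarrow> x \<in> K"
proof
 note k = submoduleD[OF M K]
 interpret R: ring R using M by (rule left_moduleD)
 assume "x \<oplus>\<^bsub>M\<^esub> y \<in> K"
 then have "x \<oplus>\<^bsub>M\<^esub> y \<oplus>\<^bsub>M\<^esub> (\<ominus>\<^bsub>R\<^esub> \<one>\<^bsub>R\<^esub>) \<odot>\<^bsub>M\<^esub> y \<in> K" using y by (intro k(3)[OF _ k(4)]) simp_all
 then show "x \<in> K" using x k(1)[OF y] by (simp add: lm_neg_one[OF M] lms[OF M])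
qed (use submoduleD(3)[OF M K] y in simp)

lemma homotopic_bd:
 assumes X: "module_complex R X" and Y: "module_complex R Y" and h: "homotopic R X Y f g"
  and g: "\<And>x. x \<in> elts X i ==> g i x \<in> elts Y i" and x: "x \<in> cyc X i"
 shows "f i x \<in> bd Y i \<longleftrightarrow> g i x \<in> bd Y i"
proof -
 obtain s where s: "\<And>i. s i \<in> mod_hom R (obj X i) (obj Y (i - 1))"
  "\<And>i x. x \<in> elts X i ==>
    f i x = g i x \<oplus>\<^bsub>obj Y i\<^esub> (dif Y (i - 1) (s i x) \<oplus>\<^bsub>obj Y i\<^esub> s (i + 1) (dif X i x))"
  using h unfolding homotopic_def by blast
 note Xm = module_complexD(1)[OF X] and Ym = module_complexD(1)[OF Y]
 have xc: "x \<in> elts X i" "dif X i x = null X (i + 1)" using x by (simp_all add: cyc_def)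
 have "s (i + 1) (dif X i x) = null Y i" using hom_simps(4)[OF s(1)[of "i + 1"] Xm Ym] xc(2) by simp
 moreover have sx: "dif Y (i - 1) (s i x) \<in> bd Y i" using mod_homD(1)[OF s(1) xc(1)] by (simp add: bd_def)
 ultimately have "f i x = g i x \<oplus>\<^bsub>obj Y i\<^esub> dif Y (i - 1) (s i x)"
  using s(2)[OF xc(1)] submoduleD(1)[OF Ym bd_submodule[OF Y] sx] by (simp add: lm[OF Ym])
 then show ?thesis using sub_cancel[OF Ym bd_submodule[OF Y] g[OF xc(1)] sx] by simp
qed

text \<open>Only the underlying quasi-isomorphisms of an isomorphism of the derived category are needed.  That the second
 leg \<open>f\<close> of the roof is a quasi-isomorphism follows because the roof has an inverse: \<open>f\<close> is injective in
 cohomology since one composite is the identity, and surjective since the other one is.\<close>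

lemma derived_isomorphicD:
 assumes iso: "derived_isomorphic TYPE('u) R X Y" and X: "module_complex R X" and Y: "module_complex R Y"
 shows "\<exists>(Z :: (('a, 'u) module, 'u) cochain) s f. module_complex (R :: ('a, 'r) ring_scheme) Z \<and>
  chain_map R Z X s \<and> coh_inj Z X s \<and> coh_surj Z X s \<and>
  chain_map R Z Y f \<and> coh_inj Z Y f \<and> coh_surj Z Y f"
proof -
 obtain \<alpha> :: "('a, 'u, _, _) roof" and \<beta> :: "('a, 'u, _, _) roof" and \<gamma> :: "('a, 'u, _, _) roof" and \<delta> :: "('a, 'u, _, _) roof" where r: "is_roof R X Y \<alpha>" "is_roof R Y X \<beta>" "roof_composite R Y \<alpha> \<beta> \<gamma>"
   "roof_equiv TYPE('u) R X X \<gamma> (id_roof X)" "roof_composite R X \<beta> \<alpha> \<delta>" "roof_equiv TYPE('u) R Y Y \<delta> (id_roof Y)"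
  using iso unfolding derived_isomorphic_def by blast
 obtain Z s f where a: "\<alpha> = (Z, s, f)" by (metis prod_cases3)
 obtain Z' t g where b: "\<beta> = (Z', t, g)" by (metis prod_cases3)
 obtain W p q where c: "\<gamma> = (W, p, q)" by (metis prod_cases3)
 obtain V p2 q2 where d: "\<delta> = (V, p2, q2)" by (metis prod_cases3)
 have Z: "module_complex R Z" "quasi_iso R Z X s" "chain_map R Z Y f" using r(1) by (auto simp: a is_roof_def)
 have Z': "module_complex R Z'" "quasi_iso R Z' Y t" "chain_map R Z' X g" using r(2) by (auto simp: b is_roof_def)
 obtain h k where hk: "module_complex R W" "quasi_iso R W Z h" "chain_map R W Z' k"
  "homotopic R W Y (\<lambda>i. f i \<circ> h i) (\<lambda>i. t i \<circ> k i)" "p = (\<lambda>i. s i \<circ> h i)" "q = (\<lambda>i. g i \<circ> k i)"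
  using r(3) by (auto simp: a b c roof_composite_def)
 obtain h2 k2 where hk2: "module_complex R V" "quasi_iso R V Z' h2" "chain_map R V Z k2"
  "homotopic R V X (\<lambda>i. g i \<circ> h2 i) (\<lambda>i. s i \<circ> k2 i)" "p2 = (\<lambda>i. t i \<circ> h2 i)" "q2 = (\<lambda>i. f i \<circ> k2 i)"
  using r(5) by (auto simp: a b d roof_composite_def)
 obtain W' :: "(('a, 'u) module, 'u) cochain" and h' k' where e: "module_complex R W'" "chain_map R W' W h'" "chain_map R W' X k'"
  "quasi_iso R W' X (\<lambda>i. p i \<circ> h' i)" "homotopic R W' X (\<lambda>i. p i \<circ> h' i) (\<lambda>i. (\<lambda>x. x) \<circ> k' i)"
  "homotopic R W' X (\<lambda>i. q i \<circ> h' i) (\<lambda>i. (\<lambda>x. x) \<circ> k' i)"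
  using r(4) unfolding c roof_equiv_def id_roof_def by blast
 obtain V' :: "(('a, 'u) module, 'u) cochain" and h2' k2' where e2: "module_complex R V'" "chain_map R V' V h2'" "chain_map R V' Y k2'"
  "quasi_iso R V' Y (\<lambda>i. p2 i \<circ> h2' i)" "homotopic R V' Y (\<lambda>i. p2 i \<circ> h2' i) (\<lambda>i. (\<lambda>x. x) \<circ> k2' i)"
  "homotopic R V' Y (\<lambda>i. q2 i \<circ> h2' i) (\<lambda>i. (\<lambda>x. x) \<circ> k2' i)"
  using r(6) unfolding d roof_equiv_def id_roof_def by blast
 have sm: "chain_map R Z X s" and tm: "chain_map R Z' Y t" and hm: "chain_map R W Z h" and h2m: "chain_map R V Z' h2"
  and pm': "chain_map R W' X (\<lambda>i. p i \<circ> h' i)" and p2m': "chain_map R V' Y (\<lambda>i. p2 i \<circ> h2' i)"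
  using Z(2) Z'(2) hk(2) hk2(2) e(4) e2(4) by (simp_all add: quasi_iso_def)
 have pm: "chain_map R W X p" unfolding hk(5) by (rule chain_map_comp[OF hm sm])
 have qm: "chain_map R W X q" unfolding hk(6) by (rule chain_map_comp[OF hk(3) Z'(3)])
 note si = quasi_iso_coh[OF Z(1) X Z(2)] and ti = quasi_iso_coh[OF Z'(1) Y Z'(2)] and hi = quasi_iso_coh[OF hk(1) Z(1) hk(2)]
  and phi = quasi_iso_coh[OF e(1) X e(4)] and p2hi = quasi_iso_coh[OF e2(1) Y e2(4)]
 note cl = mod_homD(1)[OF chain_mapD(1)]
 note Xm = module_complexD(1)[OF X] and Ym = module_complexD(1)[OF Y] and Wm = module_complexD(1)[OF hk(1)]
  and Zm = module_complexD(1)[OF Z(1)]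
 have "coh_inj Z Y f"
  unfolding coh_inj_def bd_def[symmetric]
 proof (intro allI ballI impI)
  fix i z assume zc: "z \<in> elts Z i" "dif Z i z = null Z (i + 1)" and fz: "f i z \<in> bd Y i"
  have z: "z \<in> cyc Z i" using zc by (simp add: cyc_def)
  obtain c w where cw: "c \<in> cyc W i" "w \<in> bd Z i" "z = h i c \<oplus>\<^bsub>obj Z i\<^esub> w"
   using coh_surjD[OF hi(2) z] by blast
  have cc: "c \<in> elts W i" using cw(1) by (simp add: cyc_def)
  have hc: "h i c \<in> elts Z i" by (rule cl[OF hm cc])
  have wc: "w \<in> elts Z i" by (rule submoduleD(1)[OF Zm bd_submodule[OF Z(1)] cw(2)])
  have "f i z = f i (h i c) \<oplus>\<^bsub>obj Y i\<^esub> f i w" unfolding cw(3) by (rule mod_homD(2)[OF chain_mapD(1)[OF Z(3)] hc wc])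
  then have "f i (h i c) \<in> bd Y i"
   using fz sub_cancel[OF Ym bd_submodule[OF Y] cl[OF Z(3) hc] chain_map_bd[OF Z(3) cw(2)]] by simp
  then have "t i (k i c) \<in> bd Y i"
   using homotopic_bd[OF hk(1) Y hk(4) _ cw(1)] cl[OF tm cl[OF hk(3)]] by simp
  then have "k i c \<in> bd Z' i" by (rule coh_injD[OF ti(1) chain_map_cyc[OF hk(1) Z'(1) hk(3) cw(1)]])
  then have qc: "q i c \<in> bd X i" using chain_map_bd[OF Z'(3)] by (simp add: hk(6))
  obtain x w' where xw: "x \<in> cyc W' i" "w' \<in> bd X i" "p i c = p i (h' i x) \<oplus>\<^bsub>obj X i\<^esub> w'"
   using coh_surjD[OF phi(2) chain_map_cyc[OF hk(1) X pm cw(1)]] by auto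
  have xc: "x \<in> elts W' i" using xw(1) by (simp add: cyc_def)
  have hx: "h' i x \<in> elts W i" "h' i x \<in> cyc W i" by (rule cl[OF e(2) xc], rule chain_map_cyc[OF e(1) hk(1) e(2) xw(1)])
  define u where "u = c \<oplus>\<^bsub>obj W i\<^esub> \<ominus>\<^bsub>obj W i\<^esub> h' i x"
  have uc: "u \<in> elts W i" by (simp add: u_def lm[OF Wm] cc hx)
  have ucyc: "u \<in> cyc W i"
   using uc cw(1) hx(2) hom_simps[OF module_complexD(2)[OF hk(1), of i] Wm Wm] by (simp add: cyc_def u_def lm[OF Wm])
  have c_eq: "c = u \<oplus>\<^bsub>obj W i\<^esub> h' i x" by (simp add: u_def lms[OF Wm] cc hx)
  have w'c: "w' \<in> elts X i" by (rule submoduleD(1)[OF Xm bd_submodule[OF X] xw(2)])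
  note ps = hom_simps[OF chain_mapD(1)[OF pm] Wm Xm]
  have "p i u = w'" using cl[OF pm cc] cl[OF pm hx(1)] w'c xw(3) by (simp add: u_def ps lm[OF Wm] cc hx lms[OF Xm])
  then have "p i u \<in> bd X i" using xw(2) by simp
  then have "h i u \<in> bd Z i"
   using coh_injD[OF si(1) chain_map_cyc[OF hk(1) Z(1) hm ucyc]] by (simp add: hk(5))
  then have ub: "u \<in> bd W i" by (rule coh_injD[OF hi(1) ucyc])
  note qs = hom_simps[OF chain_mapD(1)[OF qm] Wm Xm]
  have "q i c = q i (h' i x) \<oplus>\<^bsub>obj X i\<^esub> q i u"
   unfolding c_eq using uc hx(1) by (simp add: qs lm_ac(2)[OF Xm])
  then have "q i (h' i x) \<in> bd X i"
   using qc sub_cancel[OF Xm bd_submodule[OF X] cl[OF qm hx(1)] chain_map_bd[OF qm ub]] by simp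
  then have "k' i x \<in> bd X i" using homotopic_bd[OF e(1) X e(6) _ xw(1)] cl[OF e(3)] by simp
  then have "p i (h' i x) \<in> bd X i" using homotopic_bd[OF e(1) X e(5) _ xw(1)] cl[OF e(3)] by simp
  then have "x \<in> bd W' i" using coh_injD[OF phi(1) xw(1)] by simp
  then have "h' i x \<in> bd W i" by (rule chain_map_bd[OF e(2)])
  then have "c \<in> bd W i" unfolding c_eq by (rule submoduleD(3)[OF Wm bd_submodule[OF hk(1)] ub])
  then have "h i c \<in> bd Z i" by (rule chain_map_bd[OF hm])
  then show "z \<in> bd Z i" unfolding cw(3) by (rule submoduleD(3)[OF Zm bd_submodule[OF Z(1)] _ cw(2)])
 qed
 moreover have "coh_surj Z Y f"
  unfolding coh_surj_def
 proof (intro allI ballI impI)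
  fix i y assume "y \<in> elts Y i" "dif Y i y = null Y (i + 1)"
  then have y: "y \<in> cyc Y i" by (simp add: cyc_def)
  obtain x w where xw: "x \<in> cyc V' i" "w \<in> bd Y i" "y = p2 i (h2' i x) \<oplus>\<^bsub>obj Y i\<^esub> w"
   using coh_surjD[OF p2hi(2) y] by auto
  have xc: "x \<in> elts V' i" "dif V' i x = null V' (i + 1)" using xw(1) by (simp_all add: cyc_def)
  obtain \<sigma> where \<sigma>: "\<And>i. \<sigma> i \<in> mod_hom R (obj V' i) (obj Y (i - 1))"
   "\<And>i x. x \<in> elts V' i ==> p2 i (h2' i x) = k2' i x \<oplus>\<^bsub>obj Y i\<^esub> (dif Y (i - 1) (\<sigma> i x) \<oplus>\<^bsub>obj Y i\<^esub> \<sigma> (i + 1) (dif V' i x))"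
   using e2(5) unfolding homotopic_def by auto
  obtain \<tau> where \<tau>: "\<And>i. \<tau> i \<in> mod_hom R (obj V' i) (obj Y (i - 1))"
   "\<And>i x. x \<in> elts V' i ==> q2 i (h2' i x) = k2' i x \<oplus>\<^bsub>obj Y i\<^esub> (dif Y (i - 1) (\<tau> i x) \<oplus>\<^bsub>obj Y i\<^esub> \<tau> (i + 1) (dif V' i x))"
   using e2(6) unfolding homotopic_def by auto
  note V'm = module_complexD(1)[OF e2(1)] and dY = module_complexD(3)[OF Y]
  have z: "\<sigma> (i + 1) (dif V' i x) = null Y i" "\<tau> (i + 1) (dif V' i x) = null Y i"
   using hom_simps(4)[OF \<sigma>(1)[of "i + 1"] V'm Ym] hom_simps(4)[OF \<tau>(1)[of "i + 1"] V'm Ym] xc(2) by simp_all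
  have sc: "\<sigma> i x \<in> elts Y (i - 1)" "\<tau> i x \<in> elts Y (i - 1)"
   by (rule mod_homD(1)[OF \<sigma>(1) xc(1)], rule mod_homD(1)[OF \<tau>(1) xc(1)])
  obtain v where v: "v \<in> elts Y (i - 1)" "w = dif Y (i - 1) v" using xw(2) by (auto simp: bd_def)
  have k2c: "k2' i x \<in> elts Y i" by (rule cl[OF e2(3) xc(1)])
  let ?w = "v \<oplus>\<^bsub>obj Y (i - 1)\<^esub> (\<sigma> i x \<oplus>\<^bsub>obj Y (i - 1)\<^esub> \<ominus>\<^bsub>obj Y (i - 1)\<^esub> \<tau> i x)"
  note ds = hom_simps[OF dY Ym Ym]
  have "y = f i (k2 i (h2' i x)) \<oplus>\<^bsub>obj Y i\<^esub> dif Y (i - 1) ?w"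
   using \<sigma>(2)[OF xc(1)] \<tau>(2)[OF xc(1)] xw(3) k2c sc v
   by (simp add: z hk2(6) ds lm[OF Ym] lm_ac[OF Ym] lm_cancel[OF Ym])
  moreover have "k2 i (h2' i x) \<in> cyc Z i"
   by (rule chain_map_cyc[OF hk2(1) Z(1) hk2(3) chain_map_cyc[OF e2(1) hk2(1) e2(2) xw(1)]])
  moreover have "?w \<in> elts Y (i - 1)" using v sc by (simp add: lm[OF Ym])
  ultimately show "\<exists>x\<in>elts Z i. dif Z i x = null Z (i + 1) \<and>
    (\<exists>w\<in>elts Y (i - 1). y = f i x \<oplus>\<^bsub>obj Y i\<^esub> dif Y (i - 1) w)"
   unfolding cyc_def by blast
 qed
 ultimately show ?thesis using Z(1,3) sm si by blast
qed

section \<open>Null-homotopic maps from a complex of free modules\<close>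

text \<open>Every chain map from \<open>L\<close> to \<open>X\<close> that vanishes above degree \<open>b\<close> is null-homotopic, by a homotopy that
 vanishes above degree \<open>b\<close>.  For complexes that are unbounded in both directions the bound matters: it is
 where the inductive construction of homotopies can start.\<close>

definition tot_exact ::
 "('a, 'r) ring_scheme => (('a, 'l, 'y) module_scheme, 'l) cochain => (('a, 'b, 'x) module_scheme, 'b) cochain => int => bool" where
 "tot_exact R L X b \<longleftrightarrow> (\<forall>x. chain_map R L X x --> (\<forall>p>b. \<forall>l\<in>elts L p. x p l = null X p) -->
   (\<exists>y. (\<forall>p. y p \<in> mod_hom R (obj L (p + 1)) (obj X p)) \<and>
    (\<forall>p>b. \<forall>l\<in>elts L (p + 1). y p l = null X p) \<and>
    (\<forall>p. \<forall>l\<in>elts L p. x p l = y p (dif L p l) \<oplus>\<^bsub>obj X p\<^esub> dif X (p - 1) (y (p - 1) l))))"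

lemma tot_exactD:
 assumes "tot_exact R L X b" "chain_map R L X x" "\<And>p l. p > b ==> l \<in> elts L p ==> x p l = null X p"
 shows "\<exists>y. (\<forall>p. y p \<in> mod_hom R (obj L (p + 1)) (obj X p)) \<and>
    (\<forall>p>b. \<forall>l\<in>elts L (p + 1). y p l = null X p) \<and>
    (\<forall>p. \<forall>l\<in>elts L p. x p l = y p (dif L p l) \<oplus>\<^bsub>obj X p\<^esub> dif X (p - 1) (y (p - 1) l))"
 using assms unfolding tot_exact_def by blast

lemma downward_choice:
 fixes b :: int
 assumes start: "Good (b + 1) s0" and step: "\<And>q s. q \<le> b + 1 ==> Good q s ==> \<exists>t. Good (q - 1) t \<and> Rel q s t"
 shows "\<exists>S. (\<forall>q>b. S q = s0) \<and> (\<forall>q\<le>b + 1. Good q (S q) \<and> Rel q (S q) (S (q - 1)))"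
proof -
 have "\<exists>T. \<forall>k. (Good (b + 1 - int k) (T k) \<and> (k = 0 --> T k = s0)) \<and> Rel (b + 1 - int k) (T k) (T (Suc k))"
 proof (rule dependent_nat_choice)
  show "\<exists>s. Good (b + 1 - int 0) s \<and> (0 = 0 --> s = s0)" using start by auto
 next
  fix s k assume s: "Good (b + 1 - int k) s \<and> (k = 0 --> s = s0)"
  have e: "b + 1 - int (Suc k) = b + 1 - int k - 1" by simp
  show "\<exists>t. (Good (b + 1 - int (Suc k)) t \<and> (Suc k = 0 --> t = s0)) \<and> Rel (b + 1 - int k) s t"
   unfolding e using step[of "b + 1 - int k" s] s by auto
 qed
 then obtain T where T: "\<And>k. Good (b + 1 - int k) (T k)" "T 0 = s0" "\<And>k. Rel (b + 1 - int k) (T k) (T (Suc k))"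
  by blast
 define S where "S q = (if q > b then s0 else T (nat (b + 1 - q)))" for q
 have S: "S q = T (nat (b + 1 - q))" if "q \<le> b + 1" for q
  using that T(2) by (cases "q = b + 1") (simp_all add: S_def)
 have "Good q (S q) \<and> Rel q (S q) (S (q - 1))" if q: "q \<le> b + 1" for q
 proof -
  have e: "b + 1 - int (nat (b + 1 - q)) = q" "nat (b + 1 - (q - 1)) = Suc (nat (b + 1 - q))" using q by auto
  show ?thesis using T(1)[of "nat (b + 1 - q)"] T(3)[of "nat (b + 1 - q)"] S[of q] S[of "q - 1"] q unfolding e by simp
 qed
 then show ?thesis by (intro exI[of _ S]) (simp add: S_def)
qed

lemma upward_choice:
 fixes a :: int
 assumes start: "Good a s0" and step: "\<And>q s. q \<ge> a ==> Good q s ==> \<exists>t. Good (q + 1) t \<and> Rel q s t"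
 shows "\<exists>S. (\<forall>q\<le>a. S q = s0) \<and> (\<forall>q\<ge>a. Good q (S q) \<and> Rel q (S q) (S (q + 1)))"
proof -
 have "\<exists>S. (\<forall>q>- a - 1. S q = s0) \<and> (\<forall>q\<le>- a - 1 + 1. Good (- q) (S q) \<and> Rel (- q) (S q) (S (q - 1)))"
  by (rule downward_choice[of "\<lambda>q s. Good (- q) s" "- a - 1" s0 "\<lambda>q s t. Rel (- q) s t"])
   (use start step[of "- q" for q] in \<open>auto simp: add.commute\<close>)
 then obtain S where S: "\<And>q. q > - a - 1 ==> S q = s0" "\<And>q. q \<le> - a ==> Good (- q) (S q) \<and> Rel (- q) (S q) (S (q - 1))"
  by auto
 show ?thesis
 proof (intro exI[of _ "\<lambda>q. S (- q)"] conjI allI impI)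
  fix q assume "q \<le> a" then show "S (- q) = s0" by (intro S(1)) simp
 next
  fix q assume "q \<ge> a"
  then show "Good q (S (- q))" "Rel q (S (- q)) (S (- (q + 1)))" using S(2)[of "- q"] by auto
 qed
qed

text \<open>One step in the comparison of \<open>X\<close> and \<open>Y\<close>: the mapping cone of a quasi-isomorphism is exact, hence so are
 homomorphisms from a free module into it.\<close>

lemma cone_step:
 assumes X: "module_complex R X" and Y: "module_complex R Y" and f: "chain_map R X Y f"
  and inj: "coh_inj X Y f" and surj: "coh_surj X Y f"
  and z: "z \<in> mod_hom R (free R {..<n::nat}) (obj X (i + 1))" and y: "y \<in> mod_hom R (free R {..<n}) (obj Y i)"
  and dz: "\<And>l. l \<in> carrier (free R {..<n}) ==> dif X (i + 1) (z l) = null X (i + 2)"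
  and fz: "\<And>l. l \<in> carrier (free R {..<n}) ==> f (i + 1) (z l) = dif Y i (y l)"
 shows "\<exists>a\<in>mod_hom R (free R {..<n}) (obj X i). \<exists>w\<in>mod_hom R (free R {..<n}) (obj Y (i - 1)).
  (\<forall>l\<in>carrier (free R {..<n}). dif X i (a l) = z l) \<and>
  (\<forall>l\<in>carrier (free R {..<n}). f i (a l) = y l \<oplus>\<^bsub>obj Y i\<^esub> dif Y (i - 1) (w l))"
proof -
 note Xm = module_complexD(1)[OF X] and Ym = module_complexD(1)[OF Y]
 note R = left_moduleD(1)[OF Xm]
 note F = left_module_free[OF R, of "{..<n}"]
 note dX = module_complexD(2)[OF X] and dY = module_complexD(2)[OF Y] and dY' = module_complexD(3)[OF Y]
 note fs = hom_simps[OF chain_mapD(1)[OF f] Xm Ym] and xs = hom_simps[OF dX Xm Xm] and ys = hom_simps[OF dY Ym Ym]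
 have "z l \<in> dif X i ` elts X i" if l: "l \<in> carrier (free R {..<n})" for l
  using coh_injD[OF inj, of "z l" "i + 1"] dz[OF l] fz[OF l] mod_homD(1)[OF z l] mod_homD(1)[OF y l]
  by (simp add: cyc_def bd_def add.assoc)
 then obtain u where u: "u \<in> mod_hom R (free R {..<n}) (obj X i)" "\<And>l. l \<in> carrier (free R {..<n}) ==> dif X i (u l) = z l"
  using proj_lift[OF projective_free[OF R] Xm Xm dX z] by blast
 define v where "v l = f i (u l) \<oplus>\<^bsub>obj Y i\<^esub> \<ominus>\<^bsub>obj Y i\<^esub> y l" for l
 have v: "v \<in> mod_hom R (free R {..<n}) (obj Y i)"
  unfolding v_def by (rule hom_diff[OF hom_comp[OF u(1) chain_mapD(1)[OF f]] y Ym])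
 have dv: "v l \<in> cyc Y i" if l: "l \<in> carrier (free R {..<n})" for l
  using mod_homD(1)[OF v l] mod_homD(1)[OF u(1) l] mod_homD(1)[OF y l] fz[OF l] u(2)[OF l] chain_mapD(2)[OF f, of "u l" i]
  by (simp add: cyc_def v_def ys fs lm[OF Ym])
 have "\<exists>x\<in>cyc X i. \<exists>w\<in>elts Y (i - 1). v (bas R r) = f i x \<oplus>\<^bsub>obj Y i\<^esub> dif Y (i - 1) w" if r: "r \<in> {..<n}" for r
  using coh_surjD[OF surj dv[OF bas_in[OF R r]]] by (auto simp: bd_def)
 then obtain e0 w0 where ew: "\<And>r. r \<in> {..<n} ==> e0 r \<in> cyc X i" "\<And>r. r \<in> {..<n} ==> w0 r \<in> elts Y (i - 1)"
  "\<And>r. r \<in> {..<n} ==> v (bas R r) = f i (e0 r) \<oplus>\<^bsub>obj Y i\<^esub> dif Y (i - 1) (w0 r)" by metis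
 have e0c: "r \<in> {..<n} ==> e0 r \<in> elts X i" for r using ew(1) by (simp add: cyc_def)
 have e: "lin R (obj X i) e0 \<in> mod_hom R (free R {..<n}) (obj X i)" by (rule lin_hom[OF Xm e0c])
 have w: "lin R (obj Y (i - 1)) w0 \<in> mod_hom R (free R {..<n}) (obj Y (i - 1))" by (rule lin_hom[OF Ym ew(2)])
 have eb: "lin R (obj X i) e0 (bas R r) = e0 r" "lin R (obj Y (i - 1)) w0 (bas R r) = w0 r" if "r \<in> {..<n}" for r
  by (rule lin_bas[OF Xm that e0c], assumption, rule lin_bas[OF Ym that ew(2)], assumption)
 have v_eq: "v l = f i (lin R (obj X i) e0 l) \<oplus>\<^bsub>obj Y i\<^esub> dif Y (i - 1) (lin R (obj Y (i - 1)) w0 l)" if l: "l \<in> carrier (free R {..<n})" for l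
  by (rule free_hom_eq[OF R Ym v hom_add[OF hom_comp[OF e chain_mapD(1)[OF f]] hom_comp[OF w dY'] Ym] _ l])
   (simp add: eb ew(3))
 have de: "dif X i (lin R (obj X i) e0 l) = null X (i + 1)" if l: "l \<in> carrier (free R {..<n})" for l
  by (rule free_hom_eq[OF R Xm hom_comp[OF e dX] hom_zero[OF Xm] _ l]) (use ew(1) in \<open>simp add: eb cyc_def\<close>)
 show ?thesis
 proof (intro bexI[OF _ hom_diff[OF u(1) e Xm]] bexI[OF _ w] conjI ballI)
  fix l assume l: "l \<in> carrier (free R {..<n})"
  note c = mod_homD(1)[OF u(1) l] mod_homD(1)[OF e l] mod_homD(1)[OF w l] mod_homD(1)[OF y l]
  show "dif X i (u l \<oplus>\<^bsub>obj X i\<^esub> \<ominus>\<^bsub>obj X i\<^esub> lin R (obj X i) e0 l) = z l"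
   using c mod_homD(1)[OF z l] by (simp add: xs lm[OF Xm] u(2)[OF l] de[OF l])
  have "f i (u l) \<oplus>\<^bsub>obj Y i\<^esub> \<ominus>\<^bsub>obj Y i\<^esub> y l =
    f i (lin R (obj X i) e0 l) \<oplus>\<^bsub>obj Y i\<^esub> dif Y (i - 1) (lin R (obj Y (i - 1)) w0 l)"
   using v_eq[OF l] by (simp add: v_def)
  then have "f i (u l) = f i (lin R (obj X i) e0 l) \<oplus>\<^bsub>obj Y i\<^esub> dif Y (i - 1) (lin R (obj Y (i - 1)) w0 l) \<oplus>\<^bsub>obj Y i\<^esub> y l"
   using c mod_homD(1)[OF dY' c(3)] by (metis fs(1) lm(1,3,5,7)[OF Ym] lm_ac(1)[OF Ym])
  then show "f i (u l \<oplus>\<^bsub>obj X i\<^esub> \<ominus>\<^bsub>obj X i\<^esub> lin R (obj X i) e0 l) = y l \<oplus>\<^bsub>obj Y i\<^esub> dif Y (i - 1) (lin R (obj Y (i - 1)) w0 l)"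
   using c mod_homD(1)[OF dY' c(3)] by (simp add: fs lm[OF Xm] lms[OF Ym])
 qed
qed

lemma lm_id:
 assumes M: "left_module R M" and "a \<in> carrier M" "b \<in> carrier M" "c \<in> carrier M"
 shows "a = a \<oplus>\<^bsub>M\<^esub> \<ominus>\<^bsub>M\<^esub> b \<oplus>\<^bsub>M\<^esub> c \<oplus>\<^bsub>M\<^esub> (b \<oplus>\<^bsub>M\<^esub> \<ominus>\<^bsub>M\<^esub> c)"
  and "a \<oplus>\<^bsub>M\<^esub> b \<oplus>\<^bsub>M\<^esub> \<ominus>\<^bsub>M\<^esub> (a \<oplus>\<^bsub>M\<^esub> \<ominus>\<^bsub>M\<^esub> \<zero>\<^bsub>M\<^esub> \<oplus>\<^bsub>M\<^esub> c) = b \<oplus>\<^bsub>M\<^esub> \<ominus>\<^bsub>M\<^esub> c"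
 using assms(2-4) by (simp_all add: lms[OF M])

text \<open>The homotopy is constructed by descending induction, starting above the bound.  At each stage \<open>cone_step\<close>
 provides the next component, together with a homotopy \<open>c\<close> between its image in \<open>Y\<close> and the given one.\<close>

lemma tot_exact_pullback:
 fixes X :: "(('a, 'b, 'x) module_scheme, 'b) cochain" and Y :: "(('a, 'c, 'y) module_scheme, 'c) cochain"
  and L :: "(('a, nat => 'a) module, nat => 'a) cochain" and R :: "('a, 'r) ring_scheme"
 assumes X: "module_complex R X" and Y: "module_complex R Y" and L: "module_complex R L" and Lo: "\<And>j. obj L j = Fr R (\<nu> j)"
  and f: "chain_map R X Y f" and inj: "coh_inj X Y f" and surj: "coh_surj X Y f" and Yex: "tot_exact R L Y b"
 shows "tot_exact R L X b"
 unfolding tot_exact_def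
proof (intro allI impI)
 fix x assume x: "chain_map R L X x" and xz0: "\<forall>p>b. \<forall>l\<in>elts L p. x p l = null X p"
 then have xz: "x p l = null X p" if "p > b" "l \<in> elts L p" for p l using that by blast
 note Xm = module_complexD(1)[OF X] and Ym = module_complexD(1)[OF Y] and Lm = module_complexD(1)[OF L]
 note dX = module_complexD(2)[OF X] and dY = module_complexD(2)[OF Y] and dL = module_complexD(2)[OF L]
 note dX' = module_complexD(3)[OF X] and dY' = module_complexD(3)[OF Y] and dL' = module_complexD(3)[OF L]
 note fs = hom_simps[OF chain_mapD(1)[OF f] Xm Ym] and dXs = hom_simps[OF dX Xm Xm] and dYs = hom_simps[OF dY Ym Ym]
  and dXs' = hom_simps[OF dX' Xm Xm] and dYs' = hom_simps[OF dY' Ym Ym] and dLs = hom_simps[OF dL Lm Lm] and dLs' = hom_simps[OF dL' Lm Lm]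
  and xs = hom_simps[OF chain_mapD(1)[OF x] Lm Xm]
 have fx: "chain_map R L Y (\<lambda>p. f p \<circ> x p)" by (rule chain_map_comp[OF x f])
 have "(f p \<circ> x p) l = null Y p" if "p > b" "l \<in> elts L p" for p l
  using xz[OF that] by (simp add: fs)
 from tot_exactD[OF Yex fx this] obtain y where y: "\<And>p. y p \<in> mod_hom R (obj L (p + 1)) (obj Y p)"
  "\<And>p l. p > b ==> l \<in> elts L (p + 1) ==> y p l = null Y p"
  "\<And>p l. l \<in> elts L p ==> f p (x p l) = y p (dif L p l) \<oplus>\<^bsub>obj Y p\<^esub> dif Y (p - 1) (y (p - 1) l)"
  unfolding comp_def by metis
 have y': "y (p - 1) \<in> mod_hom R (obj L p) (obj Y (p - 1))" for p using y(1)[of "p - 1"] by simp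
 have y'': "y (p - 1 - 1) \<in> mod_hom R (obj L (p - 1)) (obj Y (p - 1 - 1))" for p using y(1)[of "p - 1 - 1"] by simp
 note ys = hom_simps[OF y(1) Lm Ym] and ys' = hom_simps[OF y' Lm Ym] and ys'' = hom_simps[OF y'' Lm Ym]
 define Good where "Good q s \<longleftrightarrow> (case s of (a, c) => a \<in> mod_hom R (obj L (q + 1)) (obj X q) \<and> c \<in> mod_hom R (obj L (q + 1)) (obj Y (q - 1)) \<and>
   (\<forall>l\<in>elts L q. dif X q (x q l \<oplus>\<^bsub>obj X q\<^esub> \<ominus>\<^bsub>obj X q\<^esub> a (dif L q l)) = null X (q + 1)) \<and>
   (\<forall>l\<in>elts L q. f q (x q l \<oplus>\<^bsub>obj X q\<^esub> \<ominus>\<^bsub>obj X q\<^esub> a (dif L q l)) =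
    dif Y (q - 1) (y (q - 1) l \<oplus>\<^bsub>obj Y (q - 1)\<^esub> \<ominus>\<^bsub>obj Y (q - 1)\<^esub> c (dif L q l))))" for q s
 define Rel where "Rel q s t \<longleftrightarrow> (\<forall>l\<in>elts L q. x q l = fst s (dif L q l) \<oplus>\<^bsub>obj X q\<^esub> dif X (q - 1) (fst t l))"
  for q and s t :: "((nat => 'a) => 'b) \<times> ((nat => 'a) => 'c)"
 have "\<exists>S. (\<forall>q>b. S q = (\<lambda>l. null X (b + 1), \<lambda>l. null Y b)) \<and> (\<forall>q\<le>b + 1. Good q (S q) \<and> Rel q (S q) (S (q - 1)))"
 proof (rule downward_choice)
  have "dif Y b (y b l) = null Y (b + 1)" if l: "l \<in> elts L (b + 1)" for l
  proof -
   have "f (b + 1) (x (b + 1) l) = y (b + 1) (dif L (b + 1) l) \<oplus>\<^bsub>obj Y (b + 1)\<^esub> dif Y b (y b l)"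
    using y(3)[OF l] by simp
   moreover have "y (b + 1) (dif L (b + 1) l) = null Y (b + 1)"
    by (rule y(2)[OF _ dLs(1)[OF l]]) simp
   moreover have "x (b + 1) l = null X (b + 1)" by (rule xz[OF _ l]) simp
   ultimately have "null Y (b + 1) = null Y (b + 1) \<oplus>\<^bsub>obj Y (b + 1)\<^esub> dif Y b (y b l)"
    by (simp only: fs(4))
   then show ?thesis by (simp only: lm(4)[OF Ym dYs(1)[OF ys(1)[OF l]]])
  qed
  then show "Good (b + 1) (\<lambda>l. null X (b + 1), \<lambda>l. null Y b)"
   using ys(1)[of _ b] by (simp add: Good_def hom_zero[OF Xm] hom_zero[OF Ym] xz lm[OF Xm] lm[OF Ym] dXs fs)
 next
  fix q s assume "q \<le> b + 1" and G: "Good q s"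
  obtain a c where s: "s = (a, c)" by (cases s)
  have a: "a \<in> mod_hom R (obj L (q + 1)) (obj X q)" and c: "c \<in> mod_hom R (obj L (q + 1)) (obj Y (q - 1))"
   and g1: "\<And>l. l \<in> elts L q ==> dif X q (x q l \<oplus>\<^bsub>obj X q\<^esub> \<ominus>\<^bsub>obj X q\<^esub> a (dif L q l)) = null X (q + 1)"
   and g2: "\<And>l. l \<in> elts L q ==> f q (x q l \<oplus>\<^bsub>obj X q\<^esub> \<ominus>\<^bsub>obj X q\<^esub> a (dif L q l)) =
    dif Y (q - 1) (y (q - 1) l \<oplus>\<^bsub>obj Y (q - 1)\<^esub> \<ominus>\<^bsub>obj Y (q - 1)\<^esub> c (dif L q l))"
   using G by (auto simp: Good_def s)
  note as = hom_simps[OF a Lm Xm] and cs = hom_simps[OF c Lm Ym]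
  have z: "(\<lambda>l. x q l \<oplus>\<^bsub>obj X q\<^esub> \<ominus>\<^bsub>obj X q\<^esub> a (dif L q l)) \<in> mod_hom R (obj L q) (obj X q)"
   by (rule hom_diff[OF chain_mapD(1)[OF x] hom_comp[OF dL a] Xm])
  have w: "(\<lambda>l. y (q - 1) l \<oplus>\<^bsub>obj Y (q - 1)\<^esub> \<ominus>\<^bsub>obj Y (q - 1)\<^esub> c (dif L q l)) \<in> mod_hom R (obj L q) (obj Y (q - 1))"
   by (rule hom_diff[OF y' hom_comp[OF dL c] Ym])
  have e: "q - 1 + 1 = q" "q - 1 + 2 = q + 1" by simp_all
  from cone_step[OF X Y f inj surj, of _ "\<nu> q" "q - 1", folded Lo, unfolded e, OF z w g1 g2]
  obtain a' w' where aw: "a' \<in> mod_hom R (obj L q) (obj X (q - 1))" "w' \<in> mod_hom R (obj L q) (obj Y (q - 1 - 1))"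
   "\<And>l. l \<in> elts L q ==> dif X (q - 1) (a' l) = x q l \<oplus>\<^bsub>obj X q\<^esub> \<ominus>\<^bsub>obj X q\<^esub> a (dif L q l)"
   "\<And>l. l \<in> elts L q ==> f (q - 1) (a' l) = y (q - 1) l \<oplus>\<^bsub>obj Y (q - 1)\<^esub> \<ominus>\<^bsub>obj Y (q - 1)\<^esub> c (dif L q l)
     \<oplus>\<^bsub>obj Y (q - 1)\<^esub> dif Y (q - 1 - 1) (w' l)"
   by blast
  note as' = hom_simps[OF aw(1) Lm Xm] and ws' = hom_simps[OF aw(2) Lm Ym]
  have "Good (q - 1) (a', w')"
   unfolding Good_def prod.case e
  proof (intro conjI ballI aw(1,2))
   fix l assume l: "l \<in> elts L (q - 1)"
   have dl: "dif L (q - 1) l \<in> elts L q" by (rule dLs'(1)[OF l])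
   have ddl: "dif L q (dif L (q - 1) l) = null L (q + 1)" by (rule module_complexD(5)[OF L l])
   have xl: "x q (dif L (q - 1) l) = dif X (q - 1) (x (q - 1) l)" by (rule chain_mapD(3)[OF x l])
   show "dif X (q - 1) (x (q - 1) l \<oplus>\<^bsub>obj X (q - 1)\<^esub> \<ominus>\<^bsub>obj X (q - 1)\<^esub> a' (dif L (q - 1) l)) = null X q"
    using xs(1)[OF l] as'(1)[OF dl] xs(1)[OF dl] dXs'(1)[OF xs(1)[OF l]]
    by (simp add: dXs' lm[OF Xm] aw(3)[OF dl] xl ddl as(4))
   have cy: "f (q - 1) (x (q - 1) l) = y (q - 1) (dif L (q - 1) l) \<oplus>\<^bsub>obj Y (q - 1)\<^esub> dif Y (q - 1 - 1) (y (q - 1 - 1) l)"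
    by (rule y(3)[OF l])
   note m = ys'(1)[OF dl] ys''(1)[OF l] ws'(1)[OF dl] xs(1)[OF l] as'(1)[OF dl]
   note m2 = dYs'(1)[OF ys''(1)[OF l]] dYs'(1)[OF ws'(1)[OF dl]]
   show "f (q - 1) (x (q - 1) l \<oplus>\<^bsub>obj X (q - 1)\<^esub> \<ominus>\<^bsub>obj X (q - 1)\<^esub> a' (dif L (q - 1) l)) =
    dif Y (q - 1 - 1) (y (q - 1 - 1) l \<oplus>\<^bsub>obj Y (q - 1 - 1)\<^esub> \<ominus>\<^bsub>obj Y (q - 1 - 1)\<^esub> w' (dif L (q - 1) l))"
    unfolding fs(2)[OF xs(1)[OF l] lm(3)[OF Xm as'(1)[OF dl]]] fs(5)[OF as'(1)[OF dl]] cy aw(4)[OF dl] ddl cs(4)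
     dYs'(2)[OF ys''(1)[OF l] lm(3)[OF Ym ws'(1)[OF dl]]] dYs'(5)[OF ws'(1)[OF dl]]
    by (rule lm_id(2)[OF Ym m(1) m2])
  qed
  moreover have "Rel q s (a', w')"
   unfolding Rel_def s fst_conv
  proof
   fix l assume l: "l \<in> elts L q"
   show "x q l = a (dif L q l) \<oplus>\<^bsub>obj X q\<^esub> dif X (q - 1) (a' l)"
    using xs(1)[OF l] as(1)[OF dLs(1)[OF l]] by (simp add: aw(3)[OF l] lms[OF Xm])
  qed
  ultimately show "\<exists>t. Good (q - 1) t \<and> Rel q s t" by blast
 qed
 then obtain S where S: "\<And>q. q > b ==> S q = (\<lambda>l. null X (b + 1), \<lambda>l. null Y b)"
  "\<And>q. q \<le> b + 1 ==> Good q (S q)" "\<And>q. q \<le> b + 1 ==> Rel q (S q) (S (q - 1))" by blast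
 define z where "z p = (if p > b then (\<lambda>l. null X p) else fst (S p))" for p
 show "\<exists>y. (\<forall>p. y p \<in> mod_hom R (obj L (p + 1)) (obj X p)) \<and> (\<forall>p>b. \<forall>l\<in>elts L (p + 1). y p l = null X p) \<and>
    (\<forall>p. \<forall>l\<in>elts L p. x p l = y p (dif L p l) \<oplus>\<^bsub>obj X p\<^esub> dif X (p - 1) (y (p - 1) l))"
 proof (intro exI[of _ z] conjI allI impI ballI)
  show "z p \<in> mod_hom R (obj L (p + 1)) (obj X p)" for p
   using S(2)[of p] by (auto simp: z_def hom_zero[OF Xm] Good_def split: prod.splits)
  show "z p l = null X p" if "b < p" for p l using that by (simp add: z_def)
  fix p l assume l: "l \<in> elts L p"
  show "x p l = z p (dif L p l) \<oplus>\<^bsub>obj X p\<^esub> dif X (p - 1) (z (p - 1) l)"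
  proof (cases "p \<le> b + 1")
   case True
   then have "x p l = fst (S p) (dif L p l) \<oplus>\<^bsub>obj X p\<^esub> dif X (p - 1) (fst (S (p - 1)) l)"
    using S(3)[OF True] l unfolding Rel_def by blast
   moreover have "fst (S p) (dif L p l) = z p (dif L p l)"
    using True S(1)[of p] by (cases "p = b + 1") (simp_all add: z_def)
   ultimately show ?thesis using True by (simp add: z_def)
  next
   case False
   then show ?thesis using xz[OF _ l] by (simp add: z_def dXs'(4) lm[OF Xm])
  qed
 qed
qed

text \<open>A chain map \<open>y\<close> to \<open>Y\<close> is lifted to a chain map \<open>x\<close> to \<open>X\<close>, up to a homotopy \<open>c\<close>, again downwards from the
 bound; the null-homotopy of \<open>x\<close> and \<open>c\<close> yield one of \<open>y\<close>.\<close>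

lemma tot_exact_pushforward:
 fixes X :: "(('a, 'b, 'x) module_scheme, 'b) cochain" and Y :: "(('a, 'c, 'y) module_scheme, 'c) cochain"
  and L :: "(('a, nat => 'a) module, nat => 'a) cochain" and R :: "('a, 'r) ring_scheme"
 assumes X: "module_complex R X" and Y: "module_complex R Y" and L: "module_complex R L" and Lo: "\<And>j. obj L j = Fr R (\<nu> j)"
  and f: "chain_map R X Y f" and inj: "coh_inj X Y f" and surj: "coh_surj X Y f" and Xex: "tot_exact R L X b"
 shows "tot_exact R L Y b"
 unfolding tot_exact_def
proof (intro allI impI)
 fix y assume y: "chain_map R L Y y" and yz0: "\<forall>p>b. \<forall>l\<in>elts L p. y p l = null Y p"
 then have yz: "y p l = null Y p" if "p > b" "l \<in> elts L p" for p l using that by blast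
 note Xm = module_complexD(1)[OF X] and Ym = module_complexD(1)[OF Y] and Lm = module_complexD(1)[OF L]
 note dX = module_complexD(2)[OF X] and dY = module_complexD(2)[OF Y] and dL = module_complexD(2)[OF L]
 note dX' = module_complexD(3)[OF X] and dY' = module_complexD(3)[OF Y] and dL' = module_complexD(3)[OF L]
 note fs = hom_simps[OF chain_mapD(1)[OF f] Xm Ym] and dXs = hom_simps[OF dX Xm Xm] and dYs = hom_simps[OF dY Ym Ym]
  and dXs' = hom_simps[OF dX' Xm Xm] and dYs' = hom_simps[OF dY' Ym Ym] and dLs = hom_simps[OF dL Lm Lm] and dLs' = hom_simps[OF dL' Lm Lm]
  and ys = hom_simps[OF chain_mapD(1)[OF y] Lm Ym]
 define Good where "Good q s \<longleftrightarrow> (case s of (a, c) => a \<in> mod_hom R (obj L q) (obj X q) \<and> c \<in> mod_hom R (obj L q) (obj Y (q - 1)) \<and>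
   (\<forall>l\<in>elts L (q - 1). dif X q (a (dif L (q - 1) l)) = null X (q + 1)) \<and>
   (\<forall>l\<in>elts L (q - 1). f q (a (dif L (q - 1) l)) =
    dif Y (q - 1) (y (q - 1) l \<oplus>\<^bsub>obj Y (q - 1)\<^esub> \<ominus>\<^bsub>obj Y (q - 1)\<^esub> c (dif L (q - 1) l))))" for q s
 define Rel where "Rel q s t \<longleftrightarrow> (\<forall>l\<in>elts L (q - 1). dif X (q - 1) (fst t l) = fst s (dif L (q - 1) l) \<and>
   y (q - 1) l = f (q - 1) (fst t l) \<oplus>\<^bsub>obj Y (q - 1)\<^esub> (snd s (dif L (q - 1) l) \<oplus>\<^bsub>obj Y (q - 1)\<^esub> dif Y (q - 1 - 1) (snd t l)))"
  for q and s t :: "((nat => 'a) => 'b) \<times> ((nat => 'a) => 'c)"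
 have "\<exists>S. (\<forall>q>b. S q = (\<lambda>l. null X (b + 1), \<lambda>l. null Y b)) \<and> (\<forall>q\<le>b + 1. Good q (S q) \<and> Rel q (S q) (S (q - 1)))"
 proof (rule downward_choice)
  have "dif Y b (y b l) = null Y (b + 1)" if l: "l \<in> elts L b" for l
   using chain_mapD(2)[OF y l] yz[OF _ dLs(1)[OF l]] by simp
  then show "Good (b + 1) (\<lambda>l. null X (b + 1), \<lambda>l. null Y b)"
   using ys(1)[of _ b] by (simp add: Good_def hom_zero[OF Xm] hom_zero[OF Ym] lm[OF Xm] lm[OF Ym] dXs fs)
 next
  fix q s assume "q \<le> b + 1" and G: "Good q s"
  obtain a c where s: "s = (a, c)" by (cases s)
  have a: "a \<in> mod_hom R (obj L q) (obj X q)" and c: "c \<in> mod_hom R (obj L q) (obj Y (q - 1))"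
   and g1: "\<And>l. l \<in> elts L (q - 1) ==> dif X q (a (dif L (q - 1) l)) = null X (q + 1)"
   and g2: "\<And>l. l \<in> elts L (q - 1) ==> f q (a (dif L (q - 1) l)) =
    dif Y (q - 1) (y (q - 1) l \<oplus>\<^bsub>obj Y (q - 1)\<^esub> \<ominus>\<^bsub>obj Y (q - 1)\<^esub> c (dif L (q - 1) l))"
   using G by (auto simp: Good_def s)
  note as = hom_simps[OF a Lm Xm] and cs = hom_simps[OF c Lm Ym]
  have z: "(\<lambda>l. a (dif L (q - 1) l)) \<in> mod_hom R (obj L (q - 1)) (obj X q)" by (rule hom_comp[OF dL' a])
  have w: "(\<lambda>l. y (q - 1) l \<oplus>\<^bsub>obj Y (q - 1)\<^esub> \<ominus>\<^bsub>obj Y (q - 1)\<^esub> c (dif L (q - 1) l)) \<in> mod_hom R (obj L (q - 1)) (obj Y (q - 1))"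
   by (rule hom_diff[OF chain_mapD(1)[OF y] hom_comp[OF dL' c] Ym])
  have e: "q - 1 + 1 = q" "q - 1 + 2 = q + 1" by simp_all
  from cone_step[OF X Y f inj surj, of _ "\<nu> (q - 1)" "q - 1", folded Lo, unfolded e, OF z w g1 g2]
  obtain a' w' where aw: "a' \<in> mod_hom R (obj L (q - 1)) (obj X (q - 1))" "w' \<in> mod_hom R (obj L (q - 1)) (obj Y (q - 1 - 1))"
   "\<And>l. l \<in> elts L (q - 1) ==> dif X (q - 1) (a' l) = a (dif L (q - 1) l)"
   "\<And>l. l \<in> elts L (q - 1) ==> f (q - 1) (a' l) = y (q - 1) l \<oplus>\<^bsub>obj Y (q - 1)\<^esub> \<ominus>\<^bsub>obj Y (q - 1)\<^esub> c (dif L (q - 1) l)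
     \<oplus>\<^bsub>obj Y (q - 1)\<^esub> dif Y (q - 1 - 1) (w' l)"
   by blast
  note as' = hom_simps[OF aw(1) Lm Xm] and ws' = hom_simps[OF aw(2) Lm Ym]
  let ?c' = "\<lambda>l. \<ominus>\<^bsub>obj Y (q - 1 - 1)\<^esub> w' l"
  have c': "?c' \<in> mod_hom R (obj L (q - 1)) (obj Y (q - 1 - 1))" by (rule hom_neg[OF aw(2) Ym])
  have "Good (q - 1) (a', ?c')"
   unfolding Good_def prod.case e
  proof (intro conjI ballI aw(1) c')
   fix l assume l: "l \<in> elts L (q - 1 - 1)"
   have dl: "dif L (q - 1 - 1) l \<in> elts L (q - 1)" by (rule dLs'(1)[OF l])
   have ddl: "dif L (q - 1) (dif L (q - 1 - 1) l) = null L q" using module_complexD(5)[OF L l] by simp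
   show "dif X (q - 1) (a' (dif L (q - 1 - 1) l)) = null X q" by (simp only: aw(3)[OF dl] ddl as(4))
   have yl: "y (q - 1) (dif L (q - 1 - 1) l) = dif Y (q - 1 - 1) (y (q - 1 - 1) l)" by (rule chain_mapD(3)[OF y l])
   note m = ys(1)[OF l] ws'(1)[OF dl] dYs'(1)[OF ys(1)[OF l]] dYs'(1)[OF ws'(1)[OF dl]]
   show "f (q - 1) (a' (dif L (q - 1 - 1) l)) =
    dif Y (q - 1 - 1) (y (q - 1 - 1) l \<oplus>\<^bsub>obj Y (q - 1 - 1)\<^esub> \<ominus>\<^bsub>obj Y (q - 1 - 1)\<^esub> ?c' (dif L (q - 1 - 1) l))"
    using m by (simp only: dYs' lm[OF Ym] aw(4)[OF dl] ddl cs(4) yl)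
  qed
  moreover have "Rel q s (a', ?c')"
   unfolding Rel_def s fst_conv snd_conv
  proof (intro ballI conjI)
   fix l assume l: "l \<in> elts L (q - 1)"
   show "dif X (q - 1) (a' l) = a (dif L (q - 1) l)" by (rule aw(3)[OF l])
   show "y (q - 1) l = f (q - 1) (a' l) \<oplus>\<^bsub>obj Y (q - 1)\<^esub> (c (dif L (q - 1) l) \<oplus>\<^bsub>obj Y (q - 1)\<^esub> dif Y (q - 1 - 1) (?c' l))"
    unfolding aw(4)[OF l] dYs'(5)[OF ws'(1)[OF l]]
    by (rule lm_id(1)[OF Ym ys(1)[OF l] cs(1)[OF dLs'(1)[OF l]] dYs'(1)[OF ws'(1)[OF l]]])
  qed
  ultimately show "\<exists>t. Good (q - 1) t \<and> Rel q s t" by blast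
 qed
 then obtain S where S: "\<And>q. q > b ==> S q = (\<lambda>l. null X (b + 1), \<lambda>l. null Y b)"
  "\<And>q. q \<le> b + 1 ==> Good q (S q)" "\<And>q. q \<le> b + 1 ==> Rel q (S q) (S (q - 1))" by blast
 define x where "x p = (if p > b then (\<lambda>l. null X p) else fst (S p))" for p
 define c where "c p = (if p > b then (\<lambda>l. null Y (p - 1)) else snd (S p))" for p
 have xS: "x p l = fst (S p) l" "c p l = snd (S p) l" if "p \<le> b + 1" for p l
  using that S(1)[of p] by (cases "p = b + 1"; simp add: x_def c_def)+
 have xh: "x p \<in> mod_hom R (obj L p) (obj X p)" and ch: "c p \<in> mod_hom R (obj L p) (obj Y (p - 1))" for p
  using S(2)[of p] by (auto simp: x_def c_def hom_zero[OF Xm] hom_zero[OF Ym] Good_def split: prod.splits)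
 have e: "q + 1 - 1 = q" for q :: int by simp
 have eq: "dif X q (x q l) = x (q + 1) (dif L q l)"
  "y q l = f q (x q l) \<oplus>\<^bsub>obj Y q\<^esub> (c (q + 1) (dif L q l) \<oplus>\<^bsub>obj Y q\<^esub> dif Y (q - 1) (c q l))"
  if l: "l \<in> elts L q" for q l
 proof -
  show "dif X q (x q l) = x (q + 1) (dif L q l)"
  proof (cases "q \<le> b")
   case True
   then show ?thesis using S(3)[of "q + 1"] l xS[of q] xS[of "q + 1"] unfolding Rel_def e by simp
  qed (simp add: x_def dXs(4))
  show "y q l = f q (x q l) \<oplus>\<^bsub>obj Y q\<^esub> (c (q + 1) (dif L q l) \<oplus>\<^bsub>obj Y q\<^esub> dif Y (q - 1) (c q l))"
  proof (cases "q \<le> b")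
   case True
   then show ?thesis using S(3)[of "q + 1"] l xS[of q] xS[of "q + 1"] unfolding Rel_def e by simp
  qed (use yz[OF _ l] in \<open>simp add: x_def c_def dYs'(4) fs(4) lm[OF Ym]\<close>)
 qed
 have xc: "chain_map R L X x" unfolding chain_map_def using xh eq(1) by simp
 have "x p l = null X p" if "p > b" for p l using that by (simp add: x_def)
 from tot_exactD[OF Xex xc this] obtain z where z: "\<And>p. z p \<in> mod_hom R (obj L (p + 1)) (obj X p)"
  "\<And>p l. p > b ==> l \<in> elts L (p + 1) ==> z p l = null X p"
  "\<And>p l. l \<in> elts L p ==> x p l = z p (dif L p l) \<oplus>\<^bsub>obj X p\<^esub> dif X (p - 1) (z (p - 1) l)"
  by metis
 have z': "z (p - 1) \<in> mod_hom R (obj L p) (obj X (p - 1))" for p using z(1)[of "p - 1"] by simp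
 have ch': "c (p + 1) \<in> mod_hom R (obj L (p + 1)) (obj Y p)" for p using ch[of "p + 1"] by simp
 note zs = hom_simps[OF z(1) Lm Xm] and zs' = hom_simps[OF z' Lm Xm] and cs = hom_simps[OF ch Lm Ym] and cs' = hom_simps[OF ch' Lm Ym]
 define w where "w p l = f p (z p l) \<oplus>\<^bsub>obj Y p\<^esub> c (p + 1) l" for p l
 show "\<exists>w. (\<forall>p. w p \<in> mod_hom R (obj L (p + 1)) (obj Y p)) \<and> (\<forall>p>b. \<forall>l\<in>elts L (p + 1). w p l = null Y p) \<and>
    (\<forall>p. \<forall>l\<in>elts L p. y p l = w p (dif L p l) \<oplus>\<^bsub>obj Y p\<^esub> dif Y (p - 1) (w (p - 1) l))"
 proof (intro exI[of _ w] conjI allI impI ballI)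
  show "w p \<in> mod_hom R (obj L (p + 1)) (obj Y p)" for p
   unfolding w_def by (rule hom_add[OF hom_comp[OF z(1) chain_mapD(1)[OF f]] ch' Ym])
  show "w p l = null Y p" if "b < p" "l \<in> elts L (p + 1)" for p l
   using that z(2)[OF that] by (simp add: w_def c_def fs(4) lm[OF Ym])
  fix p l assume l: "l \<in> elts L p"
  have dl: "dif L p l \<in> elts L (p + 1)" by (rule dLs(1)[OF l])
  have zc: "z p (dif L p l) \<in> elts X p" "z (p - 1) l \<in> elts X (p - 1)" "dif X (p - 1) (z (p - 1) l) \<in> elts X p"
   by (rule zs(1)[OF dl], rule zs'(1)[OF l], rule dXs'(1)[OF zs'(1)[OF l]])
  have wl: "w (p - 1) l = f (p - 1) (z (p - 1) l) \<oplus>\<^bsub>obj Y (p - 1)\<^esub> c p l" by (simp add: w_def)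
  have "f p (x p l) = f p (z p (dif L p l)) \<oplus>\<^bsub>obj Y p\<^esub> dif Y (p - 1) (f (p - 1) (z (p - 1) l))"
   by (simp add: z(3)[OF l] fs(2)[OF zc(1,3)] chain_mapD(3)[OF f zc(2)])
  then show "y p l = w p (dif L p l) \<oplus>\<^bsub>obj Y p\<^esub> dif Y (p - 1) (w (p - 1) l)"
   unfolding wl w_def eq(2)[OF l]
   using fs(1)[OF zc(1)] fs(1)[OF zc(2)] dYs'(1)[OF fs(1)[OF zc(2)]] cs'(1)[OF dl] cs(1)[OF l] dYs'(1)[OF cs(1)[OF l]]
   by (simp add: dYs' lms[OF Ym])
 qed
qed

section \<open>The complexes of homomorphisms on a bimodule\<close>

lemma rhom_simps:
 "carrier (rhom R N Nr J) = mod_hom (op_ring R) Nr J \<inter> extensional (carrier N)"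
 "\<zero>\<^bsub>rhom R N Nr J\<^esub> = (\<lambda>x\<in>carrier N. \<zero>\<^bsub>J\<^esub>)"
 "f \<oplus>\<^bsub>rhom R N Nr J\<^esub> g = (\<lambda>x\<in>carrier N. f x \<oplus>\<^bsub>J\<^esub> g x)"
 "a \<odot>\<^bsub>rhom R N Nr J\<^esub> f = (\<lambda>x\<in>carrier N. f (smult N a x))"
 by (simp_all add: rhom_def)

lemma left_hom_simps:
 "carrier (left_hom R N J) = mod_hom R N J \<inter> extensional (carrier N)"
 "\<zero>\<^bsub>left_hom R N J\<^esub> = (\<lambda>x\<in>carrier N. \<zero>\<^bsub>J\<^esub>)"
 "f \<oplus>\<^bsub>left_hom R N J\<^esub> g = (\<lambda>x\<in>carrier N. f x \<oplus>\<^bsub>J\<^esub> g x)"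
 "a \<odot>\<^bsub>left_hom R N J\<^esub> f = (\<lambda>x\<in>carrier N. rsmult J (f x) a)"
 by (simp_all add: left_hom_def)

lemma restrict_ext_eq:
 "f \<in> extensional S ==> (\<And>x. x \<in> S ==> g x = f x) ==> (\<lambda>x\<in>S. g x) = f"
 by (auto simp: extensional_def fun_eq_iff)

text \<open>A module whose additive structure is pointwise, on a set of functions closed under it.\<close>

lemma pointwise_module:
 fixes J :: "('c, 'j, 'y) module_scheme" and H :: "('a, 't => 'j, 'h) module_scheme"
 assumes J: "left_module S J" and R: "ring R"
  and c: "\<And>f x. f \<in> carrier H ==> x \<in> T ==> f x \<in> carrier J" and ext: "\<And>f. f \<in> carrier H ==> f \<in> extensional T"
  and zero: "\<zero>\<^bsub>H\<^esub> = (\<lambda>x\<in>T. \<zero>\<^bsub>J\<^esub>)" and add: "\<And>f g. f \<oplus>\<^bsub>H\<^esub> g = (\<lambda>x\<in>T. f x \<oplus>\<^bsub>J\<^esub> g x)"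
  and zc: "\<zero>\<^bsub>H\<^esub> \<in> carrier H" and ac: "\<And>f g. f \<in> carrier H ==> g \<in> carrier H ==> f \<oplus>\<^bsub>H\<^esub> g \<in> carrier H"
  and nc: "\<And>f. f \<in> carrier H ==> (\<lambda>x\<in>T. \<ominus>\<^bsub>J\<^esub> f x) \<in> carrier H"
  and sc: "\<And>a f. a \<in> carrier R ==> f \<in> carrier H ==> a \<odot>\<^bsub>H\<^esub> f \<in> carrier H"
  and s1: "\<And>a b f x. a \<in> carrier R ==> b \<in> carrier R ==> f \<in> carrier H ==> x \<in> T ==>
   ((a \<oplus>\<^bsub>R\<^esub> b) \<odot>\<^bsub>H\<^esub> f) x = (a \<odot>\<^bsub>H\<^esub> f) x \<oplus>\<^bsub>J\<^esub> (b \<odot>\<^bsub>H\<^esub> f) x"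
  and s2: "\<And>a f g x. a \<in> carrier R ==> f \<in> carrier H ==> g \<in> carrier H ==> x \<in> T ==>
   (a \<odot>\<^bsub>H\<^esub> (f \<oplus>\<^bsub>H\<^esub> g)) x = (a \<odot>\<^bsub>H\<^esub> f) x \<oplus>\<^bsub>J\<^esub> (a \<odot>\<^bsub>H\<^esub> g) x"
  and s3: "\<And>a b f x. a \<in> carrier R ==> b \<in> carrier R ==> f \<in> carrier H ==> x \<in> T ==>
   ((a \<otimes>\<^bsub>R\<^esub> b) \<odot>\<^bsub>H\<^esub> f) x = (a \<odot>\<^bsub>H\<^esub> (b \<odot>\<^bsub>H\<^esub> f)) x"
  and s4: "\<And>f x. f \<in> carrier H ==> x \<in> T ==> (\<one>\<^bsub>R\<^esub> \<odot>\<^bsub>H\<^esub> f) x = f x"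
 shows "left_module R H"
proof -
 have eqI: "f = g" if "f \<in> extensional T" "g \<in> extensional T" "\<And>x. x \<in> T ==> f x = g x" for f g :: "'t => 'j"
  by (rule extensionalityI[OF that])
 show ?thesis
 proof (rule left_moduleI[OF R])
  show "abelian_group H"
  proof (rule ab_groupI)
   fix f assume f: "f \<in> carrier H"
   show "\<zero>\<^bsub>H\<^esub> \<oplus>\<^bsub>H\<^esub> f = f" unfolding add zero by (rule restrict_ext_eq[OF ext[OF f]]) (simp add: c f lm[OF J])
   show "\<exists>g\<in>carrier H. g \<oplus>\<^bsub>H\<^esub> f = \<zero>\<^bsub>H\<^esub>"
    by (rule bexI[OF _ nc[OF f]]) (auto simp: add zero c f lm[OF J] intro!: restrict_ext)
   fix g assume g: "g \<in> carrier H"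
   show "f \<oplus>\<^bsub>H\<^esub> g = g \<oplus>\<^bsub>H\<^esub> f" unfolding add by (rule restrict_ext) (simp add: c f g lm_ac(2)[OF J])
   fix h assume h: "h \<in> carrier H"
   show "f \<oplus>\<^bsub>H\<^esub> g \<oplus>\<^bsub>H\<^esub> h = f \<oplus>\<^bsub>H\<^esub> (g \<oplus>\<^bsub>H\<^esub> h)" unfolding add by (rule restrict_ext) (simp add: c f g h lm_ac(1)[OF J])
  qed (use zc ac in auto)
  fix a f assume af: "a \<in> carrier R" "f \<in> carrier H"
  show "a \<odot>\<^bsub>H\<^esub> f \<in> carrier H" by (rule sc[OF af])
  fix b assume b: "b \<in> carrier R"
  show "(a \<oplus>\<^bsub>R\<^esub> b) \<odot>\<^bsub>H\<^esub> f = a \<odot>\<^bsub>H\<^esub> f \<oplus>\<^bsub>H\<^esub> b \<odot>\<^bsub>H\<^esub> f"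
   unfolding add by (rule restrict_ext_eq[symmetric, OF ext]) (use sc s1 af b ring.ring_simprules(1)[OF R] in auto)
  show "(a \<otimes>\<^bsub>R\<^esub> b) \<odot>\<^bsub>H\<^esub> f = a \<odot>\<^bsub>H\<^esub> (b \<odot>\<^bsub>H\<^esub> f)"
   by (rule eqI[OF ext ext s3[OF af(1) b af(2)]]) (use sc af b ring.ring_simprules(5)[OF R] in auto)
 next
  fix a f g assume afg: "a \<in> carrier R" "f \<in> carrier H" "g \<in> carrier H"
  show "a \<odot>\<^bsub>H\<^esub> (f \<oplus>\<^bsub>H\<^esub> g) = a \<odot>\<^bsub>H\<^esub> f \<oplus>\<^bsub>H\<^esub> a \<odot>\<^bsub>H\<^esub> g"
   unfolding add[of "a \<odot>\<^bsub>H\<^esub> f"] by (rule restrict_ext_eq[symmetric, OF ext]) (use sc ac s2 afg in auto)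
 next
  fix f assume f: "f \<in> carrier H"
  show "\<one>\<^bsub>R\<^esub> \<odot>\<^bsub>H\<^esub> f = f" by (rule eqI[OF ext ext s4[OF f]]) (use sc f ring.ring_simprules(6)[OF R] in auto)
 qed
qed

context tensor_bimodule
begin

lemma rhom_mem:
 "f \<in> carrier (rhom A N (right_of N) J) \<longleftrightarrow> f \<in> mod_hom (op_ring A) (right_of N) J \<and> f \<in> extensional (carrier N)"
 by (simp add: rhom_simps)

lemma restrict_rhom:
 "f \<in> mod_hom (op_ring A) (right_of N) J ==> (\<lambda>x\<in>carrier N. f x) \<in> carrier (rhom A N (right_of N) J)"
 using restrict_hom[OF Nr] by (simp add: rhom_simps)

lemma rhom_module:
 assumes J: "left_module (op_ring A) J"
 shows "left_module (op_ring A) (rhom A N (right_of N) J)"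
proof (rule pointwise_module[OF J O])
 let ?H = "rhom A N (right_of N) J"
 show fc: "f x \<in> carrier J" if "f \<in> carrier ?H" "x \<in> carrier N" for f x
  using mod_homD(1)[of f "op_ring A" "right_of N" J x] that by (simp add: rhom_mem)
 show "f \<in> extensional (carrier N)" if "f \<in> carrier ?H" for f using that by (simp add: rhom_mem)
 show "\<zero>\<^bsub>?H\<^esub> = (\<lambda>x\<in>carrier N. \<zero>\<^bsub>J\<^esub>)" "f \<oplus>\<^bsub>?H\<^esub> g = (\<lambda>x\<in>carrier N. f x \<oplus>\<^bsub>J\<^esub> g x)" for f g
  by (simp_all add: rhom_simps)
 show "\<zero>\<^bsub>?H\<^esub> \<in> carrier ?H" unfolding rhom_simps(2) by (rule restrict_rhom[OF hom_zero[OF J]])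
 show "f \<oplus>\<^bsub>?H\<^esub> g \<in> carrier ?H" if "f \<in> carrier ?H" "g \<in> carrier ?H" for f g
  unfolding rhom_simps(3) by (rule restrict_rhom[OF hom_add[OF _ _ J]]) (use that in \<open>simp_all add: rhom_mem\<close>)
 show "(\<lambda>x\<in>carrier N. \<ominus>\<^bsub>J\<^esub> f x) \<in> carrier ?H" if "f \<in> carrier ?H" for f
  by (rule restrict_rhom[OF hom_neg[OF _ J]]) (use that in \<open>simp add: rhom_mem\<close>)
 fix a f assume a: "a \<in> carrier (op_ring A)" and f: "f \<in> carrier ?H"
 have fh: "f \<in> mod_hom (op_ring A) (right_of N) J" using f by (simp add: rhom_mem)
 note fs = hom_simps[OF fh Nr J]
 have la: "(\<lambda>x. smult N a x) \<in> mod_hom (op_ring A) (right_of N) (right_of N)"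
  by (rule mod_homI) (use a in \<open>simp_all add: lm[OF Nl] bisc\<close>)
 show "a \<odot>\<^bsub>?H\<^esub> f \<in> carrier ?H" unfolding rhom_simps(4) by (rule restrict_rhom[OF hom_comp[OF la fh]])
 fix x assume x: "x \<in> carrier N"
 show "(a \<odot>\<^bsub>?H\<^esub> (f \<oplus>\<^bsub>?H\<^esub> g)) x = (a \<odot>\<^bsub>?H\<^esub> f) x \<oplus>\<^bsub>J\<^esub> (a \<odot>\<^bsub>?H\<^esub> g) x" for g
  using a x by (simp add: rhom_simps lm[OF Nl])
 fix b assume b: "b \<in> carrier (op_ring A)"
 show "((a \<oplus>\<^bsub>op_ring A\<^esub> b) \<odot>\<^bsub>?H\<^esub> f) x = (a \<odot>\<^bsub>?H\<^esub> f) x \<oplus>\<^bsub>J\<^esub> (b \<odot>\<^bsub>?H\<^esub> f) x"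
  using a b x fs(2)[of "a \<odot>\<^bsub>N\<^esub> x" "b \<odot>\<^bsub>N\<^esub> x"] by (simp add: rhom_simps lm[OF Nl])
 show "((a \<otimes>\<^bsub>op_ring A\<^esub> b) \<odot>\<^bsub>?H\<^esub> f) x = (a \<odot>\<^bsub>?H\<^esub> (b \<odot>\<^bsub>?H\<^esub> f)) x"
  using a b x by (simp add: rhom_simps lm[OF Nl])
next
 fix f x assume "f \<in> carrier (rhom A N (right_of N) J)" "x \<in> carrier N"
 then show "(\<one>\<^bsub>op_ring A\<^esub> \<odot>\<^bsub>rhom A N (right_of N) J\<^esub> f) x = f x" by (simp add: rhom_simps lm[OF Nl])
qed

lemma left_hom_module:
 assumes J: "bimodule A J"
 shows "left_module (op_ring A) (left_hom A N J)"
proof -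
 have Jl: "left_module A J" and Jr: "left_module (op_ring A) (right_of J)"
  and bi: "\<And>a b x. a \<in> carrier A ==> b \<in> carrier A ==> x \<in> carrier J ==> rsmult J (smult J a x) b = smult J a (rsmult J x b)"
  using J by (auto simp: bimodule_def)
 note jr = lm(12,16,18,19,15)[OF Jr, simplified]
 let ?H = "left_hom A N J"
 have mem: "f \<in> carrier ?H \<longleftrightarrow> f \<in> mod_hom A N J \<and> f \<in> extensional (carrier N)" for f by (simp add: left_hom_simps)
 have restr: "(\<lambda>x\<in>carrier N. f x) \<in> carrier ?H" if "f \<in> mod_hom A N J" for f
  using restrict_hom[OF Nl that] by (simp add: left_hom_simps)
 have fc: "f x \<in> carrier J" if "f \<in> carrier ?H" "x \<in> carrier N" for f x
  using mod_homD(1)[of f A N J x] that by (simp add: mem)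
 show ?thesis
 proof (rule pointwise_module[OF Jl O])
  show "f x \<in> carrier J" if "f \<in> carrier ?H" "x \<in> carrier N" for f x by (rule fc[OF that])
  show "f \<in> extensional (carrier N)" if "f \<in> carrier ?H" for f using that by (simp add: mem)
  show "\<zero>\<^bsub>?H\<^esub> = (\<lambda>x\<in>carrier N. \<zero>\<^bsub>J\<^esub>)" "f \<oplus>\<^bsub>?H\<^esub> g = (\<lambda>x\<in>carrier N. f x \<oplus>\<^bsub>J\<^esub> g x)" for f g
   by (simp_all add: left_hom_simps)
  show "\<zero>\<^bsub>?H\<^esub> \<in> carrier ?H" unfolding left_hom_simps(2) by (rule restr[OF hom_zero[OF Jl]])
  show "f \<oplus>\<^bsub>?H\<^esub> g \<in> carrier ?H" if "f \<in> carrier ?H" "g \<in> carrier ?H" for f g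
   unfolding left_hom_simps(3) by (rule restr[OF hom_add[OF _ _ Jl]]) (use that in \<open>simp_all add: mem\<close>)
  show "(\<lambda>x\<in>carrier N. \<ominus>\<^bsub>J\<^esub> f x) \<in> carrier ?H" if "f \<in> carrier ?H" for f
   by (rule restr[OF hom_neg[OF _ Jl]]) (use that in \<open>simp add: mem\<close>)
  fix a f assume a: "a \<in> carrier (op_ring A)" and f: "f \<in> carrier ?H"
  have fh: "f \<in> mod_hom A N J" using f by (simp add: mem)
  have ra: "(\<lambda>x. rsmult J x a) \<in> mod_hom A J J"
   by (rule mod_homI) (use a in \<open>simp_all add: jr bi\<close>)
  show "a \<odot>\<^bsub>?H\<^esub> f \<in> carrier ?H" unfolding left_hom_simps(4) by (rule restr[OF hom_comp[OF fh ra]])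
  fix x assume x: "x \<in> carrier N"
  show "(a \<odot>\<^bsub>?H\<^esub> (f \<oplus>\<^bsub>?H\<^esub> g)) x = (a \<odot>\<^bsub>?H\<^esub> f) x \<oplus>\<^bsub>J\<^esub> (a \<odot>\<^bsub>?H\<^esub> g) x" if "g \<in> carrier ?H" for g
   using a x fc[OF f x] fc[OF that x] by (simp add: left_hom_simps jr)
  fix b assume b: "b \<in> carrier (op_ring A)"
  show "((a \<oplus>\<^bsub>op_ring A\<^esub> b) \<odot>\<^bsub>?H\<^esub> f) x = (a \<odot>\<^bsub>?H\<^esub> f) x \<oplus>\<^bsub>J\<^esub> (b \<odot>\<^bsub>?H\<^esub> f) x"
   using a b x fc[OF f x] by (simp add: left_hom_simps jr)
  show "((a \<otimes>\<^bsub>op_ring A\<^esub> b) \<odot>\<^bsub>?H\<^esub> f) x = (a \<odot>\<^bsub>?H\<^esub> (b \<odot>\<^bsub>?H\<^esub> f)) x"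
   using a b x fc[OF f x] by (simp add: left_hom_simps jr)
 next
  fix f x assume "f \<in> carrier ?H" "x \<in> carrier N"
  then show "(\<one>\<^bsub>op_ring A\<^esub> \<odot>\<^bsub>?H\<^esub> f) x = f x" using fc[of f x] by (simp add: left_hom_simps jr)
 qed
qed

text \<open>For the complex of right modules that underlies a complex \<open>I\<close> of bimodules, \<open>Hc\<close> is \<open>RHom_right A N I\<close>.\<close>

definition Hc :: "(('a, 'i, 'y) module_scheme, 'i) cochain => (('a, 'n => 'i) module, 'n => 'i) cochain" where
 "Hc J = \<lparr>obj = (\<lambda>k. rhom A N (right_of N) (obj J k)), dif = (\<lambda>k f. compose (carrier N) (dif J k) f)\<rparr>"

lemma Hc_simps [simp]: "obj (Hc J) k = rhom A N (right_of N) (obj J k)" "dif (Hc J) k f = compose (carrier N) (dif J k) f"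
 by (simp_all add: Hc_def)

lemma Hc_complex:
 assumes J: "module_complex (op_ring A) J"
 shows "module_complex (op_ring A) (Hc J)"
 unfolding module_complex_def Hc_simps
proof (intro allI conjI ballI)
 note j = module_complexD[OF J]
 fix i
 show "left_module (op_ring A) (rhom A N (right_of N) (obj J i))" by (rule rhom_module[OF j(1)])
 show "compose (carrier N) (dif J i) \<in> mod_hom (op_ring A) (rhom A N (right_of N) (obj J i)) (rhom A N (right_of N) (obj J (i + 1)))"
 proof (rule mod_homI)
  fix f assume f: "f \<in> carrier (rhom A N (right_of N) (obj J i))"
  then have fh: "f \<in> mod_hom (op_ring A) (right_of N) (obj J i)" by (simp add: rhom_mem)
  show "compose (carrier N) (dif J i) f \<in> carrier (rhom A N (right_of N) (obj J (i + 1)))"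
   unfolding compose_def by (rule restrict_rhom[OF hom_comp[OF fh j(2)]])
  show "compose (carrier N) (dif J i) (a \<odot>\<^bsub>rhom A N (right_of N) (obj J i)\<^esub> f) =
    a \<odot>\<^bsub>rhom A N (right_of N) (obj J (i + 1))\<^esub> compose (carrier N) (dif J i) f" if "a \<in> carrier (op_ring A)" for a
   using that by (auto simp: compose_def rhom_simps lm[OF Nl] intro!: restrict_ext)
  fix g assume g: "g \<in> carrier (rhom A N (right_of N) (obj J i))"
  then have gh: "g \<in> mod_hom (op_ring A) (right_of N) (obj J i)" by (simp add: rhom_mem)
  show "compose (carrier N) (dif J i) (f \<oplus>\<^bsub>rhom A N (right_of N) (obj J i)\<^esub> g) =
    compose (carrier N) (dif J i) f \<oplus>\<^bsub>rhom A N (right_of N) (obj J (i + 1))\<^esub> compose (carrier N) (dif J i) g"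
   using mod_homD(1)[OF fh] mod_homD(1)[OF gh] mod_homD(2)[OF j(2)]
   by (auto simp: compose_def rhom_simps intro!: restrict_ext)
 qed
 fix f assume f: "f \<in> carrier (rhom A N (right_of N) (obj J i))"
 then have fh: "f \<in> mod_hom (op_ring A) (right_of N) (obj J i)" by (simp add: rhom_mem)
 show "compose (carrier N) (dif J (i + 1)) (compose (carrier N) (dif J i) f) = \<zero>\<^bsub>rhom A N (right_of N) (obj J (i + 1 + 1))\<^esub>"
  using mod_homD(1)[OF fh] j(4)[of _ i] by (auto simp: compose_def rhom_simps add.assoc intro!: restrict_ext)
qed

text \<open>By adjunction, maps from \<open>L n\<close> to \<open>Hom(N, J p)\<close> are maps from the tuples \<open>W n\<close> to the injective module
 \<open>J p\<close>; hence exactness of \<open>W\<close> gives exactness of these groups of maps.  In degrees \<open>p \<ge> d\<close> the extension can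
 moreover be chosen with values in the cocycles.\<close>

lemma row_exact:
 assumes I: "fin_inj_coresolution (op_ring A) B J \<epsilon> d" and fg: "fin_gen (op_ring A) (right_of N)"
  and h: "h \<in> mod_hom (op_ring A) (L n0) (L n1)" and k: "k \<in> mod_hom (op_ring A) (L n1) (L n2)"
  and ex: "\<And>u. u \<in> carrier (W n1) ==> cmap n1 n2 k u = (\<lambda>s. \<zero>\<^bsub>N\<^esub>) ==> \<exists>v\<in>carrier (W n0). u = cmap n0 n1 h v"
  and x: "x \<in> mod_hom (op_ring A) (L n1) (rhom A N (right_of N) (obj J p))"
  and xz: "\<And>l w. l \<in> carrier (L n0) ==> w \<in> carrier N ==> x (h l) w = null J p"
 shows "\<exists>y\<in>mod_hom (op_ring A) (L n2) (rhom A N (right_of N) (obj J p)). (\<forall>l\<in>carrier (L n1). x l = y (k l)) \<and>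
  (int d \<le> p --> (\<forall>l\<in>carrier (L n1). \<forall>w\<in>carrier N. dif J p (x l w) = null J (p + 1)) -->
   (\<forall>l\<in>carrier (L n2). \<forall>w\<in>carrier N. dif J p (y l w) = null J (p + 1)))"
proof -
 interpret I: fin_inj_coresolution "op_ring A" B J \<epsilon> d by (rule I)
 obtain m :: nat and \<pi>0 where "\<pi>0 \<in> mod_hom (op_ring A) (Fr (op_ring A) m) (right_of N)"
  "\<pi>0 ` vecs (op_ring A) m = carrier (right_of N)" using fin_gen_surj[OF Nr fg] by blast
 from dsum_surj[OF Nr this] obtain m' :: nat and \<pi> where \<pi>: "\<pi> \<in> mod_hom (op_ring A) (Fr (op_ring A) m') (Wr n2)"
  "\<pi> ` vecs (op_ring A) m' = carrier (Wr n2)" by blast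
 obtain \<xi> where \<xi>: "\<xi> \<in> mod_hom (op_ring A) (Wr n1) (obj J p)"
  "\<And>l y. l \<in> carrier (L n1) ==> y \<in> carrier N ==> \<xi> (gen l y) = x l y"
  using adjunct[OF I.X x] by blast
 note xis = hom_simps[OF \<xi>(1) Wrm I.X]
 have \<xi>c: "\<xi> (cmap n0 n1 h v) = null J p" if v: "v \<in> carrier (W n0)" for v
  by (rule W_hom_eq[OF I.X hom_comp[OF cmap_hom[OF h] \<xi>(1)] hom_zero[OF I.X] _ v])
   (simp add: cmap_gen[OF h] \<xi>(2) mod_homD(1)[OF h] xz del: free_op_carrier)
 have ker: "\<xi> u = null J p" if "u \<in> carrier (Wr n1)" "cmap n1 n2 k u = \<zero>\<^bsub>Wr n2\<^esub>" for u
  using ex[of u] \<xi>c that by auto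
 have "\<exists>\<eta>\<in>mod_hom (op_ring A) (Wr n2) (obj J p). (\<forall>u\<in>carrier (Wr n1). \<xi> u = \<eta> (cmap n1 n2 k u)) \<and>
  (int d \<le> p --> (\<forall>l\<in>carrier (L n1). \<forall>w\<in>carrier N. dif J p (x l w) = null J (p + 1)) -->
   (\<forall>u\<in>carrier (Wr n2). dif J p (\<eta> u) = null J (p + 1)))"
 proof (cases "int d \<le> p \<and> (\<forall>l\<in>carrier (L n1). \<forall>w\<in>carrier N. dif J p (x l w) = null J (p + 1))")
  case True
  then obtain p' where p: "p = int p'" "d \<le> p'" by (metis nat_int nat_mono zero_le_imp_eq_int order_trans of_nat_0_le_iff)
  have "dif J p (\<xi> u) = null J (p + 1)" if u: "u \<in> carrier (W n1)" for u
   by (rule W_hom_eq[OF I.X hom_comp[OF \<xi>(1) I.dX] hom_zero[OF I.X] _ u])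
    (use True in \<open>simp add: \<xi>(2) del: free_op_carrier\<close>)
  then have "\<And>u. u \<in> carrier (Wr n1) ==> dif J (int p') (\<xi> u) = null J (int p' + 1)" by (simp add: p)
  from I.cocycle_extension[OF Wrm Wrm \<pi> cmap_hom[OF k] \<xi>(1)[unfolded p] ker[unfolded p] this p(2)]
  show ?thesis unfolding p by blast
 next
  case False
  have "\<exists>\<eta>\<in>mod_hom (op_ring A) (Wr n2) (obj J p). \<forall>u\<in>carrier (Wr n1). \<xi> u = \<eta> (cmap n1 n2 k u)"
   by (rule injective_factor[OF I.inj Wrm Wrm \<pi> cmap_hom[OF k] \<xi>(1) ker])
  then show ?thesis using False by blast
 qed
 then obtain \<eta> where \<eta>: "\<eta> \<in> mod_hom (op_ring A) (Wr n2) (obj J p)" "\<And>u. u \<in> carrier (Wr n1) ==> \<xi> u = \<eta> (cmap n1 n2 k u)"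
  and \<eta>d: "int d \<le> p ==> \<forall>l\<in>carrier (L n1). \<forall>w\<in>carrier N. dif J p (x l w) = null J (p + 1) ==>
   \<forall>u\<in>carrier (Wr n2). dif J p (\<eta> u) = null J (p + 1)" by blast
 show ?thesis
 proof (rule bexI[OF _ coadjunct[OF I.X \<eta>(1)]], intro conjI ballI impI)
  fix l assume l: "l \<in> carrier (L n1)"
  have kl: "k l \<in> carrier (L n2)" by (rule mod_homD(1)[OF k l])
  have "x l \<in> extensional (carrier N)" using mod_homD(1)[OF x l] by (simp add: rhom_mem)
  then show "x l = (\<lambda>y\<in>carrier N. \<eta> (gen (k l) y))"
  proof (rule restrict_ext_eq[symmetric])
   fix w assume w: "w \<in> carrier N"
   have "x l w = \<eta> (cmap n1 n2 k (gen l w))" using \<xi>(2)[OF l w] \<eta>(2)[of "gen l w"] gen_W[OF l w] by simp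
   then show "\<eta> (gen (k l) w) = x l w" by (simp add: cmap_gen[OF k l w])
  qed
 next
  fix l w assume d: "int d \<le> p" "\<forall>l\<in>carrier (L n1). \<forall>w\<in>carrier N. dif J p (x l w) = null J (p + 1)"
   and l: "l \<in> carrier (L n2)" and w: "w \<in> carrier N"
  then show "dif J p ((\<lambda>y\<in>carrier N. \<eta> (gen l y)) w) = null J (p + 1)" using \<eta>d[OF d] gen_W[OF l w] by simp
 qed
qed

text \<open>Column by column, starting in degree 0, the injectivity of the components of \<open>J\<close> produces a
 null-homotopy; in the last degree \<open>b\<close> the injectivity of the cocycles is used.\<close>

lemma Hc_tot_exact:
 assumes I: "fin_inj_coresolution (op_ring A) B J \<epsilon> d" and fg: "fin_gen (op_ring A) (right_of N)"
  and C: "module_complex (op_ring A) C" and Co: "\<And>j. obj C j = L (\<nu> j)"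
  and ex: "\<And>j u. u \<in> carrier (W (\<nu> j)) ==> cmap (\<nu> j) (\<nu> (j + 1)) (dif C j) u = (\<lambda>s. \<zero>\<^bsub>N\<^esub>) ==>
   \<exists>v\<in>carrier (W (\<nu> (j - 1))). u = cmap (\<nu> (j - 1)) (\<nu> j) (dif C (j - 1)) v"
  and db: "int d \<le> b"
 shows "tot_exact (op_ring A) C (Hc J) b"
 unfolding tot_exact_def
proof (intro allI impI)
 interpret I: fin_inj_coresolution "op_ring A" B J \<epsilon> d by (rule I)
 let ?O = "op_ring A" and ?H = "Hc J"
 note Hx = Hc_complex[OF I.c(1)]
 note Hm = module_complexD(1)[OF Hx] and Cm = module_complexD(1)[OF C]
 note dH = module_complexD(2)[OF Hx] and dH' = module_complexD(3)[OF Hx] and dC = module_complexD(2)[OF C] and dC' = module_complexD(3)[OF C]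
 note dHs = hom_simps[OF dH Hm Hm] and dHs' = hom_simps[OF dH' Hm Hm] and dCs = hom_simps[OF dC Cm Cm] and dCs' = hom_simps[OF dC' Cm Cm]
 fix x assume x: "chain_map ?O C ?H x" and xz0: "\<forall>p>b. \<forall>l\<in>elts C p. x p l = null ?H p"
 then have xz: "x p l = null ?H p" if "p > b" "l \<in> elts C p" for p l using that by blast
 note xs = hom_simps[OF chain_mapD(1)[OF x] Cm Hm]
 have neg: "f = null ?H p" if "p < 0" "f \<in> elts ?H p" for p f
 proof -
  have f: "f \<in> mod_hom ?O (right_of N) (obj J p)" "f \<in> extensional (carrier N)" using that(2) by (simp_all add: rhom_mem)
  show ?thesis
   unfolding Hc_simps rhom_simps
  proof (rule restrict_ext_eq[symmetric, OF f(2)])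
   fix w assume "w \<in> carrier N"
   then show "null J p = f w" using mod_homD(1)[OF f(1), of w] I.c(7)[OF that(1)] by simp
  qed
 qed
 have cyc: "dif J p (f w) = null J (p + 1)" if "dif ?H p f = null ?H (p + 1)" "w \<in> carrier N" for p f w
  using fun_cong[OF that(1), of w] that(2) by (simp add: compose_def rhom_simps)
 define Good where "Good q y \<longleftrightarrow> y \<in> mod_hom ?O (obj C q) (obj ?H (q - 1)) \<and>
   (\<forall>l\<in>elts C (q - 1). dif ?H (q - 1) (x (q - 1) l \<oplus>\<^bsub>obj ?H (q - 1)\<^esub> \<ominus>\<^bsub>obj ?H (q - 1)\<^esub> y (dif C (q - 1) l)) = null ?H q) \<and>
   (q > b --> (\<forall>l\<in>elts C q. dif ?H (q - 1) (y l) = null ?H q)) \<and>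
   (q > b + 1 --> (\<forall>l\<in>elts C q. y l = null ?H (q - 1)))" for q y
 define Rel where "Rel q y y' \<longleftrightarrow> (\<forall>l\<in>elts C q. x q l = y' (dif C q l) \<oplus>\<^bsub>obj ?H q\<^esub> dif ?H (q - 1) (y l))" for q y y'
 have "\<exists>S. (\<forall>q\<le>0. S q = (\<lambda>l. null ?H (- 1))) \<and> (\<forall>q\<ge>0. Good q (S q) \<and> Rel q (S q) (S (q + 1)))"
 proof (rule upward_choice)
  have "x (- 1) l = null ?H (- 1)" if "l \<in> elts C (- 1)" for l
   by (rule neg[OF _ xs(1)[OF that]]) simp
  then show "Good 0 (\<lambda>l. null ?H (- 1))"
   using hom_zero[OF Hm[of "- 1"], of "obj C 0"] dHs(4)[of "- 1"] db lm(2,4,9)[OF Hm[of "- 1"]] by (simp add: Good_def del: Hc_simps)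
 next
  fix q y assume q0: "q \<ge> 0" and G: "Good q y"
  have y: "y \<in> mod_hom ?O (obj C q) (obj ?H (q - 1))"
   and g1: "\<And>l. l \<in> elts C (q - 1) ==> dif ?H (q - 1) (x (q - 1) l \<oplus>\<^bsub>obj ?H (q - 1)\<^esub> \<ominus>\<^bsub>obj ?H (q - 1)\<^esub> y (dif C (q - 1) l)) = null ?H q"
   and g2: "\<And>l. q > b ==> l \<in> elts C q ==> dif ?H (q - 1) (y l) = null ?H q"
   using G unfolding Good_def by blast+
  note ys = hom_simps[OF y Cm Hm]
  let ?e = "\<lambda>l. x q l \<oplus>\<^bsub>obj ?H q\<^esub> \<ominus>\<^bsub>obj ?H q\<^esub> dif ?H (q - 1) (y l)"
  have e: "?e \<in> mod_hom ?O (obj C q) (obj ?H q)" by (rule hom_diff[OF chain_mapD(1)[OF x] hom_comp[OF y dH'] Hm])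
  have ec: "?e l \<in> elts ?H q" if "l \<in> elts C q" for l by (rule mod_homD(1)[OF e that])
  have e0: "?e (dif C (q - 1) l) = null ?H q" if l: "l \<in> elts C (q - 1)" for l
  proof -
   have dl: "dif C (q - 1) l \<in> elts C q" by (rule dCs'(1)[OF l])
   show ?thesis
    using g1[OF l] unfolding chain_mapD(3)[OF x l] dHs'(2)[OF xs(1)[OF l] lm(3)[OF Hm ys(1)[OF dl]]] dHs'(5)[OF ys(1)[OF dl]] .
  qed
  have xe: "x q l = ?e l \<oplus>\<^bsub>obj ?H q\<^esub> dif ?H (q - 1) (y l)" if l: "l \<in> elts C q" for l
   using xs(1)[OF l] dHs'(1)[OF ys(1)[OF l]] by (simp add: lms[OF Hm] del: Hc_simps)
  have de: "dif ?H q (?e l) = dif ?H q (x q l)" if l: "l \<in> elts C q" for l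
   unfolding dHs(2)[OF xs(1)[OF l] lm(3)[OF Hm dHs'(1)[OF ys(1)[OF l]]]] dHs(5)[OF dHs'(1)[OF ys(1)[OF l]]]
    module_complexD(5)[OF Hx ys(1)[OF l]] lm(9)[OF Hm] by (rule lm(5)[OF Hm dHs(1)[OF xs(1)[OF l]]])
  show "\<exists>y'. Good (q + 1) y' \<and> Rel q y y'"
  proof (cases "q > b")
   case True
   have "Good (q + 1) (\<lambda>l. null ?H q)"
    unfolding Good_def using True xz[OF True] hom_zero[OF Hm[of q], of "obj C (q + 1)"] dHs(4)[of q] lm(2,4,9)[OF Hm[of q]]
    by (simp del: Hc_simps)
   moreover have "Rel q y (\<lambda>l. null ?H q)"
    unfolding Rel_def using True xz[OF True] g2[OF True] lm(2,4)[OF Hm[of q]] by (simp del: Hc_simps)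
   ultimately show ?thesis by blast
  next
   case False
   have h: "dif C (q - 1) \<in> mod_hom ?O (L (\<nu> (q - 1))) (L (\<nu> q))" using dC'[of q] unfolding Co .
   have k: "dif C q \<in> mod_hom ?O (L (\<nu> q)) (L (\<nu> (q + 1)))" using dC[of q] unfolding Co .
   have e': "?e \<in> mod_hom ?O (L (\<nu> q)) (rhom A N (right_of N) (obj J q))" using e unfolding Co Hc_simps .
   have ez: "?e (dif C (q - 1) l) w = null J q" if "l \<in> carrier (L (\<nu> (q - 1)))" "w \<in> carrier N" for l w
    using e0[of l] that by (simp add: Co rhom_simps del: free_op_carrier)
   from row_exact[OF I fg h k ex e' ez] obtain y' where
    y': "y' \<in> mod_hom ?O (obj C (q + 1)) (obj ?H q)" "\<And>l. l \<in> elts C q ==> ?e l = y' (dif C q l)"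
    "int d \<le> q ==> \<forall>l\<in>elts C q. \<forall>w\<in>carrier N. dif J q (?e l w) = null J (q + 1) ==>
     \<forall>l\<in>elts C (q + 1). \<forall>w\<in>carrier N. dif J q (y' l w) = null J (q + 1)"
    unfolding Co Hc_simps by blast
   have qe: "q + 1 - 1 = q" by simp
   have "Good (q + 1) y'"
    unfolding Good_def qe
   proof (intro conjI ballI impI y'(1))
    fix l assume l: "l \<in> elts C q"
    have dy: "dif ?H (q - 1) (y l) \<in> elts ?H q" by (rule dHs'(1)[OF ys(1)[OF l]])
    have "x q l \<oplus>\<^bsub>obj ?H q\<^esub> \<ominus>\<^bsub>obj ?H q\<^esub> ?e l = dif ?H (q - 1) (y l)"
     using xs(1)[OF l] dy by (simp add: lms[OF Hm] del: Hc_simps)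
    then have "x q l \<oplus>\<^bsub>obj ?H q\<^esub> \<ominus>\<^bsub>obj ?H q\<^esub> y' (dif C q l) = dif ?H (q - 1) (y l)" unfolding y'(2)[OF l, symmetric] .
    then show "dif ?H q (x q l \<oplus>\<^bsub>obj ?H q\<^esub> \<ominus>\<^bsub>obj ?H q\<^esub> y' (dif C q l)) = null ?H (q + 1)"
     using module_complexD(5)[OF Hx ys(1)[OF l]] by (simp only:)
   next
    fix l assume "q + 1 > b" and l: "l \<in> elts C (q + 1)"
    with False have q: "q = b" by simp
    have "dif J q (?e l w) = null J (q + 1)" if l: "l \<in> elts C q" and w: "w \<in> carrier N" for l w
    proof (rule cyc[OF _ w])
     show "dif ?H q (?e l) = null ?H (q + 1)"
      unfolding de[OF l] chain_mapD(2)[OF x l, symmetric] by (rule xz[OF _ dCs(1)[OF l]]) (simp add: q)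
    qed
    then have "\<forall>w\<in>carrier N. dif J q (y' l w) = null J (q + 1)" using y'(3) db q l by blast
    then show "dif ?H q (y' l) = null ?H (q + 1)" by (auto simp: compose_def rhom_simps intro!: restrict_ext)
   next
    fix l assume "q + 1 > b + 1"
    then show "y' l = null ?H q" using False by simp
   qed
   moreover have "Rel q y y'" unfolding Rel_def using xe y'(2) by (simp del: Hc_simps)
   ultimately show ?thesis by blast
  qed
 qed
 then obtain S where S: "\<And>q. q \<le> 0 ==> S q = (\<lambda>l. null ?H (- 1))" "\<And>q. q \<ge> 0 ==> Good q (S q)" "\<And>q. q \<ge> 0 ==> Rel q (S q) (S (q + 1))"
  by blast
 define y where "y p = (if p \<ge> - 1 then S (p + 1) else (\<lambda>l. null ?H p))" for p
 show "\<exists>y. (\<forall>p. y p \<in> mod_hom ?O (obj C (p + 1)) (obj ?H p)) \<and> (\<forall>p>b. \<forall>l\<in>elts C (p + 1). y p l = null ?H p) \<and>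
    (\<forall>p. \<forall>l\<in>elts C p. x p l = y p (dif C p l) \<oplus>\<^bsub>obj ?H p\<^esub> dif ?H (p - 1) (y (p - 1) l))"
 proof (intro exI[of _ y] conjI allI impI ballI)
  show yh: "y p \<in> mod_hom ?O (obj C (p + 1)) (obj ?H p)" for p
   using S(2)[of "p + 1"] hom_zero[OF Hm[of p], of "obj C (p + 1)"] by (simp add: y_def Good_def del: Hc_simps)
  show "y p l = null ?H p" if "b < p" "l \<in> elts C (p + 1)" for p l
   using S(2)[of "p + 1"] that db by (simp add: y_def Good_def del: Hc_simps)
  fix p l assume l: "l \<in> elts C p"
  show "x p l = y p (dif C p l) \<oplus>\<^bsub>obj ?H p\<^esub> dif ?H (p - 1) (y (p - 1) l)"
  proof (cases "p \<ge> 0")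
   case True
   then show ?thesis using S(3)[OF True] l unfolding Rel_def by (simp add: y_def del: Hc_simps)
  next
   case False
   have y1: "y (p - 1) l \<in> elts ?H (p - 1)" using mod_homD(1)[OF yh[of "p - 1"], of l] l by simp
   have y2: "y p (dif C p l) \<in> elts ?H p" by (rule mod_homD(1)[OF yh dCs(1)[OF l]])
   from False have p: "p < 0" by simp
   have "y p (dif C p l) \<oplus>\<^bsub>obj ?H p\<^esub> dif ?H (p - 1) (y (p - 1) l) = null ?H p"
    by (rule neg[OF p lm(1)[OF Hm y2 dHs'(1)[OF y1]]])
   moreover have "x p l = null ?H p" by (rule neg[OF p xs(1)[OF l]])
   ultimately show ?thesis by simp
  qed
 qed
qed

end

section \<open>Dimension shifting\<close>

text \<open>\<open>Ext\<close> into a retract of \<open>Y\<close> is a retract of \<open>Ext\<close> into \<open>Y\<close>.\<close>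

lemma hom_exact_retract:
 assumes \<phi>: "\<phi> \<in> mod_hom R X Y" and \<psi>: "\<psi> \<in> mod_hom R Y X" and r: "\<And>x. x \<in> carrier X ==> \<psi> (\<phi> x) = x"
  and X: "left_module R X" and Y: "left_module R Y" and ex: "hom_exact R P f Y i"
 shows "hom_exact R P f X i"
 unfolding hom_exact_def
proof (intro ballI impI)
 fix g assume g: "g \<in> mod_hom R (P (Suc i)) X" and g0: "\<forall>x\<in>carrier (P (Suc (Suc i))). g (f (Suc i) x) = \<zero>\<^bsub>X\<^esub>"
 have "\<exists>h\<in>mod_hom R (P i) Y. \<forall>x\<in>carrier (P (Suc i)). \<phi> (g x) = h (f i x)"
  by (rule hom_exactD[OF ex hom_comp[OF g \<phi>]]) (simp add: g0 hom_simps(4)[OF \<phi> X Y])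
 then obtain h where h: "h \<in> mod_hom R (P i) Y" "\<And>x. x \<in> carrier (P (Suc i)) ==> \<phi> (g x) = h (f i x)" by blast
 show "\<exists>h\<in>mod_hom R (P i) X. \<forall>x\<in>carrier (P (Suc i)). g x = h (f i x)"
  by (rule bexI[OF _ hom_comp[OF h(1) \<psi>]]) (simp add: h(2)[symmetric] r mod_homD(1)[OF g])
qed

lemma hom_exact_dsum:
 assumes X: "left_module R X" and ex: "hom_exact R P f X i" and P: "\<And>i. left_module R (P i)"
  and fi: "f i \<in> mod_hom R (P (Suc i)) (P i)"
 shows "hom_exact R P f (dsum X {..<n::nat}) i"
 unfolding hom_exact_def
proof (intro ballI impI)
 note dc = dsum_carrier_finite[OF finite_lessThan, of _ X n]
 fix g assume g: "g \<in> mod_hom R (P (Suc i)) (dsum X {..<n})"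
  and g0: "\<forall>x\<in>carrier (P (Suc (Suc i))). g (f (Suc i) x) = \<zero>\<^bsub>dsum X {..<n}\<^esub>"
 have gs: "(\<lambda>x. g x s) \<in> mod_hom R (P (Suc i)) X" for s
  by (rule mod_homI) (use mod_homD[OF g] in \<open>simp_all add: dc\<close>)
 have "\<exists>h\<in>mod_hom R (P i) X. \<forall>x\<in>carrier (P (Suc i)). g x s = h (f i x)" for s
  by (rule hom_exactD[OF ex gs]) (simp add: g0)
 then obtain h where h: "\<And>s. h s \<in> mod_hom R (P i) X" "\<And>s x. x \<in> carrier (P (Suc i)) ==> g x s = h s (f i x)" by metis
 have "(\<lambda>x s. if s < n then h s x else \<zero>\<^bsub>X\<^esub>) \<in> mod_hom R (P i) (dsum X {..<n})"
  by (rule mod_homI) (auto simp: dc mod_homD[OF h(1)] lm[OF X] fun_eq_iff)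
 moreover have "g x = (\<lambda>s. if s < n then h s (f i x) else \<zero>\<^bsub>X\<^esub>)" if x: "x \<in> carrier (P (Suc i))" for x
  using mod_homD(1)[OF g x] h(2)[OF x] by (auto simp: dc fun_eq_iff)
 ultimately show "\<exists>h\<in>mod_hom R (P i) (dsum X {..<n}). \<forall>x\<in>carrier (P (Suc i)). g x = h (f i x)"
  by (intro bexI[of _ "\<lambda>x s. if s < n then h s x else \<zero>\<^bsub>X\<^esub>"]) auto
qed

text \<open>The piece \<open>Ext(X) \<rightarrow> Ext(Y) \<rightarrow> Ext(ker q)\<close> of a long exact sequence.\<close>

lemma hom_exact_quotient:
 assumes P: "\<And>i. projective_module R (P i)" and fi: "\<And>i. f i \<in> mod_hom R (P (Suc i)) (P i)"
  and ff: "\<And>i x. x \<in> carrier (P (Suc (Suc i))) ==> f i (f (Suc i) x) = \<zero>\<^bsub>P i\<^esub>"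
  and X: "left_module R X" and Y: "left_module R Y" and q: "q \<in> mod_hom R X Y" "q ` carrier X = carrier Y"
  and exX: "hom_exact R P f X i" and exK: "hom_exact R P f (X\<lparr>carrier := {x \<in> carrier X. q x = \<zero>\<^bsub>Y\<^esub>}\<rparr>) (Suc i)"
 shows "hom_exact R P f Y i"
 unfolding hom_exact_def
proof (intro ballI impI)
 let ?K = "X\<lparr>carrier := {x \<in> carrier X. q x = \<zero>\<^bsub>Y\<^esub>}\<rparr>"
 note Pm = projective_moduleD[OF P]
 fix g assume g: "g \<in> mod_hom R (P (Suc i)) Y" and g0: "\<forall>x\<in>carrier (P (Suc (Suc i))). g (f (Suc i) x) = \<zero>\<^bsub>Y\<^esub>"
 have "\<exists>h\<in>mod_hom R (P (Suc i)) X. \<forall>x\<in>carrier (P (Suc i)). q (h x) = g x"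
  by (rule proj_lift[OF P X Y q(1) g]) (use q(2) mod_homD(1)[OF g] in simp)
 then obtain g' where g': "g' \<in> mod_hom R (P (Suc i)) X" "\<And>x. x \<in> carrier (P (Suc i)) ==> q (g' x) = g x" by blast
 note gs = hom_simps[OF g'(1) Pm X] and qs = hom_simps[OF q(1) X Y] and fs = hom_simps[OF fi Pm Pm]
 have gf: "(\<lambda>x. g' (f (Suc i) x)) \<in> mod_hom R (P (Suc (Suc i))) ?K"
  using hom_comp[OF fi[of "Suc i"] g'(1)] g'(2) g0 fs(1) unfolding mod_hom_def by auto
 have "\<exists>h\<in>mod_hom R (P (Suc i)) ?K. \<forall>x\<in>carrier (P (Suc (Suc i))). g' (f (Suc i) x) = h (f (Suc i) x)"
  by (rule hom_exactD[OF exK gf]) (simp add: ff gs(4))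
 then obtain h where h: "h \<in> mod_hom R (P (Suc i)) ?K" "\<And>x. x \<in> carrier (P (Suc (Suc i))) ==> g' (f (Suc i) x) = h (f (Suc i) x)" by blast
 have hX: "h \<in> mod_hom R (P (Suc i)) X" using h(1) unfolding mod_hom_def by auto
 have hK: "q (h x) = \<zero>\<^bsub>Y\<^esub>" if "x \<in> carrier (P (Suc i))" for x using mod_homD(1)[OF h(1) that] by simp
 note hs = hom_simps[OF hX Pm X]
 have "\<exists>u\<in>mod_hom R (P i) X. \<forall>x\<in>carrier (P (Suc i)). g' x \<oplus>\<^bsub>X\<^esub> \<ominus>\<^bsub>X\<^esub> h x = u (f i x)"
  by (rule hom_exactD[OF exX hom_diff[OF g'(1) hX X]]) (simp add: h(2)[symmetric] lm[OF X] gs(1) fs(1))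
 then obtain u where u: "u \<in> mod_hom R (P i) X" "\<And>x. x \<in> carrier (P (Suc i)) ==> g' x \<oplus>\<^bsub>X\<^esub> \<ominus>\<^bsub>X\<^esub> h x = u (f i x)" by blast
 show "\<exists>h\<in>mod_hom R (P i) Y. \<forall>x\<in>carrier (P (Suc i)). g x = h (f i x)"
  by (rule bexI[OF _ hom_comp[OF u(1) q(1)]])
   (simp add: u(2)[symmetric] qs lm[OF X] gs(1) hs(1) g'(2) hK lm[OF Y] mod_homD(1)[OF g])
qed

text \<open>If \<open>P\<close> is a resolution of \<open>N\<close>, it suffices that the complex of homomorphisms from \<open>N\<close> itself to \<open>J\<close> is
 exact in high degrees.\<close>

lemma hom_exact_of_coresolution_module:
 assumes P: "nat_resolution R P f N \<pi>" "\<And>i. projective_module R (P i)"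
  and B: "left_module R B" and cor: "coresolution R B J \<epsilon>" and exJ: "\<And>m i. hom_exact R P f (obj J m) i"
  and exN: "\<And>p g. p0 \<le> p ==> g \<in> mod_hom R N (obj J (int p + 1)) ==>
   (\<And>x. x \<in> carrier N ==> dif J (int p + 1) (g x) = null J (int p + 2)) ==>
   \<exists>w\<in>mod_hom R N (obj J (int p)). \<forall>x\<in>carrier N. g x = dif J (int p) (w x)"
  and i: "p0 \<le> i"
 shows "hom_exact R P f B i"
proof (rule hom_exact_of_coresolution[OF P(2) _ _ B cor exJ _ i])
 note r = nat_resolutionD[OF P(1)] note X = module_complexD(1)[OF coresolutionD(1)[OF cor]]
 show "f i \<in> mod_hom R (P (Suc i)) (P i)" for i by (rule r(3))
 show "f i (f (Suc i) x) = \<zero>\<^bsub>P i\<^esub>" if "x \<in> carrier (P (Suc (Suc i)))" for i x by (rule r(7)[OF that])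
 fix p v assume p: "p0 \<le> p" and v: "v \<in> mod_hom R (P 0) (obj J (int p + 1))"
  and dv: "\<And>x. x \<in> carrier (P 0) ==> dif J (int p + 1) (v x) = null J (int p + 2)"
  and vf: "\<And>x. x \<in> carrier (P (Suc 0)) ==> v (f 0 x) = null J (int p + 1)"
 have "\<exists>u\<in>mod_hom R N (obj J (int p + 1)). \<forall>x\<in>carrier (P 0). v x = u (\<pi> x)"
  by (rule hom_factor[OF r(2) r(1) X r(4,5) v]) (use r(8) vf in blast)
 then obtain u where u: "u \<in> mod_hom R N (obj J (int p + 1))" "\<And>x. x \<in> carrier (P 0) ==> v x = u (\<pi> x)" by blast
 have "dif J (int p + 1) (u y) = null J (int p + 2)" if "y \<in> carrier N" for y
 proof -
  obtain x where x: "x \<in> carrier (P 0)" "y = \<pi> x" using r(5) \<open>y \<in> carrier N\<close> by auto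
  show ?thesis unfolding x(2) u(2)[OF x(1), symmetric] by (rule dv[OF x(1)])
 qed
 from exN[OF p u(1) this] obtain w where w: "w \<in> mod_hom R N (obj J (int p))" "\<And>x. x \<in> carrier N ==> u x = dif J (int p) (w x)" by blast
 show "\<exists>w\<in>mod_hom R (P 0) (obj J (int p)). (\<forall>x\<in>carrier (P (Suc 0)). w (f 0 x) = null J (int p)) \<and>
   (\<forall>x\<in>carrier (P 0). dif J (int p) (w x) = v x)"
  by (rule bexI[OF _ hom_comp[OF r(4) w(1)]])
   (simp add: r(6) hom_simps(4)[OF w(1) r(1) X] u(2) w(2) mod_homD(1)[OF r(4)])
qed

section \<open>Chain maps that vanish in high degrees\<close>

text \<open>As \<open>tot_exact\<close>, but the homotopy vanishes in degree \<open>b\<close>, too.  If \<open>L\<close> is replaced by its truncation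
 at the place where chain maps begin to vanish, such a homotopy is still defined.\<close>

definition tot_exact_strict :: "('a, 'r) ring_scheme => (('a, 'l, 'x) module_scheme, 'l) cochain =>
  (('a, 'b, 'y) module_scheme, 'b) cochain => int => bool" where
 "tot_exact_strict R L X b \<longleftrightarrow> (\<forall>x. chain_map R L X x \<and> (\<forall>p>b. \<forall>l\<in>elts L p. x p l = null X p) -->
   (\<exists>y. (\<forall>p. y p \<in> mod_hom R (obj L (p + 1)) (obj X p)) \<and>
    (\<forall>p\<ge>b. \<forall>l\<in>elts L (p + 1). y p l = null X p) \<and>
    (\<forall>p. \<forall>l\<in>elts L p. x p l = y p (dif L p l) \<oplus>\<^bsub>obj X p\<^esub> dif X (p - 1) (y (p - 1) l))))"

text \<open>If all cocycles of degree \<open>b\<close> are coboundaries, the component of degree \<open>b\<close> can be removed by a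
 homotopy.\<close>

lemma tot_exact_strictI:
 assumes L: "module_complex R L" and X: "module_complex R X" and P: "projective_module R (obj L b)"
  and cyc: "\<And>u. u \<in> elts X b ==> dif X b u = null X (b + 1) ==> u \<in> dif X (b - 1) ` elts X (b - 1)"
  and ex: "tot_exact R L X (b - 1)"
 shows "tot_exact_strict R L X b"
 unfolding tot_exact_strict_def
proof (intro allI impI, elim conjE)
 note Lm = module_complexD(1)[OF L] and Xm = module_complexD(1)[OF X]
 note dL = module_complexD(2)[OF L] and dL' = module_complexD(3)[OF L] and dX = module_complexD(2)[OF X] and dX' = module_complexD(3)[OF X]
 note dXs = hom_simps[OF dX Xm Xm] and dXs' = hom_simps[OF dX' Xm Xm] and dLs = hom_simps[OF dL Lm Lm]
 fix x assume x: "chain_map R L X x" and xz0: "\<forall>p>b. \<forall>l\<in>elts L p. x p l = null X p"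
 then have xz: "x p l = null X p" if "p > b" "l \<in> elts L p" for p l using that by blast
 note xh = chain_mapD(1)[OF x] note xs = hom_simps[OF xh Lm Xm]
 have "\<exists>w\<in>mod_hom R (obj L b) (obj X (b - 1)). \<forall>l\<in>elts L b. dif X (b - 1) (w l) = x b l"
 proof (rule proj_lift[OF P Xm Xm dX' xh])
  fix l assume l: "l \<in> elts L b"
  have "dif X b (x b l) = null X (b + 1)"
   unfolding chain_mapD(2)[OF x l, symmetric] by (rule xz[OF _ dLs(1)[OF l]]) simp
  then show "x b l \<in> dif X (b - 1) ` elts X (b - 1)" by (rule cyc[OF xs(1)[OF l]])
 qed
 then obtain w where w: "w \<in> mod_hom R (obj L b) (obj X (b - 1))" "\<And>l. l \<in> elts L b ==> dif X (b - 1) (w l) = x b l" by blast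
 define W where "W p = (if p = b - 1 then w else (\<lambda>l. null X p))" for p
 have W: "W p \<in> mod_hom R (obj L (p + 1)) (obj X p)" for p
  using w(1) hom_zero[OF Xm[of p], of "obj L (p + 1)"] by (simp add: W_def)
 have W': "W (p - 1) \<in> mod_hom R (obj L p) (obj X (p - 1))" for p using W[of "p - 1"] by simp
 have Wz: "W p l = null X p" if "p \<ge> b" for p l using that by (simp add: W_def)
 define z where "z p l = W p (dif L p l) \<oplus>\<^bsub>obj X p\<^esub> dif X (p - 1) (W (p - 1) l)" for p l
 have z: "z p \<in> mod_hom R (obj L p) (obj X p)" for p
  unfolding z_def by (rule hom_add[OF hom_comp[OF dL W] hom_comp[OF W' dX'] Xm])
 have dz: "z (p + 1) (dif L p l) = dif X p (z p l)" if l: "l \<in> elts L p" for p l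
 proof -
  note c = mod_homD(1)[OF W dLs(1)[OF l]] mod_homD(1)[OF W' l]
  have "z (p + 1) (dif L p l) = dif X p (W p (dif L p l))"
   using module_complexD(4)[OF L l] hom_simps(4)[OF W Lm Xm, of "p + 1"] dXs(1)[OF c(1)]
   by (simp add: z_def lm[OF Xm] add.assoc)
  also have "\<dots> = dif X p (z p l)"
   unfolding z_def dXs(2)[OF c(1) dXs'(1)[OF c(2)]] module_complexD(5)[OF X c(2)]
   by (rule lm(5)[OF Xm dXs(1)[OF c(1)], symmetric])
  finally show ?thesis .
 qed
 note zc = mod_homD(1)[OF z]
 define x' where "x' p l = x p l \<oplus>\<^bsub>obj X p\<^esub> \<ominus>\<^bsub>obj X p\<^esub> z p l" for p l
 have x': "chain_map R L X x'"
  unfolding chain_map_def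
 proof (intro allI conjI ballI)
  show "x' p \<in> mod_hom R (obj L p) (obj X p)" for p unfolding x'_def by (rule hom_diff[OF xh z Xm])
  fix p l assume l: "l \<in> elts L p"
  show "x' (p + 1) (dif L p l) = dif X p (x' p l)"
   unfolding x'_def dXs(2)[OF xs(1)[OF l] lm(3)[OF Xm zc[OF l]]] dXs(5)[OF zc[OF l]] dz[OF l] chain_mapD(2)[OF x l] ..
 qed
 have "x' p l = null X p" if p: "p > b - 1" and l: "l \<in> elts L p" for p l
 proof (cases "p = b")
  case True
  then have "z p l = x p l" using l w(2)[of l] xs(1)[OF l] by (simp add: z_def Wz lm[OF Xm]) (simp add: W_def lm[OF Xm])
  then show ?thesis using xs(1)[OF l] by (simp add: x'_def lm[OF Xm])
 next
  case False
  then have "z p l = null X p" using p hom_simps(4)[OF dX' Xm Xm, of p] by (simp add: z_def Wz lm[OF Xm])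
  then show ?thesis using xz[OF _ l] p False by (simp add: x'_def lm[OF Xm])
 qed
 from tot_exactD[OF ex x' this] obtain y where y: "\<And>p. y p \<in> mod_hom R (obj L (p + 1)) (obj X p)"
  "\<And>p l. p > b - 1 ==> l \<in> elts L (p + 1) ==> y p l = null X p"
  "\<And>p l. l \<in> elts L p ==> x' p l = y p (dif L p l) \<oplus>\<^bsub>obj X p\<^esub> dif X (p - 1) (y (p - 1) l)" by blast
 show "\<exists>y. (\<forall>p. y p \<in> mod_hom R (obj L (p + 1)) (obj X p)) \<and>
    (\<forall>p\<ge>b. \<forall>l\<in>elts L (p + 1). y p l = null X p) \<and>
    (\<forall>p. \<forall>l\<in>elts L p. x p l = y p (dif L p l) \<oplus>\<^bsub>obj X p\<^esub> dif X (p - 1) (y (p - 1) l))"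
 proof (intro exI[of _ "\<lambda>p l. y p l \<oplus>\<^bsub>obj X p\<^esub> W p l"] conjI allI impI ballI)
  show "(\<lambda>l. y p l \<oplus>\<^bsub>obj X p\<^esub> W p l) \<in> mod_hom R (obj L (p + 1)) (obj X p)" for p by (rule hom_add[OF y(1) W Xm])
  show "y p l \<oplus>\<^bsub>obj X p\<^esub> W p l = null X p" if "b \<le> p" "l \<in> elts L (p + 1)" for p l
   using y(2)[of p l] that by (simp add: Wz lm[OF Xm])
  fix p l assume l: "l \<in> elts L p"
  have y': "y (p - 1) l \<in> elts X (p - 1)" using mod_homD(1)[OF y(1), of l "p - 1"] l by simp
  note c = mod_homD(1)[OF W dLs(1)[OF l]] mod_homD(1)[OF W' l] mod_homD(1)[OF y(1) dLs(1)[OF l]] dXs'(1)[OF y']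
  note c' = c dXs'(1)[OF c(2)]
  have "x p l = x' p l \<oplus>\<^bsub>obj X p\<^esub> z p l" using xs(1)[OF l] zc[OF l] by (simp add: x'_def lms[OF Xm])
  also have "\<dots> = (y p (dif L p l) \<oplus>\<^bsub>obj X p\<^esub> W p (dif L p l)) \<oplus>\<^bsub>obj X p\<^esub> dif X (p - 1) (y (p - 1) l \<oplus>\<^bsub>obj X (p - 1)\<^esub> W (p - 1) l)"
   using c' unfolding y(3)[OF l] z_def dXs'(2)[OF y' c(2)] by (simp add: lms[OF Xm])
  finally show "x p l = y p (dif L p l) \<oplus>\<^bsub>obj X p\<^esub> W p (dif L p l) \<oplus>\<^bsub>obj X p\<^esub> dif X (p - 1) (y (p - 1) l \<oplus>\<^bsub>obj X (p - 1)\<^esub> W (p - 1) l)" .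
 qed
qed

lemma tot_exact_of_strict: "tot_exact_strict R L X b ==> tot_exact R L X b"
 unfolding tot_exact_def
proof (intro allI impI)
 fix x assume "tot_exact_strict R L X b" "chain_map R L X x" "\<forall>p>b. \<forall>l\<in>elts L p. x p l = null X p"
 then obtain y where "\<forall>p. y p \<in> mod_hom R (obj L (p + 1)) (obj X p)" "\<forall>p\<ge>b. \<forall>l\<in>elts L (p + 1). y p l = null X p"
  "\<forall>p. \<forall>l\<in>elts L p. x p l = y p (dif L p l) \<oplus>\<^bsub>obj X p\<^esub> dif X (p - 1) (y (p - 1) l)"
  unfolding tot_exact_strict_def by blast
 then show "\<exists>y. (\<forall>p. y p \<in> mod_hom R (obj L (p + 1)) (obj X p)) \<and> (\<forall>p>b. \<forall>l\<in>elts L (p + 1). y p l = null X p) \<and>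
    (\<forall>p. \<forall>l\<in>elts L p. x p l = y p (dif L p l) \<oplus>\<^bsub>obj X p\<^esub> dif X (p - 1) (y (p - 1) l))"
  by (intro exI[of _ y] conjI) simp_all
qed

text \<open>Changing the sign of the differential of \<open>L\<close> changes \<open>L\<close> by an isomorphism.\<close>

lemma tot_exact_iso:
 assumes L: "module_complex R L" and L': "module_complex R L'" and X: "module_complex R X"
  and \<phi>: "chain_map R L' L \<phi>" and \<psi>: "chain_map R L L' \<psi>"
  and inv: "\<And>p l. l \<in> elts L' p ==> \<psi> p (\<phi> p l) = l" and ex: "tot_exact R L X b"
 shows "tot_exact R L' X b"
 unfolding tot_exact_def
proof (intro allI impI)
 note Lm = module_complexD(1)[OF L] and Lm' = module_complexD(1)[OF L'] and Xm = module_complexD(1)[OF X]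
 fix x assume x: "chain_map R L' X x" and xz0: "\<forall>p>b. \<forall>l\<in>elts L' p. x p l = null X p"
 have xp: "chain_map R L X (\<lambda>p. x p \<circ> \<psi> p)" by (rule chain_map_comp[OF \<psi> x])
 have "x p (\<psi> p l) = null X p" if "p > b" "l \<in> elts L p" for p l
  using xz0 that mod_homD(1)[OF chain_mapD(1)[OF \<psi>]] by simp
 from tot_exactD[OF ex xp[unfolded comp_def] this] obtain y where y: "\<And>p. y p \<in> mod_hom R (obj L (p + 1)) (obj X p)"
  "\<And>p l. p > b ==> l \<in> elts L (p + 1) ==> y p l = null X p"
  "\<And>p l. l \<in> elts L p ==> x p (\<psi> p l) = y p (dif L p l) \<oplus>\<^bsub>obj X p\<^esub> dif X (p - 1) (y (p - 1) l)" by blast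
 show "\<exists>y. (\<forall>p. y p \<in> mod_hom R (obj L' (p + 1)) (obj X p)) \<and>
    (\<forall>p>b. \<forall>l\<in>elts L' (p + 1). y p l = null X p) \<and>
    (\<forall>p. \<forall>l\<in>elts L' p. x p l = y p (dif L' p l) \<oplus>\<^bsub>obj X p\<^esub> dif X (p - 1) (y (p - 1) l))"
 proof (intro exI[of _ "\<lambda>p l. y p (\<phi> (p + 1) l)"] conjI allI impI ballI)
  show "(\<lambda>l. y p (\<phi> (p + 1) l)) \<in> mod_hom R (obj L' (p + 1)) (obj X p)" for p by (rule hom_comp[OF chain_mapD(1)[OF \<phi>] y(1)])
  show "y p (\<phi> (p + 1) l) = null X p" if "b < p" "l \<in> elts L' (p + 1)" for p l
   by (rule y(2)[OF that(1) mod_homD(1)[OF chain_mapD(1)[OF \<phi>] that(2)]])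
  fix p l assume l: "l \<in> elts L' p"
  show "x p l = y p (\<phi> (p + 1) (dif L' p l)) \<oplus>\<^bsub>obj X p\<^esub> dif X (p - 1) (y (p - 1) (\<phi> (p - 1 + 1) l))"
   using y(3)[OF mod_homD(1)[OF chain_mapD(1)[OF \<phi>] l]] unfolding inv[OF l] chain_mapD(2)[OF \<phi> l] diff_add_cancel .
 qed
qed

section \<open>Shifted complexes\<close>

definition shift :: "int => (('a, 'b, 'x) module_scheme, 'b) cochain => (('a, 'b, 'x) module_scheme, 'b) cochain" where
 "shift q C = \<lparr>obj = (\<lambda>j. obj C (j - q)), dif = (\<lambda>j. dif C (j - q))\<rparr>"

text \<open>The sign of the differential makes the differential of the complex of homomorphisms from \<open>C\<close>
 square to zero.\<close>

definition sshift :: "int => (('a, 'b, 'x) module_scheme, 'b) cochain => (('a, 'b, 'x) module_scheme, 'b) cochain" where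
 "sshift q C = \<lparr>obj = (\<lambda>j. obj C (j - q)),
   dif = (\<lambda>j l. if even q then dif C (j - q) l else \<ominus>\<^bsub>obj C (j - q + 1)\<^esub> dif C (j - q) l)\<rparr>"

lemma shift_simps [simp]: "obj (shift q C) j = obj C (j - q)" "dif (shift q C) j = dif C (j - q)"
 by (simp_all add: shift_def)

lemma sshift_simps [simp]: "obj (sshift q C) j = obj C (j - q)"
 "dif (sshift q C) j l = (if even q then dif C (j - q) l else \<ominus>\<^bsub>obj C (j - q + 1)\<^esub> dif C (j - q) l)"
 by (simp_all add: sshift_def)

lemma shift_index: "j + 1 - q = j - q + 1" for j q :: int by simp
lemma shift_index': "j - 1 - q = j - q - 1" for j q :: int by simp

lemma shift_complex: "module_complex R C ==> module_complex R (shift q C)"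
 unfolding module_complex_def shift_simps shift_index by blast

lemma sshift_complex:
 assumes C: "module_complex R C" shows "module_complex R (sshift q C)"
 unfolding module_complex_def
proof (intro allI conjI ballI)
 note Cm = module_complexD(1)[OF C] and dC = module_complexD(2)[OF C] note dCs = hom_simps[OF dC Cm Cm]
 fix j
 show "left_module R (obj (sshift q C) j)" by (simp add: Cm)
 show "dif (sshift q C) j \<in> mod_hom R (obj (sshift q C) j) (obj (sshift q C) (j + 1))"
  unfolding sshift_def cochain.simps shift_index using dC[of "j - q"] hom_neg[OF dC Cm, of "j - q"] by (cases "even q") simp_all
 fix l assume "l \<in> elts (sshift q C) j"
 then have l: "l \<in> elts C (j - q)" by simp
 show "dif (sshift q C) (j + 1) (dif (sshift q C) j l) = null (sshift q C) (j + 1 + 1)"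
  using module_complexD(4)[OF C l] dCs(1)[OF l] unfolding sshift_simps shift_index
  by (simp add: dCs(5) lm[OF Cm] add.assoc)
qed

lemma sshift_exact:
 assumes C: "module_complex R C"
  and ex: "\<And>j x. x \<in> elts C j ==> dif C j x = null C (j + 1) ==> x \<in> dif C (j - 1) ` elts C (j - 1)"
  and x: "x \<in> elts (sshift q C) j" "dif (sshift q C) j x = null C (j - q + 1)"
 shows "x \<in> dif (sshift q C) (j - 1) ` elts (sshift q C) (j - 1)"
proof -
 note Cm = module_complexD(1)[OF C] note dCs = hom_simps[OF module_complexD(2)[OF C] Cm Cm] and dCs' = hom_simps[OF module_complexD(3)[OF C] Cm Cm]
 have xc: "x \<in> elts C (j - q)" using x(1) by simp
 have "dif C (j - q) x = null C (j - q + 1)"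
  using x(2) lm(8)[OF Cm dCs(1)[OF xc]] lm(9)[OF Cm] unfolding sshift_simps by (metis (full_types))
 from ex[OF xc this] obtain y where y: "y \<in> elts C (j - q - 1)" "x = dif C (j - q - 1) y" by blast
 have e: "j - q - 1 + 1 = j - q" by simp
 show ?thesis
 proof (rule image_eqI)
  show "(if even q then y else \<ominus>\<^bsub>obj C (j - q - 1)\<^esub> y) \<in> elts (sshift q C) (j - 1)"
   unfolding sshift_simps shift_index' using y(1) lm(3)[OF Cm y(1)] by simp
  show "x = dif (sshift q C) (j - 1) (if even q then y else \<ominus>\<^bsub>obj C (j - q - 1)\<^esub> y)"
   unfolding sshift_simps shift_index' e y(2) using dCs'(5)[OF y(1)] lm(8)[OF Cm dCs'(1)[OF y(1)]] by simp
 qed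
qed

lemma sshift_iso:
 fixes C :: "(('a, 'b, 'x) module_scheme, 'b) cochain" and q :: int
 assumes C: "module_complex R C"
 defines "\<phi> \<equiv> \<lambda>j l. if even q \<or> even j then l else \<ominus>\<^bsub>obj C (j - q)\<^esub> l"
 shows "chain_map R (sshift q C) (shift q C) \<phi>" "chain_map R (shift q C) (sshift q C) \<phi>"
  "l \<in> elts C (j - q) ==> \<phi> j (\<phi> j l) = l"
proof -
 note Cm = module_complexD(1)[OF C] and dC = module_complexD(2)[OF C] note dCs = hom_simps[OF dC Cm Cm]
 have \<phi>: "\<phi> j \<in> mod_hom R (obj C (j - q)) (obj C (j - q))" for j
  unfolding \<phi>_def 
  by (cases "even q \<or> even j") (use hom_id[where M = "obj C (j - q)" and R = R] hom_neg[OF hom_id[where M = "obj C (j - q)" and R = R] Cm] in simp_all)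
 have eq: "\<phi> (j + 1) (dif (sshift q C) j l) = dif (shift q C) j (\<phi> j l)" "\<phi> (j + 1) (dif (shift q C) j l) = dif (sshift q C) j (\<phi> j l)"
  if l: "l \<in> elts C (j - q)" for j l
  unfolding \<phi>_def sshift_simps shift_simps shift_index using dCs(5)[OF l] lm(8)[OF Cm dCs(1)[OF l]] by simp_all
 show "chain_map R (sshift q C) (shift q C) \<phi>" "chain_map R (shift q C) (sshift q C) \<phi>"
  unfolding chain_map_def using \<phi> eq by (simp_all del: sshift_simps(2))
 show "l \<in> elts C (j - q) ==> \<phi> j (\<phi> j l) = l" by (simp add: \<phi>_def lm[OF Cm])
qed

section \<open>Maps from an exact complex of free modules into a coresolution\<close>

text \<open>A chain map that vanishes above degree zero has a single component, a homomorphism from \<open>L 0\<close> to \<open>B\<close>; it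
 extends to \<open>L 1\<close> since homomorphisms from \<open>L\<close> to \<open>B\<close> form an exact complex.\<close>

lemma tot_exact_coresolution_zero:
 assumes R: "ring R" and L: "module_complex R L" and Lo: "\<And>j. obj L j = Fr R (\<nu> j)"
  and ex: "\<And>j x. x \<in> elts L j ==> dif L j x = (\<lambda>s. \<zero>\<^bsub>R\<^esub>) ==> x \<in> dif L (j - 1) ` elts L (j - 1)"
  and bound: "\<And>n f i. free_exact R n f ==> d \<le> i ==> free_hom_exact R n f B i"
  and B: "left_module R B" and cor: "coresolution R B J \<epsilon>"
 shows "tot_exact R L J 0"
 unfolding tot_exact_def
proof (intro allI impI)
 note c = coresolutionD[OF cor] note X = module_complexD(1)[OF c(1)] and Lm = module_complexD(1)[OF L]
 note ds = hom_simps[OF module_complexD(2)[OF c(1)] X X] and ds' = hom_simps[OF module_complexD(3)[OF c(1)] X X]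
  and ls = hom_simps[OF module_complexD(2)[OF L] Lm Lm] and ls' = hom_simps[OF module_complexD(3)[OF L] Lm Lm]
  and es = hom_simps[OF c(2) B X]
 fix x assume x: "chain_map R L J x" and xz0: "\<forall>p>0. \<forall>l\<in>elts L p. x p l = null J p"
 then have xz: "x p l = null J p" if "p > 0" "l \<in> elts L p" for p l using that by blast
 note xs = hom_simps[OF chain_mapD(1)[OF x] Lm X]
 have xneg: "x p l = null J p" if "p < 0" "l \<in> elts L p" for p l
  using xs(1)[OF that(2)] c(7)[OF that(1)] by simp
 have "\<exists>t\<in>mod_hom R (obj L 0) B. \<forall>l\<in>elts L 0. \<epsilon> (t l) = x 0 l"
 proof (rule proj_lift[OF _ B X c(2) chain_mapD(1)[OF x]])
  show "projective_module R (obj L 0)" unfolding Lo by (rule projective_free[OF R])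
  fix l assume l: "l \<in> elts L 0"
  have "dif J 0 (x 0 l) = null J 1" using chain_mapD(2)[OF x l] xz[of 1 "dif L 0 l"] ls(1)[OF l] by simp
  then show "x 0 l \<in> \<epsilon> ` carrier B" by (rule c(4)[OF xs(1)[OF l]])
 qed
 then obtain t where t: "t \<in> mod_hom R (obj L 0) B" "\<And>l. l \<in> elts L 0 ==> \<epsilon> (t l) = x 0 l" by blast
 have "\<exists>\<psi>\<in>mod_hom R (obj L (0 + 1)) B. \<forall>l\<in>elts L 0. t l = \<psi> (dif L 0 l)"
 proof (rule hom_exact_unbounded[OF R L Lo ex bound t(1)])
  fix l assume l: "l \<in> elts L (0 - 1)"
  have dl: "dif L (0 - 1) l \<in> elts L 0" by (rule ls'(1)[OF l])
  have "\<epsilon> (t (dif L (0 - 1) l)) = dif J (0 - 1) (x (0 - 1) l)"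
   unfolding t(2)[OF dl] by (rule chain_mapD(3)[OF x l])
  also have "\<dots> = \<epsilon> \<zero>\<^bsub>B\<^esub>" using xneg[OF _ l] ds'(4)[of 0] es(4) by simp
  finally show "t (dif L (0 - 1) l) = \<zero>\<^bsub>B\<^esub>"
   by (rule inj_onD[OF c(3)]) (use mod_homD(1)[OF t(1) dl] lm(2)[OF B] in auto)
 qed
 then obtain \<psi> where \<psi>: "\<psi> \<in> mod_hom R (obj L 1) B" "\<And>l. l \<in> elts L 0 ==> t l = \<psi> (dif L 0 l)" by auto
 define y where "y p l = (if p = 0 then \<epsilon> (\<psi> l) else null J p)" for p l
 show "\<exists>y. (\<forall>p. y p \<in> mod_hom R (obj L (p + 1)) (obj J p)) \<and> (\<forall>p>0. \<forall>l\<in>elts L (p + 1). y p l = null J p) \<and>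
    (\<forall>p. \<forall>l\<in>elts L p. x p l = y p (dif L p l) \<oplus>\<^bsub>obj J p\<^esub> dif J (p - 1) (y (p - 1) l))"
 proof (intro exI[of _ y] conjI allI impI ballI)
  show "y p \<in> mod_hom R (obj L (p + 1)) (obj J p)" for p
   using hom_comp[OF \<psi>(1) c(2)] hom_zero[OF X[of p], of "obj L (p + 1)"] by (cases "p = 0") (simp_all add: y_def[abs_def])
  show "y p l = null J p" if "0 < p" for p l using that by (simp add: y_def)
  fix p l assume l: "l \<in> elts L p"
  consider "p < 0" | "p = 0" | "p = 1" | "p > 1" by linarith
  then show "x p l = y p (dif L p l) \<oplus>\<^bsub>obj J p\<^esub> dif J (p - 1) (y (p - 1) l)"
  proof cases
   case 1
   then show ?thesis using xneg[OF 1 l] ds'(4)[of p] by (simp add: y_def lm[OF X])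
  next
   case 2
   have e: "\<epsilon> (\<psi> (dif L 0 l)) = x 0 l" using l \<psi>(2) t(2) 2 by simp
   then show ?thesis using ds'(4)[of p] xs(1)[OF l] 2 by (simp add: y_def lm[OF X])
  next
   case 3
   then show ?thesis using xz[OF _ l] l mod_homD(1)[OF \<psi>(1), of l] c(5)[of "\<psi> l"] by (simp add: y_def lm[OF X])
  next
   case 4
   then show ?thesis using xz[OF _ l] ds'(4)[of p] by (simp add: y_def lm[OF X])
  qed
 qed
qed

text \<open>By induction on the degree: the cocycles of \<open>J\<close> in positive degrees are coboundaries, so the highest component
 of a chain map can be removed.\<close>

lemma tot_exact_coresolution:
 assumes R: "ring R" and L: "module_complex R L" and Lo: "\<And>j. obj L j = Fr R (\<nu> j)"
  and ex: "\<And>j x. x \<in> elts L j ==> dif L j x = (\<lambda>s. \<zero>\<^bsub>R\<^esub>) ==> x \<in> dif L (j - 1) ` elts L (j - 1)"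
  and bound: "\<And>n f i. free_exact R n f ==> d \<le> i ==> free_hom_exact R n f B i"
  and B: "left_module R B" and cor: "coresolution R B J \<epsilon>"
 shows "tot_exact_strict R L J (int b + 1)"
proof -
 note c = coresolutionD[OF cor]
 have step: "tot_exact_strict R L J (int b + 1)" if "tot_exact R L J (int b)" for b
 proof (rule tot_exact_strictI[OF L c(1)])
  show "projective_module R (obj L (int b + 1))" unfolding Lo by (rule projective_free[OF R])
  show "tot_exact R L J (int b + 1 - 1)" using that by simp
  fix u assume u: "u \<in> elts J (int b + 1)" "dif J (int b + 1) u = null J (int b + 1 + 1)"
  have "u \<in> dif J (int b) ` elts J (int b)" by (rule c(6)[OF _ u(1)]) (use u(2) in \<open>simp_all add: add.assoc\<close>)
  then show "u \<in> dif J (int b + 1 - 1) ` elts J (int b + 1 - 1)" by simp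
 qed
 have "tot_exact R L J (int b)" for b
 proof (induction b)
  case 0
  show ?case using tot_exact_coresolution_zero[OF R L Lo ex bound B cor] by simp
 next
  case (Suc b)
  show ?case using tot_exact_of_strict[OF step[OF Suc]] by (simp add: add.commute)
 qed
 then show ?thesis by (rule step)
qed

lemma RHom_simps [simp]:
 "obj (RHom_left R N I) k = left_hom R N (obj I k)" "dif (RHom_left R N I) k f = compose (carrier N) (dif I k) f"
 "obj (RHom_right R N I) k = right_hom R N (obj I k)" "dif (RHom_right R N I) k f = compose (carrier N) (dif I k) f"
 by (simp_all add: RHom_left_def RHom_right_def)

definition right_complex :: "(('a, 'i, 'y) bimodule_scheme, 'i) cochain => (('a, 'i) module, 'i) cochain" where
 "right_complex I = \<lparr>obj = (\<lambda>k. right_of (obj I k)), dif = dif I\<rparr>"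

lemma right_complex_simps [simp]: "obj (right_complex I) k = right_of (obj I k)" "dif (right_complex I) = dif I"
 by (simp_all add: right_complex_def)

lemma right_of_twist [simp]: "right_of (twist \<sigma> (B :: ('a, 'b, 'x) bimodule_scheme)) = right_of B"
 by (simp add: right_of_def twist_def)

lemma bimodule_coresolutionD:
 assumes "bimodule_coresolution A B I \<epsilon>"
 shows "bimodule A (obj I k)" "dif I k \<in> mod_hom A (obj I k) (obj I (k + 1))"
  "dif I k \<in> mod_hom (op_ring A) (right_of (obj I k)) (right_of (obj I (k + 1)))"
  "\<epsilon> \<in> mod_hom A B (obj I 0)" "\<epsilon> \<in> mod_hom (op_ring A) (right_of B) (right_of (obj I 0))"
  "coresolution A B I \<epsilon>"
 using assms by (auto simp: bimodule_coresolution_def bimod_hom_def)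

lemma right_coresolution:
 assumes I: "bimodule_coresolution A B I \<epsilon>"
 shows "coresolution (op_ring A) (right_of B) (right_complex I) \<epsilon>"
proof -
 note i = bimodule_coresolutionD[OF I]
 have *: "additive (right_complex I) = additive I" by (simp add: additive_def)
 show ?thesis
  using i(6) i(1,3,5) coresolutionD(1)[OF i(6)]
  unfolding coresolution_def * by (simp add: module_complex_def bimodule_def)
qed

section \<open>The dual of a truncated complex, computed with an injective bimodule coresolution\<close>

text \<open>The product of infinitely many copies of each \<open>obj I p\<close>, as an ambient module.\<close>

definition family_module :: "(('a, 'i, 'y) module_scheme, 'i) cochain => ('a, int => 'l => 'i) module" where
 "family_module I = \<lparr>carrier = {x. \<forall>p l. x p l \<in> elts I p}, monoid.mult = undefined, one = undefined,
   ring.zero = (\<lambda>p l. null I p), add = (\<lambda>x y p l. x p l \<oplus>\<^bsub>obj I p\<^esub> y p l), smult = (\<lambda>a x p l. a \<odot>\<^bsub>obj I p\<^esub> x p l)\<rparr>"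

lemma family_module:
 assumes R: "ring R" and I: "\<And>p. left_module R (obj I p)"
 shows "left_module R (family_module I)"
proof (rule left_moduleI[OF R], rule ab_groupI)
 fix x assume "x \<in> carrier (family_module I)"
 then show "\<exists>y\<in>carrier (family_module I). y \<oplus>\<^bsub>family_module I\<^esub> x = \<zero>\<^bsub>family_module I\<^esub>"
  by (intro bexI[of _ "\<lambda>p l. \<ominus>\<^bsub>obj I p\<^esub> x p l"]) (simp_all add: family_module_def lm[OF I])
qed (simp_all add: family_module_def lm[OF I] lm_ac(1)[OF I] fun_eq_iff, simp add: lm_ac(2)[OF I])

text \<open>\<open>C\<close> is an exact complex of free right modules of finite rank.  Its part in degrees at most \<open>0\<close> is a projective
 resolution of a right module, and the complex \<open>Jc\<close> computes the derived homomorphisms from this right module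
 to \<open>twist \<sigma> A\<close> with the help of \<open>I\<close>.  The other structure of \<open>I\<close> makes it a complex of left modules,
 each a finite product of injective ones.\<close>

locale dual_complex =
 fixes A :: "('a, 'r) ring_scheme" and \<sigma> :: "'a => 'a" and I :: "(('a, 'i) bimodule, 'i) cochain" and \<epsilon> :: "'a => 'i"
  and C :: "(('a, nat => 'a) module, nat => 'a) cochain" and \<nu> :: "int => nat" and d :: nat
 assumes A: "ring A" and I: "bimodule_coresolution A (twist \<sigma> (regular_bimodule A)) I \<epsilon>"
  and inj: "\<And>k. injective_module A (obj I k)"
  and C: "module_complex (op_ring A) C" and Co: "\<And>j. obj C j = Fr (op_ring A) (\<nu> j)"
  and Cex: "\<And>j x. x \<in> elts C j ==> dif C j x = (\<lambda>s. \<zero>\<^bsub>A\<^esub>) ==> x \<in> dif C (j - 1) ` elts C (j - 1)"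
  and bound: "\<And>n f i. free_exact (op_ring A) n f ==> d \<le> i ==>
   free_hom_exact (op_ring A) n f (right_of (regular_bimodule A)) i"
begin

lemmas O = ring_op_ring[OF A]
lemmas b = bimodule_coresolutionD[OF I]

lemma Il: "left_module A (obj I k)" and Ir: "left_module (op_ring A) (right_of (obj I k))"
 and bis: "a \<in> carrier A ==> b \<in> carrier A ==> x \<in> elts I k ==>
  rsmult (obj I k) (a \<odot>\<^bsub>obj I k\<^esub> x) b = a \<odot>\<^bsub>obj I k\<^esub> rsmult (obj I k) x b"
 using b(1)[of k] by (auto simp: bimodule_def)

lemmas c = coresolutionD[OF b(6)] and cr = coresolutionD[OF right_coresolution[OF I]]
lemmas ds = hom_simps[OF b(2) Il Il] and ds' = hom_simps[OF module_complexD(3)[OF c(1)] Il Il]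
lemma dr': "dif I (k - 1) \<in> mod_hom (op_ring A) (right_of (obj I (k - 1))) (right_of (obj I k))"
 using b(3)[of "k - 1"] by simp
lemmas Cm = module_complexD(1)[OF C]
lemmas dC = module_complexD(2)[OF C] and dC' = module_complexD(3)[OF C]
lemmas S = sshift_complex[OF C]

lemma sshift_free: "obj (sshift q C) j = Fr (op_ring A) (\<nu> (j - q))" by (simp add: Co)

lemma S_exact:
 "x \<in> elts (sshift q C) j ==> dif (sshift q C) j x = (\<lambda>s. \<zero>\<^bsub>A\<^esub>) ==>
  x \<in> dif (sshift q C) (j - 1) ` elts (sshift q C) (j - 1)"
 by (rule sshift_exact[OF C]) (use Cex in \<open>simp_all add: Co\<close>)

lemma right_regular: "left_module (op_ring A) (right_of (regular_bimodule A))"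
 by (rule module_cong[OF left_module_regular[OF O]]) simp_all

lemma tot_exact_strict_right:
 assumes "q \<ge> 1" shows "tot_exact_strict (op_ring A) (sshift q C) (right_complex I) q"
proof -
 have "tot_exact_strict (op_ring A) (sshift q C) (right_complex I) (int (nat (q - 1)) + 1)"
 proof (rule tot_exact_coresolution[OF O S sshift_free])
  show "coresolution (op_ring A) (right_of (regular_bimodule A)) (right_complex I) \<epsilon>"
   using right_coresolution[OF I] by simp
  show "free_exact (op_ring A) n f ==> d \<le> i ==>
   free_hom_exact (op_ring A) n f (right_of (regular_bimodule A)) i" for n f i by (rule bound)
  show "x \<in> dif (sshift q C) (j - 1) ` elts (sshift q C) (j - 1)"
   if "x \<in> elts (sshift q C) j" "dif (sshift q C) j x = (\<lambda>s. \<zero>\<^bsub>op_ring A\<^esub>)" for j x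
   by (rule S_exact[OF that(1)]) (use that(2) in \<open>simp only: op_ring_simps\<close>)
 qed (fact right_regular)
 then show ?thesis using assms by simp
qed

text \<open>Families of right linear maps \<open>C (p - q) \<rightarrow> I p\<close> for \<open>p \<le> q\<close>; the values outside are zero.  Since \<open>I p\<close> is
 zero for \<open>p < 0\<close>, such a family is finite, and there is none but zero for \<open>q < 0\<close>.\<close>

definition Jm :: "int => ('a, int => (nat => 'a) => 'i) module" where
 "Jm q = (family_module I)\<lparr>carrier := {x. (\<forall>p. x p \<in> mod_hom (op_ring A) (obj C (p - q)) (right_of (obj I p))) \<and>
   (\<forall>p l. l \<notin> elts C (p - q) --> x p l = null I p) \<and> (\<forall>p>q. \<forall>l. x p l = null I p)}\<rparr>"

lemma Jm_simps [simp]: "\<zero>\<^bsub>Jm q\<^esub> = (\<lambda>p l. null I p)" "x \<oplus>\<^bsub>Jm q\<^esub> y = (\<lambda>p l. x p l \<oplus>\<^bsub>obj I p\<^esub> y p l)"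
 "a \<odot>\<^bsub>Jm q\<^esub> x = (\<lambda>p l. a \<odot>\<^bsub>obj I p\<^esub> x p l)"
 by (simp_all add: Jm_def family_module_def)

lemma Jm_mem: "x \<in> carrier (Jm q) \<longleftrightarrow> (\<forall>p. x p \<in> mod_hom (op_ring A) (obj C (p - q)) (right_of (obj I p))) \<and>
   (\<forall>p l. l \<notin> elts C (p - q) --> x p l = null I p) \<and> (\<forall>p>q. \<forall>l. x p l = null I p)"
 by (simp add: Jm_def)

lemma JmD:
 assumes "x \<in> carrier (Jm q)"
 shows "x p \<in> mod_hom (op_ring A) (obj C (p - q)) (right_of (obj I p))" "l \<notin> elts C (p - q) ==> x p l = null I p"
  "p > q ==> x p l = null I p" "x p l \<in> elts I p"
proof -
 show h: "x p \<in> mod_hom (op_ring A) (obj C (p - q)) (right_of (obj I p))"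
  and z: "l \<notin> elts C (p - q) ==> x p l = null I p" and "p > q ==> x p l = null I p"
  using assms unfolding Jm_mem by blast+
 show "x p l \<in> elts I p"
  using mod_homD(1)[OF h, of l] z lm(2)[OF Il] by (cases "l \<in> elts C (p - q)") simp_all
qed

lemma smult_right_linear:
 assumes "a \<in> carrier A" shows "(\<lambda>x. a \<odot>\<^bsub>obj I p\<^esub> x) \<in> mod_hom (op_ring A) (right_of (obj I p)) (right_of (obj I p))"
 by (rule mod_homI) (use assms in \<open>simp_all add: lm[OF Il] bis\<close>)

lemma Jm: "left_module A (Jm q)"
 unfolding Jm_def
proof (rule left_module_sub[OF family_module[OF A Il]])
 let ?K = "{x. (\<forall>p. x p \<in> mod_hom (op_ring A) (obj C (p - q)) (right_of (obj I p))) \<and>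
   (\<forall>p l. l \<notin> elts C (p - q) --> x p l = null I p) \<and> (\<forall>p>q. \<forall>l. x p l = null I p)}"
 have K: "?K = carrier (Jm q)" by (simp add: Jm_def)
 show "submodule ?K A (family_module I)"
  unfolding submodule_iff[OF family_module[OF A Il]] K
 proof (intro conjI ballI)
  show "carrier (Jm q) \<subseteq> carrier (family_module I)" using JmD(4) by (auto simp: family_module_def)
  show "\<zero>\<^bsub>family_module I\<^esub> \<in> carrier (Jm q)"
   unfolding Jm_mem by (simp add: family_module_def hom_zero[OF Ir, simplified])
  fix x y assume x: "x \<in> carrier (Jm q)" and y: "y \<in> carrier (Jm q)"
  show "x \<oplus>\<^bsub>family_module I\<^esub> y \<in> carrier (Jm q)"
   unfolding Jm_mem using hom_add[OF JmD(1)[OF x] JmD(1)[OF y] Ir]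
   by (simp add: family_module_def JmD(2,3)[OF x] JmD(2,3)[OF y] lm[OF Il])
 next
  fix a x assume a: "a \<in> carrier A" and x: "x \<in> carrier (Jm q)"
  show "a \<odot>\<^bsub>family_module I\<^esub> x \<in> carrier (Jm q)"
   unfolding Jm_mem using hom_comp[OF JmD(1)[OF x] smult_right_linear[OF a]]
   by (simp add: family_module_def JmD(2,3)[OF x] lm[OF Il] a)
 qed
qed

definition jd :: "int => (int => (nat => 'a) => 'i) => int => (nat => 'a) => 'i" where
 "jd q x p l = (if l \<in> elts C (p - 1 - q)
   then dif I (p - 1) (x (p - 1) l) \<oplus>\<^bsub>obj I p\<^esub> \<ominus>\<^bsub>obj I p\<^esub> x p (dif (sshift q C) (p - 1) l) else null I p)"

definition Jc :: "(('a, int => (nat => 'a) => 'i) module, int => (nat => 'a) => 'i) cochain" where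
 "Jc = \<lparr>obj = Jm, dif = jd\<rparr>"

lemma Jc_simps [simp]: "obj Jc = Jm" "dif Jc = jd" by (simp_all add: Jc_def)

lemma D_hom: "dif (sshift q C) (p - 1) \<in> mod_hom (op_ring A) (obj C (p - 1 - q)) (obj C (p - q))"
 using module_complexD(2)[OF S, of q "p - 1"] by simp

lemma D_sign: "l \<in> elts C (p - q) ==> dif (sshift (q - 1) C) (p - 1) l = \<ominus>\<^bsub>obj C (p - q + 1)\<^esub> dif (sshift q C) p l"
 using hom_simps(1)[OF dC Cm Cm, of l "p - q"] by (simp add: lm[OF Cm])

lemma jd_hom: "jd q \<in> mod_hom A (Jm q) (Jm (q + 1))"
proof (rule mod_homI)
 have e: "p - (q + 1) = p - 1 - q" for p by simp
 fix x assume x: "x \<in> carrier (Jm q)"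
 note D = mod_homD(1)[OF D_hom]
 show "jd q x \<in> carrier (Jm (q + 1))"
  unfolding Jm_mem e
 proof (intro conjI allI impI)
  fix p
  have "(\<lambda>l. dif I (p - 1) (x (p - 1) l) \<oplus>\<^bsub>right_of (obj I p)\<^esub> \<ominus>\<^bsub>right_of (obj I p)\<^esub> x p (dif (sshift q C) (p - 1) l))
    \<in> mod_hom (op_ring A) (obj C (p - 1 - q)) (right_of (obj I p))"
   by (rule hom_diff[OF hom_comp[OF JmD(1)[OF x] dr'] hom_comp[OF D_hom JmD(1)[OF x]] Ir])
  then show "jd q x p \<in> mod_hom (op_ring A) (obj C (p - 1 - q)) (right_of (obj I p))"
   by (rule hom_cong[OF _ _ Cm]) (simp add: jd_def a_inv_cong[of "right_of (obj I p)" "obj I p"] del: sshift_simps)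
  show "jd q x p l = null I p" if "l \<notin> elts C (p - 1 - q)" for l using that by (simp add: jd_def)
  show "jd q x p l = null I p" if "p > q + 1" for l
   using that JmD(3)[OF x] ds'(4)[of p] by (simp add: jd_def lm[OF Il] del: sshift_simps)
 qed
 fix y assume y: "y \<in> carrier (Jm q)"
 show "jd q (x \<oplus>\<^bsub>Jm q\<^esub> y) = jd q x \<oplus>\<^bsub>Jm (q + 1)\<^esub> jd q y"
  using JmD(4)[OF x] JmD(4)[OF y] by (auto simp: jd_def fun_eq_iff ds' lms[OF Il] simp del: sshift_simps)
next
 fix a x assume a: "a \<in> carrier A" and x: "x \<in> carrier (Jm q)"
 show "jd q (a \<odot>\<^bsub>Jm q\<^esub> x) = a \<odot>\<^bsub>Jm (q + 1)\<^esub> jd q x"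
  using a JmD(4)[OF x] by (auto simp: jd_def fun_eq_iff ds' lm[OF Il] simp del: sshift_simps)
qed

lemma jd_jd:
 assumes x: "x \<in> carrier (Jm q)"
 shows "jd (q + 1) (jd q x) = (\<lambda>p l. null I p)"
proof (intro ext)
 fix p l
 note xc = JmD(4)[OF x]
 have e: "p - 1 - (q + 1) = p - 1 - 1 - q" "p - 1 - 1 + 1 = p - 1" "p - 1 - (q + 1) + 1 = p - 1 - q" "p - (q + 1) = p - 1 - q" by simp_all
 show "jd (q + 1) (jd q x) p l = null I p"
 proof (cases "l \<in> elts C (p - 1 - 1 - q)")
  case True
  define m where "m = dif (sshift q C) (p - 1 - 1) l"
  have m: "m \<in> elts C (p - 1 - q)" unfolding m_def by (rule mod_homD(1)[OF D_hom True])
  have D: "dif (sshift (q + 1) C) (p - 1) l = \<ominus>\<^bsub>obj C (p - 1 - q)\<^esub> m"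
  proof -
   have l': "l \<in> elts C (p - 1 - (q + 1))" using True by (simp only: e)
   have "m = dif (sshift (q + 1 - 1) C) (p - 1 - 1) l" by (simp add: m_def del: sshift_simps)
   also have "\<dots> = \<ominus>\<^bsub>obj C (p - 1 - q)\<^esub> dif (sshift (q + 1) C) (p - 1) l" using D_sign[OF l'] unfolding e(3) .
   finally have m_eq: "m = \<ominus>\<^bsub>obj C (p - 1 - q)\<^esub> dif (sshift (q + 1) C) (p - 1) l" .
   have "dif (sshift (q + 1) C) (p - 1) l \<in> elts C (p - (q + 1))" by (rule mod_homD(1)[OF D_hom l'])
   then have "dif (sshift (q + 1) C) (p - 1) l \<in> elts C (p - 1 - q)" unfolding e(4) .
   then show ?thesis unfolding m_eq by (rule lm(8)[OF Cm, symmetric])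
  qed
  have Dm: "dif (sshift q C) (p - 1) m = null C (p - q)"
  proof -
   have l': "l \<in> elts (sshift q C) (p - 1 - 1)" using True by simp
   have "dif (sshift q C) (p - 1) m = null (sshift q C) (p - 1 + 1)"
    unfolding m_def by (rule module_complexD(5)[OF S l'])
   then show ?thesis by (simp del: sshift_simps(2))
  qed
  have nm: "\<ominus>\<^bsub>obj C (p - 1 - q)\<^esub> m \<in> elts C (p - 1 - q)" by (rule lm(3)[OF Cm m])
  have 1: "jd q x (p - 1) l = dif I (p - 1 - 1) (x (p - 1 - 1) l) \<oplus>\<^bsub>obj I (p - 1)\<^esub> \<ominus>\<^bsub>obj I (p - 1)\<^esub> x (p - 1) m"
   unfolding jd_def m_def using True by (simp only: if_True)
  have xm: "x (p - 1) (\<ominus>\<^bsub>obj C (p - 1 - q)\<^esub> m) = \<ominus>\<^bsub>obj I (p - 1)\<^esub> x (p - 1) m"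
   using hom_simps(5)[OF JmD(1)[OF x] Cm Ir m] by (simp add: a_inv_cong[of "right_of (obj I (p - 1))" "obj I (p - 1)"])
  have "x p (dif (sshift q C) (p - 1) (\<ominus>\<^bsub>obj C (p - 1 - q)\<^esub> m)) = null I p"
   unfolding hom_simps(5)[OF D_hom Cm Cm m] Dm lm(9)[OF Cm] using hom_simps(4)[OF JmD(1)[OF x] Cm Ir] by simp
  then have 2: "jd q x p (\<ominus>\<^bsub>obj C (p - 1 - q)\<^esub> m) = \<ominus>\<^bsub>obj I p\<^esub> dif I (p - 1) (x (p - 1) m)"
   unfolding jd_def using nm xm by (simp add: ds' xc lm[OF Il] del: sshift_simps)
  have 3: "dif I (p - 1) (dif I (p - 1 - 1) (x (p - 1 - 1) l)) = null I p"
   using module_complexD(5)[OF c(1), of "x (p - 1 - 1) l" "p - 1"] xc by simp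
  have 4: "dif I (p - 1 - 1) (x (p - 1 - 1) l) \<in> elts I (p - 1)" by (rule ds'(1)[OF xc])
  have "jd (q + 1) (jd q x) p l = dif I (p - 1) (jd q x (p - 1) l) \<oplus>\<^bsub>obj I p\<^esub> \<ominus>\<^bsub>obj I p\<^esub> jd q x p (dif (sshift (q + 1) C) (p - 1) l)"
   unfolding jd_def[of "q + 1" _ p l] e using True by (simp only: if_True)
  also have "\<dots> = null I p"
   unfolding D 1 2 ds'(2)[OF 4 lm(3)[OF Il xc]] 3 ds'(5)[OF xc] by (simp add: ds' xc lm[OF Il])
  finally show ?thesis .
 next
  case False
  then show ?thesis unfolding jd_def[of "q + 1" _ p l] e by (simp only: if_False)
 qed
qed

lemma Jc_complex: "module_complex A Jc"
 unfolding module_complex_def Jc_simps using Jm jd_hom jd_jd by simp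

text \<open>The cocycles of \<open>Jc\<close> are chain maps from a shift of \<open>C\<close> that vanish in high degrees, and by \<open>jd_back\<close> its
 coboundaries are the null-homotopic ones.\<close>

lemma Jc_cocycle:
 assumes x: "x \<in> carrier (Jm q)" and z: "jd q x = (\<lambda>p l. null I p)" and l: "l \<in> elts C (p - q)"
 shows "x (p + 1) (dif (sshift q C) p l) = dif I p (x p l)"
proof -
 have e: "p + 1 - 1 = p" by simp
 have l': "l \<in> elts C (p + 1 - 1 - q)" using l by simp
 have "dif I (p + 1 - 1) (x (p + 1 - 1) l) \<oplus>\<^bsub>obj I (p + 1)\<^esub> \<ominus>\<^bsub>obj I (p + 1)\<^esub> x (p + 1) (dif (sshift q C) (p + 1 - 1) l) = null I (p + 1)"
  using fun_cong[OF fun_cong[OF z], of "p + 1" l] l' unfolding jd_def by (simp only: if_True)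
 then show ?thesis
  unfolding e using lm_eq_iff[OF Il ds(1)[OF JmD(4)[OF x]] JmD(4)[OF x]] by metis
qed

lemma jd_back:
 assumes y: "y \<in> carrier (Jm (q - 1))" and l: "l \<in> elts C (p - q)"
 shows "jd (q - 1) y p l = y p (dif (sshift q C) p l) \<oplus>\<^bsub>obj I p\<^esub> dif I (p - 1) (y (p - 1) l)"
proof -
 have e: "p - 1 - (q - 1) = p - q" "p - (q - 1) = p - q + 1" by simp_all
 have D: "dif (sshift q C) p l \<in> elts C (p - q + 1)"
  using mod_homD(1)[OF module_complexD(2)[OF S], of l q p] l by (simp add: shift_index)
 have "y p (\<ominus>\<^bsub>obj C (p - q + 1)\<^esub> dif (sshift q C) p l) = \<ominus>\<^bsub>obj I p\<^esub> y p (dif (sshift q C) p l)"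
  using hom_simps(5)[OF JmD(1)[OF y] Cm Ir, of "dif (sshift q C) p l" p] D unfolding e
  by (simp add: a_inv_cong[of "right_of (obj I p)" "obj I p"] del: sshift_simps)
 then show ?thesis
  unfolding jd_def e D_sign[OF l] using l
  by (simp add: JmD(4)[OF y] ds'(1) lm[OF Il] lm_ac(2)[OF Il] del: sshift_simps)
qed

text \<open>Homomorphisms from a free resolution into the components of \<open>Jc\<close>: on the basis of the free right
 module \<open>C (p - q)\<close> an element of \<open>Jm q\<close> is a tuple of elements of the injective module \<open>I p\<close>.\<close>

lemma Jm_hom_exact:
 assumes fe: "free_exact A n f"
 shows "free_hom_exact A n f (Jm q) i"
 unfolding hom_exact_def
proof (intro ballI impI)
 let ?P = "\<lambda>i. Fr A (n i)" and ?O = "op_ring A"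
 note F = left_module_free[OF A] and fd = free_exactD[OF fe] note fs = hom_simps[OF fd(1) F F]
 fix g assume g: "g \<in> mod_hom A (?P (Suc i)) (Jm q)" and g0: "\<forall>x\<in>carrier (?P (Suc (Suc i))). g (f (Suc i) x) = \<zero>\<^bsub>Jm q\<^esub>"
 note gJ = mod_homD(1)[OF g]
 have gl: "(\<lambda>x. g x p l) \<in> mod_hom A (?P (Suc i)) (obj I p)" for p l
  by (rule mod_homI) (simp_all add: JmD(4)[OF gJ] mod_homD(2,3)[OF g] del: dsum_simps)
 have "\<exists>h\<in>mod_hom A (?P i) (obj I p). \<forall>x\<in>carrier (?P (Suc i)). g x p (bas A s) = h (f i x)" for p s
  by (rule hom_exactD[OF hom_exact_injective[OF inj fe], OF gl]) (simp add: g0)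
 then obtain h where h: "\<And>p s. h p s \<in> mod_hom A (?P i) (obj I p)"
  "\<And>p s x. x \<in> carrier (?P (Suc i)) ==> g x p (bas A s) = h p s (f i x)" by metis
 define ll where "ll x p = lin ?O (right_of (obj I p)) (\<lambda>s. h p s x)" for x p
 have llh: "ll x p \<in> mod_hom ?O (obj C (p - q)) (right_of (obj I p))" if "x \<in> carrier (?P i)" for x p
  unfolding ll_def Co by (rule lin_hom[OF Ir]) (simp add: mod_homD(1)[OF h(1) that])
 have llb: "ll x p (bas A s) = h p s x" if "x \<in> carrier (?P i)" "s < \<nu> (p - q)" for x p s
  using lin_bas[OF Ir, of s "{..<\<nu> (p - q)}" "\<lambda>s. h p s x" p] that by (simp add: ll_def mod_homD(1)[OF h(1)])
 have eqI: "u l = v l" if "u \<in> mod_hom ?O (obj C (p - q)) (right_of (obj I p))" "v \<in> mod_hom ?O (obj C (p - q)) (right_of (obj I p))"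
  "\<And>s. s < \<nu> (p - q) ==> u (bas A s) = v (bas A s)" "l \<in> elts C (p - q)" for u v p l
  by (rule free_hom_eq[OF O Ir that(1,2)[unfolded Co] _ that(4)[unfolded Co]]) (use that(3) in simp)
 define H where "H x p l = (if p \<le> q \<and> l \<in> elts C (p - q) then ll x p l else null I p)" for x p l
 have HJ: "H x \<in> carrier (Jm q)" if x: "x \<in> carrier (?P i)" for x
  unfolding Jm_mem
 proof (intro conjI allI impI)
  show "H x p \<in> mod_hom ?O (obj C (p - q)) (right_of (obj I p))" for p
  proof (cases "p \<le> q")
   case True
   show ?thesis by (rule hom_cong[OF llh[OF x] _ Cm]) (simp add: H_def True)
  next
   case False
   show ?thesis by (rule hom_cong[OF hom_zero[OF Ir] _ Cm]) (use False in \<open>simp add: H_def\<close>)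
  qed
 qed (simp_all add: H_def)
 have "H \<in> mod_hom A (?P i) (Jm q)"
 proof (rule mod_homI)
  fix x assume x: "x \<in> carrier (?P i)"
  show "H x \<in> carrier (Jm q)" by (rule HJ[OF x])
  fix y assume y: "y \<in> carrier (?P i)"
  have xy: "x \<oplus>\<^bsub>?P i\<^esub> y \<in> carrier (?P i)" by (rule lm(1)[OF F x y])
  have "ll (x \<oplus>\<^bsub>?P i\<^esub> y) p l = ll x p l \<oplus>\<^bsub>right_of (obj I p)\<^esub> ll y p l" if "l \<in> elts C (p - q)" for p l
   by (rule eqI[OF llh[OF xy] hom_add[OF llh[OF x] llh[OF y] Ir] _ that])
    (simp add: llb[OF xy] llb[OF x] llb[OF y] mod_homD(2)[OF h(1) x y] del: dsum_simps)
  then show "H (x \<oplus>\<^bsub>?P i\<^esub> y) = H x \<oplus>\<^bsub>Jm q\<^esub> H y" by (auto simp: H_def fun_eq_iff lm[OF Il] simp del: dsum_simps)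
 next
  fix a x assume a: "a \<in> carrier A" and x: "x \<in> carrier (?P i)"
  have ax: "a \<odot>\<^bsub>?P i\<^esub> x \<in> carrier (?P i)" by (rule lm(12)[OF F a x])
  have "ll (a \<odot>\<^bsub>?P i\<^esub> x) p l = a \<odot>\<^bsub>obj I p\<^esub> ll x p l" if "l \<in> elts C (p - q)" for p l
   by (rule eqI[OF llh[OF ax] hom_comp[OF llh[OF x] smult_right_linear[OF a]] _ that])
    (simp add: llb[OF ax] llb[OF x] mod_homD(3)[OF h(1) a x] del: dsum_simps)
  then show "H (a \<odot>\<^bsub>?P i\<^esub> x) = a \<odot>\<^bsub>Jm q\<^esub> H x" by (auto simp: H_def fun_eq_iff lm[OF Il] a simp del: dsum_simps)
 qed
 moreover have "g x = H (f i x)" if x: "x \<in> carrier (?P (Suc i))" for x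
 proof (intro ext)
  fix p l
  show "g x p l = H (f i x) p l"
  proof (cases "p \<le> q \<and> l \<in> elts C (p - q)")
   case True
   have "g x p l = ll (f i x) p l"
    by (rule eqI[OF JmD(1)[OF gJ[OF x]] llh[OF fs(1)[OF x]]]) (use True in \<open>simp_all add: h(2)[OF x] llb[OF fs(1)[OF x]]\<close>)
   then show ?thesis using True by (simp add: H_def)
  next
   case False
   then show ?thesis using JmD(2,3)[OF gJ[OF x]] by (auto simp: H_def)
  qed
 qed
 ultimately show "\<exists>h\<in>mod_hom A (?P i) (Jm q). \<forall>x\<in>carrier (?P (Suc i)). g x = h (f i x)" by blast
qed

lemma Jc_exact:
 assumes x: "x \<in> carrier (Jm q)" and z: "jd q x = (\<lambda>p l. null I p)"
  and L: "tot_exact_strict (op_ring A) (sshift q C) (right_complex I) q"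
 shows "x \<in> jd (q - 1) ` carrier (Jm (q - 1))"
proof -
 have e: "p + 1 - q = p - (q - 1)" for p by simp
 have xm: "chain_map (op_ring A) (sshift q C) (right_complex I) x"
  unfolding chain_map_def using JmD(1)[OF x] Jc_cocycle[OF x z] by (simp del: sshift_simps(2))
 have "x p l = null (right_complex I) p" if "p > q" for p l using JmD(3)[OF x that] by simp
 with L[unfolded tot_exact_strict_def, rule_format, OF conjI, OF xm] obtain y
  where y0: "\<And>p. y p \<in> mod_hom (op_ring A) (obj (sshift q C) (p + 1)) (obj (right_complex I) p)"
  "\<And>p l. p \<ge> q ==> l \<in> elts (sshift q C) (p + 1) ==> y p l = null (right_complex I) p"
  "\<And>p l. l \<in> elts (sshift q C) p ==> x p l = y p (dif (sshift q C) p l) \<oplus>\<^bsub>obj (right_complex I) p\<^esub> dif (right_complex I) (p - 1) (y (p - 1) l)"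
  by blast
 then have y: "y p \<in> mod_hom (op_ring A) (obj C (p - (q - 1))) (right_of (obj I p))"
  "p \<ge> q ==> l \<in> elts C (p - (q - 1)) ==> y p l = null I p"
  "l \<in> elts C (p - q) ==> x p l = y p (dif (sshift q C) p l) \<oplus>\<^bsub>obj I p\<^esub> dif I (p - 1) (y (p - 1) l)" for p l
  unfolding sshift_simps(1) right_complex_simps right_of_simps e by blast+
 define Y where "Y p l = (if l \<in> elts C (p - (q - 1)) then y p l else null I p)" for p l
 have YJ: "Y \<in> carrier (Jm (q - 1))"
  unfolding Jm_mem
 proof (intro conjI allI impI)
  show "Y p \<in> mod_hom (op_ring A) (obj C (p - (q - 1))) (right_of (obj I p))" for p
   by (rule hom_cong[OF y(1) _ Cm]) (simp add: Y_def)
 qed (use y(2) in \<open>auto simp: Y_def\<close>)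
 have "x = jd (q - 1) Y"
 proof (intro ext)
  fix p l
  show "x p l = jd (q - 1) Y p l"
  proof (cases "l \<in> elts C (p - q)")
   case True
   have D: "dif (sshift q C) p l \<in> elts C (p - (q - 1))"
    using mod_homD(1)[OF module_complexD(2)[OF S], of l q p] True unfolding sshift_simps(1) e by blast
   have l: "l \<in> elts C (p - 1 - (q - 1))" using True by simp
   have "Y p (dif (sshift q C) p l) = y p (dif (sshift q C) p l)" "Y (p - 1) l = y (p - 1) l"
    unfolding Y_def using D l by (simp_all only: if_True)
   then show ?thesis unfolding jd_back[OF YJ True] using y(3)[OF True] by (simp only:)
  next
   case False
   then show ?thesis using JmD(2)[OF x False] by (simp add: jd_def)
  qed
 qed
 then show ?thesis using YJ by blast
qed

text \<open>The zeroth cocycles of \<open>Jc\<close> are the \<open>A\<close>-linear functionals on \<open>C 0\<close> that vanish on the image of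
 \<open>C (-1)\<close>.  If the differential \<open>C 0 \<rightarrow> C 1\<close> is the transpose of \<open>f\<close>, these functionals form the image of \<open>f\<close>.\<close>

lemma Jc_coresolution:
 assumes \<sigma>: "\<And>a. a \<in> carrier A ==> \<sigma> a \<in> carrier A"
  and f: "f \<in> mod_hom A (Fr A (\<nu> 1)) (Fr A (\<nu> 0))" and Cf: "\<And>l. l \<in> elts C 0 ==> dif C 0 l = transp A (\<nu> 1) (\<nu> 0) f l"
 shows "coresolution A (twist \<sigma> ((Fr A (\<nu> 0))\<lparr>carrier := f ` vecs A (\<nu> 1)\<rparr>)) Jc
  (\<lambda>z p l. if p = 0 \<and> l \<in> elts C 0 then \<epsilon> (pair A (\<nu> 0) z l) else null I p)"
proof -
 let ?O = "op_ring A"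
 define \<eta> where "\<eta> z p l = (if p = 0 \<and> l \<in> elts C 0 then \<epsilon> (pair A (\<nu> 0) z l) else null I p)" for z and p :: int and l
 let ?K = "f ` vecs A (\<nu> 1)"
 let ?B = "twist \<sigma> ((Fr A (\<nu> 0))\<lparr>carrier := ?K\<rparr>)"
 note F = left_module_free[OF A] and FO = left_module_free[OF O]
 have K: "?K \<subseteq> vecs A (\<nu> 0)" using mod_homD(1)[OF f] by blast
 have zc: "z s \<in> carrier A" if "z \<in> vecs A (\<nu> 0)" for z s using that by (simp add: free_fin)
 have C0: "obj C 0 = Fr ?O (\<nu> 0)" "obj C 1 = Fr ?O (\<nu> 1)" by (simp_all add: Co)
 have pr: "(\<lambda>l. pair A (\<nu> 0) z l) \<in> mod_hom ?O (obj C 0) (right_of (regular_bimodule A))" if "z \<in> vecs A (\<nu> 0)" for z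
  using pair_hom_right[OF A, where t = z and n = "\<nu> 0"] zc[OF that] unfolding C0 by (simp add: mod_hom_def)
 have er: "\<epsilon> \<in> mod_hom ?O (right_of (regular_bimodule A)) (right_of (obj I 0))" using b(5) by simp
 have el: "\<epsilon> (r \<oplus>\<^bsub>A\<^esub> s) = \<epsilon> r \<oplus>\<^bsub>obj I 0\<^esub> \<epsilon> s" "\<epsilon> (\<sigma> a \<otimes>\<^bsub>A\<^esub> r) = a \<odot>\<^bsub>obj I 0\<^esub> \<epsilon> r" "\<epsilon> r \<in> elts I 0"
  if "a \<in> carrier A" "r \<in> carrier A" "s \<in> carrier A" for a r s
  using mod_homD[OF b(4)] that by simp_all
 have e0: "\<epsilon> \<zero>\<^bsub>A\<^esub> = null I 0" using hom_simps(4)[OF er right_regular Ir] by simp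
 have einj: "inj_on \<epsilon> (carrier A)" using c(3) by simp
 have pl: "pair A (\<nu> 0) z l \<in> carrier A" if "z \<in> vecs A (\<nu> 0)" "l \<in> elts C 0" for z l
  using mod_homD(1)[OF pr[OF that(1)] that(2)] by simp
 have lc: "l s \<in> carrier A" if "l \<in> elts C 0" for l s using that unfolding C0 by (simp add: free_fin)
 have ph: "pair A (\<nu> 0) (\<lambda>s. z s \<oplus>\<^bsub>A\<^esub> w s) l = pair A (\<nu> 0) z l \<oplus>\<^bsub>A\<^esub> pair A (\<nu> 0) w l"
  "a \<in> carrier A ==> pair A (\<nu> 0) (\<lambda>s. a \<otimes>\<^bsub>A\<^esub> z s) l = a \<otimes>\<^bsub>A\<^esub> pair A (\<nu> 0) z l"
  if "l \<in> elts C 0" "z \<in> vecs A (\<nu> 0)" "w \<in> vecs A (\<nu> 0)" for a z w l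
  using mod_homD(2,3)[OF pair_hom[OF A, where l = l and n = "\<nu> 0"]] lc[OF that(1)] that(2,3) by simp_all
 have \<eta>J: "\<eta> z \<in> carrier (Jm 0)" if z: "z \<in> vecs A (\<nu> 0)" for z
  unfolding Jm_mem diff_0_right
 proof (intro conjI allI impI)
  show "\<eta> z p \<in> mod_hom ?O (obj C p) (right_of (obj I p))" for p
  proof (cases "p = 0")
   case True
   have "\<eta> z 0 \<in> mod_hom ?O (obj C 0) (right_of (obj I 0))"
    by (rule hom_cong[OF hom_comp[OF pr[OF z] er] _ Cm]) (simp add: \<eta>_def)
   then show ?thesis using True by simp
  next
   case False
   show ?thesis by (rule hom_cong[OF hom_zero[OF Ir] _ Cm]) (simp add: \<eta>_def False)
  qed
 qed (auto simp: \<eta>_def)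
 have \<eta>h: "\<eta> \<in> mod_hom A ?B (Jm 0)"
 proof (rule mod_homI)
  fix z assume "z \<in> carrier ?B"
  then have z: "z \<in> vecs A (\<nu> 0)" using K by auto
  show "\<eta> z \<in> carrier (Jm 0)" by (rule \<eta>J[OF z])
  fix w assume "w \<in> carrier ?B"
  then have w: "w \<in> vecs A (\<nu> 0)" using K by auto
  show "\<eta> (z \<oplus>\<^bsub>?B\<^esub> w) = \<eta> z \<oplus>\<^bsub>Jm 0\<^esub> \<eta> w"
   using ph(1)[OF _ z w] el(1)[OF _ pl[OF z] pl[OF w], of "\<zero>\<^bsub>A\<^esub>"] ag(2)[OF ring.is_abelian_group[OF A]]
   by (auto simp: \<eta>_def fun_eq_iff lm[OF Il])
 next
  fix a z assume a: "a \<in> carrier A" and "z \<in> carrier ?B"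
  then have z: "z \<in> vecs A (\<nu> 0)" using K by auto
  show "\<eta> (a \<odot>\<^bsub>?B\<^esub> z) = a \<odot>\<^bsub>Jm 0\<^esub> \<eta> z"
   using ph(2)[OF _ z z \<sigma>[OF a]] el(2)[OF a pl[OF z] pl[OF z]]
   by (auto simp: \<eta>_def fun_eq_iff lm[OF Il] a)
 qed
 have \<eta>0: "\<eta> z 0 (bas A s) = \<epsilon> (z s)" if "z \<in> vecs A (\<nu> 0)" "s < \<nu> 0" for z s
  using pair_bas_right[OF A _ that(2), where t = z] zc[OF that(1)] bas_in[OF O, of s "{..<\<nu> 0}"] that(2) by (simp add: \<eta>_def C0)
 have \<eta>inj: "inj_on \<eta> (carrier ?B)"
 proof (rule inj_onI)
  fix z w assume "z \<in> carrier ?B" "w \<in> carrier ?B" and eq: "\<eta> z = \<eta> w"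
  then have z: "z \<in> vecs A (\<nu> 0)" and w: "w \<in> vecs A (\<nu> 0)" using K by auto
  show "z = w"
  proof
   fix s
   show "z s = w s"
   proof (cases "s < \<nu> 0")
    case True
    have "\<epsilon> (z s) = \<epsilon> (w s)" using \<eta>0[OF z True] \<eta>0[OF w True] eq by simp
    then show ?thesis by (rule inj_onD[OF einj]) (simp_all add: zc z w)
   qed (use z w in \<open>simp add: free_fin\<close>)
  qed
 qed
 have pf: "pair A (\<nu> 0) (f y) l = pair A (\<nu> 1) y (dif C 0 l)" if "y \<in> vecs A (\<nu> 1)" "l \<in> elts C 0" for y l
  using pair_transp[OF A f that(1), of l] that(2) lc[OF that(2)] unfolding Cf[OF that(2)] C0 by simp
 have cyc1: "jd 0 (\<eta> z) = (\<lambda>p l. null I p)" if zK: "z \<in> ?K" for z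
 proof (intro ext)
  fix p l
  obtain y where y: "y \<in> vecs A (\<nu> 1)" "z = f y" using zK by blast
  have z: "z \<in> vecs A (\<nu> 0)" using K zK by blast
  have 1: "dif I (p - 1) (\<eta> z (p - 1) l) = null I p"
  proof (cases "p = 1 \<and> l \<in> elts C 0")
   case True
   then show ?thesis using c(5)[of "pair A (\<nu> 0) z l"] pl[OF z] by (simp add: \<eta>_def)
  next
   case False
   then have "\<eta> z (p - 1) l = null I (p - 1)" by (auto simp: \<eta>_def)
   then show ?thesis by (simp add: ds'(4))
  qed
  have 2: "\<eta> z p (dif C (p - 1) l) = null I p" if l: "l \<in> elts C (p - 1)"
  proof (cases "p = 0")
   case True
   have "dif C 0 (dif C (0 - 1) l) = (\<lambda>s. \<zero>\<^bsub>A\<^esub>)" using module_complexD(5)[OF C, of l 0] l True by (simp add: C0)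
   moreover have dl: "dif C (- 1) l \<in> elts C 0" using mod_homD(1)[OF dC'[of 0], of l] l True by simp
   ultimately have "pair A (\<nu> 0) z (dif C (- 1) l) = pair A (\<nu> 1) y (\<lambda>s. \<zero>\<^bsub>A\<^esub>)" using pf[OF y(1) dl] y(2) by simp
   also have "\<dots> = \<zero>\<^bsub>A\<^esub>"
    using hom_simps(4)[OF pair_hom_right[OF A, of "\<nu> 1" y] FO left_module_regular[OF O]] y(1) by (simp add: free_fin)
   finally show ?thesis using True dl e0 by (simp add: \<eta>_def)
  qed (simp add: \<eta>_def)
  show "jd 0 (\<eta> z) p l = null I p" using 1 2 by (simp add: jd_def lm[OF Il])
 qed
 have cyc2: "x \<in> \<eta> ` ?K" if x: "x \<in> carrier (Jm 0)" and z: "jd 0 x = (\<lambda>p l. null I p)" for x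
 proof -
  have xm: "chain_map ?O (sshift 0 C) (right_complex I) x"
   unfolding chain_map_def using JmD(1)[OF x] Jc_cocycle[OF x z] by (simp del: sshift_simps(2))
  have "tot_exact ?O (sshift 0 C) (right_complex I) 0"
  proof (rule tot_exact_coresolution_zero[OF O S sshift_free _ _ right_regular])
   show "coresolution ?O (right_of (regular_bimodule A)) (right_complex I) \<epsilon>"
    using right_coresolution[OF I] by simp
   show "free_exact ?O n f ==> d \<le> i ==>
    free_hom_exact ?O n f (right_of (regular_bimodule A)) i" for n f i by (rule bound)
   show "x \<in> dif (sshift 0 C) (j - 1) ` elts (sshift 0 C) (j - 1)"
    if "x \<in> elts (sshift 0 C) j" "dif (sshift 0 C) j x = (\<lambda>s. \<zero>\<^bsub>?O\<^esub>)" for j x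
    by (rule S_exact[OF that(1)]) (use that(2) in \<open>simp only: op_ring_simps\<close>)
  qed
  from tot_exactD[OF this xm] JmD(3)[OF x] obtain y
   where y0: "\<And>p. y p \<in> mod_hom ?O (obj (sshift 0 C) (p + 1)) (obj (right_complex I) p)"
   "\<And>p l. p > 0 ==> l \<in> elts (sshift 0 C) (p + 1) ==> y p l = null (right_complex I) p"
   "\<And>p l. l \<in> elts (sshift 0 C) p ==> x p l = y p (dif (sshift 0 C) p l) \<oplus>\<^bsub>obj (right_complex I) p\<^esub> dif (right_complex I) (p - 1) (y (p - 1) l)"
   unfolding right_complex_simps right_of_simps by blast
  have y: "y p \<in> mod_hom ?O (obj C (p + 1)) (right_of (obj I p))"
   "p > 0 ==> l \<in> elts C (p + 1) ==> y p l = null I p"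
   "l \<in> elts C p ==> x p l = y p (dif C p l) \<oplus>\<^bsub>obj I p\<^esub> dif I (p - 1) (y (p - 1) l)" for p l
   using y0(1)[of p] y0(2)[of p l] y0(3)[of l p] by simp_all
  note dCs = hom_simps[OF dC Cm Cm]
  have x0: "x 0 l = y 0 (dif C 0 l)" if l: "l \<in> elts C 0" for l
  proof -
   have "y (0 - 1) l \<in> elts I (0 - 1)" using mod_homD(1)[OF y(1)[of "0 - 1"], of l] l by simp
   then have "y (0 - 1) l = null I (0 - 1)" using c(7)[of "0 - 1"] by simp
   then show ?thesis using y(3)[OF l] ds'(4)[of 0] mod_homD(1)[OF y(1) dCs(1)[OF l]] by (simp add: lm[OF Il])
  qed
  have "\<exists>\<psi>\<in>mod_hom ?O (obj C 1) (right_of (regular_bimodule A)). \<forall>l\<in>elts C 1. \<epsilon> (\<psi> l) = y 0 l"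
  proof (rule proj_lift[OF _ right_regular Ir er])
   show "projective_module ?O (obj C 1)" unfolding C0 by (rule projective_free[OF O])
   show y0h: "y 0 \<in> mod_hom ?O (obj C 1) (right_of (obj I 0))" using y(1)[of 0] by simp
   fix l assume l: "l \<in> elts C 1"
   have yc: "y 0 l \<in> elts I 0" using mod_homD(1)[OF y0h l] by simp
   have "x 1 l = dif I 0 (y 0 l)"
    using y(3)[OF l] y(2)[of 1 "dif C 1 l"] dCs(1)[OF l] ds(1)[OF yc] by (simp add: lm[OF Il])
   then have "dif I 0 (y 0 l) = null I 1" using JmD(3)[OF x, of 1 l] by simp
   then show "y 0 l \<in> \<epsilon> ` carrier (right_of (regular_bimodule A))" using c(4)[OF yc] by simp
  qed
  then obtain \<psi> where \<psi>: "\<psi> \<in> mod_hom ?O (obj C 1) (right_of (regular_bimodule A))" "\<And>l. l \<in> elts C 1 ==> \<epsilon> (\<psi> l) = y 0 l" by blast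
  define w where "w s = (if s < \<nu> 1 then \<psi> (bas A s) else \<zero>\<^bsub>A\<^esub>)" for s
  have \<psi>': "\<psi> \<in> mod_hom ?O (Fr ?O (\<nu> 1)) (regular_bimodule ?O)" using \<psi>(1) unfolding C0 by (simp add: mod_hom_def)
  have w: "w \<in> vecs A (\<nu> 1)"
   using mod_homD(1)[OF \<psi>' bas_in[OF O]] ag(2)[OF ring.is_abelian_group[OF A]] by (simp add: w_def free_fin)
  have \<psi>w: "\<psi> l = pair A (\<nu> 1) w l" if "l \<in> elts C 1" for l
   using hom_eq_pair[OF O \<psi>' that[unfolded C0]] unfolding w_def[abs_def] pair_op bas_op op_ring_simps .
  have "x = \<eta> (f w)"
  proof (intro ext)
   fix p l
   show "x p l = \<eta> (f w) p l"
   proof (cases "p = 0 \<and> l \<in> elts C 0")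
    case True
    then have l: "l \<in> elts C 0" by simp
    have dl: "dif C 0 l \<in> elts C 1" using dCs(1)[OF l] by simp
    show ?thesis using True x0[OF l] \<psi>(2)[OF dl] \<psi>w[OF dl] pf[OF w l] by (simp add: \<eta>_def)
   next
    case False
    have "x p l = null I p"
    proof -
     consider "p > 0" | "p < 0" | "p = 0" "l \<notin> elts C 0" using False by linarith
     then show ?thesis
     proof cases
      case 2
      then show ?thesis using JmD(4)[OF x, of p l] c(7)[OF 2] by simp
     next
      case 3
      then show ?thesis using JmD(2)[OF x, of l p] by simp
     qed (rule JmD(3)[OF x])
    qed
    then show ?thesis using False by (auto simp: \<eta>_def)
   qed
  qed
  then show ?thesis using w by blast
 qed
 have neg: "carrier (Jm q) = {\<zero>\<^bsub>Jm q\<^esub>}" if q: "q < 0" for q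
 proof -
  have "x p l = null I p" if "x \<in> carrier (Jm q)" for x p l
   using JmD(3,4)[OF that, where p = p and l = l] c(7)[of p] q by (cases "p > q") auto
  then show ?thesis using lm(2)[OF Jm, of q] by (fastforce simp: fun_eq_iff)
 qed
 have exq: "trivial_group (mod_cohomology Jc q)" if "q > 0" for q
  unfolding trivial_mod_cohomology_iff[OF Jc_complex] Jc_simps
  using Jc_exact[OF _ _ tot_exact_strict_right, of _ q] that by simp
 show ?thesis
  unfolding coresolution_def \<eta>_def[symmetric, abs_def]
  using Jc_complex neg \<eta>h \<eta>inj exq cyc1 cyc2 K \<eta>J by (auto simp: image_subset_iff)
qed

text \<open>A cocycle of \<open>Hom(N, Jc)\<close> is a chain map from a shift of \<open>C\<close> to \<open>RHom_left A N I\<close>.\<close>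

lemma Jc_hom_exact:
 assumes N: "bimodule A N" and L: "tot_exact_strict (op_ring A) (sshift q C) (RHom_left A N I) q"
  and g: "g \<in> mod_hom A N (Jm q)" and dg: "\<And>y. y \<in> carrier N ==> jd q (g y) = (\<lambda>p l. null I p)"
 shows "\<exists>w\<in>mod_hom A N (Jm (q - 1)). \<forall>y\<in>carrier N. g y = jd (q - 1) (w y)"
proof -
 have Nl: "left_module A N" using N by (simp add: bimodule_def)
 have e: "p + 1 - q = p - (q - 1)" for p by simp
 note gJ = mod_homD(1)[OF g]
 let ?G = "RHom_left A N I"
 define X where "X p l = (\<lambda>y\<in>carrier N. g y p l)" for p l
 have Xc: "X p l \<in> carrier (left_hom A N (obj I p))" for p l
 proof -
  have "(\<lambda>y. g y p l) \<in> mod_hom A N (obj I p)"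
   by (rule mod_homI) (simp_all add: JmD(4)[OF gJ] mod_homD(2,3)[OF g])
  then show ?thesis unfolding left_hom_simps X_def by (rule restrict_hom[OF Nl])
 qed
 have gh: "g y p (l \<oplus>\<^bsub>obj C (p - q)\<^esub> m) = g y p l \<oplus>\<^bsub>obj I p\<^esub> g y p m" "a \<in> carrier A ==> g y p (a \<odot>\<^bsub>obj C (p - q)\<^esub> l) = rsmult (obj I p) (g y p l) a"
  if "y \<in> carrier N" "l \<in> elts C (p - q)" "m \<in> elts C (p - q)" for a y p l m
  using mod_homD(2,3)[OF JmD(1)[OF gJ[OF that(1)]]] that(2,3) by simp_all
 have Xm: "chain_map (op_ring A) (sshift q C) ?G X"
  unfolding chain_map_def
 proof (intro allI conjI ballI)
  fix p
  show "X p \<in> mod_hom (op_ring A) (obj (sshift q C) p) (obj ?G p)"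
  proof (rule mod_homI)
   fix l assume l: "l \<in> elts (sshift q C) p"
   show "X p l \<in> elts ?G p" using Xc by simp
   show "X p (a \<odot>\<^bsub>obj (sshift q C) p\<^esub> l) = a \<odot>\<^bsub>obj ?G p\<^esub> X p l" if "a \<in> carrier (op_ring A)" for a
    using l gh(2) that by (auto simp: X_def left_hom_simps intro!: restrict_ext)
   fix m assume m: "m \<in> elts (sshift q C) p"
   show "X p (l \<oplus>\<^bsub>obj (sshift q C) p\<^esub> m) = X p l \<oplus>\<^bsub>obj ?G p\<^esub> X p m"
    using l m gh(1) by (auto simp: X_def left_hom_simps intro!: restrict_ext)
  qed
  fix l assume "l \<in> elts (sshift q C) p"
  then have l: "l \<in> elts C (p - q)" by simp
  show "X (p + 1) (dif (sshift q C) p l) = dif ?G p (X p l)"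
   unfolding X_def RHom_simps compose_def
   by (rule restrict_ext) (simp add: Jc_cocycle[OF gJ dg l] del: sshift_simps(2))
 qed
 have "X p l = null ?G p" if "p > q" for p l
  unfolding X_def RHom_simps left_hom_simps by (rule restrict_ext) (rule JmD(3)[OF gJ that])
 with L[unfolded tot_exact_strict_def, rule_format, OF conjI, OF Xm] obtain y
  where y0: "\<And>p. y p \<in> mod_hom (op_ring A) (obj (sshift q C) (p + 1)) (obj ?G p)"
  "\<And>p l. p \<ge> q ==> l \<in> elts (sshift q C) (p + 1) ==> y p l = null ?G p"
  "\<And>p l. l \<in> elts (sshift q C) p ==> X p l = y p (dif (sshift q C) p l) \<oplus>\<^bsub>obj ?G p\<^esub> dif ?G (p - 1) (y (p - 1) l)"
  by blast
 have y: "y p \<in> mod_hom (op_ring A) (obj C (p - (q - 1))) (left_hom A N (obj I p))"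
  "p \<ge> q ==> l \<in> elts C (p - (q - 1)) ==> y p l = (\<lambda>w\<in>carrier N. null I p)" for p l
  using y0(1)[of p] y0(2)[of p l] unfolding sshift_simps(1) RHom_simps left_hom_simps e by blast+
 have yl: "y p l \<in> mod_hom A N (obj I p)" if "l \<in> elts C (p - (q - 1))" for p l
  using mod_homD(1)[OF y(1) that] by (simp add: left_hom_simps)
 define w where "w v p l = (if l \<in> elts C (p - (q - 1)) then y p l v else null I p)" for v p l
 have wJ: "w v \<in> carrier (Jm (q - 1))" if v: "v \<in> carrier N" for v
  unfolding Jm_mem
 proof (intro conjI allI impI)
  fix p
  have "(\<lambda>l. y p l v) \<in> mod_hom (op_ring A) (obj C (p - (q - 1))) (right_of (obj I p))"
   by (rule mod_homI) (use v mod_homD(1)[OF yl] mod_homD(2,3)[OF y(1)] in \<open>simp_all add: left_hom_simps\<close>)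
  then show "w v p \<in> mod_hom (op_ring A) (obj C (p - (q - 1))) (right_of (obj I p))"
   by (rule hom_cong[OF _ _ Cm]) (simp add: w_def)
 qed (use y(2) v in \<open>auto simp: w_def\<close>)
 show ?thesis
 proof (intro bexI[of _ w] ballI)
  show "w \<in> mod_hom A N (Jm (q - 1))"
  proof (rule mod_homI)
   fix v assume v: "v \<in> carrier N"
   show "w v \<in> carrier (Jm (q - 1))" by (rule wJ[OF v])
   show "w (a \<odot>\<^bsub>N\<^esub> v) = a \<odot>\<^bsub>Jm (q - 1)\<^esub> w v" if "a \<in> carrier A" for a
    using mod_homD(3)[OF yl] that v by (auto simp: w_def fun_eq_iff lm[OF Il])
   show "w (v \<oplus>\<^bsub>N\<^esub> v') = w v \<oplus>\<^bsub>Jm (q - 1)\<^esub> w v'" if "v' \<in> carrier N" for v'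
    using mod_homD(2)[OF yl] that v by (auto simp: w_def fun_eq_iff lm[OF Il])
  qed
  fix v assume v: "v \<in> carrier N"
  show "g v = jd (q - 1) (w v)"
  proof (intro ext)
   fix p l
   show "g v p l = jd (q - 1) (w v) p l"
   proof (cases "l \<in> elts C (p - q)")
    case True
    have D: "dif (sshift q C) p l \<in> elts C (p - (q - 1))"
     using mod_homD(1)[OF module_complexD(2)[OF S], of l q p] True unfolding sshift_simps(1) e by blast
    have l: "l \<in> elts C (p - 1 - (q - 1))" using True by simp
    have W: "w v p (dif (sshift q C) p l) = y p (dif (sshift q C) p l) v" "w v (p - 1) l = y (p - 1) l v"
     unfolding w_def using D l by (simp_all only: if_True)
    have "X p l v = y p (dif (sshift q C) p l) v \<oplus>\<^bsub>obj I p\<^esub> dif I (p - 1) (y (p - 1) l v)"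
     using fun_cong[OF y0(3)[of l p], of v] True v unfolding RHom_simps left_hom_simps compose_def sshift_simps(1) by (simp del: sshift_simps)
    then show ?thesis unfolding jd_back[OF wJ[OF v] True] W using v by (simp add: X_def)
   next
    case False
    then show ?thesis using JmD(2)[OF gJ[OF v] False] by (simp add: jd_def)
   qed
  qed
 qed
qed

end

section \<open>Property (S)\<close>

context tensor_bimodule
begin

lemma RHom_left_complex:
 assumes I: "bimodule_coresolution A B I \<epsilon>"
 shows "module_complex (op_ring A) (RHom_left A N I)"
 unfolding module_complex_def RHom_simps
proof (intro allI conjI ballI)
 note i = bimodule_coresolutionD[OF I]
 fix k
 show "left_module (op_ring A) (left_hom A N (obj I k))" by (rule left_hom_module[OF i(1)])
 have mem: "f \<in> mod_hom A N (obj I k)" if "f \<in> carrier (left_hom A N (obj I k))" for f using that by (simp add: left_hom_simps)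
 show "compose (carrier N) (dif I k) \<in> mod_hom (op_ring A) (left_hom A N (obj I k)) (left_hom A N (obj I (k + 1)))"
 proof (rule mod_homI)
  fix f assume f: "f \<in> carrier (left_hom A N (obj I k))"
  note fh = mem[OF f]
  show "compose (carrier N) (dif I k) f \<in> carrier (left_hom A N (obj I (k + 1)))"
   unfolding compose_def left_hom_simps by (rule restrict_hom[OF Nl hom_comp[OF fh i(2)]])
  show "compose (carrier N) (dif I k) (a \<odot>\<^bsub>left_hom A N (obj I k)\<^esub> f) =
    a \<odot>\<^bsub>left_hom A N (obj I (k + 1))\<^esub> compose (carrier N) (dif I k) f" if "a \<in> carrier (op_ring A)" for a
   using mod_homD(1)[OF fh] mod_homD(3)[OF i(3), of a] that
   by (auto simp: compose_def left_hom_simps intro!: restrict_ext)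
  fix g assume g: "g \<in> carrier (left_hom A N (obj I k))"
  show "compose (carrier N) (dif I k) (f \<oplus>\<^bsub>left_hom A N (obj I k)\<^esub> g) =
    compose (carrier N) (dif I k) f \<oplus>\<^bsub>left_hom A N (obj I (k + 1))\<^esub> compose (carrier N) (dif I k) g"
   using mod_homD(1)[OF fh] mod_homD(1)[OF mem[OF g]] mod_homD(2)[OF i(2)]
   by (auto simp: compose_def left_hom_simps intro!: restrict_ext)
 qed
 fix f assume f: "f \<in> carrier (left_hom A N (obj I k))"
 show "compose (carrier N) (dif I (k + 1)) (compose (carrier N) (dif I k) f) = \<zero>\<^bsub>left_hom A N (obj I (k + 1 + 1))\<^esub>"
  using mod_homD(1)[OF mem[OF f]] module_complexD(4)[OF coresolutionD(1)[OF i(6)], of _ k]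
  by (auto simp: compose_def left_hom_simps add.assoc intro!: restrict_ext)
qed

text \<open>On the right, \<open>Hc_tot_exact\<close> applies; property (S) transports the result to the left.  Finally, the injective
 dimension on the left makes cocycles of degree \<open>q\<close> coboundaries and so sharpens the bound by one.\<close>

lemma tot_exact_RHom_left:
 fixes I :: "(('a, 'i) bimodule, 'i) cochain"
 assumes I: "bimodule_coresolution A (twist \<sigma> (regular_bimodule A)) I \<epsilon>"
  and l: "fin_inj_coresolution A (twist \<sigma> (regular_bimodule A)) I \<epsilon> d"
  and r: "fin_inj_coresolution (op_ring A) (right_of (regular_bimodule A)) (right_complex I) \<epsilon> d"
  and fg: "fin_gen A N" "fin_gen (op_ring A) (right_of N)"
  and S: "property_S TYPE('u) A I N"
  and C: "module_complex (op_ring A) C" and Co: "\<And>j. obj C j = L (\<nu> j)"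
  and ex: "\<And>j u. u \<in> carrier (W (\<nu> j)) ==> cmap (\<nu> j) (\<nu> (j + 1)) (dif C j) u = (\<lambda>s. \<zero>\<^bsub>N\<^esub>) ==>
   \<exists>v\<in>carrier (W (\<nu> (j - 1))). u = cmap (\<nu> (j - 1)) (\<nu> j) (dif C (j - 1)) v"
  and q: "int d < q"
 shows "tot_exact_strict (op_ring A) (sshift q C) (RHom_left A N I) q"
proof -
 interpret l: fin_inj_coresolution A "twist \<sigma> (regular_bimodule A)" I \<epsilon> d by (rule l)
 let ?O = "op_ring A"
 note G = RHom_left_complex[OF I]
 have Hr: "Hc (right_complex I) = RHom_right A N I"
  by (simp add: Hc_def RHom_right_def right_hom_rhom)
 have H: "module_complex ?O (RHom_right A N I)"
  unfolding Hr[symmetric] by (rule Hc_complex[OF coresolutionD(1)[OF right_coresolution[OF I]]])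
 note sc = shift_complex[OF C, of q]
 have so: "obj (shift q C) j = L (\<nu> (j - q))" for j by (simp add: Co)
 have sex: "\<exists>v\<in>carrier (W (\<nu> (j - 1 - q))). u = cmap (\<nu> (j - 1 - q)) (\<nu> (j - q)) (dif (shift q C) (j - 1)) v"
  if "u \<in> carrier (W (\<nu> (j - q)))" "cmap (\<nu> (j - q)) (\<nu> (j + 1 - q)) (dif (shift q C) j) u = (\<lambda>s. \<zero>\<^bsub>N\<^esub>)" for j u
  using ex[of u "j - q"] that unfolding shift_simps shift_index shift_index' by blast
 have tr: "tot_exact ?O (shift q C) (RHom_right A N I) (q - 1)"
  unfolding Hr[symmetric] by (rule Hc_tot_exact[OF r fg(2) sc so sex]) (use q in simp_all)
 obtain Z :: "(('a, 'u) module, 'u) cochain" and s f where Z: "module_complex ?O Z"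
  "chain_map ?O Z (RHom_left A N I) s" "coh_inj Z (RHom_left A N I) s" "coh_surj Z (RHom_left A N I) s"
  "chain_map ?O Z (RHom_right A N I) f" "coh_inj Z (RHom_right A N I) f" "coh_surj Z (RHom_right A N I) f"
  using derived_isomorphicD[OF S[unfolded property_S_def] G H] by blast
 have "tot_exact ?O (shift q C) Z (q - 1)" by (rule tot_exact_pullback[OF Z(1) H sc so Z(5,6,7) tr])
 then have "tot_exact ?O (shift q C) (RHom_left A N I) (q - 1)" by (rule tot_exact_pushforward[OF Z(1) G sc so Z(2,3,4)])
 then have tl: "tot_exact ?O (sshift q C) (RHom_left A N I) (q - 1)"
  by (rule tot_exact_iso[OF sc sshift_complex[OF C] G sshift_iso(1,2)[OF C], rotated]) (rule sshift_iso(3)[OF C], simp)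
 show ?thesis
 proof (rule tot_exact_strictI[OF sshift_complex[OF C] G _ _ tl])
  show "projective_module ?O (obj (sshift q C) q)" unfolding sshift_simps(1) Co by (rule projective_free[OF O])
  fix u assume u: "u \<in> elts (RHom_left A N I) q" "dif (RHom_left A N I) q u = null (RHom_left A N I) (q + 1)"
  define p where "p = nat (q - 1)"
  have p: "q = int p + 1" "d \<le> p" using q by (simp_all add: p_def)
  have uh: "u \<in> mod_hom A N (obj I (int p + 1))" "u \<in> extensional (carrier N)" using u(1) by (simp_all add: left_hom_simps p(1))
  have "\<exists>w\<in>mod_hom A N (obj I (int p)). \<forall>x\<in>carrier N. u x = dif I (int p) (w x)"
  proof (rule l.cocycle_is_coboundary[OF Nl fg(1) uh(1) _ p(2)])
   fix x assume "x \<in> carrier N"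
   then show "dif I (int p + 1) (u x) = null I (int p + 2)"
    using fun_cong[OF u(2), of x] by (simp add: left_hom_simps compose_def p(1) add.assoc)
  qed
  then obtain w where w: "w \<in> mod_hom A N (obj I (int p))" "\<And>x. x \<in> carrier N ==> u x = dif I (int p) (w x)" by blast
  have "u = compose (carrier N) (dif I (int p)) (\<lambda>x\<in>carrier N. w x)"
   unfolding compose_def by (rule restrict_ext_eq[OF uh(2), symmetric]) (simp add: w(2))
  moreover have "(\<lambda>x\<in>carrier N. w x) \<in> carrier (left_hom A N (obj I (int p)))"
   unfolding left_hom_simps by (rule restrict_hom[OF Nl w(1)])
  ultimately show "u \<in> dif (RHom_left A N I) (q - 1) ` elts (RHom_left A N I) (q - 1)"
   by (intro image_eqI[of _ _ "\<lambda>x\<in>carrier N. w x"]) (simp_all add: p(1))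
 qed
qed

end

section \<open>Twisted modules\<close>

lemma left_module_twist:
 assumes \<sigma>: "\<sigma> \<in> ring_hom A A" and M: "left_module A M"
 shows "left_module A (twist \<sigma> M)"
proof (rule left_moduleI[OF left_moduleD(1)[OF M]])
 show "abelian_group (twist \<sigma> M)" by (rule ag_cong[OF left_moduleD(2)[OF M]]) simp_all
qed (simp_all add: lm[OF M] ring_hom_closed[OF \<sigma>] ring_hom_mult[OF \<sigma>] ring_hom_add[OF \<sigma>] ring_hom_one[OF \<sigma>])

lemma mod_hom_twist: "\<sigma> \<in> carrier A \<rightarrow> carrier A ==> h \<in> mod_hom A M N ==> h \<in> mod_hom A (twist \<sigma> M) (twist \<sigma> N)"
 by (auto simp: mod_hom_def Pi_iff)

lemma dsum_twist: "dsum (twist \<sigma> M) S = twist \<sigma> (dsum M S)"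
 by (simp add: dsum_def twist_def)

lemma twist_sub: "(twist \<sigma> M)\<lparr>carrier := K\<rparr> = twist \<sigma> (M\<lparr>carrier := K\<rparr>)"
 by (simp add: twist_def)

text \<open>As a left module \<open>twist \<sigma> A\<close> is isomorphic to \<open>A\<close>, by \<open>\<sigma>\<close>.\<close>

lemma hom_exact_twist_regular:
 assumes A: "ring A" and \<sigma>: "\<sigma> \<in> ring_iso A A" and ex: "hom_exact A P f (regular_bimodule A) i"
 shows "hom_exact A P f (twist \<sigma> (regular_bimodule A)) i"
proof -
 have h: "\<sigma> \<in> ring_hom A A" and bij: "bij_betw \<sigma> (carrier A) (carrier A)" using \<sigma> by (simp_all add: ring_iso_def)
 note hs = ring_hom_closed[OF h] ring_hom_mult[OF h] ring_hom_add[OF h]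
 define \<tau> where "\<tau> = inv_into (carrier A) \<sigma>"
 have \<tau>: "\<tau> x \<in> carrier A" "\<sigma> (\<tau> x) = x" if "x \<in> carrier A" for x
  using that bij bij_betw_inv_into_right[OF bij] bij_betwE[OF bij_betw_inv_into[OF bij]] by (auto simp: \<tau>_def)
 have \<tau>\<sigma>: "\<tau> (\<sigma> x) = x" if "x \<in> carrier A" for x using bij_betw_inv_into_left[OF bij that] by (simp add: \<tau>_def)
 have eqI: "x = y" if "\<sigma> x = \<sigma> y" "x \<in> carrier A" "y \<in> carrier A" for x y
  using arg_cong[OF that(1), of \<tau>] unfolding \<tau>\<sigma>[OF that(2)] \<tau>\<sigma>[OF that(3)] .
 interpret ring A by (rule A)
 show ?thesis
 proof (rule hom_exact_retract[OF _ _ _ left_module_twist[OF h left_module_regular[OF A]] left_module_regular[OF A] ex])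
  show "\<tau> \<in> mod_hom A (twist \<sigma> (regular_bimodule A)) (regular_bimodule A)"
  proof (rule mod_homI)
   fix x assume "x \<in> carrier (twist \<sigma> (regular_bimodule A))"
   then have x: "x \<in> carrier A" by simp
   show "\<tau> x \<in> carrier (regular_bimodule A)" using \<tau>(1)[OF x] by simp
   show "\<tau> (a \<odot>\<^bsub>twist \<sigma> (regular_bimodule A)\<^esub> x) = a \<odot>\<^bsub>regular_bimodule A\<^esub> \<tau> x" if "a \<in> carrier A" for a
    by (rule eqI) (simp_all add: \<tau> hs x that)
   fix y assume "y \<in> carrier (twist \<sigma> (regular_bimodule A))"
   then have y: "y \<in> carrier A" by simp
   show "\<tau> (x \<oplus>\<^bsub>twist \<sigma> (regular_bimodule A)\<^esub> y) = \<tau> x \<oplus>\<^bsub>regular_bimodule A\<^esub> \<tau> y"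
    by (rule eqI) (simp_all add: \<tau> hs x y)
  qed
  show "\<sigma> \<in> mod_hom A (regular_bimodule A) (twist \<sigma> (regular_bimodule A))"
   by (rule mod_homI) (simp_all add: hs)
 qed (simp add: \<tau>)
qed

section \<open>Vanishing of Ext\<close>

text \<open>\<open>Ext\<close> into twisted free modules vanishes in high degrees, so the vanishing passes from the \<open>k\<close>-th syzygy of
 \<open>M\<close> down to \<open>M\<close>.\<close>

lemma hom_exact_from_syzygy:
 assumes A: "ring A" and \<sigma>: "\<sigma> \<in> ring_hom A A" and M: "left_module A M"
  and nf: "free_exact A n f" "nat_resolution A (\<lambda>i. Fr A (n i)) f M \<pi>"
  and mg: "free_exact A m g"
  and ex: "\<And>i. d \<le> i ==> free_hom_exact A m g (twist \<sigma> (regular_bimodule A)) i"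
  and syz: "\<And>i. d \<le> i ==> free_hom_exact A m g
   (twist \<sigma> ((Fr A (n k))\<lparr>carrier := f k ` vecs A (n (Suc k))\<rparr>)) i"
  and i: "d \<le> i"
 shows "free_hom_exact A m g (twist \<sigma> M) i"
proof -
 let ?Q = "\<lambda>i. Fr A (m i)"
 let ?Z = "\<lambda>k. (Fr A (n k))\<lparr>carrier := f k ` vecs A (n (Suc k))\<rparr>"
 note F = left_module_free[OF A] and fd = free_exactD[OF nf(1)] and gd = free_exactD[OF mg] and r = nat_resolutionD[OF nf(2)]
 note tw = left_module_twist[OF \<sigma>]
 have \<sigma>c: "\<sigma> \<in> carrier A \<rightarrow> carrier A" using \<sigma> by (simp add: ring_hom_def)
 have gg: "g i (g (Suc i) x) = \<zero>\<^bsub>Fr A (m i)\<^esub>" if "x \<in> vecs A (m (Suc (Suc i)))" for i x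
  using gd(2)[OF that] by simp
 have exF: "hom_exact A ?Q g (twist \<sigma> (Fr A (n k))) i" if "d \<le> i" for k i
  unfolding dsum_twist[symmetric] by (rule hom_exact_dsum[where P = ?Q and f = g, OF tw[OF left_module_regular[OF A]] ex[OF that] F gd(1)])
 have ker: "f (Suc k) ` vecs A (n (Suc (Suc k))) = {x \<in> vecs A (n (Suc k)). f k x = \<zero>\<^bsub>Fr A (n k)\<^esub>}" for k
  using nf(1) by (simp add: free_exact_def)
 have down: "hom_exact A ?Q g (twist \<sigma> (?Z k)) i" if "d \<le> i" "\<And>i. d \<le> i ==> hom_exact A ?Q g (twist \<sigma> (?Z (Suc k))) i" for k i
 proof (rule hom_exact_quotient[where P = ?Q and f = g, OF projective_free[OF A] gd(1) gg tw[OF F[of "{..<n (Suc k)}"]]])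
  have Z: "left_module A (?Z k)" by (rule left_module_sub[OF F submodule_image[OF F F fd(1)]])
  show "left_module A (twist \<sigma> (?Z k))" by (rule tw[OF Z])
  have "f k \<in> mod_hom A (Fr A (n (Suc k))) (?Z k)" using fd(1)[of k] unfolding mod_hom_def by auto
  then show "f k \<in> mod_hom A (twist \<sigma> (Fr A (n (Suc k)))) (twist \<sigma> (?Z k))" by (rule mod_hom_twist[OF \<sigma>c])
  show "f k ` carrier (twist \<sigma> (Fr A (n (Suc k)))) = carrier (twist \<sigma> (?Z k))" by simp
  show "hom_exact A ?Q g (twist \<sigma> (Fr A (n (Suc k)))) i" by (rule exF[OF that(1)])
  show "hom_exact A ?Q g ((twist \<sigma> (Fr A (n (Suc k))))\<lparr>carrier := {x \<in> carrier (twist \<sigma> (Fr A (n (Suc k)))). f k x = \<zero>\<^bsub>twist \<sigma> (?Z k)\<^esub>}\<rparr>) (Suc i)"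
   using that(2)[of "Suc i"] that(1) ker[of k] by (simp add: twist_sub)
 qed
 have all: "\<And>i. d \<le> i ==> hom_exact A ?Q g (twist \<sigma> (?Z (k - j))) i" if "j \<le> k" for j
  using that
 proof (induction j)
  case 0
  then show ?case using syz by simp
 next
  case (Suc j)
  have "Suc (k - Suc j) = k - j" using Suc.prems by simp
  then show ?case using down[OF Suc.prems(1), of "k - Suc j"] Suc.IH Suc.prems(2) by simp
 qed
 have Z0: "hom_exact A ?Q g (twist \<sigma> (?Z 0)) i" if "d \<le> i" for i using all[of k i] that by simp
 show ?thesis
 proof (rule hom_exact_quotient[where P = ?Q and f = g, OF projective_free[OF A] gd(1) gg tw[OF F[of "{..<n 0}"]] tw[OF M] mod_hom_twist[OF \<sigma>c r(4)]])
  show "\<pi> ` carrier (twist \<sigma> (Fr A (n 0))) = carrier (twist \<sigma> M)" using r(5) by simp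
  show "hom_exact A ?Q g (twist \<sigma> (Fr A (n 0))) i" by (rule exF[OF i])
  have "f 0 ` vecs A (n (Suc 0)) = {x \<in> vecs A (n 0). \<pi> x = \<zero>\<^bsub>M\<^esub>}"
   using nf(2) by (simp add: nat_resolution_def)
  then show "hom_exact A ?Q g ((twist \<sigma> (Fr A (n 0)))\<lparr>carrier := {x \<in> carrier (twist \<sigma> (Fr A (n 0))). \<pi> x = \<zero>\<^bsub>twist \<sigma> M\<^esub>}\<rparr>) (Suc i)"
   using Z0[of "Suc i"] i by (simp add: twist_sub)
 qed
qed

text \<open>In high degrees the complete resolution \<open>L\<close> is the dual of the resolution of \<open>M\<close>, and the tensor product of
 \<open>L\<close> with \<open>N\<close> is the complex of homomorphisms from the resolution to \<open>N\<close>.  So it is exact there, and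
 everywhere by property (R).\<close>

lemma complete_resolution_tensor_exact:
 fixes A :: "('a, 'r) ring_scheme" and N :: "('a, 'n, 'x) module_scheme"
  and L :: "(('a, nat => 'a) module, nat => 'a) cochain"
 assumes A: "ring A" and N: "left_module A N" and R: "property_R A N" and fe: "free_exact A n f"
  and L: "module_complex (op_ring A) L" "\<And>j. obj L j = Fr (op_ring A) (\<nu> j)"
   "\<And>j x. x \<in> elts L j ==> dif L j x = (\<lambda>s. \<zero>\<^bsub>A\<^esub>) ==> x \<in> dif L (j - 1) ` elts L (j - 1)"
   "\<And>i. k \<le> i ==> \<nu> (int i) = n i \<and> dif L (int i) = transp A (n (Suc i)) (n i) (f i)"
  and ex: "\<And>i. i0 \<le> i ==> free_hom_exact A n f N i"
 shows "trivial_group (cohomology (tensor_complex A L N) j)"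
proof -
 interpret tensor_free A N by (rule tensor_free.intro[OF N])
 note fd = free_exactD[OF fe]
 have tt: "transp (op_ring A) (n i) (n (Suc i)) (transp A (n (Suc i)) (n i) (f i)) x = f i x" if "x \<in> vecs A (n (Suc i))" for i x
  by (rule transp_transp[OF A fd(1) that])
 have "trivial_group (cohomology (tensor_complex A L N) (int (Suc i)))" if i: "i0 \<le> i" "k \<le> i" for i
 proof -
  have e: "int (Suc i) - 1 = int i" "int (Suc i) + 1 = int (Suc (Suc i))" by simp_all
  have e': "int i + 1 = int (Suc i)" by simp
  have li: "\<nu> (int i) = n i" "dif L (int i) = transp A (n (Suc i)) (n i) (f i)" using L(4)[of i] i by simp_all
  have ls: "\<nu> (int (Suc i)) = n (Suc i)" "dif L (int (Suc i)) = transp A (n (Suc (Suc i))) (n (Suc i)) (f (Suc i))" using L(4)[of "Suc i"] i by simp_all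
  have lss: "\<nu> (int (Suc (Suc i))) = n (Suc (Suc i))" using L(4)[of "Suc (Suc i)"] i by simp
  have h: "\<exists>h\<in>mod_hom A (Fr A (n i)) N. \<forall>x\<in>vecs A (n (Suc i)). g x = h (f i x)"
   if "g \<in> mod_hom A (Fr A (n (Suc i))) N" "\<And>x. x \<in> vecs A (n (Suc (Suc i))) ==> g (f (Suc i) x) = \<zero>\<^bsub>N\<^esub>" for g
   by (rule hom_exactD[OF ex[OF i(1)], OF that])
  show ?thesis
  proof (rule trivial_tensor_cohomologyI[OF L(1,2)], unfold e e' li ls lss)
   fix g assume "g \<in> mod_hom A (Fr A (n (Suc i))) N"
    "\<And>x. x \<in> vecs A (n (Suc (Suc i))) ==> g (transp (op_ring A) (n (Suc i)) (n (Suc (Suc i))) (transp A (n (Suc (Suc i))) (n (Suc i)) (f (Suc i))) x) = \<zero>\<^bsub>N\<^esub>"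
   then show "\<exists>h\<in>mod_hom A (Fr A (n i)) N. \<forall>x\<in>vecs A (n (Suc i)). g x = h (transp (op_ring A) (n i) (n (Suc i)) (transp A (n (Suc i)) (n i) (f i)) x)"
    using h by (simp add: tt)
  qed
 qed
 then have "\<forall>i\<ge>int (Suc (max i0 k)). trivial_group (cohomology (tensor_complex A L N) i)"
 proof (intro allI impI)
  fix j assume a: "\<And>i. i0 \<le> i ==> k \<le> i ==> trivial_group (cohomology (tensor_complex A L N) (int (Suc i)))"
   and j: "j \<ge> int (Suc (max i0 k))"
  then have "j = int (Suc (nat j - 1))" "i0 \<le> nat j - 1" "k \<le> nat j - 1" by auto
  then show "trivial_group (cohomology (tensor_complex A L N) j)" using a[of "nat j - 1"] by metis
 qed
 then have ev: "\<forall>\<^sub>F i in at_top. trivial_group (cohomology (tensor_complex A L N) i)"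
  unfolding eventually_at_top_linorder by blast
 have "exact_complex (op_ring A) L"
  unfolding exact_complex_def trivial_mod_cohomology_iff[OF L(1)] using L(1,3) by (simp add: L(2))
 moreover have "fin_gen (op_ring A) (obj L i) \<and> projective_module (op_ring A) (obj L i)" for i
  unfolding L(2) using fin_gen_free[OF O] projective_free[OF O] by blast
 ultimately show ?thesis using R ev unfolding property_R_def by blast
qed

theorem theorem1p9:
  fixes A :: "('a, 'r) ring_scheme"
    and \<sigma> :: "'a \<Rightarrow> 'a"
    and I :: "(('a, 'i) bimodule, 'i) cochain"
    and \<epsilon> :: "'a \<Rightarrow> 'i"
    and M :: "('a, 'm) module"
    and N :: "('a, 'n) bimodule"
  assumes "ring A" and "noetherian A"
    and "\<sigma> \<in> ring_iso A A"
    and "bimodule_coresolution A (twist \<sigma> (regular_bimodule A)) I \<epsilon>"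
    and "\<And>k. injective_module A (obj I k)"
    and "\<And>k. injective_module (op_ring A) (right_of (obj I k))"
    and "inj_dim TYPE('u) A (regular_bimodule A) < \<infinity>"
    and "inj_dim TYPE('u) (op_ring A) (right_of (regular_bimodule A)) < \<infinity>"
    and "left_module A M" and "fin_gen A M"
    and "bimodule A N" and "fin_gen A N" and "fin_gen (op_ring A) (right_of N)"
    and "property_R A N"
    and "property_S TYPE('u) A I N"
    and "\<forall>\<^sub>F i in sequentially. trivial_group (Ext A i M N)"
  shows "\<forall>\<^sub>F i in sequentially. trivial_group (Ext A i N (twist \<sigma> M))"
proof -
 note A = assms(1) and I = assms(4) and M = assms(9)
 let ?O = "op_ring A" and ?reg = "regular_bimodule A"
 note O = ring_op_ring[OF A]
 have noeth: "left_noetherian A" "left_noetherian ?O" using assms(2) by (simp_all add: noetherian_def)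
 have \<sigma>: "\<sigma> \<in> ring_hom A A" using assms(3) by (simp add: ring_iso_def)
 interpret tensor_bimodule A N by (rule tensor_bimodule.intro[OF assms(11)])
 obtain E :: "(('a, 'u) module, 'u) cochain" and e d1 where E: "coresolution A ?reg E e" "\<And>i. injective_module A (obj E i)"
  "\<And>i. i > int d1 ==> elts E i = {null E i}" using inj_dim_finiteD[OF assms(7)] by blast
 obtain E' :: "(('a, 'u) module, 'u) cochain" and e' d2 where E': "coresolution ?O (right_of ?reg) E' e'" "\<And>i. injective_module ?O (obj E' i)"
  "\<And>i. i > int d2 ==> elts E' i = {null E' i}" using inj_dim_finiteD[OF assms(8)] by blast
 define d where "d = max d1 d2"
 have d: "d1 \<le> d" "d2 \<le> d" by (simp_all add: d_def)
 have right_reg: "left_module ?O (right_of ?reg)" by (rule module_cong[OF left_module_regular[OF O]]) simp_all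
 have bound_left: "free_hom_exact A n f ?reg i" if "free_exact A n f" "d \<le> i" for n f i
  by (rule hom_exact_of_finite_coresolution[OF left_module_regular[OF A] E that(1) order_trans[OF d(1) that(2)]])
 have bound_right: "free_hom_exact ?O n f (right_of ?reg) i" if "free_exact ?O n f" "d \<le> i" for n f i
  by (rule hom_exact_of_finite_coresolution[OF right_reg E' that(1) order_trans[OF d(2) that(2)]])
 have bound_twist: "free_hom_exact A n f (twist \<sigma> ?reg) i" if "free_exact A n f" "d \<le> i" for n f i
  by (rule hom_exact_twist_regular[OF A assms(3) bound_left[OF that]])
 have l: "fin_inj_coresolution A (twist \<sigma> ?reg) I \<epsilon> d"
  by (intro fin_inj_coresolution.intro noeth(1) left_module_twist[OF \<sigma> left_module_regular[OF A]]
   bimodule_coresolutionD(6)[OF I] assms(5) bound_twist)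
 have r: "fin_inj_coresolution ?O (right_of ?reg) (right_complex I) \<epsilon> d"
 proof (intro fin_inj_coresolution.intro noeth(2) right_reg bound_right)
  show "coresolution ?O (right_of ?reg) (right_complex I) \<epsilon>" using right_coresolution[OF I] by simp
  show "injective_module ?O (obj (right_complex I) i)" for i using assms(6) by simp
 qed
 obtain n f \<pi> where nf: "free_exact A n f" "nat_resolution A (\<lambda>i. Fr A (n i)) f M \<pi>"
  using free_resolution[OF noeth(1) M assms(10)] by blast
 obtain m g \<rho> where mg: "free_exact A m g" "nat_resolution A (\<lambda>i. Fr A (m i)) g N \<rho>"
  using free_resolution[OF noeth(1) Nl assms(12)] by blast
 obtain i0 where i0: "\<And>i. i0 \<le> i ==> trivial_group (Ext A i M N)" using assms(16) by (auto simp: eventually_sequentially)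
 have exMN: "free_hom_exact A n f N i" if "i0 \<le> i" for i
  using i0[of "Suc i"] that trivial_Ext_iff[OF noeth(1) M assms(10) Nl nf(2), of i] by simp
 obtain L :: "(('a, nat => 'a) module, nat => 'a) cochain" and \<nu> where Lc: "module_complex ?O L" "\<And>j. obj L j = Fr ?O (\<nu> j)"
  "\<And>j x. x \<in> elts L j ==> dif L j x = (\<lambda>s. \<zero>\<^bsub>A\<^esub>) ==> x \<in> dif L (j - 1) ` elts L (j - 1)"
  "\<And>i. d \<le> i ==> \<nu> (int i) = n i \<and> dif L (int i) = transp A (n (Suc i)) (n i) (f i)"
  using complete_resolution[OF A noeth(2) nf(1) bound_left[OF nf(1)] order_refl] by blast
 have tens: "trivial_group (cohomology (tensor_complex A L N) j)" for j
  by (rule complete_resolution_tensor_exact[OF A Nl assms(14) nf(1) Lc exMN])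
 note Wex = tens[unfolded trivial_tensor_cohomology_iff[OF Lc(1,2)], rule_format]
 \<comment> \<open>After the shift, the differential from degree 0 to degree 1 is the transpose of \<open>f d\<close>.\<close>
 define C where "C = shift (- int d) L"
 define \<mu> where "\<mu> j = \<nu> (j - (- int d))" for j
 have C: "module_complex ?O C" unfolding C_def by (rule shift_complex[OF Lc(1)])
 have Co: "obj C j = Fr ?O (\<mu> j)" for j by (simp add: C_def \<mu>_def Lc(2))
 have Cex: "x \<in> dif C (j - 1) ` elts C (j - 1)" if "x \<in> elts C j" "dif C j x = (\<lambda>s. \<zero>\<^bsub>A\<^esub>)" for j x
  using Lc(3)[of x "j - (- int d)"] that unfolding C_def shift_simps shift_index' by blast
 have CW: "\<exists>v\<in>carrier (dsum N {..<\<mu> (j - 1)}). u = cmap (\<mu> (j - 1)) (\<mu> j) (dif C (j - 1)) v"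
  if "u \<in> carrier (dsum N {..<\<mu> j})" "cmap (\<mu> j) (\<mu> (j + 1)) (dif C j) u = (\<lambda>s. \<zero>\<^bsub>N\<^esub>)" for j u
  using Wex[of u "j - (- int d)"] that unfolding C_def \<mu>_def shift_simps shift_index' shift_index by blast
 interpret D: dual_complex A \<sigma> I \<epsilon> C \<mu> d
  by (intro dual_complex.intro A I assms(5) C Co Cex bound_right)
 have \<mu>01: "\<mu> 0 = n d" "\<mu> 1 = n (Suc d)" "dif C 0 = transp A (n (Suc d)) (n d) (f d)"
  using Lc(4)[of d] Lc(4)[of "Suc d"] by (simp_all add: \<mu>_def C_def add.commute)
 let ?Z = "(Fr A (n d))\<lparr>carrier := f d ` vecs A (n (Suc d))\<rparr>"
 have Z: "left_module A (twist \<sigma> ?Z)"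
  by (rule left_module_twist[OF \<sigma> left_module_sub[OF left_module_free[OF A] submodule_image[OF left_module_free[OF A] left_module_free[OF A] free_exactD(1)[OF nf(1)]]]])
 have cor: "coresolution A (twist \<sigma> ?Z) D.Jc
  (\<lambda>z p l. if p = 0 \<and> l \<in> elts C 0 then \<epsilon> (pair A (\<mu> 0) z l) else null I p)"
  using D.Jc_coresolution[of "f d"] free_exactD(1)[OF nf(1), of d] ring_hom_closed[OF \<sigma>] unfolding \<mu>01 by blast
 have syz: "free_hom_exact A m g (twist \<sigma> ?Z) i" if "d \<le> i" for i
 proof (rule hom_exact_of_coresolution_module[where P = "\<lambda>i. Fr A (m i)" and f = g, OF mg(2) projective_free[OF A] Z cor _ _ that])
  show "free_hom_exact A m g (obj D.Jc q) i" for q i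
   using D.Jm_hom_exact[OF mg(1)] by simp
  fix p h assume p: "d \<le> p" and h: "h \<in> mod_hom A N (obj D.Jc (int p + 1))"
   and dh: "\<And>x. x \<in> carrier N ==> dif D.Jc (int p + 1) (h x) = null D.Jc (int p + 2)"
  have "tot_exact_strict ?O (sshift (int p + 1) C) (RHom_left A N I) (int p + 1)"
   by (rule tot_exact_RHom_left[OF I l r assms(12,13,15) C Co CW]) (use p in simp_all)
  from D.Jc_hom_exact[OF assms(11) this] h dh
  show "\<exists>w\<in>mod_hom A N (obj D.Jc (int p)). \<forall>x\<in>carrier N. h x = dif D.Jc (int p) (w x)" by simp
 qed
 have "free_hom_exact A m g (twist \<sigma> M) i" if "d \<le> i" for i
  by (rule hom_exact_from_syzygy[OF A \<sigma> M nf mg(1) bound_twist[OF mg(1)] syz that])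
 then have "trivial_group (Ext A (Suc i) N (twist \<sigma> M))" if "d \<le> i" for i
  using trivial_Ext_iff[OF noeth(1) Nl assms(12) left_module_twist[OF \<sigma> M] mg(2), of i] that by blast
 then have "trivial_group (Ext A i N (twist \<sigma> M))" if "Suc d \<le> i" for i
  using that by (cases i) auto
 then show ?thesis by (auto simp: eventually_sequentially)
qed

end
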